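(* Let $\alpha>0$ and let $A$ be a $0$-sectorial operator on a Banach space $X$ with an $R$-bounded $\mathcal{M}^\alpha_1$ calculus, that is, $A$ has an $\mathcal{M}^\alpha_1$ calculus and the set $\{f(A):\ f\in\mathcal{M}^\alpha_1,\ \|f\|_{\mathcal{M}^\alpha_1}\le1\}$ is $R$-bounded. Let $A$ have a Paley-Littlewood decomposition, i.e. for a homogeneous dyadic partition of unity $(\dot\varphi_n)_{n\in\mathbb{Z}}$ on $\mathbb{R}_+$ the series $\sum_{n\in\mathbb{Z}}\dot\varphi_n(A)x$ converges unconditionally in $X$ for all $x\in X$ and $$\|x\|\cong\mathbb{E}\Bigl\|\sum_{n\in\mathbb{Z}}\epsilon_n\dot\varphi_n(A)x\Bigr\|_X\cong\sup\Bigl\{\Bigl\|\sum_{n\in\mathbb{Z}}a_n\dot\varphi_n(A)x\Bigr\|:\ a_n\in\mathbb{C},\ |a_n|\le1\Bigr\}\qquad(x\in X).$$ Then $A$ has a bounded $\mathcal{M}^\alpha$ calculus.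
   Context: $\mathbb{R}_+=(0,\infty)$. $a\cong b$ means two-sided estimates with constants independent of $x$. $(\epsilon_n)$ is a sequence of independent Rademacher variables ($P(\epsilon_n=\pm1)=\frac12$), $\mathbb{E}$ is expectation. A set $\tau\subset B(X)$ is $R$-bounded if there is $C<\infty$ with $\mathbb{E}\|\sum_{k=1}^n\epsilon_kT_kx_k\|\le C\,\mathbb{E}\|\sum_{k=1}^n\epsilon_kx_k\|$ for all $n$, $T_k\in\tau$, $x_k\in X$. Sectorial operators. $\Sigma_\omega=\{z\in\mathbb{C}\setminus\{0\}:|\arg z|<\omega\}$ and $H^\infty(\Sigma_\omega)$ is the Banach algebra of bounded holomorphic functions on $\Sigma_\omega$ with the sup norm. A closed densely defined operator $A$ on $X$ is $\omega$-sectorial if $\sigma(A)\subset\overline{\Sigma_\omega}$, its range $R(A)$ is dense in $X$, and for every $\theta>\omega$ there is $C_\theta$ with $\|\lambda(\lambda-A)^{-1}\|\le C_\theta$ for all $\lambda\in\mathbb{C}\setminus\overline{\Sigma_\theta}$ (then $A$ is injective). $A$ is $0$-sectorial if it is $\omega$-sectorial for all $\omega>0$. Let $H^\infty_0(\Sigma_\theta)=\{f\in H^\infty(\Sigma_\theta):\exists C,\epsilon>0:\ |f(\lambda)|\le C(1+|\log\lambda|)^{-1-\epsilon}\}$. For $f\in H_0^\infty(\Sigma_\theta)$, $f(A)=\frac1{2\pi i}\int_\Gamma f(\lambda)(\lambda-A)^{-1}d\lambda\in B(X)$, $\Gamma=\partial\Sigma_\sigma$ oriented counterclockwise, $0<\sigma<\theta$.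 With $\rho(\lambda)=\lambda(1+\lambda)^{-2}$, if $f$ is holomorphic on $\Sigma_\theta$ and $\rho^n f\in H^\infty_0(\Sigma_\theta)$ for some $n$, then $f(A)=\rho(A)^{-n}(\rho^nf)(A)$ with its natural domain, which is a closed densely defined operator. Besov spaces and Mihlin classes. Let $\phi_0,\phi_1\in C_c^\infty(\mathbb{R})$, $\operatorname{supp}\phi_1\subset[\frac12,2]$, $\operatorname{supp}\phi_0\subset[-1,1]$, $\phi_n=\phi_1(2^{1-n}\cdot)$ for $n\ge2$, $\phi_n=\phi_{-n}(-\cdot)$ for $n\le-1$, $\sum_{n\in\mathbb{Z}}\phi_n=1$ on $\mathbb{R}$. $\mathcal{B}^\alpha_{\infty,1}$ is the space of bounded uniformly continuous $f:\mathbb{R}\to\mathbb{C}$ with $\|f\|_{\mathcal{B}^\alpha_{\infty,1}}=\sum_{n\in\mathbb{Z}}2^{|n|\alpha}\|f*\check\phi_n\|_\infty<\infty$, $\check{\ }$ being the inverse Fourier transform. For $f:\mathbb{R}_+\to\mathbb{C}$ put $f_e(x)=f(e^x)$. $\mathcal{M}^\alpha=\{f:\mathbb{R}_+\to\mathbb{C}:\ f_e\in\mathcal{B}^\alpha_{\infty,1}\}$ with $\|f\|_{\mathcal{M}^\alpha}=\|f_e\|_{\mathcal{B}^\alpha_{\infty,1}}$. A homogeneous dyadic partition of unity on $\mathbb{R}_+$ is $\dot\varphi_n=\dot\varphi(2^{-n}\cdot)$, $n\in\mathbb{Z}$, with $\dot\varphi\in C_c^\infty(0,\infty)$, $\operatorname{supp}\dot\varphi\subset[\frac12,2]$,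 $\sum_{n\in\mathbb{Z}}\dot\varphi(2^{-n}t)=1$ for $t>0$. $\mathcal{M}^\alpha_1=\{f\in\mathcal{M}^\alpha:\ \|f\|_{\mathcal{M}^\alpha_1}=\sum_{n\in\mathbb{Z}}\|f\dot\varphi_n\|_{\mathcal{M}^\alpha}<\infty\}$ (independent of the partition up to equivalent norms); $H_0^\infty(\Sigma_\omega)$ is dense in it for every $\omega\in(0,\pi)$. $A$ has an $\mathcal{M}^\alpha_1$ calculus if for some $\omega\in(0,\pi)$ there is $C$ with $\|f(A)\|\le C\|f\|_{\mathcal{M}^\alpha_1}$ for all $f\in H_0^\infty(\Sigma_\omega)$; then $f(A)\in B(X)$ is defined for $f\in\mathcal{M}^\alpha_1$ by continuous extension. $A$ has a bounded $\mathcal{M}^\alpha$ calculus if there is $C$ with $\|f(A)\|\le C\|f\|_{\mathcal{M}^\alpha}$ for all $f\in\bigcap_{0<\omega<\pi}H^\infty(\Sigma_\omega)\cap\mathcal{M}^\alpha$. *)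

theory Defs
  imports "HOL-Probability.Probability" "HOL-Complex_Analysis.Complex_Analysis"
begin

subsection \<open>Complex Banach spaces and bounded operators\<close>

class complex_banach = banach +
  fixes scaleC :: "complex \<Rightarrow> 'a \<Rightarrow> 'a" (infixr "*\<^sub>C" 75)
  assumes scaleC_add_right: "c *\<^sub>C (x + y) = c *\<^sub>C x + c *\<^sub>C y"
    and scaleC_add_left: "(c + d) *\<^sub>C x = c *\<^sub>C x + d *\<^sub>C x"
    and scaleC_scaleC: "c *\<^sub>C d *\<^sub>C x = (c * d) *\<^sub>C x"
    and scaleC_of_real: "complex_of_real r *\<^sub>C x = r *\<^sub>R x"
    and norm_scaleC: "norm (c *\<^sub>C x) = cmod c * norm x"

lemma bounded_linear_scaleC: "bounded_linear (\<lambda>x::'a::complex_banach. c *\<^sub>C x)"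
proof (rule bounded_linear_intro[where K = "cmod c"])
  fix r and x :: 'a
  show "c *\<^sub>C (r *\<^sub>R x) = r *\<^sub>R (c *\<^sub>C x)"
    by (simp add: scaleC_of_real[symmetric] scaleC_scaleC mult.commute)
qed (simp_all add: scaleC_add_right norm_scaleC mult.commute)

definition op_scaleC :: "complex \<Rightarrow> ('a \<Rightarrow>\<^sub>L 'a) \<Rightarrow> ('a::complex_banach \<Rightarrow>\<^sub>L 'a)" where
  "op_scaleC c T = Blinfun (\<lambda>x. c *\<^sub>C T x)"

lemma op_scaleC_apply: "blinfun_apply (op_scaleC c T) x = c *\<^sub>C blinfun_apply T x"
  unfolding op_scaleC_def
  by (subst bounded_linear_Blinfun_apply)
    (auto intro!: bounded_linear_compose[OF bounded_linear_scaleC] blinfun.bounded_linear_right)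


subsection \<open>Unbounded operators\<close>

text \<open>An (unbounded) operator is represented by its graph. Elements of \<open>'a \<Rightarrow>\<^sub>L 'a\<close> are
  a priori only real linear; resolvents of a complex linear operator, and hence all operators
  formed from them below, are automatically complex linear.\<close>

definition complex_linear_operator :: "('a::complex_banach \<times> 'a) set \<Rightarrow> bool" where
  "complex_linear_operator A \<longleftrightarrow> single_valued A \<and> (0, 0) \<in> A \<and>
     (\<forall>x y u v. (x, y) \<in> A \<longrightarrow> (u, v) \<in> A \<longrightarrow> (x + u, y + v) \<in> A) \<and>
     (\<forall>c x y. (x, y) \<in> A \<longrightarrow> (c *\<^sub>C x, c *\<^sub>C y) \<in> A)"

definition graph_of :: "('a \<Rightarrow>\<^sub>L 'a) \<Rightarrow> ('a::complex_banach \<times> 'a) set" where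
  "graph_of T = {(x, y). y = blinfun_apply T x}"

text \<open>\<open>T = (z - A)\<^sup>-\<^sup>1\<close>: the equation \<open>y = T x\<close> means \<open>y \<in> D(A)\<close> and \<open>z y - A y = x\<close>.\<close>

definition is_resolvent :: "('a::complex_banach \<times> 'a) set \<Rightarrow> complex \<Rightarrow> ('a \<Rightarrow>\<^sub>L 'a) \<Rightarrow> bool" where
  "is_resolvent A z T \<longleftrightarrow> (\<forall>x y. y = blinfun_apply T x \<longleftrightarrow> (y, z *\<^sub>C y - x) \<in> A)"

definition spectrum :: "('a::complex_banach \<times> 'a) set \<Rightarrow> complex set" where
  "spectrum A = {z. \<not> (\<exists>T. is_resolvent A z T)}"

definition resolvent :: "('a::complex_banach \<times> 'a) set \<Rightarrow> complex \<Rightarrow> ('a \<Rightarrow>\<^sub>L 'a)" where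
  "resolvent A z = (THE T. is_resolvent A z T)"

definition sector :: "real \<Rightarrow> complex set" where
  "sector \<omega> = {z. z \<noteq> 0 \<and> \<bar>Arg z\<bar> < \<omega>}"

definition sectorial :: "real \<Rightarrow> ('a::complex_banach \<times> 'a) set \<Rightarrow> bool" where
  "sectorial \<omega> A \<longleftrightarrow> complex_linear_operator A \<and> closed A \<and>
     closure (Domain A) = UNIV \<and> closure (Range A) = UNIV \<and>
     spectrum A \<subseteq> closure (sector \<omega>) \<and>
     (\<forall>\<theta>>\<omega>. \<exists>C. \<forall>z\<in>- closure (sector \<theta>). norm (op_scaleC z (resolvent A z)) \<le> C)"

definition zero_sectorial :: "('a::complex_banach \<times> 'a) set \<Rightarrow> bool" where
  "zero_sectorial A \<longleftrightarrow> (\<forall>\<omega>>0. sectorial \<omega> A)"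


subsection \<open>Holomorphic functional calculus\<close>

definition Hinf :: "real \<Rightarrow> (complex \<Rightarrow> complex) set" where
  "Hinf \<theta> = {f. f holomorphic_on sector \<theta> \<and> bounded (f ` sector \<theta>)}"

definition Hinf0 :: "real \<Rightarrow> (complex \<Rightarrow> complex) set" where
  "Hinf0 \<theta> = {f \<in> Hinf \<theta>. \<exists>C>0. \<exists>\<epsilon>>0. \<forall>z\<in>sector \<theta>.
      cmod (f z) \<le> C * (1 + cmod (Ln z)) powr (- 1 - \<epsilon>)}"

text \<open>\<open>(1 / (2 \<pi> \<i>)) \<integral> f(z) (z - A)\<^sup>-\<^sup>1 dz\<close> over the boundary of \<open>sector \<sigma>\<close>, counterclockwise:
  the lower ray is traversed from 0 to infinity, the upper one back to 0. The rays are
  parametrised by \<open>z = exp (t \<mp> \<i> \<sigma>)\<close>, \<open>t \<in> \<real>\<close>, so that \<open>dz = z dt\<close>. The integral is the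
  operator-norm valued gauge integral (the Bochner integral of the library would require
  separability).\<close>

definition ray_integrand ::
    "('a::complex_banach \<times> 'a) set \<Rightarrow> (complex \<Rightarrow> complex) \<Rightarrow> real \<Rightarrow> real \<Rightarrow> ('a \<Rightarrow>\<^sub>L 'a)" where
  "ray_integrand A f s t =
     (let z = exp (Complex t s) in op_scaleC (f z * z) (resolvent A z))"

definition sector_boundary_integral ::
    "real \<Rightarrow> ('a::complex_banach \<times> 'a) set \<Rightarrow> (complex \<Rightarrow> complex) \<Rightarrow> ('a \<Rightarrow>\<^sub>L 'a)" where
  "sector_boundary_integral \<sigma> A f = op_scaleC (1 / (2 * of_real pi * \<i>))
     (integral UNIV (ray_integrand A f (- \<sigma>)) - integral UNIV (ray_integrand A f \<sigma>))"

text \<open>\<open>f(A)\<close> for \<open>f \<in> Hinf0 \<theta>\<close>. By Cauchy's theorem every contour angle between 0 and \<open>\<theta>\<close>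
  gives the same operator when \<open>A\<close> is 0-sectorial; \<open>\<theta>/2\<close> is one admissible choice.\<close>

definition hcalc ::
    "real \<Rightarrow> ('a::complex_banach \<times> 'a) set \<Rightarrow> (complex \<Rightarrow> complex) \<Rightarrow> ('a \<Rightarrow>\<^sub>L 'a)" where
  "hcalc \<theta> A f = sector_boundary_integral (\<theta> / 2) A f"

definition rho :: "complex \<Rightarrow> complex" where
  "rho z = z / (1 + z)\<^sup>2"

text \<open>The closed operator \<open>\<rho>(A)\<^sup>-\<^sup>n (\<rho>\<^sup>n f)(A)\<close> as a graph: \<open>x\<close> is in the natural domain iff
  \<open>(\<rho>\<^sup>n f)(A) x\<close> is in the range of \<open>\<rho>(A)\<^sup>n\<close>. All admissible \<open>n\<close> give the same operator; we take
  the least one.\<close>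

definition ext_hcalc ::
    "real \<Rightarrow> ('a::complex_banach \<times> 'a) set \<Rightarrow> (complex \<Rightarrow> complex) \<Rightarrow> ('a \<times> 'a) set" where
  "ext_hcalc \<theta> A f = (let n = (LEAST n. (\<lambda>z. rho z ^ n * f z) \<in> Hinf0 \<theta>) in
     {(x, y). (blinfun_apply (hcalc \<theta> A rho) ^^ n) y
                = blinfun_apply (hcalc \<theta> A (\<lambda>z. rho z ^ n * f z)) x})"


subsection \<open>Partitions of unity, Besov spaces and Mihlin classes\<close>

definition smooth :: "(real \<Rightarrow> complex) \<Rightarrow> bool" where
  "smooth f \<longleftrightarrow> (\<exists>F. F 0 = f \<and>
     (\<forall>k x. (F k has_vector_derivative F (Suc k) x) (at x)))"

definition supp :: "(real \<Rightarrow> complex) \<Rightarrow> real set" where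
  "supp f = closure {x. f x \<noteq> 0}"

definition inhomogeneous_partition :: "(int \<Rightarrow> real \<Rightarrow> complex) \<Rightarrow> bool" where
  "inhomogeneous_partition \<phi> \<longleftrightarrow>
     smooth (\<phi> 0) \<and> smooth (\<phi> 1) \<and> supp (\<phi> 0) \<subseteq> {-1..1} \<and> supp (\<phi> 1) \<subseteq> {1/2..2} \<and>
     (\<forall>n\<ge>2. \<forall>t. \<phi> n t = \<phi> 1 (2 powi (1 - n) * t)) \<and>
     (\<forall>n\<le>-1. \<forall>t. \<phi> n t = \<phi> (- n) (- t)) \<and>
     (\<forall>t. ((\<lambda>n. \<phi> n t) has_sum 1) UNIV)"

text \<open>Functions in \<open>C\<^sub>c\<^sup>\<infinity>(0,\<infinity>)\<close> are identified with their extension by zero to the real line.\<close>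

definition dyadic_piece :: "(real \<Rightarrow> complex) \<Rightarrow> int \<Rightarrow> real \<Rightarrow> complex" where
  "dyadic_piece \<psi> n t = \<psi> (2 powi (- n) * t)"

definition homogeneous_partition :: "(real \<Rightarrow> complex) \<Rightarrow> bool" where
  "homogeneous_partition \<psi> \<longleftrightarrow> smooth \<psi> \<and> supp \<psi> \<subseteq> {1/2..2} \<and>
     (\<forall>t>0. ((\<lambda>n. dyadic_piece \<psi> n t) has_sum 1) UNIV)"

definition inv_fourier :: "(real \<Rightarrow> complex) \<Rightarrow> real \<Rightarrow> complex" where
  "inv_fourier g x = (1 / (2 * pi)) * (LBINT t. g t * exp (\<i> * of_real (x * t)))"

definition convolution :: "(real \<Rightarrow> complex) \<Rightarrow> (real \<Rightarrow> complex) \<Rightarrow> real \<Rightarrow> complex" where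
  "convolution f g x = (LBINT y. f (x - y) * g y)"

definition besov_term ::
    "(int \<Rightarrow> real \<Rightarrow> complex) \<Rightarrow> real \<Rightarrow> (real \<Rightarrow> complex) \<Rightarrow> int \<Rightarrow> real" where
  "besov_term \<phi> \<alpha> f n =
     2 powr (\<bar>real_of_int n\<bar> * \<alpha>) * (SUP x. cmod (convolution f (inv_fourier (\<phi> n)) x))"

definition besov :: "(int \<Rightarrow> real \<Rightarrow> complex) \<Rightarrow> real \<Rightarrow> (real \<Rightarrow> complex) set" where
  "besov \<phi> \<alpha> = {f. bounded (range f) \<and> uniformly_continuous_on UNIV f \<and>
                   besov_term \<phi> \<alpha> f summable_on UNIV}"

definition besov_norm :: "(int \<Rightarrow> real \<Rightarrow> complex) \<Rightarrow> real \<Rightarrow> (real \<Rightarrow> complex) \<Rightarrow> real" where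
  "besov_norm \<phi> \<alpha> f = (\<Sum>\<^sub>\<infinity>n. besov_term \<phi> \<alpha> f n)"

text \<open>Functions on the positive half line are total functions on the reals of which only the
  values at positive arguments matter.\<close>

definition mihlin :: "(int \<Rightarrow> real \<Rightarrow> complex) \<Rightarrow> real \<Rightarrow> (real \<Rightarrow> complex) set" where
  "mihlin \<phi> \<alpha> = {f. (\<lambda>x. f (exp x)) \<in> besov \<phi> \<alpha>}"

definition mihlin_norm :: "(int \<Rightarrow> real \<Rightarrow> complex) \<Rightarrow> real \<Rightarrow> (real \<Rightarrow> complex) \<Rightarrow> real" where
  "mihlin_norm \<phi> \<alpha> f = besov_norm \<phi> \<alpha> (\<lambda>x. f (exp x))"

definition mihlin1_term ::
    "(int \<Rightarrow> real \<Rightarrow> complex) \<Rightarrow> (real \<Rightarrow> complex) \<Rightarrow> real \<Rightarrow> (real \<Rightarrow> complex) \<Rightarrow> int \<Rightarrow> real" where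
  "mihlin1_term \<phi> \<eta> \<alpha> f n = mihlin_norm \<phi> \<alpha> (\<lambda>t. f t * dyadic_piece \<eta> n t)"

definition mihlin1 ::
    "(int \<Rightarrow> real \<Rightarrow> complex) \<Rightarrow> (real \<Rightarrow> complex) \<Rightarrow> real \<Rightarrow> (real \<Rightarrow> complex) set" where
  "mihlin1 \<phi> \<eta> \<alpha> = {f \<in> mihlin \<phi> \<alpha>.
     (\<forall>n. (\<lambda>t. f t * dyadic_piece \<eta> n t) \<in> mihlin \<phi> \<alpha>) \<and>
     mihlin1_term \<phi> \<eta> \<alpha> f summable_on UNIV}"

definition mihlin1_norm ::
    "(int \<Rightarrow> real \<Rightarrow> complex) \<Rightarrow> (real \<Rightarrow> complex) \<Rightarrow> real \<Rightarrow> (real \<Rightarrow> complex) \<Rightarrow> real" where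
  "mihlin1_norm \<phi> \<eta> \<alpha> f = (\<Sum>\<^sub>\<infinity>n. mihlin1_term \<phi> \<eta> \<alpha> f n)"

abbreviation on_reals :: "(complex \<Rightarrow> complex) \<Rightarrow> real \<Rightarrow> complex" where
  "on_reals f \<equiv> (\<lambda>t. f (complex_of_real t))"


subsection \<open>Mihlin calculi\<close>

definition mihlin1_estimate ::
    "(int \<Rightarrow> real \<Rightarrow> complex) \<Rightarrow> (real \<Rightarrow> complex) \<Rightarrow> real \<Rightarrow> ('a::complex_banach \<times> 'a) set
      \<Rightarrow> real \<Rightarrow> bool" where
  "mihlin1_estimate \<phi> \<eta> \<alpha> A \<omega> \<longleftrightarrow>
     (\<exists>C. \<forall>f\<in>Hinf0 \<omega>. norm (hcalc \<omega> A f) \<le> C * mihlin1_norm \<phi> \<eta> \<alpha> (on_reals f))"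

definition has_mihlin1_calculus ::
    "(int \<Rightarrow> real \<Rightarrow> complex) \<Rightarrow> (real \<Rightarrow> complex) \<Rightarrow> real \<Rightarrow> ('a::complex_banach \<times> 'a) set
      \<Rightarrow> bool" where
  "has_mihlin1_calculus \<phi> \<eta> \<alpha> A \<longleftrightarrow> (\<exists>\<omega>. 0 < \<omega> \<and> \<omega> < pi \<and> mihlin1_estimate \<phi> \<eta> \<alpha> A \<omega>)"

text \<open>Extension by continuity: \<open>f(A)\<close> is the operator-norm limit of \<open>g k (A)\<close> for \<open>g k \<in> Hinf0 \<omega>\<close>
  tending to \<open>f\<close> in the \<open>mihlin1\<close> norm, where \<open>\<omega>\<close> is an angle at which the estimate holds. The
  limit depends neither on the sequence nor on \<open>\<omega>\<close>.\<close>

definition mihlin1_calc ::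
    "(int \<Rightarrow> real \<Rightarrow> complex) \<Rightarrow> (real \<Rightarrow> complex) \<Rightarrow> real \<Rightarrow> ('a::complex_banach \<times> 'a) set
      \<Rightarrow> (real \<Rightarrow> complex) \<Rightarrow> ('a \<Rightarrow>\<^sub>L 'a)" where
  "mihlin1_calc \<phi> \<eta> \<alpha> A f = (THE T. \<exists>\<omega> g. 0 < \<omega> \<and> \<omega> < pi \<and> mihlin1_estimate \<phi> \<eta> \<alpha> A \<omega> \<and>
     (\<forall>k::nat. g k \<in> Hinf0 \<omega>) \<and>
     (\<lambda>k. mihlin1_norm \<phi> \<eta> \<alpha> (\<lambda>t. f t - on_reals (g k) t)) \<longlonglongrightarrow> 0 \<and>
     (\<lambda>k. hcalc \<omega> A (g k)) \<longlonglongrightarrow> T)"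

definition has_bounded_mihlin_calculus ::
    "(int \<Rightarrow> real \<Rightarrow> complex) \<Rightarrow> real \<Rightarrow> ('a::complex_banach \<times> 'a) set \<Rightarrow> bool" where
  "has_bounded_mihlin_calculus \<phi> \<alpha> A \<longleftrightarrow>
     (\<exists>C. \<forall>f. (\<forall>\<omega>. 0 < \<omega> \<and> \<omega> < pi \<longrightarrow> f \<in> Hinf \<omega>) \<and> on_reals f \<in> mihlin \<phi> \<alpha> \<longrightarrow>
        (\<forall>\<theta>. 0 < \<theta> \<and> \<theta> < pi \<longrightarrow>
           (\<exists>T. ext_hcalc \<theta> A f = graph_of T \<and> norm T \<le> C * mihlin_norm \<phi> \<alpha> (on_reals f))))"


subsection \<open>R-boundedness and Paley-Littlewood decomposition\<close>

text \<open>The joint law of a family of independent Rademacher variables; the variables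
  themselves are the coordinates.\<close>

definition rademacher :: "('i \<Rightarrow> real) measure" where
  "rademacher = (\<Pi>\<^sub>M i\<in>UNIV. measure_pmf (pmf_of_set {-1, 1}))"

definition R_bounded :: "('a \<Rightarrow>\<^sub>L 'a::complex_banach) set \<Rightarrow> bool" where
  "R_bounded \<tau> \<longleftrightarrow> (\<exists>C. \<forall>(n::nat) T x. (\<forall>k\<in>{1..n}. T k \<in> \<tau>) \<longrightarrow>
     (\<integral>\<epsilon>. norm (\<Sum>k=1..n. \<epsilon> k *\<^sub>R blinfun_apply (T k) (x k)) \<partial>rademacher)
       \<le> C * (\<integral>\<epsilon>. norm (\<Sum>k=1..n. \<epsilon> k *\<^sub>R x k) \<partial>rademacher))"

definition equivalent :: "('x \<Rightarrow> real) \<Rightarrow> ('x \<Rightarrow> real) \<Rightarrow> bool" where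
  "equivalent a b \<longleftrightarrow> (\<exists>c>0. \<exists>C>0. \<forall>x. c * a x \<le> b x \<and> b x \<le> C * a x)"

text \<open>\<open>summable_on\<close> (convergence along the net of finite index sets) is unconditional
  convergence. It makes the random series converge for every choice of signs and the supremum
  be taken over a bounded set.\<close>

definition paley_littlewood ::
    "(int \<Rightarrow> real \<Rightarrow> complex) \<Rightarrow> (real \<Rightarrow> complex) \<Rightarrow> real \<Rightarrow> ('a::complex_banach \<times> 'a) set
      \<Rightarrow> (real \<Rightarrow> complex) \<Rightarrow> bool" where
  "paley_littlewood \<phi> \<eta> \<alpha> A \<psi> \<longleftrightarrow>
     (let P = (\<lambda>n x. blinfun_apply (mihlin1_calc \<phi> \<eta> \<alpha> A (dyadic_piece \<psi> n)) x);
          E = (\<lambda>x. \<integral>\<epsilon>. norm (\<Sum>\<^sub>\<infinity>n. \<epsilon> n *\<^sub>R P n x) \<partial>rademacher);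
          S = (\<lambda>x. SUP a\<in>{a::int \<Rightarrow> complex. \<forall>n. cmod (a n) \<le> 1}. norm (\<Sum>\<^sub>\<infinity>n. a n *\<^sub>C P n x))
      in (\<forall>x. (\<lambda>n. P n x) summable_on UNIV) \<and> equivalent norm E \<and> equivalent E S)"

end

theory Submission
  imports Defs
begin

text \<open>Write \<open>P\<^sub>n = \<psi>\<^sub>n(A)\<close> for the Paley-Littlewood pieces. The
  operator \<open>f(A)\<close> is the sum of the operators \<open>T\<^sub>n = (f
  \<psi>\<^sub>n)(A)\<close>. Each \<open>f \<psi>\<^sub>n\<close> lives on one dyadic
  interval, so its \<open>mihlin1\<close> norm is at most a constant times the Mihlin norm
  of \<open>f\<close>, uniformly in \<open>n\<close>, and the \<open>T\<^sub>n\<close> form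
  an R-bounded family. For a finite partial sum \<open>y = \<Sum>\<^sub>n T\<^sub>n
  x\<close>, \<open>n \<in> F\<close>, the calculus gives \<open>P\<^sub>m y =
  \<Sum>\<^sub>d T\<^sub>m P\<^bsub>m+d\<^esub> x\<close> with \<open>\<bar>d\<bar> \<le>
  2\<close> and \<open>m + d \<in> F\<close>. Hence, by the equivalence of the norm with the
  random sum and by R-boundedness, \<open>\<parallel>y\<parallel>\<close> is at most a
  constant times \<open>\<E> \<parallel>\<Sum>\<^sub>m \<epsilon>\<^sub>m P\<^sub>m
  y\<parallel>\<close>, hence at most a constant times the Mihlin norm of \<open>f\<close>
  times \<open>\<E> \<parallel>\<Sum>\<^sub>n \<epsilon>\<^sub>n P\<^sub>n
  x\<parallel>\<close> over \<open>n \<in> F\<close>. The last average is at most a constant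
  times \<open>\<parallel>x\<parallel>\<close> (this is where the supremum over multipliers
  of modulus at most 1 enters), and it is small when \<open>F\<close> avoids a large finite
  set, because \<open>\<Sum>\<^sub>n P\<^sub>n x\<close> converges unconditionally. So
  \<open>T x = \<Sum>\<^sub>n T\<^sub>n x\<close> converges and \<open>T\<close> has the
  required norm (\<open>multiplier_operator\<close>). That the pieces add up to the identity
  (\<open>P_has_sum\<close>) follows from the equivalence of norms: \<open>x -
  \<Sum>\<^sub>n P\<^sub>n x\<close> is annihilated by all \<open>P\<^sub>m\<close>. Finally
  \<open>\<rho>(A) T = (\<rho> f)(A)\<close> piece by piece, and \<open>\<rho>(A)\<close> is
  injective since each \<open>P\<^sub>n\<close> factors through it; therefore
  \<open>T\<close> is the extended calculus of \<open>f\<close>.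

  The functional analysis rests on three facts about the calculi. First, the contour integral
  calculus on \<open>Hinf0\<close> is multiplicative (\<open>hcalc_mult\<close>). In
  logarithmic coordinates the rays are horizontal lines. Cauchy's formula gives
  \<open>R(e\<^sup>v) g(A) = g(e\<^sup>v) R(e\<^sup>v) - K(v)\<close>, where
  \<open>K\<close> extends continuously across the real axis; hence the integrals of
  \<open>f(e\<^sup>v) e\<^sup>v K(v)\<close> along the two lines agree and cancel. Secondly,
  if \<open>u\<close> is a test function in the logarithmic variable, then
  \<open>u(A)\<close> is the limit of the operators of its convolutions with Gaussians.
  These are entire functions of \<open>log z\<close>, belong to \<open>Hinf0\<close> at
  every angle, and converge together with all derivatives and with the weight \<open>1 +
  x\<^sup>2\<close>. So the calculus of test functions is well defined and inherits
  linearity and multiplicativity (\<open>calc_limit_approx\<close>,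
  \<open>hcalc_calc\<close>, \<open>calc_mult\<close>). Thirdly, smooth functions with
  bounded derivatives are multipliers of Besov spaces (\<open>besov_multiplier\<close>),
  which is what bounds the \<open>mihlin1\<close> norm of \<open>f \<psi>\<^sub>n\<close>.
  All functions that occur are smooth in the logarithmic variable with bounded derivatives,
  so Besov norms are only ever computed for such functions.\<close>

section \<open>Iterated derivatives of smooth functions\<close>

definition D :: "(real \<Rightarrow> complex) \<Rightarrow> real \<Rightarrow> complex" where
  "D f x = vector_derivative f (at x)"

abbreviation nd :: "nat \<Rightarrow> (real \<Rightarrow> complex) \<Rightarrow> real \<Rightarrow> complex" where
  "nd k f \<equiv> (D ^^ k) f"

lemma nd_Suc: "nd (Suc k) f = nd k (D f)"
  by (simp add: funpow_Suc_right del: funpow.simps)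

text \<open>Closure of smooth functions under products and substitutions is proved by induction on the
  number of derivatives; the witness sequence in the definition of \<open>smooth\<close>
  does not lend itself to that.\<close>

fun times_diff :: "nat \<Rightarrow> (real \<Rightarrow> complex) \<Rightarrow> bool" where
  "times_diff 0 f = True"
| "times_diff (Suc k) f = ((\<forall>x. f differentiable at x) \<and> times_diff k (D f))"

lemma D_eqI: "(\<And>x. (f has_vector_derivative f' x) (at x)) \<Longrightarrow> D f = f'"
  by (auto simp: D_def fun_eq_iff vector_derivative_at)

lemma has_D: "f differentiable at x \<Longrightarrow> (f has_vector_derivative D f x) (at x)"
  by (simp add: D_def vector_derivative_works[symmetric])

lemma smooth_iff_times_diff: "smooth f \<longleftrightarrow> (\<forall>k. times_diff k f)"
proof
  assume "smooth f"
  then obtain F where F: "F 0 = f" "\<And>k x. (F k has_vector_derivative F (Suc k) x) (at x)"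
    unfolding smooth_def by auto
  have "times_diff k (F n)" for k n
  proof (induction k arbitrary: n)
    case (Suc k)
    have "D (F n) = F (Suc n)" using F(2) by (rule D_eqI)
    with Suc F(2) show ?case by (auto intro: differentiableI_vector)
  qed simp
  with F(1) show "\<forall>k. times_diff k f" by metis
next
  assume td: "\<forall>k. times_diff k f"
  have "times_diff (k + n) f \<Longrightarrow> times_diff n (nd k f)" for k n
    by (induction k arbitrary: f) (auto simp: nd_Suc simp del: funpow.simps(2))
  then have "times_diff (Suc 0) (nd k f)" for k using td by blast
  then have "(nd k f has_vector_derivative nd (Suc k) f x) (at x)" for k x
    using has_D[of "nd k f"] by auto
  then show "smooth f" unfolding smooth_def by (intro exI[of _ "\<lambda>k. nd k f"]) simp
qed

lemma smooth_differentiable: "smooth f \<Longrightarrow> f differentiable at x"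
  unfolding smooth_def using differentiableI_vector by metis

lemma smooth_has_D: "smooth f \<Longrightarrow> (f has_vector_derivative D f x) (at x)"
  by (intro has_D smooth_differentiable)

lemma smooth_D: "smooth f \<Longrightarrow> smooth (D f)"
  unfolding smooth_iff_times_diff by (metis times_diff.simps(2))

lemma smooth_nd: "smooth f \<Longrightarrow> smooth (nd k f)"
  by (induction k) (auto intro: smooth_D)

lemma smooth_has_nd: "smooth f \<Longrightarrow> (nd k f has_vector_derivative nd (Suc k) f x) (at x)"
  using smooth_has_D[OF smooth_nd] by simp

lemma smooth_continuous: "smooth f \<Longrightarrow> continuous_on S f"
  by (meson smooth_differentiable differentiable_imp_continuous_within continuous_at_imp_continuous_on)

lemma times_diff_Suc_D: "times_diff (Suc k) f \<Longrightarrow> times_diff k f"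
  by (induction k arbitrary: f) auto

lemma times_diff_add:
  "times_diff k f \<Longrightarrow> times_diff k g \<Longrightarrow> times_diff k (\<lambda>x. f x + g x)"
proof (induction k arbitrary: f g)
  case (Suc k)
  have "D (\<lambda>x. f x + g x) = (\<lambda>x. D f x + D g x)"
    using Suc.prems by (intro D_eqI has_vector_derivative_add has_D) auto
  with Suc show ?case by auto
qed simp

lemma times_diff_mult:
  "times_diff k f \<Longrightarrow> times_diff k g \<Longrightarrow> times_diff k (\<lambda>x. f x * g x)"
proof (induction k arbitrary: f g)
  case (Suc k)
  have "D (\<lambda>x. f x * g x) = (\<lambda>x. f x * D g x + D f x * g x)"
    using Suc.prems by (intro D_eqI has_vector_derivative_mult has_D) auto
  moreover have "times_diff k f" "times_diff k g"
    using Suc.prems times_diff_Suc_D by blast+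
  ultimately show ?case using Suc by (auto intro!: times_diff_add)
qed simp

lemma smooth_add: "smooth f \<Longrightarrow> smooth g \<Longrightarrow> smooth (\<lambda>x. f x + g x)"
  and smooth_mult: "smooth f \<Longrightarrow> smooth g \<Longrightarrow> smooth (\<lambda>x. f x * g x)"
  by (auto simp: smooth_iff_times_diff intro: times_diff_add times_diff_mult)

lemma smooth_const: "smooth (\<lambda>_. c)"
  unfolding smooth_def
  by (intro exI[of _ "\<lambda>k. if k = 0 then (\<lambda>_. c) else (\<lambda>_. 0)"])
     (auto intro: has_vector_derivative_const)

lemma smooth_id: "smooth complex_of_real"
  unfolding smooth_def
  by (intro exI[of _ "\<lambda>k. if k = 0 then complex_of_real else if k = 1 then (\<lambda>_. 1) else (\<lambda>_. 0)"])
     (auto intro!: has_vector_derivative_of_real derivative_eq_intros simp: has_vector_derivative_const)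

lemma smooth_exp: "smooth (\<lambda>x. complex_of_real (exp x))"
  unfolding smooth_def
  by (intro exI[of _ "\<lambda>_ x. complex_of_real (exp x)"] conjI allI has_vector_derivative_of_real DERIV_exp refl)

lemma smooth_cmult: "smooth f \<Longrightarrow> smooth (\<lambda>x. c * f x)"
  by (intro smooth_mult smooth_const)

lemma smooth_minus: "smooth f \<Longrightarrow> smooth (\<lambda>x. - f x)"
  using smooth_cmult[of f "-1"] by simp

lemma D_add: "smooth f \<Longrightarrow> smooth g \<Longrightarrow> D (\<lambda>x. f x + g x) = (\<lambda>x. D f x + D g x)"
  by (intro D_eqI has_vector_derivative_add smooth_has_D)

lemma D_mult: "smooth f \<Longrightarrow> smooth g \<Longrightarrow> D (\<lambda>x. f x * g x) = (\<lambda>x. f x * D g x + D f x * g x)"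
  by (intro D_eqI has_vector_derivative_mult smooth_has_D)

lemma nd_add: "smooth f \<Longrightarrow> smooth g \<Longrightarrow> nd k (\<lambda>x. f x + g x) = (\<lambda>x. nd k f x + nd k g x)"
  by (induction k) (auto simp: D_add smooth_nd)

lemma nd_cmult: "smooth f \<Longrightarrow> nd k (\<lambda>x. c * f x) = (\<lambda>x. c * nd k f x)"
proof (induction k)
  case (Suc k)
  have "D (\<lambda>x. c * nd k f x) = (\<lambda>x. c * nd (Suc k) f x)"
    by (intro D_eqI has_vector_derivative_mult_right smooth_has_nd Suc.prems)
  then show ?case using Suc by simp
qed simp

lemma nd_diff: "smooth f \<Longrightarrow> smooth g \<Longrightarrow> nd k (\<lambda>x. f x - g x) = (\<lambda>x. nd k f x - nd k g x)"
  using nd_add[of f "\<lambda>x. - g x" k] nd_cmult[of g k "-1"] smooth_minus[of g] by simp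

text \<open>Every application of the product rule doubles the number of terms, which replaces the
  binomial coefficients of Leibniz' rule. All bounds are at one point, so that weights
  depending on the point can be inserted.\<close>

lemma nd_mult_bound:
  assumes "smooth f" "smooth g"
    and "\<And>i. i \<le> k \<Longrightarrow> cmod (nd i f x) \<le> a" "\<And>i. i \<le> k \<Longrightarrow> cmod (nd i g x) \<le> b"
  shows "cmod (nd k (\<lambda>y. f y * g y) x) \<le> 2 ^ k * (a * b)"
  using assms
proof (induction k arbitrary: f g)
  case 0
  have "cmod (f x) \<le> a" "cmod (g x) \<le> b" using 0(3)[of 0] 0(4)[of 0] by simp_all
  then have "cmod (f x) * cmod (g x) \<le> a * b"
    by (intro mult_mono) (auto intro: order_trans[OF norm_ge_zero])
  then show ?case by (simp add: norm_mult)
next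
  case (Suc k)
  have *: "nd (Suc k) (\<lambda>y. f y * g y) x = nd k (\<lambda>y. f y * D g y) x + nd k (\<lambda>y. D f y * g y) x"
    using Suc.prems(1,2) by (simp add: nd_Suc D_mult nd_add smooth_mult smooth_D del: funpow.simps(2))
  have "cmod (nd i (D g) x) \<le> b" "cmod (nd i (D f) x) \<le> a" if "i \<le> k" for i
    using Suc.prems(3,4)[of "Suc i"] that by (simp_all add: nd_Suc del: funpow.simps(2))
  moreover have "cmod (nd i g x) \<le> b" "cmod (nd i f x) \<le> a" if "i \<le> k" for i
    using Suc.prems(3,4)[of i] that by auto
  ultimately have "cmod (nd k (\<lambda>y. f y * D g y) x) \<le> 2 ^ k * (a * b)"
    "cmod (nd k (\<lambda>y. D f y * g y) x) \<le> 2 ^ k * (a * b)"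
    using Suc.prems(1,2) by (intro Suc.IH; simp add: smooth_D)+
  then show ?case unfolding * by (intro order_trans[OF norm_triangle_ineq]) simp
qed

lemma times_diff_affine: "times_diff k f \<Longrightarrow> times_diff k (\<lambda>x. f (a * x + b))"
proof (induction k arbitrary: f)
  case (Suc k)
  have "D (\<lambda>x. f (a * x + b)) = (\<lambda>x. a * D f (a * x + b))"
  proof (rule D_eqI)
    fix x
    have "(f \<circ> (\<lambda>x. a * x + b) has_vector_derivative a *\<^sub>R D f (a * x + b)) (at x)"
      by (rule vector_diff_chain_at)
        (use Suc.prems has_D in \<open>auto intro!: derivative_eq_intros simp: has_real_derivative_iff_has_vector_derivative[symmetric]\<close>)
    then show "((\<lambda>x. f (a * x + b)) has_vector_derivative a * D f (a * x + b)) (at x)"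
      by (simp add: o_def scaleR_conv_of_real)
  qed
  moreover have "(\<lambda>x. f (a * x + b)) differentiable at x" for x
    using Suc.prems differentiable_chain_at[of "\<lambda>x. a * x + b" x f] by (auto simp: o_def)
  moreover have "times_diff k (\<lambda>x. complex_of_real a * D f (a * x + b))"
    using Suc smooth_const[of "complex_of_real a"] unfolding smooth_iff_times_diff
    by (intro times_diff_mult) auto
  ultimately show ?case by simp
qed simp

lemma smooth_affine: "smooth f \<Longrightarrow> smooth (\<lambda>x. f (a * x + b))"
  by (simp add: smooth_iff_times_diff times_diff_affine)

lemma D_affine: "smooth f \<Longrightarrow> D (\<lambda>x. f (a * x + b)) = (\<lambda>x. a * D f (a * x + b))"
proof (rule D_eqI)
  fix x assume f: "smooth f"
  have "(f \<circ> (\<lambda>x. a * x + b) has_vector_derivative a *\<^sub>R D f (a * x + b)) (at x)"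
    by (rule vector_diff_chain_at)
      (use smooth_has_D[OF f] in \<open>auto intro!: derivative_eq_intros simp: has_real_derivative_iff_has_vector_derivative[symmetric]\<close>)
  then show "((\<lambda>x. f (a * x + b)) has_vector_derivative a * D f (a * x + b)) (at x)"
    by (simp add: o_def scaleR_conv_of_real)
qed

lemma nd_shift: "smooth f \<Longrightarrow> nd k (\<lambda>x. f (x + b)) = (\<lambda>x. nd k f (x + b))"
proof (induction k)
  case (Suc k)
  show ?case using D_affine[OF smooth_nd[OF Suc.prems, of k], of 1 b] Suc by simp
qed simp

lemma times_diff_exp: "times_diff k f \<Longrightarrow> times_diff k (\<lambda>x. f (exp x))"
proof (induction k arbitrary: f)
  case (Suc k)
  have *: "((\<lambda>x. f (exp x)) has_vector_derivative exp x * D f (exp x)) (at x)" for x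
  proof -
    have "(f \<circ> exp has_vector_derivative exp x *\<^sub>R D f (exp x)) (at x)"
      by (rule vector_diff_chain_at)
        (use Suc.prems has_D in \<open>auto intro!: derivative_eq_intros simp: has_real_derivative_iff_has_vector_derivative[symmetric]\<close>)
    then show ?thesis by (simp add: o_def scaleR_conv_of_real exp_of_real)
  qed
  have "D (\<lambda>x. f (exp x)) = (\<lambda>x. complex_of_real (exp x) * D f (exp x))"
    using * by (intro D_eqI) (simp add: exp_of_real)
  moreover have "times_diff k (\<lambda>x. complex_of_real (exp x) * D f (exp x))"
    using Suc smooth_exp unfolding smooth_iff_times_diff by (intro times_diff_mult) auto
  ultimately show ?case using * differentiableI_vector by auto
qed simp

lemma smooth_exp_subst: "smooth f \<Longrightarrow> smooth (\<lambda>x. f (exp x))"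
  by (simp add: smooth_iff_times_diff times_diff_exp)

lemma D_cong_open:
  assumes "open S" "x \<in> S" "\<And>y. y \<in> S \<Longrightarrow> f y = g y" shows "D f x = D g x"
  unfolding D_def using assms
  by (intro vector_derivative_cong_eq) (auto simp: eventually_nhds)

lemma nd_cong_open:
  assumes "open S" "\<And>y. y \<in> S \<Longrightarrow> f y = g y" shows "x \<in> S \<Longrightarrow> nd k f x = nd k g x"
proof (induction k arbitrary: x)
  case (Suc k)
  then show ?case using D_cong_open[OF assms(1) Suc.prems, of "nd k f" "nd k g"] by simp
qed (use assms in auto)

lemma nd_zero: "nd k (\<lambda>_. 0) = (\<lambda>_. 0)"
  by (induction k) (auto intro!: D_eqI has_vector_derivative_const)

lemma nd_zero_outside:
  assumes "closed S" "\<And>y. y \<notin> S \<Longrightarrow> f y = 0" shows "x \<notin> S \<Longrightarrow> nd k f x = 0"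
  using nd_cong_open[of "- S" f "\<lambda>_. 0" x k] assms by (auto simp: nd_zero)

text \<open>The quotient rule gives \<open>h'/t - (h/t)/t\<close>, two quotients of functions that
  vanish near 0, so the induction closes. At the origin the default value of the division is
  the correct value 0.\<close>

lemma times_diff_div_id:
  assumes "0 < d"
  shows "times_diff k h \<Longrightarrow> (\<And>t. \<bar>t\<bar> < d \<Longrightarrow> h t = 0) \<Longrightarrow> times_diff k (\<lambda>t. h t / complex_of_real t)"
proof (induction k arbitrary: h)
  case (Suc k)
  have z: "D h t = 0" if "\<bar>t\<bar> < d" for t
    using nd_cong_open[of "{-d<..<d}" h "\<lambda>_. 0" t 1] Suc.prems(2) that nd_zero[of 1] by (auto simp: abs_less_iff)
  \<comment> \<open>the derivative of the quotient, also correct at 0, where it evaluates to 0\<close>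
  let ?g = "\<lambda>t. D h t / of_real t + (-1) * ((h t / of_real t) / of_real t)"
  have *: "((\<lambda>t. h t / complex_of_real t) has_vector_derivative ?g t) (at t)" for t
  proof (cases "t = 0")
    case True
    have "((\<lambda>t. h t / complex_of_real t) has_vector_derivative 0) (at t)"
      by (rule has_vector_derivative_transform_within_open[of "\<lambda>_. 0" _ _ "{-d<..<d}"])
         (use True \<open>0 < d\<close> Suc.prems(2) in \<open>auto simp: abs_less_iff has_vector_derivative_const\<close>)
    then show ?thesis using True by simp
  next
    case False
    have "((\<lambda>t. h t * complex_of_real (inverse t)) has_vector_derivative
        h t * complex_of_real (- (inverse t * inverse t)) + D h t * complex_of_real (inverse t)) (at t)"
      using False Suc.prems has_D
      by (intro has_vector_derivative_mult has_vector_derivative_of_real)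
         (auto intro!: derivative_eq_intros simp: power2_eq_square)
    then show ?thesis using False by (simp add: field_simps)
  qed
  have "times_diff k h" using Suc.prems times_diff_Suc_D by blast
  then have h1: "times_diff k (\<lambda>t. h t / complex_of_real t)" using Suc.IH Suc.prems(2) by blast
  have "times_diff k (\<lambda>t. h t / complex_of_real t / complex_of_real t)"
    by (rule Suc.IH[OF h1]) (use Suc.prems(2) in auto)
  moreover have "times_diff k (\<lambda>t. D h t / complex_of_real t)"
    using Suc.prems z by (intro Suc.IH) auto
  ultimately have "times_diff k ?g" using smooth_const[of "-1"] unfolding smooth_iff_times_diff
    by (intro times_diff_add times_diff_mult) auto
  moreover have "D (\<lambda>t. h t / complex_of_real t) = ?g" using * by (rule D_eqI)
  ultimately show ?case using * differentiableI_vector by auto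
qed simp

lemma smooth_div_id:
  assumes "0 < d" "smooth h" "\<And>t. \<bar>t\<bar> < d \<Longrightarrow> h t = 0"
  shows "smooth (\<lambda>t. h t / complex_of_real t)"
  using assms times_diff_div_id by (auto simp: smooth_iff_times_diff)

text \<open>Makes the Cauchy estimates available for derivatives along the real line.\<close>

lemma holomorphic_on_line_smooth:
  assumes "h holomorphic_on S" "open S" "range complex_of_real \<subseteq> S"
  shows "smooth (\<lambda>x. h (of_real x))" "nd k (\<lambda>x. h (of_real x)) = (\<lambda>x. (deriv ^^ k) h (of_real x))"
proof -
  have *: "((\<lambda>x. (deriv ^^ k) h (complex_of_real x)) has_vector_derivative (deriv ^^ Suc k) h (complex_of_real x)) (at x)" for k x
  proof -
    have "(deriv ^^ k) h holomorphic_on S" using assms by (intro holomorphic_higher_deriv)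
    then have "((deriv ^^ k) h has_field_derivative (deriv ^^ Suc k) h (of_real x)) (at (of_real x))"
      using assms by (auto intro!: holomorphic_derivI[of _ S])
    then show ?thesis by (rule has_vector_derivative_real_field)
  qed
  show "smooth (\<lambda>x. h (of_real x))"
    unfolding smooth_def using * by (intro exI[of _ "\<lambda>k x. (deriv ^^ k) h (of_real x)"]) auto
  show "nd k (\<lambda>x. h (of_real x)) = (\<lambda>x. (deriv ^^ k) h (of_real x))"
  proof (induction k)
    case (Suc k)
    have "D (\<lambda>x. (deriv ^^ k) h (complex_of_real x)) = (\<lambda>x. (deriv ^^ Suc k) h (of_real x))"
      using * by (rule D_eqI)
    then show ?case using Suc by simp
  qed simp
qed

section \<open>Differentiation under the integral\<close>

lemma integrable_decay2: "integrable lborel (\<lambda>x::real. 1 / (1 + x\<^sup>2))"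
  using integrable_inverse_1_plus_square
  by (simp add: set_integrable_def inverse_eq_divide einterval_def)

lemma has_vector_derivative_iff_quotient:
  fixes f :: "real \<Rightarrow> 'b::real_normed_vector"
  shows "(f has_vector_derivative f') (at x) \<longleftrightarrow>
    ((\<lambda>y. (1 / (y - x)) *\<^sub>R (f y - f x)) \<longlongrightarrow> f') (at x)"
proof -
  have *: "norm ((1 / norm (y - x)) *\<^sub>R (f y - (f x + (y - x) *\<^sub>R f'))) =
      norm ((1 / (y - x)) *\<^sub>R (f y - f x) - f')" if "y \<noteq> x" for y
  proof -
    have "(1 / (y - x)) *\<^sub>R (f y - f x) - f' = (1 / (y - x)) *\<^sub>R (f y - (f x + (y - x) *\<^sub>R f'))"
    proof -
      have "(1 / (y - x)) *\<^sub>R ((y - x) *\<^sub>R f') = f'" using that by simp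
      then show ?thesis by (simp only: scaleR_diff_right scaleR_add_right) (simp add: algebra_simps)
    qed
    then show ?thesis by simp
  qed
  have "(f has_vector_derivative f') (at x) \<longleftrightarrow>
      ((\<lambda>y. (1 / norm (y - x)) *\<^sub>R (f y - (f x + (y - x) *\<^sub>R f'))) \<longlongrightarrow> 0) (at x)"
    unfolding has_vector_derivative_def has_derivative_within by (simp add: bounded_linear_scaleR_left)
  also have "\<dots> \<longleftrightarrow> ((\<lambda>y. norm ((1 / norm (y - x)) *\<^sub>R (f y - (f x + (y - x) *\<^sub>R f')))) \<longlongrightarrow> 0) (at x)"
    by (rule tendsto_norm_zero_iff[symmetric])
  also have "\<dots> \<longleftrightarrow> ((\<lambda>y. norm ((1 / (y - x)) *\<^sub>R (f y - f x) - f')) \<longlongrightarrow> 0) (at x)"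
    using * by (intro filterlim_cong refl) (auto simp: eventually_at_filter)
  also have "\<dots> \<longleftrightarrow> ((\<lambda>y. (1 / (y - x)) *\<^sub>R (f y - f x)) \<longlongrightarrow> f') (at x)"
    by (simp add: tendsto_norm_zero_iff LIM_zero_iff)
  finally show ?thesis .
qed

text \<open>Dominated convergence: by the mean value inequality the difference quotients are dominated
  by \<open>w\<close>.\<close>

lemma has_vector_derivative_lebesgue_param:
  fixes G :: "real \<Rightarrow> real \<Rightarrow> complex"
  assumes int: "\<And>x. integrable lborel (G x)"
    and der: "\<And>x t. ((\<lambda>x. G x t) has_vector_derivative G' x t) (at x)"
    and meas: "\<And>x. G' x \<in> borel_measurable borel"
    and w: "integrable lborel w" and bd: "\<And>x t. cmod (G' x t) \<le> w t"
  shows "((\<lambda>x. LBINT t. G x t) has_vector_derivative (LBINT t. G' x t)) (at x)"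
proof -
  have "((\<lambda>y. (1 / (y - x)) *\<^sub>R ((LBINT t. G y t) - (LBINT t. G x t))) \<longlongrightarrow> (LBINT t. G' x t)) (at x)"
    unfolding tendsto_at_iff_sequentially comp_def
  proof (intro allI impI)
    fix X :: "nat \<Rightarrow> real" assume X: "\<forall>i. X i \<in> UNIV - {x}" "X \<longlonglongrightarrow> x"
    have "(\<lambda>i. LBINT t. (1 / (X i - x)) *\<^sub>R (G (X i) t - G x t)) \<longlonglongrightarrow> (LBINT t. G' x t)"
    proof (rule integral_dominated_convergence[where w = w])
      show "AE t in lborel. (\<lambda>i. (1 / (X i - x)) *\<^sub>R (G (X i) t - G x t)) \<longlonglongrightarrow> G' x t"
      proof (intro always_eventually allI)
        fix t
        have "((\<lambda>y. (1 / (y - x)) *\<^sub>R (G y t - G x t)) \<longlongrightarrow> G' x t) (at x)"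
          using der[of t x] by (simp add: has_vector_derivative_iff_quotient)
        then show "(\<lambda>i. (1 / (X i - x)) *\<^sub>R (G (X i) t - G x t)) \<longlonglongrightarrow> G' x t"
          using X unfolding tendsto_at_iff_sequentially comp_def by auto
      qed
      show "AE t in lborel. cmod ((1 / (X i - x)) *\<^sub>R (G (X i) t - G x t)) \<le> w t" for i
      proof (intro always_eventually allI)
        fix t
        have w0: "0 \<le> w t" using bd[of 0 t] norm_ge_zero order_trans by blast
        have onb: "onorm (\<lambda>h. h *\<^sub>R G' y t) \<le> w t" for y
          using bd[of y t] by (intro onorm_bound w0) (simp add: mult.commute mult_left_mono)
        have "cmod (G (X i) t - G x t) \<le> w t * norm (X i - x)"
          using der by (intro differentiable_bound[of UNIV "\<lambda>y. G y t" "\<lambda>y h. h *\<^sub>R G' y t"])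
            (auto simp: has_vector_derivative_def onb)
        then show "cmod ((1 / (X i - x)) *\<^sub>R (G (X i) t - G x t)) \<le> w t"
          using X(1) unfolding norm_scaleR by (simp add: pos_divide_le_eq)
      qed
    qed (use meas w int in \<open>auto dest: borel_measurable_integrable\<close>)
    then show "(\<lambda>i. (1 / (X i - x)) *\<^sub>R ((LBINT t. G (X i) t) - (LBINT t. G x t))) \<longlonglongrightarrow> (LBINT t. G' x t)"
      by (simp add: int)
  qed
  then show ?thesis by (simp add: has_vector_derivative_iff_quotient)
qed

text \<open>The bound \<open>v\<close> on the inner integrals provides absolute integrability in the
  plane.\<close>

lemma fubini_real:
  fixes f :: "real \<Rightarrow> real \<Rightarrow> complex"
  assumes c: "continuous_on UNIV (\<lambda>p. f (fst p) (snd p))"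
    and i: "\<And>y. integrable lborel (f y)"
    and v: "integrable lborel v" "\<And>y. (LBINT z. cmod (f y z)) \<le> v y"
  shows "(LBINT y. LBINT z. f y z) = (LBINT z. LBINT y. f y z)"
proof -
  have m: "(\<lambda>p. f (fst p) (snd p)) \<in> borel_measurable (lborel \<Otimes>\<^sub>M lborel)"
    using borel_measurable_continuous_onI[OF c] by (simp add: lborel_prod)
  have [measurable]: "(\<lambda>(y, z). f y z) \<in> borel_measurable (lborel \<Otimes>\<^sub>M lborel)"
    using m by (simp add: case_prod_beta)
  have "integrable (lborel \<Otimes>\<^sub>M lborel) (\<lambda>(y, z). f y z)"
  proof (rule lborel_pair.Fubini_integrable)
    show "integrable lborel (\<lambda>x. LBINT y. norm (case (x, y) of (y, z) \<Rightarrow> f y z))"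
    proof (rule Bochner_Integration.integrable_bound[OF v(1)])
      show "AE x in lborel. norm (LBINT y. cmod (case (x, y) of (y, z) \<Rightarrow> f y z)) \<le> norm (v x)"
        using v(2) by (auto intro!: always_eventually intro: order_trans[OF v(2)] simp: abs_of_nonneg)
    qed measurable
  qed (use i in auto)
  then show ?thesis
    by (simp add: lborel_pair.Fubini_integral[of f])
qed

lemma integral_derivative_zero:
  fixes h :: "real \<Rightarrow> complex"
  assumes d: "\<And>x. (h has_vector_derivative h' x) (at x)" and c: "continuous_on UNIV h'"
    and i: "integrable lborel h'" and l: "(h \<longlongrightarrow> 0) at_top" "(h \<longlongrightarrow> 0) at_bot"
  shows "(LBINT x. h' x) = 0"
proof -
  have "(LBINT x=-\<infinity>..\<infinity>. h' x) = 0 - 0"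
  proof (rule interval_integral_FTC_integrable)
    show "((h \<circ> real_of_ereal) \<longlongrightarrow> 0) (at_right (- \<infinity>))"
      using l(2) by (simp add: ereal_tendsto_simps)
    show "((h \<circ> real_of_ereal) \<longlongrightarrow> 0) (at_left \<infinity>)"
      using l(1) by (simp add: ereal_tendsto_simps)
  qed (use d c i in \<open>auto simp: set_integrable_def einterval_def continuous_on_eq_continuous_at\<close>)
  then show ?thesis by (simp add: interval_lebesgue_integral_def einterval_def set_lebesgue_integral_def)
qed

section \<open>Test functions and their inverse Fourier transforms\<close>

text \<open>The class \<open>C\<^sub>c\<^sup>\<infinity>(\<real>)\<close>.\<close>

definition test :: "(real \<Rightarrow> complex) \<Rightarrow> bool" where
  "test m \<longleftrightarrow> smooth m \<and> (\<exists>a. \<forall>t. a < \<bar>t\<bar> \<longrightarrow> m t = 0)"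

lemma test_smooth: "test m \<Longrightarrow> smooth m" by (simp add: test_def)

lemma test_mult: "test m \<Longrightarrow> smooth g \<Longrightarrow> test (\<lambda>t. m t * g t)"
  by (auto simp: test_def smooth_mult)

lemma test_mult': "test m \<Longrightarrow> smooth g \<Longrightarrow> test (\<lambda>t. g t * m t)"
  by (auto simp: test_def smooth_mult)

lemma test_D: "test m \<Longrightarrow> test (D m)"
proof -
  assume "test m"
  then obtain a where "smooth m" "\<And>t. t \<notin> {-a..a} \<Longrightarrow> m t = 0"
    unfolding test_def by (metis abs_le_iff atLeastAtMost_iff linorder_not_le minus_le_iff)
  then have "smooth (D m)" "\<And>t. t \<notin> {-a..a} \<Longrightarrow> D m t = 0"
    using nd_zero_outside[of "{-a..a}" m _ 1] by (auto simp: smooth_D)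
  then show ?thesis unfolding test_def by (intro conjI exI[of _ a]) (auto simp: abs_if split: if_splits)
qed

lemma test_integrable: "test m \<Longrightarrow> integrable lborel m"
proof -
  assume "test m"
  then obtain a where a: "smooth m" "\<And>t. t \<notin> {-a..a} \<Longrightarrow> m t = 0"
    unfolding test_def by (metis abs_le_iff atLeastAtMost_iff linorder_not_le minus_le_iff)
  have "integrable lborel (\<lambda>x. indicator {-a..a} x *\<^sub>R m x)"
    by (intro borel_integrable_compact smooth_continuous a) auto
  moreover have "(\<lambda>x. indicator {-a..a} x *\<^sub>R m x) = m"
    using a by (auto simp: fun_eq_iff indicator_def)
  ultimately show ?thesis by simp
qed

lemma test_bounded: "test m \<Longrightarrow> \<exists>B. \<forall>t. cmod (m t) \<le> B"
proof -
  assume "test m"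
  then obtain a where a: "smooth m" "\<And>t. t \<notin> {-a..a} \<Longrightarrow> m t = 0"
    unfolding test_def by (metis abs_le_iff atLeastAtMost_iff linorder_not_le minus_le_iff)
  have "bounded (m ` {-a..a})"
    by (intro compact_imp_bounded compact_continuous_image smooth_continuous a) auto
  then obtain B where B: "\<And>t. t \<in> {-a..a} \<Longrightarrow> cmod (m t) \<le> B"
    unfolding bounded_iff by blast
  have "cmod (m t) \<le> max B 0" for t
    using B[of t] a(2)[of t] by (cases "t \<in> {-a..a}") (auto simp del: atLeastAtMost_iff)
  then show ?thesis by blast
qed

lemma test_integral_D: "test m \<Longrightarrow> (LBINT t. D m t) = 0"
proof (rule integral_derivative_zero)
  assume m: "test m"
  then obtain a where a: "\<And>t. a < \<bar>t\<bar> \<Longrightarrow> m t = 0" unfolding test_def by blast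
  show "(m \<longlongrightarrow> 0) at_top"
    by (rule tendsto_eventually) (auto intro!: eventually_at_top_linorderI[of "\<bar>a\<bar> + 1"] a)
  show "(m \<longlongrightarrow> 0) at_bot"
    by (rule tendsto_eventually) (auto intro!: eventually_at_bot_linorderI[of "- \<bar>a\<bar> - 1"] a)
qed (auto intro: smooth_continuous smooth_D smooth_has_D test_smooth test_integrable test_D)

lemma wave_has_derivative:
  "((\<lambda>t. exp (\<i> * complex_of_real (x * t))) has_vector_derivative \<i> * x * exp (\<i> * of_real (x * t))) (at t)"
proof -
  have "((\<lambda>z. exp (\<i> * (of_real x * z))) has_field_derivative \<i> * x * exp (\<i> * (of_real x * of_real t))) (at (of_real t))"
    by (auto intro!: derivative_eq_intros)
  from has_vector_derivative_real_field[OF this] show ?thesis by simp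
qed

lemma smooth_wave: "smooth (\<lambda>t. exp (\<i> * complex_of_real (x * t)))"
proof -
  have "((\<lambda>t. (\<i> * x) ^ k * exp (\<i> * complex_of_real (x * t))) has_vector_derivative
    (\<i> * x) ^ Suc k * exp (\<i> * complex_of_real (x * t))) (at t)" for k t
    using has_vector_derivative_mult_right[OF wave_has_derivative[of x t], of "(\<i> * x) ^ k"]
    by (simp add: mult_ac)
  then show ?thesis unfolding smooth_def
    by (intro exI[of _ "\<lambda>k t. (\<i> * x) ^ k * exp (\<i> * complex_of_real (x * t))"]) auto
qed

text \<open>Integration by parts against the wave \<open>exp(i x t)\<close>.\<close>

lemma inv_fourier_D:
  assumes "test m" shows "inv_fourier (D m) x = - \<i> * x * inv_fourier m x"
proof -
  let ?e = "\<lambda>t. exp (\<i> * complex_of_real (x * t))"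
  have D: "D (\<lambda>t. m t * ?e t) = (\<lambda>t. \<i> * x * (m t * ?e t) + D m t * ?e t)"
    using D_mult[OF test_smooth[OF assms] smooth_wave, of x] D_eqI[OF wave_has_derivative, of x]
    by (simp add: mult_ac)
  have "(LBINT t. \<i> * x * (m t * ?e t) + D m t * ?e t) = 0"
    using test_integral_D[OF test_mult[OF assms smooth_wave], of x] unfolding D .
  then have "\<i> * x * (LBINT t. m t * ?e t) + (LBINT t. D m t * ?e t) = 0"
    using test_integrable[OF test_mult[OF assms smooth_wave], of x]
      test_integrable[OF test_mult[OF test_D[OF assms] smooth_wave], of x] by simp
  then have "(LBINT t. D m t * ?e t) = - (\<i> * x * (LBINT t. m t * ?e t))"
    by (simp add: add_eq_0_iff)
  then show ?thesis unfolding inv_fourier_def by simp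
qed

lemma inv_fourier_bound: "cmod (inv_fourier m x) \<le> (1 / (2 * pi)) * (LBINT t. cmod (m t))"
proof -
  have "cmod (LBINT t. m t * exp (\<i> * of_real (x * t))) \<le> (LBINT t. cmod (m t * exp (\<i> * of_real (x * t))))"
    by (rule integral_norm_bound)
  then show ?thesis unfolding inv_fourier_def
    by (simp add: norm_mult norm_divide divide_right_mono)
qed

text \<open>Two derivatives of \<open>m\<close> turn into the factor \<open>x\<^sup>2\<close>.\<close>

lemma inv_fourier_decay:
  assumes "test m"
  obtains C where "C \<ge> 0" "\<And>x. cmod (inv_fourier m x) \<le> C * (1 / (1 + x\<^sup>2))"
proof -
  define a b where "a = (1 / (2 * pi)) * (LBINT t. cmod (m t))" and
    "b = (1 / (2 * pi)) * (LBINT t. cmod (D (D m) t))"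
  have "cmod (inv_fourier m x) \<le> (a + b) * (1 / (1 + x\<^sup>2))" for x
  proof -
    have "cmod (inv_fourier m x) \<le> a" unfolding a_def by (rule inv_fourier_bound)
    moreover have "x\<^sup>2 * cmod (inv_fourier m x) \<le> b"
      using inv_fourier_bound[of "D (D m)" x] assms
      by (simp add: inv_fourier_D test_D b_def norm_mult power2_eq_square abs_mult[symmetric] mult.assoc[symmetric])
    ultimately have "(1 + x\<^sup>2) * cmod (inv_fourier m x) \<le> a + b" by (simp add: algebra_simps)
    moreover have "1 + x\<^sup>2 > 0" by (simp add: add_pos_nonneg)
    ultimately show ?thesis by (simp add: field_simps)
  qed
  moreover have "a + b \<ge> 0" unfolding a_def b_def by simp
  ultimately show ?thesis using that by blast
qed

lemma inv_fourier_has_derivative: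
  assumes "test m"
  shows "(inv_fourier m has_vector_derivative inv_fourier (\<lambda>t. \<i> * t * m t) x) (at x)"
proof -
  have tm: "test (\<lambda>t. \<i> * of_real t * m t)"
    using assms by (intro test_mult' smooth_mult smooth_const smooth_id)
  have sw: "smooth (\<lambda>t. exp (\<i> * (of_real x * of_real t)))" for x using smooth_wave[of x] by simp
  have "((\<lambda>x. LBINT t. m t * exp (\<i> * of_real (x * t))) has_vector_derivative
     (LBINT t. (\<i> * t * m t) * exp (\<i> * of_real (x * t)))) (at x)"
  proof (rule has_vector_derivative_lebesgue_param[where w = "\<lambda>t. cmod (\<i> * of_real t * m t)"])
    show "integrable lborel (\<lambda>t. m t * exp (\<i> * of_real (x * t)))" for x
      by (intro test_integrable test_mult[OF assms smooth_wave])
    show "((\<lambda>x. m t * exp (\<i> * of_real (x * t))) has_vector_derivative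
       (\<i> * t * m t) * exp (\<i> * of_real (x * t))) (at x)" for t x
      using has_vector_derivative_mult_right[OF wave_has_derivative[of t x], of "m t"]
      by (simp add: mult_ac)
    show "(\<lambda>t. \<i> * of_real t * m t * exp (\<i> * of_real (x * t))) \<in> borel_measurable borel" for x
      by (intro borel_measurable_continuous_onI smooth_continuous smooth_mult[OF test_smooth[OF tm]] smooth_wave)
    show "integrable lborel (\<lambda>t. cmod (\<i> * of_real t * m t))"
      using test_integrable[OF tm] by (rule integrable_norm)
  qed (simp add: norm_mult)
  from has_vector_derivative_mult_right[OF this, of "1 / (2 * pi)"] show ?thesis
    unfolding inv_fourier_def by simp
qed

lemma inv_fourier_continuous: "test m \<Longrightarrow> continuous_on S (inv_fourier m)"
  using inv_fourier_has_derivative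
  by (meson has_vector_derivative_continuous continuous_at_imp_continuous_on)

lemma inv_fourier_integrable: "test m \<Longrightarrow> integrable lborel (inv_fourier m)"
proof -
  assume m: "test m"
  obtain C where C: "C \<ge> 0" "\<And>x. cmod (inv_fourier m x) \<le> C * (1 / (1 + x\<^sup>2))"
    using inv_fourier_decay[OF m] by blast
  show ?thesis
    by (rule Bochner_Integration.integrable_bound[OF integrable_mult_right[OF integrable_decay2, of C]])
      (use C in \<open>auto simp: abs_mult add_pos_nonneg less_imp_le abs_of_nonneg intro!: always_eventually
         borel_measurable_continuous_onI inv_fourier_continuous[OF m]\<close>)
qed

lemma normal_density_fourier:
  "(LBINT y. std_normal_density y * exp (\<i> * complex_of_real (u * y))) = complex_of_real (sqrt (2 * pi) * std_normal_density u)"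
proof -
  have r: "sqrt (2 * pi) * std_normal_density u = exp (- (u^2) / 2)"
    by (simp add: std_normal_density_def)
  have "char std_normal_distribution u = (LBINT y. std_normal_density y *\<^sub>R iexp (u * y))"
    unfolding char_def by (subst integral_density) (auto intro!: always_eventually)
  then show ?thesis
    unfolding r char_std_normal_distribution by (simp add: scaleR_conv_of_real)
qed

lemma integrable_std_normal: "integrable lborel std_normal_density"
  by simp

lemma normal_density_le: "std_normal_density u \<le> std_normal_density 0"
  by (auto simp: std_normal_density_def divide_right_mono)

text \<open>Gaussian regularisation. The average of \<open>m(s + d u)\<close> over a normal variable
  \<open>u\<close> tends to \<open>m s\<close> as \<open>d\<close> tends to 0. Since the
  normal density is its own Fourier transform up to a constant, Fubini's theorem turns this
  average into the inversion integral with the damping factor \<open>N(d v)\<close>, which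
  tends to the undamped one by dominated convergence.\<close>

lemma fourier_inversion:
  assumes m: "test m"
  shows "(LBINT y. inv_fourier m y * exp (- \<i> * complex_of_real (y * s))) = m s"
proof -
  let ?N = std_normal_density
  define L where "L d = (LBINT u. m (s + d * u) * of_real (?N u))" for d
  have cm: "continuous_on UNIV m" by (intro smooth_continuous test_smooth m)
  have cm': "continuous_on S (\<lambda>x. m (h x))" if "continuous_on S h" for S and h :: "'c::topological_space \<Rightarrow> real"
    using continuous_on_compose2[OF cm that] by simp
  have cN: "continuous_on S (\<lambda>x. ?N (h x))" if "continuous_on S h" for S and h :: "'c::topological_space \<Rightarrow> real"
    unfolding std_normal_density_def using that by (intro continuous_intros) auto
  obtain B where B: "\<And>t. cmod (m t) \<le> B" using test_bounded[OF m] by blast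
  have pz: "complex_of_real (2 * pi) * (complex_of_real (1 / (2 * pi)) * z) = z" for z by simp
  \<comment> \<open>Fubini's theorem and the substitution \<open>y = d v\<close>\<close>
  have L_eq: "L d = sqrt (2 * pi) * (LBINT v. of_real (?N (d * v)) * (inv_fourier m v * exp (- \<i> * of_real (v * s))))"
    if d: "d > 0" for d
  proof -
    have "sqrt (2 * pi) * L d = (LBINT u. m (s + d * u) * (LBINT y. ?N y * exp (\<i> * of_real (u * y))))"
      unfolding L_def normal_density_fourier by (simp flip: integral_mult_right_zero add: mult_ac)
    also have "\<dots> = (LBINT u. LBINT y. m (s + d * u) * (?N y * exp (\<i> * of_real (u * y))))" by simp
    also have "\<dots> = (LBINT y. LBINT u. m (s + d * u) * (?N y * exp (\<i> * of_real (u * y))))"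
    proof (rule fubini_real)
      show "continuous_on UNIV (\<lambda>p. m (s + d * fst p) * (?N (snd p) * exp (\<i> * of_real (fst p * snd p))))"
        by (intro continuous_intros cm' cN)
      show "integrable lborel (\<lambda>z. m (s + d * y) * (?N z * exp (\<i> * of_real (y * z))))" for y
        by (rule Bochner_Integration.integrable_bound[OF integrable_mult_right[OF integrable_std_normal, of "cmod (m (s + d * y))"]])
           (auto simp: norm_mult intro!: always_eventually borel_measurable_continuous_onI continuous_intros cN)
      show "integrable lborel (\<lambda>u. cmod (m (s + d * u)))"
        using lborel_integrable_real_affine[OF test_integrable[OF m], of d s] d by (intro integrable_norm) auto
      show "(LBINT z. cmod (m (s + d * y) * (?N z * exp (\<i> * of_real (y * z))))) \<le> cmod (m (s + d * y))" for y
        by (simp add: norm_mult)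
    qed
    also have "\<dots> = (LBINT y. ?N y * (LBINT u. m (s + d * u) * exp (\<i> * of_real (u * y))))"
      by (simp flip: integral_mult_right_zero add: mult_ac)
    also have "\<dots> = (LBINT y. (2 * pi / d) * (?N y * (inv_fourier m (y / d) * exp (- \<i> * of_real (y / d * s)))))"
    proof (rule Bochner_Integration.integral_cong[OF refl])
      fix y
      have "(LBINT u. m (s + d * u) * exp (\<i> * of_real (u * y))) =
          (1 / d) *\<^sub>R (LBINT t. m t * exp (\<i> * of_real ((t - s) / d * y)))"
        using lborel_integral_real_affine[of d "\<lambda>t. m t * exp (\<i> * of_real ((t - s) / d * y))" s] d by simp
      also have "(LBINT t. m t * exp (\<i> * of_real ((t - s) / d * y))) =
          (LBINT t. exp (- \<i> * of_real (y / d * s)) * (m t * exp (\<i> * of_real (y / d * t))))"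
        by (intro Bochner_Integration.integral_cong refl)
          (simp add: exp_add[symmetric] algebra_simps diff_divide_distrib)
      also have "\<dots> = exp (- \<i> * of_real (y / d * s)) * (2 * pi * inv_fourier m (y / d))"
        unfolding inv_fourier_def by (simp only: pz integral_mult_right_zero)
      finally show "?N y * (LBINT u. m (s + d * u) * exp (\<i> * of_real (u * y))) =
          (2 * pi / d) * (?N y * (inv_fourier m (y / d) * exp (- \<i> * of_real (y / d * s))))"
        by (simp add: scaleR_conv_of_real mult_ac)
    qed
    also have "\<dots> = (2 * pi / d) * (LBINT y. ?N y * (inv_fourier m (y / d) * exp (- \<i> * of_real (y / d * s))))"
      by simp
    also have "(LBINT y. ?N y * (inv_fourier m (y / d) * exp (- \<i> * of_real (y / d * s)))) =
        d *\<^sub>R (LBINT v. of_real (?N (d * v)) * (inv_fourier m v * exp (- \<i> * of_real (v * s))))"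
      using lborel_integral_real_affine[of d "\<lambda>y. ?N y * (inv_fourier m (y / d) * exp (- \<i> * of_real (y / d * s)))" 0] d
      by simp
    finally have "sqrt (2 * pi) * L d = (2 * pi) * (LBINT v. of_real (?N (d * v)) * (inv_fourier m v * exp (- \<i> * of_real (v * s))))"
      using d by (simp add: scaleR_conv_of_real)
    also have "complex_of_real (2 * pi) = of_real (sqrt (2 * pi)) * of_real (sqrt (2 * pi))"
      by (simp flip: of_real_mult)
    finally show ?thesis by (simp add: mult.assoc)
  qed
  have lim0: "(\<lambda>k. s + (1 / real (Suc k)) * u) \<longlonglongrightarrow> s + 0 * u" for s u
    using LIMSEQ_inverse_real_of_nat by (intro tendsto_intros) (simp add: inverse_eq_divide)
  have l1: "(\<lambda>k. L (1 / real (Suc k))) \<longlonglongrightarrow> (LBINT u. m s * of_real (?N u))"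
    unfolding L_def
  proof (rule integral_dominated_convergence[where w = "\<lambda>u. B * ?N u"])
    show "AE u in lborel. (\<lambda>k. m (s + 1 / real (Suc k) * u) * of_real (?N u)) \<longlonglongrightarrow> m s * of_real (?N u)"
    proof (intro always_eventually allI tendsto_intros)
      fix u
      have "isCont m s" using cm by (simp add: continuous_on_eq_continuous_at)
      then show "(\<lambda>k. m (s + 1 / real (Suc k) * u)) \<longlonglongrightarrow> m s"
        using isCont_tendsto_compose lim0[of s u] by auto
    qed
  qed (use B in \<open>auto simp: norm_mult intro!: always_eventually borel_measurable_continuous_onI continuous_intros cm' cN mult_right_mono\<close>)
  let ?I = "LBINT v. of_real (?N 0) * (inv_fourier m v * exp (- \<i> * of_real (v * s)))"
  have ic: "continuous_on UNIV (inv_fourier m)" by (rule inv_fourier_continuous[OF m])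
  have l2: "(\<lambda>k. LBINT v. of_real (?N (1 / real (Suc k) * v)) * (inv_fourier m v * exp (- \<i> * of_real (v * s))))
      \<longlonglongrightarrow> ?I"
  proof (rule integral_dominated_convergence[where w = "\<lambda>v. ?N 0 * cmod (inv_fourier m v)"])
    show "AE v in lborel. (\<lambda>k. of_real (?N (1 / real (Suc k) * v)) * (inv_fourier m v * exp (- \<i> * of_real (v * s))))
      \<longlonglongrightarrow> of_real (?N 0) * (inv_fourier m v * exp (- \<i> * of_real (v * s)))"
    proof (intro always_eventually allI tendsto_intros)
      fix v
      have "isCont ?N 0" using cN[OF continuous_on_id, of UNIV] by (simp add: continuous_on_eq_continuous_at)
      then show "(\<lambda>k. ?N (1 / real (Suc k) * v)) \<longlonglongrightarrow> ?N 0"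
        using isCont_tendsto_compose[of 0 ?N] lim0[of 0 v] by auto
    qed
    show "integrable lborel (\<lambda>v. ?N 0 * cmod (inv_fourier m v))"
      using inv_fourier_integrable[OF m] by simp
    show "AE v in lborel. cmod (of_real (?N (1 / real (Suc k) * v)) * (inv_fourier m v * exp (- \<i> * of_real (v * s))))
       \<le> ?N 0 * cmod (inv_fourier m v)" for k
      using normal_density_le by (auto simp: norm_mult intro!: always_eventually mult_right_mono)
  qed (auto intro!: borel_measurable_continuous_onI continuous_intros cN ic)
  have "(\<lambda>k. L (1 / real (Suc k))) \<longlonglongrightarrow> sqrt (2 * pi) * ?I"
    using tendsto_mult_left[OF l2, of "of_real (sqrt (2 * pi))"] by (simp add: L_eq)
  from LIMSEQ_unique[OF this l1] have "sqrt (2 * pi) * ?I = m s" by simp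
  then show ?thesis by (simp add: std_normal_density_def)
qed

lemma inv_fourier_scale:
  assumes "l \<noteq> 0"
  shows "inv_fourier (\<lambda>t. m (l * t)) x = complex_of_real (1 / \<bar>l\<bar>) * inv_fourier m (x / l)"
proof -
  have "(LBINT t. m t * exp (\<i> * of_real (x / l * t))) = \<bar>l\<bar> *\<^sub>R (LBINT t. m (l * t) * exp (\<i> * of_real (x * t)))"
    using lborel_integral_real_affine[of l "\<lambda>t. m t * exp (\<i> * of_real (x / l * t))" 0] assms by simp
  then show ?thesis using assms unfolding inv_fourier_def by (simp add: scaleR_conv_of_real)
qed

text \<open>Dilations do not change the \<open>L\<^sup>1\<close> norm of the transform. Hence all
  kernels of a dyadic partition are bounded in \<open>L\<^sup>1\<close> by the norms of two
  of them.\<close>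

lemma inv_fourier_scale_L1:
  assumes "l \<noteq> 0"
  shows "(LBINT x. cmod (inv_fourier (\<lambda>t. m (l * t)) x)) = (LBINT x. cmod (inv_fourier m x))"
proof -
  have "(LBINT x. cmod (inv_fourier m (x / l))) = \<bar>l\<bar> * (LBINT x. cmod (inv_fourier m x))"
    using lborel_integral_real_affine[of l "\<lambda>x. cmod (inv_fourier m (x / l))" 0] assms by simp
  then show ?thesis using assms by (simp add: inv_fourier_scale norm_mult norm_divide)
qed

lemma test_scale: "test m \<Longrightarrow> l \<noteq> 0 \<Longrightarrow> test (\<lambda>t. m (l * t))"
proof -
  assume m: "test m" and l: "l \<noteq> 0"
  then obtain a where a: "\<And>t. a < \<bar>t\<bar> \<Longrightarrow> m t = 0" by (auto simp: test_def)
  have "m (l * t) = 0" if "a / \<bar>l\<bar> < \<bar>t\<bar>" for t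
    using that l by (intro a) (simp add: field_simps abs_mult)
  then show ?thesis using m smooth_affine[of m l 0] unfolding test_def by auto
qed

text \<open>Fubini's theorem, after which the integral over \<open>y\<close> is evaluated by the
  inversion formula.\<close>

lemma inv_fourier_mult:
  assumes "test p" "test q"
  shows "convolution (inv_fourier p) (inv_fourier q) x = inv_fourier (\<lambda>t. p t * q t) x"
proof -
  let ?e = "\<lambda>x y t. exp (\<i> * complex_of_real ((x - y) * t))"
  have cp: "continuous_on S (\<lambda>x. p (h x))" if "continuous_on S h" for S and h :: "'c::topological_space \<Rightarrow> real"
    using continuous_on_compose2[OF smooth_continuous[OF test_smooth[OF assms(1)], of UNIV] that] by simp
  have cq: "continuous_on S (\<lambda>x. inv_fourier q (h x))" if "continuous_on S h" for S and h :: "'c::topological_space \<Rightarrow> real"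
    using continuous_on_compose2[OF inv_fourier_continuous[OF assms(2), of UNIV] that] by simp
  have e: "?e x y t = exp (\<i> * of_real (x * t)) * exp (- \<i> * of_real (y * t))" for y t
    by (simp add: exp_add[symmetric] algebra_simps)
  have "convolution (inv_fourier p) (inv_fourier q) x =
      (1 / (2 * pi)) * (LBINT y. LBINT t. p t * ?e x y t * inv_fourier q y)"
    unfolding convolution_def inv_fourier_def[of p]
    by (simp flip: integral_mult_right_zero integral_mult_left_zero add: mult_ac)
  also have "(LBINT y. LBINT t. p t * ?e x y t * inv_fourier q y) =
      (LBINT t. LBINT y. p t * ?e x y t * inv_fourier q y)"
  proof (rule fubini_real)
    show "continuous_on UNIV (\<lambda>z. p (snd z) * ?e x (fst z) (snd z) * inv_fourier q (fst z))"
      by (intro continuous_intros cp cq)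
    show "integrable lborel (\<lambda>t. p t * ?e x y t * inv_fourier q y)" for y
      by (intro integrable_mult_left test_integrable test_mult assms smooth_wave)
    show "integrable lborel (\<lambda>y. (LBINT t. cmod (p t)) * cmod (inv_fourier q y))"
      using inv_fourier_integrable[OF assms(2)] by simp
    show "(LBINT t. cmod (p t * ?e x y t * inv_fourier q y)) \<le> (LBINT t. cmod (p t)) * cmod (inv_fourier q y)" for y
      by (simp add: norm_mult)
  qed
  also have "(\<lambda>t. LBINT y. p t * ?e x y t * inv_fourier q y) =
      (\<lambda>t. p t * exp (\<i> * of_real (x * t)) * (LBINT y. inv_fourier q y * exp (- \<i> * of_real (y * t))))"
    unfolding e by (simp flip: integral_mult_right_zero add: mult_ac)
  finally show ?thesis
    unfolding fourier_inversion[OF assms(2)] by (simp add: inv_fourier_def[of "\<lambda>t. p t * q t"] mult_ac)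
qed

section \<open>Convolution with transforms of test functions\<close>

text \<open>The class contains the test functions and the bounded holomorphic functions on a strip
  (restricted to the line), and it is closed under products and under convolution with
  integrable kernels. Derivatives and convolutions can be interchanged freely inside it.\<close>

definition Cb :: "(real \<Rightarrow> complex) \<Rightarrow> bool" where
  "Cb g \<longleftrightarrow> smooth g \<and> (\<forall>k. \<exists>B. \<forall>x. cmod (nd k g x) \<le> B)"

lemma Cb_smooth: "Cb g \<Longrightarrow> smooth g" by (simp add: Cb_def)

lemma Cb_boundE: assumes "Cb g" obtains B where "B \<ge> 0" "\<And>x. cmod (nd k g x) \<le> B"
  using assms unfolding Cb_def by (meson norm_ge_zero order_trans)

lemma Cb_nd: "Cb g \<Longrightarrow> Cb (nd k g)"
proof -
  assume g: "Cb g"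
  have "nd j (nd k g) = nd (j + k) g" for j by (simp add: funpow_add)
  then show ?thesis using g unfolding Cb_def by (auto intro: smooth_nd)
qed

lemma Cb_D: "Cb g \<Longrightarrow> Cb (D g)" using Cb_nd[of g 1] by simp

lemma Cb_bounds_upto:
  assumes "Cb g" obtains B where "B \<ge> 0" "\<And>j x. j \<le> N \<Longrightarrow> cmod (nd j g x) \<le> B"
proof -
  obtain b where b: "\<And>j x. cmod (nd j g x) \<le> b j" using assms unfolding Cb_def by metis
  have "cmod (nd j g x) \<le> \<bar>Max (b ` {..N})\<bar>" if "j \<le> N" for j x
    by (rule order_trans[OF b]) (use that in \<open>auto intro: order_trans[OF Max_ge abs_ge_self]\<close>)
  then show ?thesis using that by (meson abs_ge_zero)
qed

lemma Cb_mult: "Cb f \<Longrightarrow> Cb g \<Longrightarrow> Cb (\<lambda>x. f x * g x)"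
  unfolding Cb_def
proof (intro conjI smooth_mult allI; (elim conjE)?)
  fix k assume f: "smooth f" "\<forall>k. \<exists>B. \<forall>x. cmod (nd k f x) \<le> B" and g: "smooth g" "\<forall>k. \<exists>B. \<forall>x. cmod (nd k g x) \<le> B"
  then have "Cb f" "Cb g" by (auto simp: Cb_def)
  then obtain A B where "\<And>j x. j \<le> k \<Longrightarrow> cmod (nd j f x) \<le> A" "\<And>j x. j \<le> k \<Longrightarrow> cmod (nd j g x) \<le> B"
    by (metis Cb_bounds_upto)
  then show "\<exists>B. \<forall>x. cmod (nd k (\<lambda>x. f x * g x) x) \<le> B"
    using nd_mult_bound[OF f(1) g(1)] by blast
qed

lemma Cb_continuous: "Cb g \<Longrightarrow> continuous_on S g" by (intro smooth_continuous Cb_smooth)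

lemma Cb_continuous_comp: "Cb g \<Longrightarrow> continuous_on S h \<Longrightarrow> continuous_on S (\<lambda>x. g (h x))"
  using continuous_on_compose2[OF Cb_continuous[of g UNIV], of S h] by simp

lemma test_Cb: "test m \<Longrightarrow> Cb m"
proof -
  assume m: "test m"
  have "test (nd k m)" for k using m by (induction k) (auto intro: test_D)
  then show ?thesis unfolding Cb_def using m test_bounded test_smooth by blast
qed

lemma conv_integrable:
  assumes g: "continuous_on UNIV g" and B: "\<And>x. cmod (g x) \<le> B" and K: "integrable lborel K"
  shows "integrable lborel (\<lambda>y. g (x - y) * K y)"
proof (rule Bochner_Integration.integrable_bound[OF integrable_mult_right[OF integrable_norm[OF K], of B]])
  have "continuous_on UNIV (\<lambda>y. g (x - y))"
    by (rule continuous_on_compose2[OF g]) (auto intro!: continuous_intros)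
  then have "(\<lambda>y. g (x - y)) \<in> borel_measurable lborel" by (simp add: borel_measurable_continuous_onI)
  then show "(\<lambda>y. g (x - y) * K y) \<in> borel_measurable lborel"
    using borel_measurable_integrable[OF K] by (intro borel_measurable_times) auto
  have "B \<ge> 0" using B norm_ge_zero order_trans by blast
  then show "AE y in lborel. cmod (g (x - y) * K y) \<le> norm (B * cmod (K y))"
    using B by (auto simp: norm_mult intro!: always_eventually mult_right_mono)
qed

lemma conv_bound:
  assumes B: "\<And>x. cmod (g x) \<le> B" and K: "integrable lborel K"
  shows "cmod (convolution g K x) \<le> B * (LBINT y. cmod (K y))"
proof (cases "integrable lborel (\<lambda>y. g (x - y) * K y)")
  case True
  have "cmod (convolution g K x) \<le> (LBINT y. cmod (g (x - y) * K y))"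
    unfolding convolution_def by (rule integral_norm_bound)
  also have "\<dots> \<le> (LBINT y. B * cmod (K y))"
    using integrable_norm[OF True] K B by (intro integral_mono) (auto simp: norm_mult intro: mult_right_mono)
  finally show ?thesis by simp
next
  case False
  have "B \<ge> 0" using B norm_ge_zero order_trans by blast
  then show ?thesis using False by (simp add: convolution_def not_integrable_integral_eq)
qed

lemma conv_has_derivative:
  assumes g: "Cb g" and K: "integrable lborel K"
  shows "(convolution g K has_vector_derivative convolution (D g) K x) (at x)"
proof -
  obtain B0 where B0: "\<And>x. cmod (g x) \<le> B0" using Cb_boundE[OF g, of 0] by auto
  obtain B where B: "\<And>x. cmod (D g x) \<le> B" using Cb_boundE[OF g, of 1] by auto
  have "((\<lambda>x. LBINT y. g (x - y) * K y) has_vector_derivative (LBINT y. D g (x - y) * K y)) (at x)"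
  proof (rule has_vector_derivative_lebesgue_param[where w = "\<lambda>y. B * cmod (K y)"])
    show "integrable lborel (\<lambda>y. g (x - y) * K y)" for x
      by (rule conv_integrable[OF Cb_continuous[OF g] B0 K])
    have i: "integrable lborel (\<lambda>y. D g (x - y) * K y)" for x
      by (rule conv_integrable[OF Cb_continuous[OF Cb_D[OF g]] B K])
    show "((\<lambda>x. g (x - t) * K t) has_vector_derivative D g (x - t) * K t) (at x)" for t x
    proof -
      have "((\<lambda>x. g (1 * x + - t)) has_vector_derivative 1 * D g (1 * x + - t)) (at x)"
        using smooth_has_D[OF smooth_affine[OF Cb_smooth[OF g]], of 1 "- t" x] D_affine[OF Cb_smooth[OF g], of 1 "- t"]
        by simp
      then show ?thesis by (intro has_vector_derivative_mult_left) simp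
    qed
    show "(\<lambda>y. D g (x - y) * K y) \<in> borel_measurable borel" for x
      using borel_measurable_integrable[OF i] by simp
    show "integrable lborel (\<lambda>y. B * cmod (K y))" using K by simp
  qed (use B in \<open>auto simp: norm_mult intro: mult_right_mono\<close>)
  then show ?thesis unfolding convolution_def[abs_def] .
qed

lemma nd_conv:
  assumes g: "Cb g" and K: "integrable lborel K"
  shows "nd k (convolution g K) = convolution (nd k g) K"
proof (induction k)
  case (Suc k)
  show ?case using D_eqI[OF conv_has_derivative[OF Cb_nd[OF g] K], of k] Suc by simp
qed simp

lemma conv_Cb:
  assumes g: "Cb g" and K: "integrable lborel K"
  shows "Cb (convolution g K)"
  unfolding Cb_def
proof
  show "smooth (convolution g K)" unfolding smooth_def
    using conv_has_derivative[OF Cb_nd[OF g] K]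
    by (intro exI[of _ "\<lambda>k. convolution (nd k g) K"]) simp
  show "\<forall>k. \<exists>B. \<forall>x. cmod (nd k (convolution g K) x) \<le> B"
    unfolding nd_conv[OF assms] using Cb_boundE[OF g] conv_bound[OF _ K] by metis
qed

lemma kernel_tendsto_0:
  assumes "test m" shows "(inv_fourier m \<longlongrightarrow> 0) at_top" "(inv_fourier m \<longlongrightarrow> 0) at_bot"
proof -
  obtain C where C: "C \<ge> 0" "\<And>x. cmod (inv_fourier m x) \<le> C * (1 / (1 + x\<^sup>2))"
    using inv_fourier_decay[OF assms] by blast
  have l: "((\<lambda>x::real. C * (1 / (1 + x\<^sup>2))) \<longlongrightarrow> 0) at_top" "((\<lambda>x::real. C * (1 / (1 + x\<^sup>2))) \<longlongrightarrow> 0) at_bot"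
    by real_asymp+
  show "(inv_fourier m \<longlongrightarrow> 0) at_top"
    by (rule Lim_null_comparison[OF always_eventually l(1)]) (use C(2) in blast)
  show "(inv_fourier m \<longlongrightarrow> 0) at_bot"
    by (rule Lim_null_comparison[OF always_eventually l(2)]) (use C(2) in blast)
qed

lemma smooth_monom_mult: "smooth (\<lambda>t. \<i> * complex_of_real t)"
  by (intro smooth_cmult smooth_id)

text \<open>Integration by parts moves the derivative to the kernel, where it becomes multiplication by
  \<open>i t\<close> before the transform.\<close>

lemma conv_D:
  assumes g: "Cb g" and m: "test m"
  shows "convolution (D g) (inv_fourier m) x = convolution g (inv_fourier (\<lambda>t. \<i> * t * m t)) x"
proof -
  have m': "test (\<lambda>t. \<i> * complex_of_real t * m t)"
    using test_mult'[OF m smooth_monom_mult] .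
  obtain B0 where B0: "\<And>x. cmod (g x) \<le> B0" using Cb_boundE[OF g, of 0] by auto
  obtain B where B: "\<And>x. cmod (D g x) \<le> B" using Cb_boundE[OF g, of 1] by auto
  let ?K = "inv_fourier m" and ?K' = "inv_fourier (\<lambda>t. \<i> * t * m t)"
  have i1: "integrable lborel (\<lambda>y. g (x - y) * ?K' y)"
    by (rule conv_integrable[OF Cb_continuous[OF g] B0 inv_fourier_integrable[OF m']])
  have i2: "integrable lborel (\<lambda>y. D g (x - y) * ?K y)"
    by (rule conv_integrable[OF Cb_continuous[OF Cb_D[OF g]] B inv_fourier_integrable[OF m]])
  have "(LBINT y. g (x - y) * ?K' y + (- D g (x - y)) * ?K y) = 0"
  proof (rule integral_derivative_zero)
    fix y
    have "((\<lambda>y. g (-1 * y + x)) has_vector_derivative - 1 * D g (-1 * y + x)) (at y)"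
      using smooth_has_D[OF smooth_affine[OF Cb_smooth[OF g]], of "-1" x y] D_affine[OF Cb_smooth[OF g], of "-1" x]
      by simp
    then show "((\<lambda>y. g (x - y) * ?K y) has_vector_derivative g (x - y) * ?K' y + (- D g (x - y)) * ?K y) (at y)"
      by (intro has_vector_derivative_mult inv_fourier_has_derivative[OF m]) simp
  next
    show "continuous_on UNIV (\<lambda>y. g (x - y) * ?K' y + - D g (x - y) * ?K y)"
      by (intro continuous_intros inv_fourier_continuous m m' Cb_continuous_comp[OF g] Cb_continuous_comp[OF Cb_D[OF g]])
    show "integrable lborel (\<lambda>y. g (x - y) * ?K' y + - D g (x - y) * ?K y)"
      using i1 i2 by simp
    have *: "((\<lambda>y. g (x - y) * ?K y) \<longlongrightarrow> 0) F" if "(?K \<longlongrightarrow> 0) F" for F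
    proof (rule Lim_null_comparison)
      show "\<forall>\<^sub>F y in F. cmod (g (x - y) * ?K y) \<le> B0 * cmod (?K y)"
        using B0 by (auto simp: norm_mult intro!: always_eventually mult_right_mono)
      show "((\<lambda>y. B0 * cmod (?K y)) \<longlongrightarrow> 0) F"
        using tendsto_mult_left[OF tendsto_norm_zero[OF that], of B0] by simp
    qed
    show "((\<lambda>y. g (x - y) * ?K y) \<longlongrightarrow> 0) at_top" "((\<lambda>y. g (x - y) * ?K y) \<longlongrightarrow> 0) at_bot"
      using * kernel_tendsto_0[OF m] by auto
  qed
  then show ?thesis unfolding convolution_def using i1 i2 by simp
qed

lemma conv_nd:
  assumes g: "Cb g"
  shows "test m \<Longrightarrow> convolution (nd k g) (inv_fourier m) x = convolution g (inv_fourier (\<lambda>t. (\<i> * t) ^ k * m t)) x"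
proof (induction k arbitrary: m)
  case (Suc k)
  have "convolution (nd (Suc k) g) (inv_fourier m) x = convolution (nd k g) (inv_fourier (\<lambda>t. \<i> * t * m t)) x"
    using conv_D[OF Cb_nd[OF g] Suc.prems] by simp
  also have "\<dots> = convolution g (inv_fourier (\<lambda>t. (\<i> * t) ^ k * (\<i> * t * m t))) x"
    using test_mult'[OF Suc.prems smooth_monom_mult] by (rule Suc.IH)
  finally show ?case by (simp add: mult_ac)
qed simp

text \<open>Successive convolutions multiply the symbols.\<close>

lemma conv_assoc:
  assumes g: "Cb g" and p: "test p" and q: "test q"
  shows "convolution (convolution g (inv_fourier p)) (inv_fourier q) x = convolution g (inv_fourier (\<lambda>t. p t * q t)) x"
proof -
  obtain B where B: "B \<ge> 0" "\<And>x. cmod (g x) \<le> B" using Cb_boundE[OF g, of 0] by auto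
  let ?P = "inv_fourier p" and ?Q = "inv_fourier q"
  have cP: "continuous_on S (\<lambda>x. ?P (h x))" if "continuous_on S h" for S and h :: "'c::topological_space \<Rightarrow> real"
    using continuous_on_compose2[OF inv_fourier_continuous[OF p, of UNIV] that] by simp
  have cQ: "continuous_on S (\<lambda>x. ?Q (h x))" if "continuous_on S h" for S and h :: "'c::topological_space \<Rightarrow> real"
    using continuous_on_compose2[OF inv_fourier_continuous[OF q, of UNIV] that] by simp
  have iP: "integrable lborel (\<lambda>z. ?P (z - y))" for y
    using lborel_integrable_real_affine[OF inv_fourier_integrable[OF p], of 1 "- y"] by (simp add: algebra_simps)
  have "convolution (convolution g ?P) ?Q x = (LBINT y. LBINT z. g (x - y - z) * ?P z * ?Q y)"
    unfolding convolution_def by simp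
  also have "\<dots> = (LBINT y. LBINT z. g (x - z) * ?P (z - y) * ?Q y)"
  proof (rule Bochner_Integration.integral_cong[OF refl])
    fix y show "(LBINT z. g (x - y - z) * ?P z * ?Q y) = (LBINT z. g (x - z) * ?P (z - y) * ?Q y)"
      using lborel_integral_real_affine[of 1 "\<lambda>z. g (x - y - z) * ?P z * ?Q y" "- y"] by (simp add: algebra_simps)
  qed
  also have "\<dots> = (LBINT z. LBINT y. g (x - z) * ?P (z - y) * ?Q y)"
  proof (rule fubini_real)
    show "continuous_on UNIV (\<lambda>w. g (x - snd w) * ?P (snd w - fst w) * ?Q (fst w))"
      by (intro continuous_intros cP cQ Cb_continuous_comp[OF g])
    show i: "integrable lborel (\<lambda>z. g (x - z) * ?P (z - y) * ?Q y)" for y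
      by (intro integrable_mult_left conv_integrable[OF Cb_continuous[OF g] B(2) iP])
    show "integrable lborel (\<lambda>y. B * (LBINT z. cmod (?P z)) * cmod (?Q y))"
      using inv_fourier_integrable[OF q] by simp
    show "(LBINT z. cmod (g (x - z) * ?P (z - y) * ?Q y)) \<le> B * (LBINT z. cmod (?P z)) * cmod (?Q y)" for y
    proof -
      have "(LBINT z. cmod (g (x - z) * ?P (z - y) * ?Q y)) \<le> (LBINT z. B * cmod (?P (z - y)) * cmod (?Q y))"
      proof (rule integral_mono)
        show "integrable lborel (\<lambda>z. B * cmod (?P (z - y)) * cmod (?Q y))" using iP[of y] by simp
      qed (use integrable_norm[OF i, of y] B in \<open>auto simp: norm_mult intro!: mult_right_mono\<close>)
      also have "\<dots> = B * (LBINT z. cmod (?P (z - y))) * cmod (?Q y)" by simp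
      also have "(LBINT z. cmod (?P (z - y))) = (LBINT z. cmod (?P z))"
        using lborel_integral_real_affine[of 1 "\<lambda>z. cmod (?P z)" "- y"] by (simp add: algebra_simps)
      finally show ?thesis .
    qed
  qed
  also have "\<dots> = (LBINT z. g (x - z) * convolution ?P ?Q z)"
    unfolding convolution_def by (simp flip: integral_mult_right_zero add: mult_ac)
  finally have "convolution (convolution g ?P) ?Q x = (LBINT z. g (x - z) * convolution ?P ?Q z)" .
  then show ?thesis unfolding inv_fourier_mult[OF p q]
    by (simp only: convolution_def[of g "inv_fourier (\<lambda>t. p t * q t)" x])
qed

lemma inv_fourier_add:
  assumes "test p" "test q" shows "inv_fourier (\<lambda>t. p t + q t) x = inv_fourier p x + inv_fourier q x"
  using test_integrable[OF test_mult[OF assms(1) smooth_wave], of x] test_integrable[OF test_mult[OF assms(2) smooth_wave], of x]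
  unfolding inv_fourier_def by (simp add: ring_distribs)

lemma test_add: "test p \<Longrightarrow> test q \<Longrightarrow> test (\<lambda>t. p t + q t)"
proof -
  assume p: "test p" and q: "test q"
  obtain a b where "\<And>t. a < \<bar>t\<bar> \<Longrightarrow> p t = 0" "\<And>t. b < \<bar>t\<bar> \<Longrightarrow> q t = 0"
    using p q unfolding test_def by metis
  then have "\<And>t. max a b < \<bar>t\<bar> \<Longrightarrow> p t + q t = 0" by auto
  then show ?thesis using p q unfolding test_def by (blast intro: smooth_add)
qed

lemma inv_fourier_cmult: "inv_fourier (\<lambda>t. c * m t) x = c * inv_fourier m x"
  unfolding inv_fourier_def by (simp add: mult.assoc)

lemma conv_sum:
  assumes g: "Cb g" and "finite I" and "\<And>i. i \<in> I \<Longrightarrow> test (p i)"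
  shows "test (\<lambda>t. \<Sum>i\<in>I. p i t) \<and> (\<Sum>i\<in>I. convolution g (inv_fourier (p i)) x) = convolution g (inv_fourier (\<lambda>t. \<Sum>i\<in>I. p i t)) x"
  using assms(2,3)
proof (induction I rule: finite_induct)
  case empty
  have "inv_fourier (\<lambda>t. 0) = (\<lambda>x. 0)" by (simp add: inv_fourier_def fun_eq_iff)
  then show ?case by (simp add: convolution_def test_def smooth_const)
next
  case (insert i I)
  obtain B where B: "B \<ge> 0" "\<And>x. cmod (g x) \<le> B" using Cb_boundE[OF g, of 0] by auto
  have t: "test (p i)" "test (\<lambda>t. \<Sum>i\<in>I. p i t)" using insert by auto
  note ii = conv_integrable[OF Cb_continuous[OF g] B(2) inv_fourier_integrable]
  have "convolution g (inv_fourier (\<lambda>t. p i t + (\<Sum>i\<in>I. p i t))) x =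
    convolution g (inv_fourier (p i)) x + convolution g (inv_fourier (\<lambda>t. \<Sum>i\<in>I. p i t)) x"
    unfolding convolution_def inv_fourier_add[OF t] using ii[OF t(1), of x] ii[OF t(2), of x] by (simp add: ring_distribs)
  then show ?case using insert test_add[OF t] by simp
qed

section \<open>The inhomogeneous partition of unity\<close>

lemma supp_zero: "supp f \<subseteq> S \<Longrightarrow> t \<notin> S \<Longrightarrow> f t = 0"
  using closure_subset[of "{x. f x \<noteq> 0}"] by (auto simp: supp_def)

text \<open>The factor that makes \<open>\<phi> n\<close> a dilation of \<open>\<phi> 1\<close> for all
  nonzero \<open>n\<close>; the sign takes care of negative \<open>n\<close>.\<close>

definition dil :: "int \<Rightarrow> real" where
  "dil n = (if n > 0 then 1 else - 1) * 2 powi (1 - \<bar>n\<bar>)"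

lemma dil_nz: "dil n \<noteq> 0" by (simp add: dil_def)

lemma abs_dil: "\<bar>dil n\<bar> = 2 powi (1 - \<bar>n\<bar>)" by (simp add: dil_def abs_mult)

locale besov_classes =
  fixes \<phi> :: "int \<Rightarrow> real \<Rightarrow> complex"
  assumes P: "inhomogeneous_partition \<phi>"
begin

lemmas P' = P[unfolded inhomogeneous_partition_def]
lemmas smooth_phi0 = P'[THEN conjunct1]
  and smooth_phi1 = P'[THEN conjunct2, THEN conjunct1]
  and supp_phi0 = P'[THEN conjunct2, THEN conjunct2, THEN conjunct1]
  and supp_phi1 = P'[THEN conjunct2, THEN conjunct2, THEN conjunct2, THEN conjunct1]

lemma phi_eq_dil: "n \<noteq> 0 \<Longrightarrow> \<phi> n t = \<phi> 1 (dil n * t)"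
proof -
  have pos: "\<phi> n t = \<phi> 1 (2 powi (1 - n) * t)" if "n \<ge> 1" for n t
  proof (cases "n = 1")
    case False
    have "\<forall>n\<ge>2. \<forall>t. \<phi> n t = \<phi> 1 (2 powi (1 - n) * t)"
      using P unfolding inhomogeneous_partition_def by (elim conjE)
    moreover have "2 \<le> n" using False that by simp
    ultimately show ?thesis by blast
  qed simp
  assume "n \<noteq> 0"
  then consider "n \<ge> 1" | "n \<le> -1" by linarith
  then show ?thesis
  proof cases
    case 2
    have "\<forall>n\<le>-1. \<forall>t. \<phi> n t = \<phi> (- n) (- t)"
      using P unfolding inhomogeneous_partition_def by (elim conjE)
    with 2 have "\<phi> n t = \<phi> (- n) (- t)" by blast
    also have "\<dots> = \<phi> 1 (2 powi (1 - (- n)) * (- t))" using 2 by (intro pos) simp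
    also have "2 powi (1 - (- n)) * (- t) = dil n * t" using 2 by (simp add: dil_def)
    finally show ?thesis .
  next
    case 1
    then have d: "2 powi (1 - n) * t = dil n * t" by (simp add: dil_def)
    show ?thesis using pos[OF 1, of t] unfolding d .
  qed
qed

lemma phi0_zero: "1 < \<bar>t\<bar> \<Longrightarrow> \<phi> 0 t = 0" and phi1_zero: "\<bar>t - 5/4\<bar> > 3/4 \<Longrightarrow> \<phi> 1 t = 0"
proof -
  show "1 < \<bar>t\<bar> \<Longrightarrow> \<phi> 0 t = 0" by (rule supp_zero[OF supp_phi0]) auto
  show "\<bar>t - 5/4\<bar> > 3/4 \<Longrightarrow> \<phi> 1 t = 0" by (rule supp_zero[OF supp_phi1]) (auto simp: abs_if split: if_splits)
qed

lemma phi1_ball: "2 < \<bar>t\<bar> \<Longrightarrow> \<phi> 1 t = 0" by (rule phi1_zero) linarith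

lemma phi1_zero': "\<bar>t\<bar> < 1/2 \<Longrightarrow> \<phi> 1 t = 0" by (rule phi1_zero) linarith

lemma test_phi: "test (\<phi> n)"
proof (cases "n = 0")
  case True
  have "test (\<phi> 0)" unfolding test_def
    by (intro conjI smooth_phi0 exI[of _ 1] allI impI phi0_zero)
  then show ?thesis unfolding True .
next
  case False
  have "test (\<phi> 1)" unfolding test_def
    by (intro conjI smooth_phi1 exI[of _ 2] allI impI phi1_ball)
  then have "test (\<lambda>t. \<phi> 1 (dil n * t))" by (rule test_scale[OF _ dil_nz])
  moreover have "\<phi> n = (\<lambda>t. \<phi> 1 (dil n * t))" using phi_eq_dil[OF False] by (rule ext)
  ultimately show ?thesis by (simp only:)
qed

text \<open>The symmetric partial sums of the partition. They turn out to be dilations of \<open>\<phi>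
  0\<close>.\<close>

definition \<Phi> :: "nat \<Rightarrow> real \<Rightarrow> complex" where
  "\<Phi> L t = (\<Sum>k\<in>{- int L..int L}. \<phi> k t)"

lemma Phi_Suc: "\<Phi> (Suc L) t = \<Phi> L t + (\<phi> 1 (t / 2 ^ L) + \<phi> 1 (- (t / 2 ^ L)))"
proof -
  have "{- int (Suc L)..int (Suc L)} = insert (int (Suc L)) (insert (- int (Suc L)) {- int L..int L})" by auto
  moreover have "\<phi> (int (Suc L)) t = \<phi> 1 (t / 2 ^ L)" "\<phi> (- int (Suc L)) t = \<phi> 1 (- (t / 2 ^ L))"
  proof -
    have d: "dil (int (Suc L)) * t = t / 2 ^ L" "dil (- int (Suc L)) * t = - (t / 2 ^ L)"
      by (simp_all add: dil_def power_int_minus divide_simps)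
    show "\<phi> (int (Suc L)) t = \<phi> 1 (t / 2 ^ L)"
      using phi_eq_dil[of "int (Suc L)" t] unfolding d(1) by simp
    show "\<phi> (- int (Suc L)) t = \<phi> 1 (- (t / 2 ^ L))"
      using phi_eq_dil[of "- int (Suc L)" t] unfolding d(2) by simp
  qed
  ultimately show ?thesis by (simp add: \<Phi>_def algebra_simps)
qed

lemma Phi_tendsto: "(\<lambda>L. \<Phi> L t) \<longlonglongrightarrow> 1"
proof -
  have "\<forall>t. ((\<lambda>n. \<phi> n t) has_sum 1) UNIV"
    using P unfolding inhomogeneous_partition_def by (elim conjE)
  then have "((\<lambda>n. \<phi> n t) has_sum 1) UNIV" ..
  then have l: "((\<lambda>F. \<Sum>k\<in>F. \<phi> k t) \<longlongrightarrow> 1) (finite_subsets_at_top UNIV)" by (simp add: has_sum_def)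
  have "filterlim (\<lambda>L. {- int L..int L}) (finite_subsets_at_top UNIV) sequentially"
    unfolding filterlim_finite_subsets_at_top
  proof (intro allI impI, elim conjE)
    fix X :: "int set" assume X: "finite X"
    define M where "M = Max (insert 0 (abs ` X))"
    have M: "\<bar>x\<bar> \<le> M" if "x \<in> X" for x unfolding M_def using X that by (intro Max_ge) auto
    have "X \<subseteq> {- int L..int L}" if "L \<ge> nat M" for L
    proof
      fix x assume "x \<in> X"
      then show "x \<in> {- int L..int L}" using M[of x] that by (simp add: abs_le_iff nat_le_iff)
    qed
    then show "\<forall>\<^sub>F L in sequentially. finite {- int L..int L} \<and> X \<subseteq> {- int L..int L} \<and> {- int L..int L} \<subseteq> UNIV"
      by (auto intro!: eventually_sequentiallyI[of "nat M"])
  qed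
  from filterlim_compose[OF l this] show ?thesis by (simp add: \<Phi>_def)
qed

text \<open>Partial sums at \<open>t\<close> and at \<open>t/2\<close> differ by a shift of the index.
  Comparing their limits 1 gives a scaling identity for \<open>\<phi> 0\<close>, although
  \<open>\<phi> 0\<close> and \<open>\<phi> 1\<close> are prescribed separately.\<close>

lemma phi0_half: "\<phi> 0 (t / 2) = \<phi> 0 t + (\<phi> 1 t + \<phi> 1 (- t))"
proof -
  have *: "\<Phi> (Suc L) t = \<Phi> L (t / 2) - \<phi> 0 (t / 2) + (\<phi> 0 t + (\<phi> 1 t + \<phi> 1 (- t)))" for L
  proof (induction L)
    case (Suc L)
    then show ?case unfolding Phi_Suc[of "Suc L"] Phi_Suc[of L "t / 2"] by simp
  qed (simp add: Phi_Suc, simp add: \<Phi>_def)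
  have "(\<lambda>L. \<Phi> (Suc L) t) \<longlonglongrightarrow> 1 - \<phi> 0 (t / 2) + (\<phi> 0 t + (\<phi> 1 t + \<phi> 1 (- t)))"
    unfolding * by (intro tendsto_intros Phi_tendsto)
  moreover have "(\<lambda>L. \<Phi> (Suc L) t) \<longlonglongrightarrow> 1" using Phi_tendsto by (rule LIMSEQ_Suc)
  ultimately have "1 - \<phi> 0 (t / 2) + (\<phi> 0 t + (\<phi> 1 t + \<phi> 1 (- t))) = 1" by (rule LIMSEQ_unique)
  then have "\<phi> 0 t + (\<phi> 1 t + \<phi> 1 (- t)) - \<phi> 0 (t / 2) = 0" by (simp add: algebra_simps)
  then show ?thesis by simp
qed

lemma Phi_eq: "\<Phi> L t = \<phi> 0 (t / 2 ^ L)"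
proof (induction L)
  case (Suc L)
  then show ?case using phi0_half[of "t / 2 ^ L"] by (simp add: Phi_Suc mult.commute)
qed (simp add: \<Phi>_def)

text \<open>Near the origin only \<open>\<phi> 0\<close> contributes to the partition. Thus a dilation
  of \<open>\<phi> 0\<close> is equal to 1 on the support of any given \<open>\<phi>
  n\<close>.\<close>

lemma phi0_one: "\<bar>t\<bar> < 1/2 \<Longrightarrow> \<phi> 0 t = 1"
proof -
  assume t: "\<bar>t\<bar> < 1/2"
  have "\<Phi> L t = \<phi> 0 t" for L
  proof (induction L)
    case (Suc L)
    have "\<bar>t / 2 ^ L\<bar> \<le> \<bar>t\<bar> / 1" unfolding abs_divide by (intro divide_left_mono) auto
    then have "\<bar>t / 2 ^ L\<bar> < 1/2" using t unfolding div_by_1 by linarith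
    then show ?case using phi1_zero'[of "t / 2 ^ L"] phi1_zero'[of "- (t / 2 ^ L)"] Suc by (simp add: Phi_Suc)
  qed (simp add: \<Phi>_def)
  then show ?thesis using Phi_tendsto[of t] LIMSEQ_unique[OF tendsto_const] by (simp add: LIMSEQ_const_iff)
qed

end

lemma abs_dil_eq: "\<bar>dil n\<bar> = 2 / 2 ^ nat \<bar>n\<bar>"
proof -
  have "(2::real) powi (1 - \<bar>n\<bar>) = 2 powi 1 / 2 powi \<bar>n\<bar>" by (rule power_int_diff) simp
  then show ?thesis by (simp add: abs_dil power_int_def)
qed

context besov_classes
begin

definition "ker n = inv_fourier (\<phi> n)"

lemma ker_integrable: "integrable lborel (ker n)"
  unfolding ker_def by (intro inv_fourier_integrable test_phi)

text \<open>By dilation invariance this bounds the \<open>L\<^sup>1\<close> norms of all kernels.\<close>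

definition "L1 = max (LBINT x. cmod (ker 0 x)) (LBINT x. cmod (ker 1 x))"

lemma L1_nonneg: "0 \<le> L1" unfolding L1_def by (simp add: le_max_iff_disj)

lemma ker_L1: "(LBINT x. cmod (ker n x)) \<le> L1"
proof (cases "n = 0")
  case False
  have "\<phi> n = (\<lambda>t. \<phi> 1 (dil n * t))" using phi_eq_dil[OF False] by auto
  then have "(LBINT x. cmod (ker n x)) = (LBINT x. cmod (ker 1 x))"
    unfolding ker_def using inv_fourier_scale_L1[OF dil_nz, of "\<phi> 1" n] by simp
  then show ?thesis by (simp add: L1_def)
qed (simp add: L1_def)

section \<open>Bernstein inequalities and reconstruction\<close>

text \<open>The block \<open>f * ker n\<close> is reproduced by convolution with the transform of a
  dilation of \<open>\<phi> 0\<close> that is 1 on the support of \<open>\<phi> n\<close>.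
  The derivative falls on that transform, whose \<open>L\<^sup>1\<close> norm scales like
  \<open>2\<^bsup>\<bar>n\<bar>\<^esup>\<close>.\<close>

lemma bernstein_D:
  obtains c where "c \<ge> 1" "\<And>f n B x. Cb f \<Longrightarrow> (\<And>x. cmod (convolution f (ker n) x) \<le> B) \<Longrightarrow>
     cmod (convolution (D f) (ker n) x) \<le> c * 2 ^ nat \<bar>n\<bar> * B"
proof -
  let ?m = "\<lambda>t. \<i> * complex_of_real t * \<phi> 0 t"
  have tm: "test ?m" by (rule test_mult'[OF test_phi smooth_monom_mult])
  define b where "b = (LBINT x. cmod (inv_fourier ?m x))"
  have b0: "b \<ge> 0" unfolding b_def by simp
  have "cmod (convolution (D f) (ker n) x) \<le> (4 * b + 1) * 2 ^ nat \<bar>n\<bar> * B"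
    if f: "Cb f" and B: "\<And>x. cmod (convolution f (ker n) x) \<le> B" for f n B x
  proof -
    \<comment> \<open>the dilation for which \<open>\<phi> 0 (l t)\<close> is 1 on the support of
      \<open>\<phi> n\<close>\<close>
    define l :: real where "l = 1 / (4 * 2 ^ nat \<bar>n\<bar>)"
    have l: "l > 0" unfolding l_def by simp
    let ?c = "\<lambda>t. \<phi> 0 (l * t)"
    have tc: "test ?c" using test_scale[OF test_phi] l by auto
    have "\<phi> n t * ?c t = \<phi> n t" for t
    proof (cases "\<phi> n t = 0")
      case False
      have "\<bar>t\<bar> \<le> 2 ^ nat \<bar>n\<bar>"
      proof (cases "n = 0")
        case True
        then have "\<not> 1 < \<bar>t\<bar>" using False phi0_zero[of t] by blast
        then show ?thesis using True by simp
      next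
        case n: False
        have "\<phi> 1 (dil n * t) \<noteq> 0" using False phi_eq_dil[OF n, of t] by simp
        then have "\<not> 2 < \<bar>dil n * t\<bar>" using phi1_ball by blast
        then have "\<bar>dil n * t\<bar> \<le> 2" by linarith
        moreover have "\<bar>dil n * t\<bar> = 2 * \<bar>t\<bar> / 2 ^ nat \<bar>n\<bar>"
          by (simp add: abs_mult abs_dil_eq)
        ultimately have "2 * \<bar>t\<bar> / 2 ^ nat \<bar>n\<bar> \<le> 2" by simp
        then show ?thesis by (simp add: pos_divide_le_eq)
      qed
      then have "\<bar>t\<bar> < 2 * 2 ^ nat \<bar>n\<bar>" using zero_less_power[of "2::real" "nat \<bar>n\<bar>"] by linarith
      then have "\<bar>l * t\<bar> < 1/2" unfolding l_def by (simp add: abs_mult field_simps)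
      then show ?thesis by (simp add: phi0_one)
    qed simp
    then have pc: "(\<lambda>t. \<phi> n t * ?c t) = \<phi> n" by auto
    have a: "convolution (D f) (ker n) x = convolution (convolution (D f) (ker n)) (inv_fourier ?c) x"
      unfolding ker_def conv_assoc[OF Cb_D[OF f] test_phi tc] pc ..
    have b: "convolution (D f) (ker n) = D (convolution f (ker n))"
      using nd_conv[OF f ker_integrable, of 1 n] by simp
    have c: "convolution (D (convolution f (ker n))) (inv_fourier ?c) x =
        convolution (convolution f (ker n)) (inv_fourier (\<lambda>t. \<i> * t * ?c t)) x"
      by (rule conv_D[OF conv_Cb[OF f ker_integrable] tc])
    have e: "convolution (D f) (ker n) x =
        convolution (convolution f (ker n)) (inv_fourier (\<lambda>t. \<i> * t * ?c t)) x"
      by (rule trans[OF a]) (simp only: b c)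
    have m: "(\<lambda>t. \<i> * complex_of_real t * ?c t) = (\<lambda>t. complex_of_real (1 / l) * ?m (l * t))"
      using l by (auto simp: fun_eq_iff)
    have "cmod (convolution (D f) (ker n) x) \<le> B * (LBINT y. cmod (inv_fourier (\<lambda>t. \<i> * t * ?c t) y))"
      unfolding e by (rule conv_bound[OF B inv_fourier_integrable[OF test_mult'[OF tc smooth_monom_mult]]])
    also have "(LBINT y. cmod (inv_fourier (\<lambda>t. \<i> * t * ?c t) y)) = (1 / l) * b"
      unfolding m inv_fourier_cmult b_def norm_mult using inv_fourier_scale_L1[of l ?m] l by (simp add: norm_divide)
    finally have "cmod (convolution (D f) (ker n) x) \<le> B * (4 * b * 2 ^ nat \<bar>n\<bar>)"
      by (simp add: l_def mult_ac)
    also have "\<dots> \<le> B * ((4 * b + 1) * 2 ^ nat \<bar>n\<bar>)"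
      by (intro mult_left_mono mult_right_mono order_trans[OF norm_ge_zero B]) auto
    finally show ?thesis by (simp add: mult_ac)
  qed
  then show ?thesis using that[of "4 * b + 1"] b0 by auto
qed

lemma bernstein:
  obtains c where "c \<ge> 1" "\<And>f n B x k. Cb f \<Longrightarrow> (\<And>x. cmod (convolution f (ker n) x) \<le> B) \<Longrightarrow>
     cmod (nd k (convolution f (ker n)) x) \<le> (c * 2 ^ nat \<bar>n\<bar>) ^ k * B"
proof -
  obtain c where c: "c \<ge> 1" "\<And>f n B x. Cb f \<Longrightarrow> (\<And>x. cmod (convolution f (ker n) x) \<le> B) \<Longrightarrow>
     cmod (convolution (D f) (ker n) x) \<le> c * 2 ^ nat \<bar>n\<bar> * B" using bernstein_D by blast
  have "cmod (nd k (convolution f (ker n)) x) \<le> (c * 2 ^ nat \<bar>n\<bar>) ^ k * B"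
    if f: "Cb f" and B: "\<And>x. cmod (convolution f (ker n) x) \<le> B" for f n B x k
  proof (induction k arbitrary: x)
    case 0 then show ?case using B by simp
  next
    case (Suc k)
    have "cmod (convolution (D (nd k f)) (ker n) x) \<le> c * 2 ^ nat \<bar>n\<bar> * ((c * 2 ^ nat \<bar>n\<bar>) ^ k * B)"
      using Suc by (intro c(2) Cb_nd f) (simp add: nd_conv[OF f ker_integrable])
    then show ?case using nd_conv[OF f ker_integrable, of "Suc k" n] by (simp add: mult_ac)
  qed
  then show ?thesis using that c(1) by blast
qed

text \<open>The converse of the Bernstein inequality. As \<open>\<phi> 1\<close> vanishes near 0 it can
  be divided by \<open>(i t)\<^sup>N\<close>; the division corresponds to \<open>N\<close>
  derivatives of \<open>g\<close> and gains the factor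
  \<open>2\<^bsup>-N\<bar>n\<bar>\<^esup>\<close>.\<close>

lemma conv_ker_smooth_bound:
  obtains C where "C \<ge> 0" "\<And>g n M x. Cb g \<Longrightarrow> (\<And>j x. j \<le> N \<Longrightarrow> cmod (nd j g x) \<le> M) \<Longrightarrow>
     cmod (convolution g (ker n) x) \<le> C * (1 / 2 ^ nat \<bar>n\<bar>) ^ N * M"
proof -
  \<comment> \<open>\<open>\<phi> 1\<close> with \<open>k\<close> integrations built in; a test function since
    \<open>\<phi> 1\<close> vanishes near 0\<close>
  define h where "h k = (\<lambda>t. \<phi> 1 t / (\<i> * complex_of_real t) ^ k)" for k
  have hz: "h k t = 0" if "\<bar>t\<bar> < 1/2" for k t using phi1_zero'[OF that] by (simp add: h_def)
  have "smooth (h k)" for k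
  proof (induction k)
    case 0 then show ?case using test_smooth[OF test_phi] by (simp add: h_def)
  next
    case (Suc k)
    have "smooth (\<lambda>t. (- \<i>) * (h k t / complex_of_real t))"
      using hz Suc by (intro smooth_cmult smooth_div_id[of "1/2"]) auto
    moreover have "h (Suc k) = (\<lambda>t. (- \<i>) * (h k t / complex_of_real t))"
      by (simp add: h_def fun_eq_iff divide_simps)
    ultimately show ?case by simp
  qed
  moreover have "\<forall>t. 2 < \<bar>t\<bar> \<longrightarrow> h k t = 0" for k
    using phi1_ball by (auto simp: h_def)
  ultimately have th: "test (h k)" for k unfolding test_def by blast
  define b where "b = (LBINT x. cmod (inv_fourier (h N) x))"
  have b0: "b \<ge> 0" unfolding b_def by simp
  have "cmod (convolution g (ker n) x) \<le> (L1 + 2 ^ N * b) * (1 / 2 ^ nat \<bar>n\<bar>) ^ N * M"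
    if g: "Cb g" and M: "\<And>j x. j \<le> N \<Longrightarrow> cmod (nd j g x) \<le> M" for g n M x
  proof (cases "n = 0")
    case True
    have M0: "0 \<le> M" using M[of 0] norm_ge_zero order_trans by blast
    have "cmod (convolution g (ker n) x) \<le> M * (LBINT y. cmod (ker n y))"
      using M[of 0] by (intro conv_bound ker_integrable) auto
    also have "\<dots> \<le> M * (L1 + 2 ^ N * b)"
      using M0 ker_L1 b0 by (intro mult_left_mono add_increasing2) auto
    finally show ?thesis using True by (simp add: mult_ac)
  next
    case False
    let ?m = "\<lambda>t. complex_of_real (dil n) ^ N * h N (dil n * t)"
    have tm: "test ?m" by (intro test_mult'[OF test_scale[OF th dil_nz] smooth_const])
    have M0: "0 \<le> M" using M[of 0] norm_ge_zero order_trans by blast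
    have "(\<i> * complex_of_real t) ^ N * ?m t = \<phi> n t" for t
    proof (cases "t = 0")
      case True
      have "\<phi> 1 0 = 0" by (rule phi1_zero') simp
      then show ?thesis using True phi_eq_dil[OF False] by (simp add: h_def)
    next
      case t: False
      then show ?thesis using phi_eq_dil[OF False] dil_nz[of n] by (simp add: h_def power_mult_distrib)
    qed
    then have "convolution g (ker n) x = convolution (nd N g) (inv_fourier ?m) x"
      unfolding conv_nd[OF g tm] ker_def by simp
    also have "cmod \<dots> \<le> M * (LBINT y. cmod (inv_fourier ?m y))"
      using M by (intro conv_bound inv_fourier_integrable tm) auto
    also have "(LBINT y. cmod (inv_fourier ?m y)) = \<bar>dil n\<bar> ^ N * b"
      unfolding inv_fourier_cmult b_def norm_mult using inv_fourier_scale_L1[OF dil_nz, of "h N" n]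
      by (simp add: norm_power)
    also have "\<bar>dil n\<bar> ^ N = 2 ^ N * (1 / 2 ^ nat \<bar>n\<bar>) ^ N"
      by (simp add: abs_dil_eq power_divide)
    finally have "cmod (convolution g (ker n) x) \<le> (2 ^ N * b) * ((1 / 2 ^ nat \<bar>n\<bar>) ^ N * M)" by (simp add: mult_ac)
    also have "\<dots> \<le> (L1 + 2 ^ N * b) * ((1 / 2 ^ nat \<bar>n\<bar>) ^ N * M)"
      using M0 L1_nonneg by (intro mult_right_mono) auto
    finally show ?thesis by (simp add: mult.assoc)
  qed
  then show ?thesis using that[of "L1 + 2 ^ N * b"] b0 L1_nonneg by auto
qed

lemma conv_ker_L1_bound: "(\<And>x. cmod (g x) \<le> M) \<Longrightarrow> cmod (convolution g (ker n) x) \<le> L1 * M"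
proof -
  assume M: "\<And>x. cmod (g x) \<le> M"
  then have "0 \<le> M" using norm_ge_zero order_trans by blast
  have "cmod (convolution g (ker n) x) \<le> M * (LBINT y. cmod (ker n y))"
    by (intro conv_bound ker_integrable M)
  also have "\<dots> \<le> M * L1" using \<open>0 \<le> M\<close> ker_L1 by (intro mult_left_mono)
  finally show ?thesis by (simp add: mult.commute)
qed

text \<open>The sum of the blocks up to \<open>L\<close> is the convolution with a dilated copy of
  \<open>ker 0\<close>, and these copies form an approximate identity.\<close>

lemma partial_sum_tendsto:
  assumes f: "Cb f"
  shows "(\<lambda>L. \<Sum>k\<in>{- int L..int L}. convolution f (ker k) x) \<longlonglongrightarrow> f x"
    and "\<And>B. (\<And>x. cmod (f x) \<le> B) \<Longrightarrow> cmod (\<Sum>k\<in>{- int L..int L}. convolution f (ker k) x) \<le> L1 * B"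
proof -
  let ?K = "ker 0"
  have s: "(\<lambda>t. \<Sum>i\<in>{- int L..int L}. \<phi> i t) = (\<lambda>t. \<phi> 0 (1 / 2 ^ L * t))" for L
    using Phi_eq[of L] by (simp add: \<Phi>_def fun_eq_iff)
  have e: "(\<Sum>k\<in>{- int L..int L}. convolution f (ker k) x) = convolution f (inv_fourier (\<lambda>t. \<phi> 0 (1 / 2 ^ L * t))) x" for L x
    using conv_sum[OF f, of "{- int L..int L}" \<phi> x] test_phi unfolding ker_def s by simp
  show "\<And>B. (\<And>x. cmod (f x) \<le> B) \<Longrightarrow> cmod (\<Sum>k\<in>{- int L..int L}. convolution f (ker k) x) \<le> L1 * B"
  proof -
    fix B assume B: "\<And>x. cmod (f x) \<le> B"
    then have B0: "0 \<le> B" using norm_ge_zero order_trans by blast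
    have "cmod (\<Sum>k\<in>{- int L..int L}. convolution f (ker k) x) \<le> B * (LBINT y. cmod (ker 0 y))"
      unfolding e using conv_bound[where g = f and x = x, OF B inv_fourier_integrable[OF test_scale[OF test_phi[of 0], of "1 / 2 ^ L"]]]
        inv_fourier_scale_L1[of "1 / 2 ^ L" "\<phi> 0"] by (simp add: ker_def)
    also have "\<dots> \<le> B * L1" using B0 ker_L1 by (intro mult_left_mono)
    finally show "cmod (\<Sum>k\<in>{- int L..int L}. convolution f (ker k) x) \<le> L1 * B" by (simp add: mult.commute)
  qed
  obtain B where B: "B \<ge> 0" "\<And>x. cmod (f x) \<le> B" using Cb_boundE[OF f, of 0] by auto
  have e2: "convolution f (inv_fourier (\<lambda>t. \<phi> 0 (1 / 2 ^ L * t))) x = (LBINT y. f (x - y / 2 ^ L) * ?K y)" for L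
  proof -
    have "(LBINT y. f (x - y / 2 ^ L) * ?K y) = 2 ^ L *\<^sub>R (LBINT y. f (x - y) * ?K (2 ^ L * y))"
      using lborel_integral_real_affine[of "2 ^ L" "\<lambda>y. f (x - y / 2 ^ L) * ?K y" 0] by simp
    moreover have "(LBINT y. f (x - y) * (2 ^ L * ?K (2 ^ L * y))) = 2 ^ L * (LBINT y. f (x - y) * ?K (2 ^ L * y))"
      by (subst integral_mult_right_zero[symmetric]) (simp add: mult_ac)
    ultimately show ?thesis unfolding convolution_def using inv_fourier_scale[of "1 / 2 ^ L" "\<phi> 0"]
      by (simp add: ker_def mult.commute[of "2 ^ L :: real"] scaleR_conv_of_real)
  qed
  have "(\<lambda>L. LBINT y. f (x - y / 2 ^ L) * ?K y) \<longlonglongrightarrow> (LBINT y. f x * ?K y)"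
  proof (rule integral_dominated_convergence[where w = "\<lambda>y. B * cmod (?K y)"])
    show "AE y in lborel. (\<lambda>L. f (x - y / 2 ^ L) * ?K y) \<longlonglongrightarrow> f x * ?K y"
    proof (intro always_eventually allI tendsto_intros)
      fix y
      have "(\<lambda>L. x - y / 2 ^ L) \<longlonglongrightarrow> x - 0"
        by (intro tendsto_intros LIMSEQ_divide_realpow_zero) auto
      then show "(\<lambda>L. f (x - y / 2 ^ L)) \<longlonglongrightarrow> f x"
        using isCont_tendsto_compose[of x f] Cb_continuous[OF f, of UNIV] by (simp add: continuous_on_eq_continuous_at)
    qed
  qed (use B ker_integrable[of 0] in \<open>auto simp: norm_mult ker_def intro!: always_eventually mult_right_mono
        borel_measurable_continuous_onI continuous_intros inv_fourier_continuous test_phi Cb_continuous_comp[OF f]\<close>)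
  moreover have "(LBINT y. ?K y) = 1"
    using fourier_inversion[OF test_phi, of 0 0] phi0_one[of 0] by (simp add: ker_def)
  ultimately show "(\<lambda>L. \<Sum>k\<in>{- int L..int L}. convolution f (ker k) x) \<longlonglongrightarrow> f x"
    unfolding e e2 by simp
qed

end

section \<open>Besov norms and smooth multipliers\<close>

lemma summable_on_int_decay:
  assumes "0 < \<beta>" shows "(\<lambda>d::int. 2 powr (- \<beta> * \<bar>real_of_int d\<bar>)) summable_on UNIV"
proof -
  have *: "(\<lambda>n::nat. 2 powr (- \<beta> * real n)) summable_on UNIV"
  proof (rule norm_summable_imp_summable_on)
    have "(\<lambda>n::nat. 2 powr (- \<beta> * real n)) = (\<lambda>n. (2 powr (- \<beta>)) ^ n)"
      by (simp add: fun_eq_iff powr_realpow[symmetric] powr_powr)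
    moreover have "norm ((2::real) powr (- \<beta>)) < 1" using assms powr_less_mono[of "- \<beta>" 0 2] by simp
    ultimately show "summable (\<lambda>n. norm ((2::real) powr (- \<beta> * real n)))" by (simp add: summable_geometric)
  qed
  have 1: "(\<lambda>d::int. 2 powr (- \<beta> * \<bar>real_of_int d\<bar>)) summable_on (int ` UNIV)"
    using * by (subst summable_on_reindex) (auto simp: o_def)
  have 2: "(\<lambda>d::int. 2 powr (- \<beta> * \<bar>real_of_int d\<bar>)) summable_on ((\<lambda>n. - int n) ` {1..})"
    using summable_on_subset_banach[OF *, of "{1..}"] by (subst summable_on_reindex) (auto simp: o_def inj_on_def)
  have u: "int ` UNIV \<union> (\<lambda>n. - int n) ` {1..} = UNIV"
  proof (intro set_eqI iffI UNIV_I)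
    fix d :: int show "d \<in> int ` UNIV \<union> (\<lambda>n. - int n) ` {1..}"
    proof (cases "d \<ge> 0")
      case True then show ?thesis by (auto intro!: image_eqI[of d int "nat d"])
    next
      case False then have "d = - int (nat (- d))" "nat (- d) \<in> {1..}" by auto
      then show ?thesis by blast
    qed
  qed
  have "int ` UNIV \<inter> (\<lambda>n. - int n) ` {1..} = {}" by auto
  from summable_on_Un_disjoint[OF 1 2 this] show ?thesis unfolding u .
qed

lemma finite_sum_infsum:
  fixes g :: "'i \<Rightarrow> 'k \<Rightarrow> real"
  assumes "finite F" and g: "\<And>n. g n summable_on A"
  shows "(\<lambda>k. \<Sum>n\<in>F. g n k) summable_on A \<and> infsum (\<lambda>k. \<Sum>n\<in>F. g n k) A = (\<Sum>n\<in>F. infsum (g n) A)"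
  using assms(1)
proof (induction F rule: finite_induct)
  case (insert n F)
  then show ?case using summable_on_add[OF g[of n], of "\<lambda>k. \<Sum>n\<in>F. g n k"]
      infsum_add[OF g[of n], of "\<lambda>k. \<Sum>n\<in>F. g n k"] by simp
qed simp

lemma Cb_uniformly_continuous: assumes "Cb g" shows "uniformly_continuous_on UNIV g"
proof -
  obtain B where B: "B \<ge> 0" "\<And>x. cmod (D g x) \<le> B" using Cb_boundE[OF assms, of 1] by auto
  have "onorm (\<lambda>h. h *\<^sub>R D g x) \<le> B" for x
    using B by (intro onorm_bound) (simp_all add: mult.commute[of B] mult_left_mono)
  then have "norm (g x - g y) \<le> B * norm (x - y)" for x y
    using smooth_has_D[OF Cb_smooth[OF assms]]
    by (intro differentiable_bound[of UNIV g "\<lambda>x h. h *\<^sub>R D g x"]) (auto simp: has_vector_derivative_def)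
  then have "B-lipschitz_on UNIV g" using B(1) by (intro lipschitz_onI) (auto simp: dist_norm)
  then show ?thesis by (rule lipschitz_on_uniformly_continuous)
qed

lemma Cb_add: "Cb f \<Longrightarrow> Cb g \<Longrightarrow> Cb (\<lambda>x. f x + g x)"
  unfolding Cb_def by (auto simp: smooth_add nd_add) (meson norm_triangle_mono)

lemma Cb_const: "Cb (\<lambda>_. c)"
proof -
  have "nd k (\<lambda>_. c) = (\<lambda>_. if k = 0 then c else 0)" for k
    by (induction k) (auto intro!: D_eqI)
  then show ?thesis unfolding Cb_def by (auto simp: smooth_const)
qed

lemma Cb_cmult: "Cb f \<Longrightarrow> Cb (\<lambda>x. c * f x)" by (intro Cb_mult Cb_const)

lemma Cb_diff: "Cb f \<Longrightarrow> Cb g \<Longrightarrow> Cb (\<lambda>x. f x - g x)"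
  using Cb_add[OF _ Cb_cmult[of g "-1"], of f] by simp

context besov_classes
begin

definition block_sup :: "(real \<Rightarrow> complex) \<Rightarrow> int \<Rightarrow> real" where
  "block_sup f n = (SUP x. cmod (convolution f (ker n) x))"

lemma besov_term_eq: "besov_term \<phi> \<alpha> f n = 2 powr (\<bar>real_of_int n\<bar> * \<alpha>) * block_sup f n"
  by (simp add: besov_term_def block_sup_def ker_def)

lemma block_sup_bdd: assumes "Cb f" shows "bdd_above (range (\<lambda>x. cmod (convolution f (ker n) x)))"
proof -
  obtain B where "\<And>x. cmod (f x) \<le> B" using Cb_boundE[OF assms, of 0] by auto
  from conv_ker_L1_bound[OF this] show ?thesis by (intro bdd_aboveI[of _ "L1 * B"]) auto
qed

lemma block_sup_upper: "Cb f \<Longrightarrow> cmod (convolution f (ker n) x) \<le> block_sup f n"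
  unfolding block_sup_def using block_sup_bdd by (intro cSUP_upper) auto

lemma block_sup_le: "(\<And>x. cmod (convolution f (ker n) x) \<le> c) \<Longrightarrow> block_sup f n \<le> c"
  unfolding block_sup_def by (intro cSUP_least) auto

lemma block_sup_nonneg: "Cb f \<Longrightarrow> 0 \<le> block_sup f n"
  using block_sup_upper[of f n 0] norm_ge_zero order_trans by blast

lemma besov_term_nonneg: "Cb f \<Longrightarrow> 0 \<le> besov_term \<phi> \<alpha> f n"
  by (simp add: besov_term_eq block_sup_nonneg)

lemma Cb_besovI: "Cb f \<Longrightarrow> besov_term \<phi> \<alpha> f summable_on UNIV \<Longrightarrow> f \<in> besov \<phi> \<alpha>"
proof -
  assume f: "Cb f" "besov_term \<phi> \<alpha> f summable_on UNIV"
  obtain B where "\<And>x. cmod (f x) \<le> B" using Cb_boundE[OF f(1), of 0] by auto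
  then have "bounded (range f)" by (auto simp: bounded_iff)
  then show ?thesis using f Cb_uniformly_continuous[OF f(1)] by (simp add: besov_def)
qed

lemma besov_dominated:
  assumes "Cb f" "\<And>n. besov_term \<phi> \<alpha> f n \<le> t n" "t summable_on UNIV"
  shows "f \<in> besov \<phi> \<alpha>" "besov_norm \<phi> \<alpha> f \<le> infsum t UNIV"
proof -
  have s: "besov_term \<phi> \<alpha> f summable_on UNIV"
    by (rule summable_on_comparison_test[OF assms(3)]) (use assms besov_term_nonneg in auto)
  then show "f \<in> besov \<phi> \<alpha>" by (rule Cb_besovI[OF assms(1)])
  show "besov_norm \<phi> \<alpha> f \<le> infsum t UNIV" unfolding besov_norm_def
    using assms s by (intro infsum_mono) auto
qed

text \<open>\<open>N\<close> bounded derivatives give the decay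
  \<open>2\<^bsup>-N\<bar>n\<bar>\<^esup>\<close> of the blocks, which beats the Besov
  weight since \<open>\<alpha> < N\<close>.\<close>

lemma smooth_besov:
  assumes N: "\<alpha> < real N"
  obtains K where "K \<ge> 0" "\<And>g M. Cb g \<Longrightarrow> (\<And>j x. j \<le> N \<Longrightarrow> cmod (nd j g x) \<le> M) \<Longrightarrow>
      g \<in> besov \<phi> \<alpha> \<and> besov_norm \<phi> \<alpha> g \<le> K * M"
proof -
  obtain C where C: "C \<ge> 0" "\<And>g n M x. Cb g \<Longrightarrow> (\<And>j x. j \<le> N \<Longrightarrow> cmod (nd j g x) \<le> M) \<Longrightarrow>
     cmod (convolution g (ker n) x) \<le> C * (1 / 2 ^ nat \<bar>n\<bar>) ^ N * M"
    using conv_ker_smooth_bound by blast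
  let ?p = "\<lambda>d::int. 2 powr (- (real N - \<alpha>) * \<bar>real_of_int d\<bar>)"
  have sp: "?p summable_on UNIV" using N by (intro summable_on_int_decay) auto
  have "g \<in> besov \<phi> \<alpha> \<and> besov_norm \<phi> \<alpha> g \<le> C * infsum ?p UNIV * M"
    if g: "Cb g" and M: "\<And>j x. j \<le> N \<Longrightarrow> cmod (nd j g x) \<le> M" for g M
  proof -
    have "besov_term \<phi> \<alpha> g n \<le> C * M * ?p n" for n
    proof -
      have pw: "(1 / 2 ^ nat \<bar>n\<bar>) ^ N = 2 powr (- real N * \<bar>real_of_int n\<bar>)"
        by (simp add: power_one_over powr_minus_divide powr_realpow[symmetric] powr_powr mult.commute)
      have "block_sup g n \<le> C * 2 powr (- real N * \<bar>real_of_int n\<bar>) * M"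
        unfolding pw[symmetric] using C(2)[OF g M] by (intro block_sup_le)
      then have "besov_term \<phi> \<alpha> g n \<le> 2 powr (\<bar>real_of_int n\<bar> * \<alpha>) * (C * 2 powr (- real N * \<bar>real_of_int n\<bar>) * M)"
        unfolding besov_term_eq by (intro mult_left_mono) auto
      also have "\<dots> = C * M * (2 powr (\<bar>real_of_int n\<bar> * \<alpha>) * 2 powr (- real N * \<bar>real_of_int n\<bar>))" by simp
      also have "\<dots> = C * M * ?p n" by (simp add: powr_add[symmetric] algebra_simps)
      finally show ?thesis .
    qed
    note * = besov_dominated[OF g this summable_on_cmult_right[OF sp]]
    have eq: "infsum (\<lambda>n. C * M * ?p n) UNIV = C * M * infsum ?p UNIV" by (rule infsum_cmult_right[OF sp])
    show ?thesis using *(1) *(2)[unfolded eq] by (simp only: mult_ac simp_thms)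
  qed
  moreover have "0 \<le> infsum ?p UNIV" by (intro infsum_nonneg) auto
  ultimately show ?thesis using that[of "C * infsum ?p UNIV"] C(1) by auto
qed

lemma block_sup_triangle: assumes "Cb f" "Cb g" shows "block_sup (\<lambda>x. f x + c * g x) n \<le> block_sup f n + cmod c * block_sup g n"
proof (rule block_sup_le)
  fix x
  obtain A where A: "\<And>x. cmod (f x) \<le> A" using Cb_boundE[OF assms(1), of 0] by auto
  obtain B where B: "\<And>x. cmod (g x) \<le> B" using Cb_boundE[OF assms(2), of 0] by auto
  have "convolution (\<lambda>x. f x + c * g x) (ker n) x = convolution f (ker n) x + c * convolution g (ker n) x"
    unfolding convolution_def
    using conv_integrable[OF Cb_continuous[OF assms(1)] A ker_integrable, of x n] conv_integrable[OF Cb_continuous[OF assms(2)] B ker_integrable, of x n]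
    by (simp add: ring_distribs mult.assoc)
  also have "cmod \<dots> \<le> block_sup f n + cmod c * block_sup g n"
    using block_sup_upper[OF assms(1)] block_sup_upper[OF assms(2)]
    by (intro order_trans[OF norm_triangle_ineq]) (auto simp: norm_mult intro!: add_mono mult_left_mono)
  finally show "cmod (convolution (\<lambda>x. f x + c * g x) (ker n) x) \<le> block_sup f n + cmod c * block_sup g n" .
qed

lemma besov_lincomb:
  assumes "Cb f" "Cb g" "f \<in> besov \<phi> \<alpha>" "g \<in> besov \<phi> \<alpha>"
  shows "(\<lambda>x. f x + c * g x) \<in> besov \<phi> \<alpha>"
    "besov_norm \<phi> \<alpha> (\<lambda>x. f x + c * g x) \<le> besov_norm \<phi> \<alpha> f + cmod c * besov_norm \<phi> \<alpha> g"
proof -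
  have C: "Cb (\<lambda>x. f x + c * g x)" by (intro Cb_add Cb_cmult assms)
  have s: "besov_term \<phi> \<alpha> f summable_on UNIV" "besov_term \<phi> \<alpha> g summable_on UNIV"
    using assms by (auto simp: besov_def)
  have "besov_term \<phi> \<alpha> (\<lambda>x. f x + c * g x) n \<le> besov_term \<phi> \<alpha> f n + cmod c * besov_term \<phi> \<alpha> g n" for n
    using mult_left_mono[OF block_sup_triangle[OF assms(1,2), of c n], of "2 powr (\<bar>real_of_int n\<bar> * \<alpha>)"]
    by (simp add: besov_term_eq ring_distribs mult_ac)
  note * = besov_dominated[OF C this summable_on_add[OF s(1) summable_on_cmult_right[OF s(2)]]]
  show "(\<lambda>x. f x + c * g x) \<in> besov \<phi> \<alpha>" by (rule *(1))
  show "besov_norm \<phi> \<alpha> (\<lambda>x. f x + c * g x) \<le> besov_norm \<phi> \<alpha> f + cmod c * besov_norm \<phi> \<alpha> g"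
    using *(2) infsum_add[OF s(1) summable_on_cmult_right[OF s(2)], of "cmod c"] infsum_cmult_right[OF s(2), of "cmod c"]
    by (simp add: besov_norm_def)
qed

text \<open>How the frequency block \<open>k\<close> of \<open>f\<close>, multiplied by a smooth
  function, leaks into the block \<open>n\<close>. For \<open>\<bar>n\<bar> >
  \<bar>k\<bar>\<close> the \<open>N\<close> derivatives that
  \<open>conv_ker_smooth_bound\<close> asks for cost
  \<open>2\<^bsup>N\<bar>k\<bar>\<^esup>\<close> by Bernstein's inequality; otherwise the
  trivial bound is used.\<close>

lemma block_product_bound:
  obtains E where "E \<ge> 0" "\<And>f ch M n k x. Cb f \<Longrightarrow> Cb ch \<Longrightarrow> (\<And>j x. j \<le> N \<Longrightarrow> cmod (nd j ch x) \<le> M) \<Longrightarrow>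
     cmod (convolution (\<lambda>x. convolution f (ker k) x * ch x) (ker n) x)
       \<le> E * M * block_sup f k * min 1 ((2 ^ nat \<bar>k\<bar> / 2 ^ nat \<bar>n\<bar>) ^ N)"
proof -
  obtain C where C: "C \<ge> 0" "\<And>g n M x. Cb g \<Longrightarrow> (\<And>j x. j \<le> N \<Longrightarrow> cmod (nd j g x) \<le> M) \<Longrightarrow>
     cmod (convolution g (ker n) x) \<le> C * (1 / 2 ^ nat \<bar>n\<bar>) ^ N * M"
    using conv_ker_smooth_bound by blast
  obtain c where c: "c \<ge> 1" "\<And>f n B x k. Cb f \<Longrightarrow> (\<And>x. cmod (convolution f (ker n) x) \<le> B) \<Longrightarrow>
     cmod (nd k (convolution f (ker n)) x) \<le> (c * 2 ^ nat \<bar>n\<bar>) ^ k * B" using bernstein by blast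
  define E where "E = max L1 (C * 2 ^ N * c ^ N)"
  have E0: "E \<ge> 0" unfolding E_def using L1_nonneg by simp
  have "cmod (convolution (\<lambda>x. convolution f (ker k) x * ch x) (ker n) x)
       \<le> E * M * block_sup f k * min 1 ((2 ^ nat \<bar>k\<bar> / 2 ^ nat \<bar>n\<bar>) ^ N)"
    if f: "Cb f" and chi: "Cb ch" and M: "\<And>j x. j \<le> N \<Longrightarrow> cmod (nd j ch x) \<le> M" for f ch M n k x
  proof -
    let ?h = "\<lambda>x. convolution f (ker k) x * ch x"
    have M0: "0 \<le> M" using M[of 0] norm_ge_zero order_trans by blast
    have b0: "0 \<le> block_sup f k" by (rule block_sup_nonneg[OF f])
    have fk: "Cb (convolution f (ker k))" by (rule conv_Cb[OF f ker_integrable])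
    have h: "Cb ?h" by (intro Cb_mult fk chi)
    let ?s = "c * 2 ^ nat \<bar>k\<bar>"
    have s1: "?s \<ge> 1" using mult_mono[OF c(1) one_le_power[of 2 "nat \<bar>k\<bar>"]] c(1) by simp
    have 1: "cmod (nd i (convolution f (ker k)) x) \<le> ?s ^ N * block_sup f k" if "i \<le> N" for i x
      by (rule order_trans[OF c(2)[OF f block_sup_upper[OF f]]])
        (intro mult_right_mono power_increasing that s1 b0)
    have 2: "cmod (nd j ?h x) \<le> 2 ^ N * (?s ^ N * block_sup f k * M)" if "j \<le> N" for j x
    proof -
      have "cmod (nd j ?h x) \<le> 2 ^ j * (?s ^ N * block_sup f k * M)"
        using 1 M that by (intro nd_mult_bound Cb_smooth fk chi) auto
      also have "\<dots> \<le> 2 ^ N * (?s ^ N * block_sup f k * M)"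
        using that s1 b0 M0 by (intro mult_right_mono power_increasing) auto
      finally show ?thesis .
    qed
    have a: "cmod (convolution ?h (ker n) x) \<le> (C * 2 ^ N * c ^ N) * (M * block_sup f k * ((2 ^ nat \<bar>k\<bar> / 2 ^ nat \<bar>n\<bar>) ^ N))"
      using C(2)[OF h 2, of n x] by (simp add: power_mult_distrib power_divide mult_ac)
    also have "\<dots> \<le> E * (M * block_sup f k * ((2 ^ nat \<bar>k\<bar> / 2 ^ nat \<bar>n\<bar>) ^ N))"
      using M0 b0 by (intro mult_right_mono) (auto simp: E_def)
    finally have a: "cmod (convolution ?h (ker n) x) \<le> E * M * block_sup f k * ((2 ^ nat \<bar>k\<bar> / 2 ^ nat \<bar>n\<bar>) ^ N)"
      by (simp add: mult.assoc)
    have "cmod (?h x) \<le> block_sup f k * M" for x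
      unfolding norm_mult using block_sup_upper[OF f, of k x] M[of 0 x] b0 by (intro mult_mono) auto
    then have "cmod (convolution ?h (ker n) x) \<le> L1 * (block_sup f k * M)" by (rule conv_ker_L1_bound)
    also have "\<dots> \<le> E * (block_sup f k * M)"
      using M0 b0 by (intro mult_right_mono) (auto simp: E_def)
    finally have "cmod (convolution ?h (ker n) x) \<le> E * M * block_sup f k * 1" by (simp add: mult_ac)
    with a show ?thesis by (simp add: min_def)
  qed
  then show ?thesis using that E0 by blast
qed

text \<open>Since \<open>0 < \<alpha> < N\<close>, the Besov weight can be moved from \<open>n\<close>
  to \<open>k\<close> at the price of a factor that decays geometrically in the difference
  of \<open>\<bar>n\<bar>\<close> and \<open>\<bar>k\<bar>\<close>, in both directions.\<close>

lemma weight_transfer: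
  assumes "0 < \<alpha>" "\<alpha> < real N"
  shows "2 powr (\<bar>real_of_int n\<bar> * \<alpha>) * min 1 ((2 ^ nat \<bar>k\<bar> / 2 ^ nat \<bar>n\<bar>) ^ N)
     \<le> 2 powr (\<bar>real_of_int k\<bar> * \<alpha>) * 2 powr (- min \<alpha> (real N - \<alpha>) * \<bar>real_of_int (\<bar>n\<bar> - \<bar>k\<bar>)\<bar>)"
proof -
  define a b where "a = \<bar>real_of_int n\<bar>" and "b = \<bar>real_of_int k\<bar>"
  have r: "(2 ^ nat \<bar>k\<bar> / 2 ^ nat \<bar>n\<bar>) ^ N = 2 powr ((b - a) * real N)"
    by (simp add: a_def b_def powr_realpow[symmetric] powr_diff[symmetric] powr_powr)
  show ?thesis
  proof (cases "a \<le> b")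
    case True
    have "2 powr (a * \<alpha>) * min 1 ((2 ^ nat \<bar>k\<bar> / 2 ^ nat \<bar>n\<bar>) ^ N) \<le> 2 powr (a * \<alpha>)" by simp
    also have "\<dots> \<le> 2 powr (b * \<alpha> + - min \<alpha> (real N - \<alpha>) * (b - a))"
    proof (rule powr_mono)
      have "min \<alpha> (real N - \<alpha>) * (b - a) \<le> \<alpha> * (b - a)" using True by (intro mult_right_mono) auto
      then show "a * \<alpha> \<le> b * \<alpha> + - min \<alpha> (real N - \<alpha>) * (b - a)" by (simp add: algebra_simps)
    qed simp
    finally have "2 powr (a * \<alpha>) * min 1 ((2 ^ nat \<bar>k\<bar> / 2 ^ nat \<bar>n\<bar>) ^ N) \<le>
        2 powr (b * \<alpha> + - min \<alpha> (real N - \<alpha>) * (b - a))" .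
    moreover have "\<bar>real_of_int (\<bar>n\<bar> - \<bar>k\<bar>)\<bar> = b - a" using True by (simp add: a_def b_def)
    ultimately show ?thesis unfolding powr_add by (simp only: a_def b_def)
  next
    case False
    have "2 powr (a * \<alpha>) * min 1 ((2 ^ nat \<bar>k\<bar> / 2 ^ nat \<bar>n\<bar>) ^ N) \<le> 2 powr (a * \<alpha>) * 2 powr ((b - a) * real N)"
      unfolding r by (intro mult_left_mono) auto
    also have "\<dots> = 2 powr (a * \<alpha> + (b - a) * real N)" by (simp add: powr_add)
    also have "\<dots> \<le> 2 powr (b * \<alpha> + - min \<alpha> (real N - \<alpha>) * (a - b))"
    proof (rule powr_mono)
      have "min \<alpha> (real N - \<alpha>) * (a - b) \<le> (real N - \<alpha>) * (a - b)" using False by (intro mult_right_mono) auto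
      then show "a * \<alpha> + (b - a) * real N \<le> b * \<alpha> + - min \<alpha> (real N - \<alpha>) * (a - b)" by (simp add: algebra_simps)
    qed simp
    finally show ?thesis unfolding powr_add using False by (simp add: a_def b_def)
  qed
qed

text \<open>Decompose \<open>f\<close> into its blocks. By the two preceding lemmas the blocks of the
  product are controlled by the blocks of \<open>f\<close> through a matrix with geometric
  decay away from \<open>\<bar>n\<bar> = \<bar>k\<bar>\<close>, whose sums over
  \<open>n\<close> are bounded uniformly in \<open>k\<close>.\<close>

lemma besov_multiplier:
  assumes alpha: "0 < \<alpha>" and N: "\<alpha> < real N"
  obtains K where "K \<ge> 0" "\<And>f ch M. Cb f \<Longrightarrow> Cb ch \<Longrightarrow> f \<in> besov \<phi> \<alpha> \<Longrightarrow> (\<And>j x. j \<le> N \<Longrightarrow> cmod (nd j ch x) \<le> M) \<Longrightarrow>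
      (\<lambda>x. f x * ch x) \<in> besov \<phi> \<alpha> \<and> besov_norm \<phi> \<alpha> (\<lambda>x. f x * ch x) \<le> K * M * besov_norm \<phi> \<alpha> f"
proof -
  obtain E where E: "E \<ge> 0" "\<And>f ch M n k x. Cb f \<Longrightarrow> Cb ch \<Longrightarrow> (\<And>j x. j \<le> N \<Longrightarrow> cmod (nd j ch x) \<le> M) \<Longrightarrow>
     cmod (convolution (\<lambda>x. convolution f (ker k) x * ch x) (ker n) x)
       \<le> E * M * block_sup f k * min 1 ((2 ^ nat \<bar>k\<bar> / 2 ^ nat \<bar>n\<bar>) ^ N)"
    using block_product_bound[of N] by blast
  define \<beta> where "\<beta> = min \<alpha> (real N - \<alpha>)"
  have b0: "\<beta> > 0" using assms by (simp add: \<beta>_def)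
  define p where "p d = 2 powr (- \<beta> * \<bar>real_of_int d\<bar>)" for d :: int
  define G where "G = infsum p UNIV"
  have sp: "p summable_on UNIV" unfolding p_def by (rule summable_on_int_decay[OF b0])
  have p0: "0 \<le> p d" for d by (simp add: p_def)
  have p1: "p d \<le> 1" for d using b0 powr_mono[of "- \<beta> * \<bar>real_of_int d\<bar>" 0 2] by (simp add: p_def)
  \<comment> \<open>the decay matrix; every nonzero value of \<open>\<bar>n\<bar>\<close> occurs twice, hence
    the factor 2 in the sums over \<open>n\<close>\<close>
  define q where "q n k = p (\<bar>n\<bar> - \<bar>k\<bar>)" for n k :: int
  have G0: "G \<ge> 0" unfolding G_def using p0 by (intro infsum_nonneg)
  have qsum: "(\<Sum>n\<in>F. q n k) \<le> 2 * G" if F: "finite F" for F k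
  proof -
    have *: "(\<Sum>n\<in>F. p (h n)) \<le> G" if "inj h" for h :: "int \<Rightarrow> int"
    proof -
      have "(\<Sum>n\<in>F. p (h n)) = sum p (h ` F)" using that by (subst sum.reindex) (auto simp: inj_on_def)
      also have "\<dots> \<le> G" unfolding G_def using F p0 by (intro finite_sum_le_infsum sp) auto
      finally show ?thesis .
    qed
    have "(\<Sum>n\<in>F. q n k) \<le> (\<Sum>n\<in>F. p (n - \<bar>k\<bar>) + p (- n - \<bar>k\<bar>))"
    proof (rule sum_mono)
      fix n show "q n k \<le> p (n - \<bar>k\<bar>) + p (- n - \<bar>k\<bar>)"
        using p0[of "n - \<bar>k\<bar>"] p0[of "- n - \<bar>k\<bar>"] by (cases "n \<ge> 0") (auto simp: q_def)
    qed
    also have "\<dots> \<le> 2 * G"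
      using *[of "\<lambda>n. n - \<bar>k\<bar>"] *[of "\<lambda>n. - n - \<bar>k\<bar>"] by (simp add: sum.distrib inj_def)
    finally show ?thesis .
  qed
  have "(\<lambda>x. f x * ch x) \<in> besov \<phi> \<alpha> \<and> besov_norm \<phi> \<alpha> (\<lambda>x. f x * ch x) \<le> (E * 2 * G) * M * besov_norm \<phi> \<alpha> f"
    if f: "Cb f" and chi: "Cb ch" and fb: "f \<in> besov \<phi> \<alpha>" and M: "\<And>j x. j \<le> N \<Longrightarrow> cmod (nd j ch x) \<le> M" for f ch M
  proof -
    have M0: "0 \<le> M" using M[of 0] norm_ge_zero order_trans by blast
    define t where "t k = besov_term \<phi> \<alpha> f k" for k
    have t0: "0 \<le> t k" for k unfolding t_def by (rule besov_term_nonneg[OF f])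
    have st: "t summable_on UNIV" using fb by (simp add: t_def[abs_def] besov_def)
    have stq: "(\<lambda>k. t k * q n k) summable_on UNIV" for n
      by (rule summable_on_comparison_test[OF st]) (auto simp: q_def p0 t0 intro!: mult_left_le p1)
    define R where "R n = infsum (\<lambda>k. t k * q n k) UNIV" for n
    have R0: "0 \<le> R n" for n unfolding R_def by (intro infsum_nonneg) (simp add: t0 q_def p0)
    define w where "w n = 2 powr (\<bar>real_of_int n\<bar> * \<alpha>)" for n :: int
    have w0: "w n > 0" for n by (simp add: w_def)
    let ?h = "\<lambda>k x. convolution f (ker k) x * ch x"
    have pc: "w n * cmod (convolution (?h k) (ker n) x) \<le> E * M * (t k * q n k)" for n k x
    proof -
      have "w n * cmod (convolution (?h k) (ker n) x) \<le> w n * (E * M * block_sup f k * min 1 ((2 ^ nat \<bar>k\<bar> / 2 ^ nat \<bar>n\<bar>) ^ N))"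
        using w0[of n] E(2)[OF f chi M] by (intro mult_left_mono) auto
      also have "\<dots> = E * M * block_sup f k * (w n * min 1 ((2 ^ nat \<bar>k\<bar> / 2 ^ nat \<bar>n\<bar>) ^ N))" by simp
      also have "\<dots> \<le> E * M * block_sup f k * (w k * q n k)"
        using weight_transfer[OF assms, of n k] E(1) M0 block_sup_nonneg[OF f]
        by (intro mult_left_mono) (auto simp: w_def q_def p_def \<beta>_def)
      finally show ?thesis by (simp add: t_def besov_term_eq w_def mult_ac)
    qed
    have Ch: "Cb (?h k)" for k by (intro Cb_mult conv_Cb f ker_integrable chi)
    obtain B where B: "B \<ge> 0" "\<And>x. cmod (f x) \<le> B" using Cb_boundE[OF f, of 0] by auto
    have fchi: "Cb (\<lambda>x. f x * ch x)" by (intro Cb_mult f chi)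
    \<comment> \<open>sum over the blocks of \<open>f\<close>, and pass to the limit inside the convolution by
      dominated convergence\<close>
    have lim: "w n * cmod (convolution (\<lambda>x. f x * ch x) (ker n) x) \<le> E * M * R n" for n x
    proof -
      let ?S = "\<lambda>L y. (\<Sum>k\<in>{- int L..int L}. convolution f (ker k) y) * ch y"
      have cS: "convolution (?S L) (ker n) x = (\<Sum>k\<in>{- int L..int L}. convolution (?h k) (ker n) x)" for L
      proof -
        have "integrable lborel (\<lambda>y. ?h k (x - y) * ker n y)" for k
        proof -
          obtain A where A: "\<And>x. cmod (?h k x) \<le> A" using Cb_boundE[OF Ch[of k], of 0] by auto
          show ?thesis by (rule conv_integrable[OF Cb_continuous[OF Ch] A ker_integrable])
        qed
        then show ?thesis unfolding convolution_def[of _ "ker n"] by (simp add: sum_distrib_right)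
      qed
      have "(\<lambda>L. convolution (?S L) (ker n) x) \<longlonglongrightarrow> convolution (\<lambda>x. f x * ch x) (ker n) x"
        unfolding convolution_def[of _ "ker n"]
      proof (rule integral_dominated_convergence[where w = "\<lambda>y. (L1 * B * M) * cmod (ker n y)"])
        show "AE y in lborel. (\<lambda>L. ?S L (x - y) * ker n y) \<longlonglongrightarrow> f (x - y) * ch (x - y) * ker n y"
          by (intro always_eventually allI tendsto_intros partial_sum_tendsto(1)[OF f])
        show "AE y in lborel. cmod (?S L (x - y) * ker n y) \<le> (L1 * B * M) * cmod (ker n y)" for L
        proof (intro always_eventually allI)
          fix y
          have "cmod (?S L (x - y)) \<le> (L1 * B) * M"
            unfolding norm_mult using partial_sum_tendsto(2)[OF f B(2)] M[of 0 "x - y"] L1_nonneg B(1)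
            by (intro mult_mono) auto
          then show "cmod (?S L (x - y) * ker n y) \<le> (L1 * B * M) * cmod (ker n y)"
            unfolding norm_mult[of _ "ker n y"] by (intro mult_right_mono) auto
        qed
        have ck: "continuous_on UNIV (ker n)" unfolding ker_def by (intro inv_fourier_continuous test_phi)
        show "(\<lambda>y. f (x - y) * ch (x - y) * ker n y) \<in> borel_measurable lborel"
          by (auto intro!: borel_measurable_continuous_onI continuous_intros Cb_continuous_comp[OF f] Cb_continuous_comp[OF chi] ck)
        show "(\<lambda>y. ?S L (x - y) * ker n y) \<in> borel_measurable lborel" for L
          by (auto intro!: borel_measurable_continuous_onI continuous_intros Cb_continuous_comp[OF chi] ck
             Cb_continuous_comp[OF conv_Cb[OF f ker_integrable]])
      qed (use ker_integrable in auto)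
      then have "(\<lambda>L. w n * cmod (convolution (?S L) (ker n) x)) \<longlonglongrightarrow> w n * cmod (convolution (\<lambda>x. f x * ch x) (ker n) x)"
        by (intro tendsto_intros)
      moreover have "w n * cmod (convolution (?S L) (ker n) x) \<le> E * M * R n" for L
      proof -
        have "w n * cmod (convolution (?S L) (ker n) x) \<le> (\<Sum>k\<in>{- int L..int L}. w n * cmod (convolution (?h k) (ker n) x))"
          unfolding cS sum_distrib_left[symmetric] using w0[of n] by (intro mult_left_mono norm_sum) auto
        also have "\<dots> \<le> (\<Sum>k\<in>{- int L..int L}. E * M * (t k * q n k))" by (intro sum_mono pc)
        also have "\<dots> = E * M * (\<Sum>k\<in>{- int L..int L}. t k * q n k)" by (simp add: sum_distrib_left)
        also have "\<dots> \<le> E * M * R n" unfolding R_def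
          using E(1) M0 by (intro mult_left_mono finite_sum_le_infsum stq) (auto simp: t0 q_def p0)
        finally show ?thesis .
      qed
      ultimately show ?thesis by (intro LIMSEQ_le_const2) auto
    qed
    have bt: "besov_term \<phi> \<alpha> (\<lambda>x. f x * ch x) n \<le> E * M * R n" for n
    proof -
      have "block_sup (\<lambda>x. f x * ch x) n \<le> E * M * R n / w n"
        using lim[of n] w0[of n] by (intro block_sup_le) (simp add: pos_le_divide_eq mult.commute)
      then have "block_sup (\<lambda>x. f x * ch x) n * w n \<le> E * M * R n" using w0[of n] by (simp only: pos_le_divide_eq)
      moreover have "besov_term \<phi> \<alpha> (\<lambda>x. f x * ch x) n = block_sup (\<lambda>x. f x * ch x) n * w n"
        by (simp only: besov_term_eq w_def mult.commute)
      ultimately show ?thesis by (simp only:)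
    qed
    have Rsum: "sum R F \<le> 2 * G * infsum t UNIV" if F: "finite F" for F
    proof -
      have "sum R F = infsum (\<lambda>k. \<Sum>n\<in>F. t k * q n k) UNIV"
        unfolding R_def using finite_sum_infsum[of F "\<lambda>n k. t k * q n k" UNIV, OF F stq] by simp
      also have "\<dots> \<le> infsum (\<lambda>k. 2 * G * t k) UNIV"
      proof (rule infsum_mono)
        show "(\<lambda>k. \<Sum>n\<in>F. t k * q n k) summable_on UNIV" using finite_sum_infsum[of F "\<lambda>n k. t k * q n k" UNIV, OF F stq] by blast
        show "(\<lambda>k. 2 * G * t k) summable_on UNIV" by (intro summable_on_cmult_right st)
        fix k show "(\<Sum>n\<in>F. t k * q n k) \<le> 2 * G * t k"
          using mult_left_mono[OF qsum[OF F, of k] t0[of k]] by (simp add: sum_distrib_left mult_ac)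
      qed
      also have "\<dots> = 2 * G * infsum t UNIV" by (rule infsum_cmult_right[OF st])
      finally show ?thesis .
    qed
    have sR: "R summable_on UNIV"
      by (rule nonneg_bdd_above_summable_on) (auto simp: R0 intro!: bdd_aboveI[of _ "2 * G * infsum t UNIV"] Rsum)
    have "infsum R UNIV \<le> 2 * G * infsum t UNIV"
      by (rule infsum_le_finite_sums[OF sR]) (auto intro: Rsum)
    then have "E * M * infsum R UNIV \<le> E * M * (2 * G * infsum t UNIV)"
      using E(1) M0 by (intro mult_left_mono) auto
    note bd = besov_dominated[OF fchi bt summable_on_cmult_right[OF sR]]
    have "infsum (\<lambda>n. E * M * R n) UNIV = E * M * infsum R UNIV" by (rule infsum_cmult_right[OF sR])
    moreover have "infsum t UNIV = besov_norm \<phi> \<alpha> f" by (simp add: besov_norm_def t_def[abs_def])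
    ultimately have "besov_norm \<phi> \<alpha> (\<lambda>x. f x * ch x) \<le> E * M * (2 * G * besov_norm \<phi> \<alpha> f)"
      using bd(2) \<open>E * M * infsum R UNIV \<le> E * M * (2 * G * infsum t UNIV)\<close> by (simp only:)
    then show ?thesis using bd(1) by (simp add: mult_ac)
  qed
  note main = this
  show ?thesis
  proof (rule that[of "E * 2 * G"])
    show "0 \<le> E * 2 * G" using E(1) G0 by simp
  qed (fact main)
qed

end

section \<open>Dyadic pieces and strips in the logarithmic variable\<close>

lemma summable_on_int_abs:
  fixes h :: "nat \<Rightarrow> real"
  assumes "h summable_on UNIV" shows "(\<lambda>d::int. h (nat \<bar>d\<bar>)) summable_on UNIV"
proof -
  have 1: "(\<lambda>d::int. h (nat \<bar>d\<bar>)) summable_on (int ` UNIV)"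
    using assms by (subst summable_on_reindex) (auto simp: o_def)
  have 2: "(\<lambda>d::int. h (nat \<bar>d\<bar>)) summable_on ((\<lambda>n. - int n) ` {1..})"
    using summable_on_subset_banach[OF assms, of "{1..}"] by (subst summable_on_reindex) (auto simp: o_def inj_on_def)
  have u: "int ` UNIV \<union> (\<lambda>n. - int n) ` {1..} = UNIV"
  proof (intro set_eqI iffI UNIV_I)
    fix d :: int show "d \<in> int ` UNIV \<union> (\<lambda>n. - int n) ` {1..}"
    proof (cases "d \<ge> 0")
      case True then show ?thesis by (auto intro!: image_eqI[of d int "nat d"])
    next
      case False then have "d = - int (nat (- d))" "nat (- d) \<in> {1..}" by auto
      then show ?thesis by blast
    qed
  qed
  have "int ` UNIV \<inter> (\<lambda>n. - int n) ` {1..} = {}" by auto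
  from summable_on_Un_disjoint[OF 1 2 this] show ?thesis unfolding u .
qed

text \<open>The passage to the logarithmic variable, under which Mihlin norms become Besov norms,
  dilations become translations and sectors become strips.\<close>

definition elog :: "(real \<Rightarrow> complex) \<Rightarrow> real \<Rightarrow> complex" where
  "elog f x = f (exp x)"

lemma mihlin_elog: "f \<in> mihlin \<phi> \<alpha> \<longleftrightarrow> elog f \<in> besov \<phi> \<alpha>"
  and mihlin_norm_elog: "mihlin_norm \<phi> \<alpha> f = besov_norm \<phi> \<alpha> (elog f)"
  by (simp_all add: mihlin_def mihlin_norm_def elog_def[abs_def])

lemma elog_mult: "elog (\<lambda>t. f t * g t) = (\<lambda>x. elog f x * elog g x)"
  and elog_add: "elog (\<lambda>t. f t + g t) = (\<lambda>x. elog f x + elog g x)"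
  and elog_diff: "elog (\<lambda>t. f t - g t) = (\<lambda>x. elog f x - elog g x)"
  and elog_cmult: "elog (\<lambda>t. c * g t) = (\<lambda>x. c * elog g x)"
  by (simp_all add: elog_def fun_eq_iff)

lemma elog_piece: "elog (dyadic_piece \<eta> n) = (\<lambda>x. elog \<eta> (x + (- (real_of_int n * ln 2))))"
proof
  fix x
  have "2 powi (- n) = exp (- (real_of_int n * ln 2))"
    by (simp add: powr_real_of_int' powr_def flip: powr_real_of_int')
  then show "elog (dyadic_piece \<eta> n) x = elog \<eta> (x + (- (real_of_int n * ln 2)))"
    by (simp add: elog_def dyadic_piece_def exp_add[symmetric] algebra_simps)
qed

lemma elog_hom_zero:
  assumes "homogeneous_partition \<eta>" "ln 2 < \<bar>x\<bar>" shows "elog \<eta> x = 0"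
proof -
  have s: "supp \<eta> \<subseteq> {1/2..2}" using assms unfolding homogeneous_partition_def by blast
  have "exp x \<notin> {1/2..2}"
  proof (cases "x \<ge> 0")
    case True
    then have "exp (ln 2) < exp x" using assms(2) by (subst exp_less_mono) auto
    then show ?thesis by simp
  next
    case False
    then have "exp x < exp (- ln 2)" using assms(2) by (subst exp_less_mono) auto
    then show ?thesis by (simp add: exp_minus)
  qed
  then show ?thesis unfolding elog_def by (rule supp_zero[OF s])
qed

lemma elog_hom_test: assumes "homogeneous_partition \<eta>" shows "test (elog \<eta>)"
  using assms elog_hom_zero[OF assms] smooth_exp_subst unfolding test_def homogeneous_partition_def elog_def[abs_def] by blast

lemma elog_piece_zero:
  assumes "homogeneous_partition \<eta>" "ln 2 < \<bar>x - real_of_int n * ln 2\<bar>" shows "elog (dyadic_piece \<eta> n) x = 0"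
  unfolding elog_piece using elog_hom_zero[OF assms(1)] assms(2) by simp

lemma test_shift: "test f \<Longrightarrow> test (\<lambda>x. f (x + a))"
proof -
  assume f: "test f"
  then obtain b where b: "\<And>t. b < \<bar>t\<bar> \<Longrightarrow> f t = 0" unfolding test_def by blast
  have "f (t + a) = 0" if "b + \<bar>a\<bar> < \<bar>t\<bar>" for t using that by (intro b) linarith
  then show ?thesis using f smooth_affine[of f 1 a] unfolding test_def by auto
qed

lemma elog_piece_test: "homogeneous_partition \<eta> \<Longrightarrow> test (elog (dyadic_piece \<eta> n))"
  unfolding elog_piece by (intro test_shift elog_hom_test)

lemma elog_piece_bounds:
  assumes "homogeneous_partition \<eta>"
  obtains M where "M \<ge> 0" "\<And>j n x. j \<le> N \<Longrightarrow> cmod (nd j (elog (dyadic_piece \<eta> n)) x) \<le> M"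
proof -
  obtain M where "M \<ge> 0" "\<And>j x. j \<le> N \<Longrightarrow> cmod (nd j (elog \<eta>) x) \<le> M"
    using Cb_bounds_upto[OF test_Cb[OF elog_hom_test[OF assms]]] by metis
  then show ?thesis using that[of M]
    unfolding elog_piece nd_shift[OF test_smooth[OF elog_hom_test[OF assms]]] by auto
qed

lemma nd_piece_zero:
  assumes "homogeneous_partition \<eta>" "ln 2 < \<bar>x - real_of_int n * ln 2\<bar>"
  shows "nd j (\<lambda>x. f x * elog (dyadic_piece \<eta> n) x) x = 0"
proof (rule nd_zero_outside[of "cball (real_of_int n * ln 2) (ln 2)"])
  show "f y * elog (dyadic_piece \<eta> n) y = 0" if "y \<notin> cball (real_of_int n * ln 2) (ln 2)" for y
    using elog_piece_zero[OF assms(1), of y n] that by (simp add: dist_real_def abs_minus_commute)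
qed (use assms(2) in \<open>auto simp: dist_real_def abs_minus_commute\<close>)

definition strip :: "real \<Rightarrow> complex set" where "strip w = {z. \<bar>Im z\<bar> < w}"

lemma open_strip: "open (strip w)"
proof -
  have "strip w = {z. Im z < w} \<inter> {z. - w < Im z}" by (auto simp: strip_def)
  then show ?thesis using open_halfspace_Im_lt[of w] open_halfspace_Im_gt[of "- w"] by auto
qed

lemma exp_strip: "z \<in> strip w \<Longrightarrow> w \<le> pi \<Longrightarrow> exp z \<in> sector w" "z \<in> strip w \<Longrightarrow> w \<le> pi \<Longrightarrow> Ln (exp z) = z"
proof -
  assume z: "z \<in> strip w" "w \<le> pi"
  show l: "Ln (exp z) = z" using z by (intro Ln_exp) (auto simp: strip_def)
  then have "Arg (exp z) = Im z" by (metis Arg_def exp_not_eq_zero)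
  then show "exp z \<in> sector w" using z by (simp add: strip_def sector_def)
qed

lemma Hinf_holo_strip: "f holomorphic_on sector w \<Longrightarrow> w \<le> pi \<Longrightarrow> (\<lambda>z. f (exp z)) holomorphic_on strip w"
  using holomorphic_on_compose_gen[of exp "strip w" f "sector w"] exp_strip
  by (auto simp: o_def holomorphic_on_exp)

lemma strip_smooth:
  assumes "h holomorphic_on strip w" "0 < w"
  shows "smooth (\<lambda>x. h (complex_of_real x))"
  using assms by (intro holomorphic_on_line_smooth(1)[OF _ open_strip]) (auto simp: strip_def)

lemma cball_subset_strip: "r < w \<Longrightarrow> cball (complex_of_real x) r \<subseteq> strip w"
proof
  fix z assume "r < w" "z \<in> cball (complex_of_real x) r"
  then show "z \<in> strip w" using abs_Im_le_cmod[of "complex_of_real x - z"] by (simp add: dist_norm strip_def)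
qed

text \<open>The bound is required only on a disc around \<open>x\<close>, so that decay of
  \<open>h\<close> at infinity is inherited by the derivatives.\<close>

lemma strip_deriv_bound:
  assumes h: "h holomorphic_on strip w" and r: "0 < r" "r < w"
    and B: "\<And>z. z \<in> cball (of_real x) r \<Longrightarrow> cmod (h z) \<le> B"
  shows "cmod (nd k (\<lambda>x. h (complex_of_real x)) x) \<le> fact k * B / r ^ k"
proof -
  have s: "cball (complex_of_real x) r \<subseteq> strip w" by (rule cball_subset_strip[OF r(2)])
  have "nd k (\<lambda>x. h (complex_of_real x)) x = (deriv ^^ k) h (of_real x)"
    using holomorphic_on_line_smooth(2)[OF h open_strip] r by (auto simp: strip_def fun_eq_iff image_subset_iff)
  also have "cmod \<dots> \<le> fact k * B / r ^ k"
  proof (rule Cauchy_inequality)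
    show "h holomorphic_on ball (of_real x) r" using h s by (meson ball_subset_cball holomorphic_on_subset subset_trans)
    show "continuous_on (cball (of_real x) r) h" using h s by (meson holomorphic_on_imp_continuous_on continuous_on_subset)
  qed (use r B in \<open>auto simp: dist_norm norm_minus_commute\<close>)
  finally show ?thesis .
qed

lemma Hinf_Cb:
  assumes "f \<in> Hinf w" "0 < w" "w \<le> pi" shows "Cb (elog (on_reals f))"
proof -
  have h: "(\<lambda>z. f (exp z)) holomorphic_on strip w" using assms by (intro Hinf_holo_strip) (auto simp: Hinf_def)
  obtain B where B: "\<And>z. z \<in> sector w \<Longrightarrow> cmod (f z) \<le> B" using assms(1) by (auto simp: Hinf_def bounded_iff)
  have e: "elog (on_reals f) = (\<lambda>x. f (exp (complex_of_real x)))" by (auto simp: elog_def exp_of_real)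
  have "cmod (nd k (elog (on_reals f)) x) \<le> fact k * B / (w / 2) ^ k" for k x
    unfolding e
  proof (rule strip_deriv_bound[OF h])
    fix z assume "z \<in> cball (complex_of_real x) (w / 2)"
    then have "z \<in> strip w" using cball_subset_strip[of "w / 2" w x] assms(2) by auto
    then show "cmod (f (exp z)) \<le> B" using assms by (intro B exp_strip)
  qed (use assms in auto)
  then show ?thesis unfolding Cb_def using strip_smooth[OF h] assms e by auto
qed

section \<open>Norms that are summed over dyadic pieces\<close>

text \<open>\<open>N\<close> is an auxiliary order of smoothness above \<open>\<alpha>\<close>:
  \<open>N\<close> bounded derivatives control Besov norms of order \<open>\<alpha>\<close>.\<close>

locale mihlin_classes = besov_classes +
  fixes \<eta> :: "real \<Rightarrow> complex" and \<alpha> :: real and N :: nat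
  assumes H: "homogeneous_partition \<eta>" and alpha: "0 < \<alpha>" "\<alpha> < real N"
begin

lemma term_eq: "mihlin1_term \<phi> \<eta> \<alpha> f n = besov_norm \<phi> \<alpha> (\<lambda>x. elog f x * elog (dyadic_piece \<eta> n) x)"
  by (simp add: mihlin1_term_def mihlin_norm_elog elog_mult)

lemma Cb_besov: "Cb g \<Longrightarrow> g \<in> besov \<phi> \<alpha>"
  by (rule smooth_besov[OF alpha(2)]) (metis Cb_bounds_upto)

lemma besov_norm_nonneg: "Cb g \<Longrightarrow> 0 \<le> besov_norm \<phi> \<alpha> g"
  unfolding besov_norm_def by (intro infsum_nonneg besov_term_nonneg)

lemma Cb_piece: "Cb (elog (dyadic_piece \<eta> n))" by (intro test_Cb elog_piece_test H)

lemma mihlin1_iff: "Cb (elog f) \<Longrightarrow> f \<in> mihlin1 \<phi> \<eta> \<alpha> \<longleftrightarrow> mihlin1_term \<phi> \<eta> \<alpha> f summable_on UNIV"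
  by (simp add: mihlin1_def mihlin_elog elog_mult Cb_besov Cb_mult Cb_piece)

lemma term_nonneg: "Cb (elog f) \<Longrightarrow> 0 \<le> mihlin1_term \<phi> \<eta> \<alpha> f n"
  unfolding term_eq by (intro besov_norm_nonneg Cb_mult Cb_piece)

lemma mihlin1_dominated:
  assumes "Cb (elog f)" "\<And>n. mihlin1_term \<phi> \<eta> \<alpha> f n \<le> t n" "t summable_on UNIV"
  shows "f \<in> mihlin1 \<phi> \<eta> \<alpha>" "mihlin1_norm \<phi> \<eta> \<alpha> f \<le> infsum t UNIV"
proof -
  have s: "mihlin1_term \<phi> \<eta> \<alpha> f summable_on UNIV"
    by (rule summable_on_comparison_test[OF assms(3)]) (use assms term_nonneg in auto)
  then show "f \<in> mihlin1 \<phi> \<eta> \<alpha>" by (simp add: mihlin1_iff[OF assms(1)])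
  show "mihlin1_norm \<phi> \<eta> \<alpha> f \<le> infsum t UNIV" unfolding mihlin1_norm_def
    using assms s by (intro infsum_mono) auto
qed

lemma mihlin1_norm_nonneg: "Cb (elog f) \<Longrightarrow> 0 \<le> mihlin1_norm \<phi> \<eta> \<alpha> f"
  unfolding mihlin1_norm_def by (intro infsum_nonneg term_nonneg)

lemma mihlin1_lincomb:
  assumes "Cb (elog f)" "Cb (elog g)" "f \<in> mihlin1 \<phi> \<eta> \<alpha>" "g \<in> mihlin1 \<phi> \<eta> \<alpha>"
  shows "(\<lambda>t. f t + c * g t) \<in> mihlin1 \<phi> \<eta> \<alpha>"
    "mihlin1_norm \<phi> \<eta> \<alpha> (\<lambda>t. f t + c * g t) \<le> mihlin1_norm \<phi> \<eta> \<alpha> f + cmod c * mihlin1_norm \<phi> \<eta> \<alpha> g"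
proof -
  have C: "Cb (elog (\<lambda>t. f t + c * g t))" unfolding elog_add elog_cmult by (intro Cb_add Cb_cmult assms)
  have s: "mihlin1_term \<phi> \<eta> \<alpha> f summable_on UNIV" "mihlin1_term \<phi> \<eta> \<alpha> g summable_on UNIV"
    using assms by (auto simp: mihlin1_iff)
  have "mihlin1_term \<phi> \<eta> \<alpha> (\<lambda>t. f t + c * g t) n \<le> mihlin1_term \<phi> \<eta> \<alpha> f n + cmod c * mihlin1_term \<phi> \<eta> \<alpha> g n" for n
  proof -
    have "(\<lambda>x. elog (\<lambda>t. f t + c * g t) x * elog (dyadic_piece \<eta> n) x) =
      (\<lambda>x. elog f x * elog (dyadic_piece \<eta> n) x + c * (elog g x * elog (dyadic_piece \<eta> n) x))"
      by (simp add: elog_add elog_cmult ring_distribs mult.assoc)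
    then show ?thesis unfolding term_eq
      using besov_lincomb(2)[of "\<lambda>x. elog f x * elog (dyadic_piece \<eta> n) x" "\<lambda>x. elog g x * elog (dyadic_piece \<eta> n) x" \<alpha> c]
      by (simp add: Cb_mult assms Cb_piece Cb_besov)
  qed
  note * = mihlin1_dominated[OF C this summable_on_add[OF s(1) summable_on_cmult_right[OF s(2)]]]
  show "(\<lambda>t. f t + c * g t) \<in> mihlin1 \<phi> \<eta> \<alpha>" by (rule *(1))
  show "mihlin1_norm \<phi> \<eta> \<alpha> (\<lambda>t. f t + c * g t) \<le> mihlin1_norm \<phi> \<eta> \<alpha> f + cmod c * mihlin1_norm \<phi> \<eta> \<alpha> g"
    using *(2) infsum_add[OF s(1) summable_on_cmult_right[OF s(2)], of "cmod c"] infsum_cmult_right[OF s(2), of "cmod c"]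
    by (simp add: mihlin1_norm_def)
qed

text \<open>On the support of the \<open>n\<close>-th piece the product rule bounds \<open>N\<close>
  derivatives by a multiple of \<open>b n\<close>, and the Besov norm of a smooth function
  is bounded by \<open>N\<close> derivatives.\<close>

lemma mihlin1_local_bounds:
  obtains K where "K \<ge> 0" "\<And>f b. Cb (elog f) \<Longrightarrow>
     (\<And>n j x. j \<le> N \<Longrightarrow> \<bar>x - real_of_int n * ln 2\<bar> \<le> ln 2 \<Longrightarrow> cmod (nd j (elog f) x) \<le> b n) \<Longrightarrow> b summable_on UNIV \<Longrightarrow>
     f \<in> mihlin1 \<phi> \<eta> \<alpha> \<and> mihlin1_norm \<phi> \<eta> \<alpha> f \<le> K * infsum b UNIV"
proof -
  obtain K where K: "K \<ge> 0" "\<And>g M. Cb g \<Longrightarrow> (\<And>j x. j \<le> N \<Longrightarrow> cmod (nd j g x) \<le> M) \<Longrightarrow>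
      g \<in> besov \<phi> \<alpha> \<and> besov_norm \<phi> \<alpha> g \<le> K * M" using smooth_besov[OF alpha(2)] by blast
  obtain M where M: "M \<ge> 0" "\<And>j n x. j \<le> N \<Longrightarrow> cmod (nd j (elog (dyadic_piece \<eta> n)) x) \<le> M"
    using elog_piece_bounds[OF H] by metis
  have "f \<in> mihlin1 \<phi> \<eta> \<alpha> \<and> mihlin1_norm \<phi> \<eta> \<alpha> f \<le> (K * 2 ^ N * M) * infsum b UNIV"
    if f: "Cb (elog f)" and b: "\<And>n j x. j \<le> N \<Longrightarrow> \<bar>x - real_of_int n * ln 2\<bar> \<le> ln 2 \<Longrightarrow> cmod (nd j (elog f) x) \<le> b n"
      and s: "b summable_on UNIV" for f b
  proof -
    have b0: "0 \<le> b n" for n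
    proof -
      have "cmod (nd 0 (elog f) (real_of_int n * ln 2)) \<le> b n" by (rule b) auto
      then show ?thesis using norm_ge_zero order_trans by blast
    qed
    have "mihlin1_term \<phi> \<eta> \<alpha> f n \<le> (K * 2 ^ N * M) * b n" for n
    proof -
      have "cmod (nd j (\<lambda>x. elog f x * elog (dyadic_piece \<eta> n) x) x) \<le> 2 ^ N * (b n * M)" if j: "j \<le> N" for j x
      proof (cases "ln 2 < \<bar>x - real_of_int n * ln 2\<bar>")
        case True then show ?thesis using nd_piece_zero[OF H True] M(1) b0 by simp
      next
        case False
        then have "cmod (nd j (\<lambda>x. elog f x * elog (dyadic_piece \<eta> n) x) x) \<le> 2 ^ j * (b n * M)"
          using b M j by (intro nd_mult_bound Cb_smooth f Cb_piece) auto
        also have "\<dots> \<le> 2 ^ N * (b n * M)" using b0 M(1) j by (intro mult_right_mono power_increasing) auto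
        finally show ?thesis .
      qed
      from K(2)[OF Cb_mult[OF f Cb_piece] this] show ?thesis unfolding term_eq by (simp add: mult_ac)
    qed
    note * = mihlin1_dominated[OF f this summable_on_cmult_right[OF s]]
    have eq: "infsum (\<lambda>n. (K * 2 ^ N * M) * b n) UNIV = (K * 2 ^ N * M) * infsum b UNIV" by (rule infsum_cmult_right[OF s])
    show ?thesis using *(1) *(2)[unfolded eq] by blast
  qed
  note main = this
  show ?thesis
  proof (rule that[of "K * 2 ^ N * M"])
    show "0 \<le> K * 2 ^ N * M" using K(1) M(1) by simp
  qed (fact main)
qed

text \<open>A function supported on one dyadic interval meets only five pieces of the partition, and on
  each of these \<open>u\<close> times the piece is a Besov multiplier with a bound that
  does not depend on \<open>m\<close>.\<close>

lemma mihlin1_multiplier: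
  obtains K where "K \<ge> 0" "\<And>f u m M. Cb (elog f) \<Longrightarrow> Cb (elog u) \<Longrightarrow>
     (\<And>j x. j \<le> N \<Longrightarrow> cmod (nd j (elog u) x) \<le> M) \<Longrightarrow> (\<And>x. ln 2 < \<bar>x - real_of_int m * ln 2\<bar> \<Longrightarrow> elog u x = 0) \<Longrightarrow>
     (\<lambda>t. f t * u t) \<in> mihlin1 \<phi> \<eta> \<alpha> \<and> mihlin1_norm \<phi> \<eta> \<alpha> (\<lambda>t. f t * u t) \<le> K * M * mihlin_norm \<phi> \<alpha> f"
proof -
  obtain K where K: "K \<ge> 0" "\<And>f ch M. Cb f \<Longrightarrow> Cb ch \<Longrightarrow> f \<in> besov \<phi> \<alpha> \<Longrightarrow> (\<And>j x. j \<le> N \<Longrightarrow> cmod (nd j ch x) \<le> M) \<Longrightarrow>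
      (\<lambda>x. f x * ch x) \<in> besov \<phi> \<alpha> \<and> besov_norm \<phi> \<alpha> (\<lambda>x. f x * ch x) \<le> K * M * besov_norm \<phi> \<alpha> f"
    using besov_multiplier[OF alpha] by blast
  obtain L where L: "L \<ge> 0" "\<And>j n x. j \<le> N \<Longrightarrow> cmod (nd j (elog (dyadic_piece \<eta> n)) x) \<le> L"
    using elog_piece_bounds[OF H] by metis
  have "(\<lambda>t. f t * u t) \<in> mihlin1 \<phi> \<eta> \<alpha> \<and> mihlin1_norm \<phi> \<eta> \<alpha> (\<lambda>t. f t * u t) \<le> (5 * K * 2 ^ N * L) * M * mihlin_norm \<phi> \<alpha> f"
    if f: "Cb (elog f)" and u: "Cb (elog u)" and M: "\<And>j x. j \<le> N \<Longrightarrow> cmod (nd j (elog u) x) \<le> M"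
      and z: "\<And>x. ln 2 < \<bar>x - real_of_int m * ln 2\<bar> \<Longrightarrow> elog u x = 0" for f u m M
  proof -
    \<comment> \<open>a bound for the derivatives of \<open>u\<close> times the \<open>n\<close>-th piece,
      which is zero except for five values of \<open>n\<close>\<close>
    define c where "c n = (if n \<in> {m - 2..m + 2} then 2 ^ N * (M * L) else 0)" for n
    have M0: "0 \<le> M" using M[of 0] norm_ge_zero order_trans by blast
    have t: "mihlin1_term \<phi> \<eta> \<alpha> (\<lambda>t. f t * u t) n \<le> K * c n * mihlin_norm \<phi> \<alpha> f" for n
    proof -
      let ?v = "\<lambda>x. elog u x * elog (dyadic_piece \<eta> n) x"
      have "cmod (nd j ?v x) \<le> c n" if "j \<le> N" for j x
      proof (cases "n \<in> {m - 2..m + 2}")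
        case True
        have "cmod (nd j ?v x) \<le> 2 ^ j * (M * L)"
          using M L that by (intro nd_mult_bound Cb_smooth u Cb_piece) auto
        also have "\<dots> \<le> 2 ^ N * (M * L)" using M0 L(1) that by (intro mult_right_mono power_increasing) auto
        finally show ?thesis using True by (simp add: c_def)
      next
        case False
        have "?v x = 0" for x
        proof (rule ccontr)
          assume "?v x \<noteq> 0"
          then have "\<bar>x - real_of_int m * ln 2\<bar> \<le> ln 2" "\<bar>x - real_of_int n * ln 2\<bar> \<le> ln 2"
            using z[of x] elog_piece_zero[OF H, of x n] by (auto simp: not_less[symmetric])
          then have "\<bar>real_of_int n * ln 2 - real_of_int m * ln 2\<bar> \<le> 2 * ln 2" by linarith
          then have "\<bar>real_of_int (n - m)\<bar> * ln 2 \<le> 2 * ln 2" by (simp add: left_diff_distrib[symmetric] abs_mult)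
          then have "\<bar>real_of_int (n - m)\<bar> \<le> 2" by (rule mult_right_le_imp_le) simp
          then have "\<bar>n - m\<bar> \<le> 2" by linarith
          then show False using False by auto
        qed
        then have "?v = (\<lambda>_. 0)" by auto
        then show ?thesis using nd_zero[of j] M0 L(1) by (simp add: c_def)
      qed
      from K(2)[OF f Cb_mult[OF u Cb_piece] Cb_besov[OF f] this] show ?thesis
        unfolding term_eq mihlin_norm_elog elog_mult by (simp add: mult.assoc)
    qed
    have C: "Cb (elog (\<lambda>t. f t * u t))" unfolding elog_mult by (intro Cb_mult f u)
    have hs: "((\<lambda>n. K * c n * mihlin_norm \<phi> \<alpha> f) has_sum (\<Sum>n\<in>{m - 2..m + 2}. K * c n * mihlin_norm \<phi> \<alpha> f)) UNIV"
      by (rule has_sum_finite_neutralI[of "{m - 2..m + 2}"]) (auto simp: c_def)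
    have "(\<Sum>n\<in>{m - 2..m + 2}. K * c n * mihlin_norm \<phi> \<alpha> f) = (5 * K * 2 ^ N * L) * M * mihlin_norm \<phi> \<alpha> f"
    proof -
      have "(\<Sum>n\<in>{m - 2..m + 2}. K * c n * mihlin_norm \<phi> \<alpha> f) =
          (\<Sum>n\<in>{m - 2..m + 2}. K * (2 ^ N * (M * L)) * mihlin_norm \<phi> \<alpha> f)"
        by (intro sum.cong refl) (simp add: c_def)
      also have "\<dots> = real (card {m - 2..m + 2}) * (K * (2 ^ N * (M * L)) * mihlin_norm \<phi> \<alpha> f)"
        by (rule sum_constant)
      also have "card {m - 2..m + 2} = 5" by simp
      finally show ?thesis by (simp only: mult_ac of_nat_numeral)
    qed
    with hs mihlin1_dominated[OF C t has_sum_imp_summable[OF hs]] show ?thesis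
      using infsumI[OF hs] by simp
  qed
  note main = this
  show ?thesis
  proof (rule that[of "5 * K * 2 ^ N * L"])
    show "0 \<le> 5 * K * 2 ^ N * L" using K(1) L(1) by simp
  qed (fact main)
qed

text \<open>By the Cauchy estimates the logarithmic decay of \<open>g\<close> on a sector passes to its
  derivatives on the half line, and it is summable over the dyadic intervals.\<close>

lemma Hinf0_mihlin1:
  assumes g: "g \<in> Hinf0 w" and w: "0 < w" "w < pi"
  shows "Cb (elog (on_reals g))" "on_reals g \<in> mihlin1 \<phi> \<eta> \<alpha>"
proof -
  have gH: "g \<in> Hinf w" using g by (simp add: Hinf0_def)
  show C: "Cb (elog (on_reals g))" using Hinf_Cb[OF gH] w by simp
  obtain c e where ce: "c > 0" "e > 0" "\<And>z. z \<in> sector w \<Longrightarrow> cmod (g z) \<le> c * (1 + cmod (Ln z)) powr (- 1 - e)"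
    using g unfolding Hinf0_def by blast
  have h: "(\<lambda>z. g (exp z)) holomorphic_on strip w" using gH w by (intro Hinf_holo_strip) (auto simp: Hinf_def)
  define r where "r = w / 2"
  have r: "0 < r" "r < w" "r < 2" using w pi_less_4 by (auto simp: r_def)
  have el: "elog (on_reals g) = (\<lambda>x. g (exp (complex_of_real x)))" by (auto simp: elog_def exp_of_real)
  obtain K where K: "K \<ge> 0" "\<And>f b. Cb (elog f) \<Longrightarrow>
     (\<And>n j x. j \<le> N \<Longrightarrow> \<bar>x - real_of_int n * ln 2\<bar> \<le> ln 2 \<Longrightarrow> cmod (nd j (elog f) x) \<le> b n) \<Longrightarrow> b summable_on UNIV \<Longrightarrow>
     f \<in> mihlin1 \<phi> \<eta> \<alpha> \<and> mihlin1_norm \<phi> \<eta> \<alpha> f \<le> K * infsum b UNIV" using mihlin1_local_bounds by blast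
  define Q where "Q = Max ((\<lambda>j. fact j / r ^ j) ` {..N})"
  define b where "b n = Q * (c * ((1 + \<bar>real_of_int n\<bar>) / 10) powr (- 1 - e))" for n :: int
  have "cmod (nd j (elog (on_reals g)) x) \<le> b n" if j: "j \<le> N" and x: "\<bar>x - real_of_int n * ln 2\<bar> \<le> ln 2" for j x n
  proof -
    let ?B = "c * ((1 + \<bar>real_of_int n\<bar>) / 10) powr (- 1 - e)"
    have "cmod (nd j (elog (on_reals g)) x) \<le> fact j * ?B / r ^ j" unfolding el
    proof (rule strip_deriv_bound[OF h r(1,2)])
      fix z assume z: "z \<in> cball (complex_of_real x) r"
      have 1: "cmod (complex_of_real x - z) \<le> r" using z by (simp add: dist_norm)
      have "\<bar>Im (complex_of_real x - z)\<bar> \<le> r" using 1 abs_Im_le_cmod order_trans by blast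
      then have zs: "z \<in> strip w" using r by (simp add: strip_def)
      have "\<bar>x\<bar> - r \<le> cmod z" using 1 norm_triangle_ineq2[of "complex_of_real x" z] by simp
      moreover have "\<bar>real_of_int n * ln 2\<bar> - ln 2 \<le> \<bar>x\<bar>" using x by linarith
      moreover have "\<bar>real_of_int n * ln 2\<bar> = \<bar>real_of_int n\<bar> * ln 2" by (simp add: abs_mult)
      moreover have "\<bar>real_of_int n\<bar> * (1/2) \<le> \<bar>real_of_int n\<bar> * ln 2"
        using ln2_ge_two_thirds by (intro mult_left_mono) auto
      ultimately have "\<bar>real_of_int n\<bar> / 2 - 4 \<le> cmod z" using r(3) ln2_le_25_over_36 by linarith
      moreover have "(1 + a) / 10 \<le> 1 + c" if "a / 2 - 4 \<le> c" "0 \<le> c" for a c :: real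
      proof -
        have "a \<le> 8 + 2 * c" using that(1) by (simp add: field_simps)
        then have "1 + a \<le> 10 * (1 + c)" using that(2) by simp
        then show ?thesis by simp
      qed
      ultimately have lower: "(1 + \<bar>real_of_int n\<bar>) / 10 \<le> 1 + cmod z"
        using norm_ge_zero[of z] by blast
      have "cmod (g (exp z)) \<le> c * (1 + cmod z) powr (- 1 - e)"
        using ce(3)[OF exp_strip(1)[OF zs]] exp_strip(2)[OF zs] w by simp
      also have "\<dots> \<le> ?B"
        using lower ce by (intro mult_left_mono powr_mono2') auto
      finally show "cmod (g (exp z)) \<le> ?B" .
    qed
    also have "\<dots> = (fact j / r ^ j) * ?B" by simp
    also have "\<dots> \<le> Q * ?B" unfolding Q_def using j ce by (intro mult_right_mono Max_ge) auto
    finally show ?thesis by (simp add: b_def)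
  qed
  moreover have "b summable_on UNIV"
  proof -
    have "summable (\<lambda>n. real (Suc n) powr (- 1 - e))"
      using summable_real_powr_iff[of "- 1 - e"] ce(2) summable_Suc_iff[of "\<lambda>n. real n powr (- 1 - e)"] by simp
    then have "(\<lambda>n. real (Suc n) powr (- 1 - e)) summable_on UNIV"
      by (intro norm_summable_imp_summable_on) simp
    from summable_on_cmult_right[OF summable_on_int_abs[OF this], of "Q * c * (1/10) powr (- 1 - e)"]
    have "(\<lambda>n::int. Q * c * (1/10) powr (- 1 - e) * real (Suc (nat \<bar>n\<bar>)) powr (- 1 - e)) summable_on UNIV" .
    moreover have "Q * c * (1/10) powr (- 1 - e) * real (Suc (nat \<bar>n\<bar>)) powr (- 1 - e) = b n" for n
      using powr_mult[of "1/10" "1 + \<bar>real_of_int n\<bar>" "- 1 - e"] by (simp add: b_def)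
    ultimately show ?thesis by simp
  qed
  ultimately show "on_reals g \<in> mihlin1 \<phi> \<eta> \<alpha>" using K(2)[OF C] by blast
qed

end

section \<open>Complex scalars and improper integrals of operators\<close>

lemma scaleC_one: "1 *\<^sub>C x = (x::'a::complex_banach)"
  using scaleC_of_real[of 1 x] by simp

lemma bounded_bilinear_op_scaleC: "bounded_bilinear (op_scaleC :: complex \<Rightarrow> ('a \<Rightarrow>\<^sub>L 'a) \<Rightarrow> ('a::complex_banach \<Rightarrow>\<^sub>L 'a))"
proof
  fix a b :: complex and T S :: "'a \<Rightarrow>\<^sub>L 'a" and r :: real
  show "op_scaleC (a + b) T = op_scaleC a T + op_scaleC b T"
    by (rule blinfun_eqI) (simp add: op_scaleC_apply scaleC_add_left blinfun.add_left)
  show "op_scaleC a (T + S) = op_scaleC a T + op_scaleC a S"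
    by (rule blinfun_eqI) (simp add: op_scaleC_apply scaleC_add_right blinfun.add_left)
  show "op_scaleC (r *\<^sub>R a) T = r *\<^sub>R op_scaleC a T"
    by (rule blinfun_eqI) (simp add: op_scaleC_apply scaleR_conv_of_real scaleC_of_real scaleC_scaleC[symmetric] blinfun.scaleR_left)
  show "op_scaleC a (r *\<^sub>R T) = r *\<^sub>R op_scaleC a T"
    by (rule blinfun_eqI) (simp add: op_scaleC_apply blinfun.scaleR_left linear_scale[OF bounded_linear.linear[OF bounded_linear_scaleC]])
  show "\<exists>K. \<forall>a (T :: 'a \<Rightarrow>\<^sub>L 'a). norm (op_scaleC a T) \<le> norm a * norm T * K"
  proof (intro exI[of _ 1] allI)
    fix a :: complex and T :: "'a \<Rightarrow>\<^sub>L 'a"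
    show "norm (op_scaleC a T) \<le> norm a * norm T * 1"
      by (rule norm_blinfun_bound)
        (auto simp: op_scaleC_apply norm_scaleC mult.assoc intro!: mult_left_mono norm_blinfun)
  qed
qed

interpretation osc: bounded_bilinear "op_scaleC :: complex \<Rightarrow> ('a \<Rightarrow>\<^sub>L 'a) \<Rightarrow> ('a::complex_banach \<Rightarrow>\<^sub>L 'a)"
  by (rule bounded_bilinear_op_scaleC)

lemma norm_op_scaleC: "norm (op_scaleC c T) \<le> cmod c * norm T"
  by (rule norm_blinfun_bound)
    (auto simp: op_scaleC_apply norm_scaleC mult.assoc intro!: mult_left_mono norm_blinfun)

lemma op_scaleC_assoc: "op_scaleC c (op_scaleC d T) = op_scaleC (c * d) T"
  by (rule blinfun_eqI) (simp add: op_scaleC_apply scaleC_scaleC)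

lemma op_scaleC_one: "op_scaleC 1 T = T"
  by (rule blinfun_eqI) (simp add: op_scaleC_apply scaleC_one)

lemma op_scaleC_of_real: "op_scaleC (of_real r) T = r *\<^sub>R T"
  by (rule blinfun_eqI) (simp add: op_scaleC_apply scaleC_of_real blinfun.scaleR_left)

lemma op_scaleC_compose: "op_scaleC c T o\<^sub>L S = op_scaleC c (T o\<^sub>L S)"
  by (rule blinfun_eqI) (simp add: op_scaleC_apply)

text \<open>Bounded operators are a priori only real linear. Complex linearity of resolvents is used to
  move complex scalars past them.\<close>

definition clin :: "('a::complex_banach \<Rightarrow>\<^sub>L 'a) \<Rightarrow> bool" where
  "clin T \<longleftrightarrow> (\<forall>c x. T (c *\<^sub>C x) = c *\<^sub>C T x)"

lemma clin_compose: "clin T \<Longrightarrow> T o\<^sub>L op_scaleC c S = op_scaleC c (T o\<^sub>L S)"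
  by (rule blinfun_eqI) (simp add: op_scaleC_apply clin_def)

lemma compose_diff: "(S - T) o\<^sub>L U = (S o\<^sub>L U) - (T o\<^sub>L U)" "U o\<^sub>L (S - T) = (U o\<^sub>L S) - (U o\<^sub>L T)"
  by (auto intro!: blinfun_eqI simp: blinfun.diff_left blinfun.diff_right)

lemma has_integral_UNIV_boxes:
  fixes f :: "real \<Rightarrow> 'b::banach"
  assumes "(f has_integral i) UNIV" "0 < e"
  shows "\<exists>B>0. \<forall>a b. ball 0 B \<subseteq> cbox a b \<longrightarrow> norm (integral (cbox a b) f - i) < e"
  using assms by (simp only: has_integral_alt' UNIV_I if_True)

text \<open>Integrals over different large intervals differ by at most the corresponding difference for
  \<open>g\<close>. The argument only uses norms of integrals over intervals, so the range
  of \<open>f\<close> may be nonseparable.\<close>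

lemma integrable_dominated_UNIV:
  fixes f :: "real \<Rightarrow> 'b::banach"
  assumes c: "continuous_on UNIV f" and g: "g integrable_on UNIV" and le: "\<And>t. norm (f t) \<le> g t"
  shows "f integrable_on UNIV" "(\<lambda>N. integral {- real N..real N} f) \<longlonglongrightarrow> integral UNIV f"
proof -
  have fi: "f integrable_on {a..b}" for a b
    using continuous_on_subset[OF c] by (intro integrable_continuous_interval) auto
  have gi: "g integrable_on {a..b}" for a b
    using integrable_on_subcbox[OF g, of a b] by (simp add: cbox_interval)
  have tail: "norm (integral {a..b} f - integral {- B..B} f) \<le> integral {a..b} g - integral {- B..B} g"
    if "a \<le> - B" "B \<le> b" "0 < B" for a b B
  proof -
    have s: "integral {a..b} h = integral {a..- B} h + (integral {- B..B} h + integral {B..b} h)"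
      if h: "h integrable_on {a..b}" for h :: "real \<Rightarrow> 'c::banach"
    proof -
      have "integral {- B..B} h + integral {B..b} h = integral {- B..b} h"
        using \<open>a \<le> - B\<close> \<open>B \<le> b\<close> \<open>0 < B\<close> integrable_subinterval_real[OF h, of "- B" b]
        by (intro Henstock_Kurzweil_Integration.integral_combine[where a = "- B" and c = B and b = b and f = h]) auto
      then show ?thesis using Henstock_Kurzweil_Integration.integral_combine[OF \<open>a \<le> - B\<close> _ h] \<open>B \<le> b\<close> \<open>0 < B\<close> by simp
    qed
    have "norm (integral {a..- B} f + integral {B..b} f) \<le> integral {a..- B} g + integral {B..b} g"
      by (intro order_trans[OF norm_triangle_ineq] add_mono integral_norm_bound_integral fi gi le)
    then show ?thesis using s[OF fi] s[OF gi] by (simp add: algebra_simps)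
  qed
  have gB: "\<exists>B>0. \<forall>a b. a \<le> - B \<longrightarrow> B \<le> b \<longrightarrow> \<bar>integral {a..b} g - integral UNIV g\<bar> < e" if e: "e > 0" for e
  proof -
    have "(g has_integral integral UNIV g) UNIV" using g by (rule integrable_integral)
    then obtain B where B: "B > 0" "\<And>a b. ball 0 B \<subseteq> cbox a b \<Longrightarrow> norm (integral (cbox a b) g - integral UNIV g) < e"
      using has_integral_UNIV_boxes[OF _ e] by blast
    have "\<bar>integral {a..b} g - integral UNIV g\<bar> < e" if "a \<le> - B" "B \<le> b" for a b
    proof -
      have "ball 0 B \<subseteq> cbox a b" using that by (auto simp: dist_real_def)
      from B(2)[OF this] show ?thesis by (simp add: cbox_interval)
    qed
    then show ?thesis using B(1) by blast
  qed
  have ball: "a \<le> - B \<and> B \<le> b" if "ball 0 B \<subseteq> cbox a b" "B > 0" for a b B :: real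
  proof -
    have "closure (ball 0 B) \<subseteq> cbox a b" using that(1) by (intro closure_minimal) auto
    then have "cball 0 B \<subseteq> cbox a b" using that(2) by simp
    moreover have "- B \<in> cball 0 B" "B \<in> cball 0 B" using that(2) by auto
    ultimately have "- B \<in> cbox a b" "B \<in> cbox a b" by blast+
    then show ?thesis by (simp add: cbox_interval)
  qed
  have cmp: "\<exists>B>0. \<forall>a b. a \<le> - B \<longrightarrow> B \<le> b \<longrightarrow> norm (integral {a..b} f - integral {- B..B} f) < e" if e: "e > 0" for e
  proof -
    obtain B where B: "B > 0" "\<And>a b. a \<le> - B \<Longrightarrow> B \<le> b \<Longrightarrow> \<bar>integral {a..b} g - integral UNIV g\<bar> < e / 2"
      using gB[of "e / 2"] e by auto
    have "norm (integral {a..b} f - integral {- B..B} f) < e" if "a \<le> - B" "B \<le> b" for a b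
      using tail[OF that B(1)] B(2)[OF that] B(2)[of "- B" B] by linarith
    then show ?thesis using B(1) by blast
  qed
  show fU: "f integrable_on UNIV"
  proof (rule iffD2[OF integrable_alt], intro conjI allI impI)
    show "(\<lambda>x. if x \<in> UNIV then f x else 0) integrable_on cbox a b" for a b
      using fi by (simp add: cbox_interval)
    fix e :: real assume e: "e > 0"
    obtain B where B: "B > 0" "\<And>a b. a \<le> - B \<Longrightarrow> B \<le> b \<Longrightarrow> norm (integral {a..b} f - integral {- B..B} f) < e / 2"
      using cmp[of "e / 2"] e by auto
    show "\<exists>B>0. \<forall>a b c d. ball 0 B \<subseteq> cbox a b \<and> ball 0 B \<subseteq> cbox c d \<longrightarrow>
       norm (integral (cbox a b) (\<lambda>x. if x \<in> UNIV then f x else 0) - integral (cbox c d) (\<lambda>x. if x \<in> UNIV then f x else 0)) < e"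
    proof (intro exI conjI allI impI; (elim conjE)?)
      fix a b c d :: real assume *: "ball 0 B \<subseteq> cbox a b" "ball 0 B \<subseteq> cbox c d"
      have "norm (integral {a..b} f - integral {- B..B} f) < e / 2" "norm (integral {c..d} f - integral {- B..B} f) < e / 2"
        using B(2) ball[OF *(1) B(1)] ball[OF *(2) B(1)] by blast+
      then have "norm (integral {a..b} f - integral {c..d} f) < e" by (rule norm_triangle_half_l)
      then show "norm (integral (cbox a b) (\<lambda>x. if x \<in> UNIV then f x else 0) - integral (cbox c d) (\<lambda>x. if x \<in> UNIV then f x else 0)) < e"
        by (simp add: cbox_interval)
    qed (rule B(1))
  qed
  show "(\<lambda>N. integral {- real N..real N} f) \<longlonglongrightarrow> integral UNIV f"
  proof (rule LIMSEQ_I)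
    fix e :: real assume e: "e > 0"
    obtain B where B: "B > 0" "\<And>a b. ball 0 B \<subseteq> cbox a b \<Longrightarrow> norm (integral (cbox a b) f - integral UNIV f) < e"
      using has_integral_UNIV_boxes[OF integrable_integral[OF fU] e] by blast
    have "norm (integral {- real N..real N} f - integral UNIV f) < e" if "N \<ge> nat \<lceil>B\<rceil>" for N
    proof -
      have "ball 0 B \<subseteq> cbox (- real N) (real N)" using that by (auto simp: dist_real_def nat_le_iff ceiling_le_iff)
      from B(2)[OF this] show ?thesis by (simp add: cbox_interval)
    qed
    then show "\<exists>N0. \<forall>N\<ge>N0. norm (integral {- real N..real N} f - integral UNIV f) < e" by blast
  qed
qed

lemma integrable_poly_decay: "0 < e \<Longrightarrow> (\<lambda>t::real. (1 + \<bar>t\<bar>) powr (- 1 - e)) integrable_on UNIV"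
proof -
  assume e: "0 < e"
  define h where "h x = (1 + x) powr (- 1 - e) * indicator {0..} x" for x :: real
  have hm: "h \<in> borel_measurable borel" unfolding h_def by measurable
  have "(\<integral>\<^sup>+x. ennreal ((1 + x) powr (- 1 - e)) * indicator {0..} x \<partial>lborel) = 0 - (- ((1 + 0) powr (- e)) / e)"
  proof (rule nn_integral_FTC_atLeast)
    show "((\<lambda>x. - ((1 + x) powr (- e)) / e) has_real_derivative (1 + x) powr (- 1 - e)) (at x)" if "0 \<le> x" for x
    proof -
      have "((\<lambda>x. (1 + x) powr (- e)) has_real_derivative (- e * (1 + x) powr (- e - 1)) * 1) (at x)"
        using that by (intro DERIV_chain2[OF has_real_derivative_powr]) (auto intro!: derivative_eq_intros)
      moreover have p: "- 1 - e = - e - 1" by simp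
      ultimately show ?thesis using DERIV_cmult[of "\<lambda>x. (1 + x) powr (- e)" _ x UNIV "- 1 / e"] e unfolding p
        by (fastforce simp: algebra_simps)
    qed
    show "((\<lambda>x. - ((1 + x) powr (- e)) / e) \<longlongrightarrow> 0) at_top" using e by real_asymp
  qed (auto)
  moreover have "ennreal ((1 + x) powr (- 1 - e)) * indicator {0..} x = ennreal (norm (h x))" for x
    by (simp add: h_def split: split_indicator)
  ultimately have "(\<integral>\<^sup>+x. ennreal (norm (h x)) \<partial>lborel) < \<infinity>" by simp
  then have hi: "integrable lborel h" using hm by (intro integrableI_bounded) auto
  have "integrable lborel (\<lambda>x. h (0 + (- 1) * x))" using hi by (intro lborel_integrable_real_affine) auto
  then have "integrable lborel (\<lambda>x. h x + h (- x))" using hi by simp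
  then have "integrable lborel (\<lambda>t::real. (1 + \<bar>t\<bar>) powr (- 1 - e))"
  proof (rule Bochner_Integration.integrable_bound)
    show "AE x in lborel. norm ((1 + \<bar>x\<bar>) powr (- 1 - e)) \<le> norm (h x + h (- x))"
      by (intro always_eventually allI) (auto simp: h_def split: split_indicator)
  qed simp
  then show ?thesis by (rule integrable_on_lborel)
qed

text \<open>Complex differentiability of an operator-valued function with derivative \<open>F'\<close>,
  tested along all real directions \<open>d\<close>. Together with continuity of
  \<open>F'\<close> this suffices for Cauchy's theorem on rectangles, and it only involves
  derivatives in one real variable.\<close>

definition odiff :: "(complex \<Rightarrow> ('a::complex_banach \<Rightarrow>\<^sub>L 'a)) \<Rightarrow> (complex \<Rightarrow> ('a \<Rightarrow>\<^sub>L 'a)) \<Rightarrow> complex \<Rightarrow> bool" where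
  "odiff F F' w \<longleftrightarrow> (\<forall>d. ((\<lambda>\<tau>. F (w + of_real \<tau> * d)) has_vector_derivative op_scaleC d (F' w)) (at 0))"

lemma odiff_at:
  assumes "odiff F F' (w + of_real t * d)"
  shows "((\<lambda>\<tau>. F (w + of_real \<tau> * d)) has_vector_derivative op_scaleC d (F' (w + of_real t * d))) (at t)"
proof -
  have "((\<lambda>\<tau>. F (w + of_real t * d + of_real \<tau> * d)) has_vector_derivative op_scaleC d (F' (w + of_real t * d))) (at (t - t))"
    using assms unfolding odiff_def by simp
  from vector_diff_chain_at[of "\<lambda>x. x - t" 1 t "\<lambda>\<tau>. F (w + of_real t * d + of_real \<tau> * d)", OF _ this]
  show ?thesis by (simp add: o_def algebra_simps has_vector_derivative_diff_const)
qed

text \<open>Cauchy's theorem on a rectangle, with the vertical sides estimated. Differentiating the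
  integral over the horizontal segment with respect to its height \<open>s\<close> gives
  \<open>\<i> F'\<close>, whose integral is the difference of \<open>F\<close> at the end
  points; so the integral is Lipschitz in \<open>s\<close>.\<close>

lemma line_integral_shift:
  fixes F F' :: "complex \<Rightarrow> ('a::complex_banach \<Rightarrow>\<^sub>L 'a)"
  assumes ab: "a \<le> b" and N: "0 \<le> N"
    and d: "\<And>w. a \<le> Im w \<Longrightarrow> Im w \<le> b \<Longrightarrow> odiff F F' w"
    and c: "continuous_on {w. a \<le> Im w \<and> Im w \<le> b} F'"
    and E: "\<And>s. a \<le> s \<Longrightarrow> s \<le> b \<Longrightarrow> norm (F (Complex N s)) \<le> E \<and> norm (F (Complex (- N) s)) \<le> E"
  shows "norm (integral {- N..N} (\<lambda>t. F (Complex t b)) - integral {- N..N} (\<lambda>t. F (Complex t a))) \<le> 2 * E * (b - a)"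
proof -
  let ?I = "\<lambda>s. integral (cbox (- N) N) (\<lambda>t. F (Complex t s))"
  have dt: "((\<lambda>t. F (Complex t s)) has_vector_derivative F' (Complex t s)) (at t)" if "a \<le> s" "s \<le> b" for s t
  proof -
    have e: "Complex 0 s + of_real t * 1 = Complex t s" for t by (simp add: complex_eq_iff)
    from odiff_at[of F F' "Complex 0 s" t 1] d[of "Complex t s"] that show ?thesis
      unfolding e by (simp add: op_scaleC_one)
  qed
  have ds: "((\<lambda>s. F (Complex t s)) has_vector_derivative op_scaleC \<i> (F' (Complex t s))) (at s)" if "a \<le> s" "s \<le> b" for s t
  proof -
    have e: "Complex t 0 + of_real s * \<i> = Complex t s" for s by (simp add: complex_eq_iff)
    from odiff_at[of F F' "Complex t 0" s \<i>] d[of "Complex t s"] that show ?thesis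
      unfolding e by simp
  qed
  have cF': "continuous_on ({a..b} \<times> cbox (- N) N) (\<lambda>(s, t). op_scaleC \<i> (F' (Complex t s)))"
    unfolding case_prod_beta
    by (intro osc.continuous_on continuous_intros continuous_on_compose2[OF c])
      (auto intro!: continuous_intros simp: Complex_eq)
  have der: "(?I has_vector_derivative op_scaleC \<i> (F (Complex N s) - F (Complex (- N) s))) (at s within {a..b})"
    if s: "s \<in> {a..b}" for s
  proof -
    have "(?I has_vector_derivative integral (cbox (- N) N) (\<lambda>t. op_scaleC \<i> (F' (Complex t s)))) (at s within {a..b})"
    proof (rule leibniz_rule_vector_derivative[where U = "{a..b}" and fx = "\<lambda>s t. op_scaleC \<i> (F' (Complex t s))"])
      show "((\<lambda>s. F (Complex t s)) has_vector_derivative op_scaleC \<i> (F' (Complex t s))) (at s within {a..b})"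
        if "s \<in> {a..b}" for s t using ds that by (auto intro: has_vector_derivative_at_within)
      show "(\<lambda>t. F (Complex t s)) integrable_on cbox (- N) N" if "s \<in> {a..b}" for s
        using dt[of s] that by (intro integrable_continuous continuous_at_imp_continuous_on)
          (auto intro: has_vector_derivative_continuous)
    qed (use s cF' in auto)
    also have "integral (cbox (- N) N) (\<lambda>t. op_scaleC \<i> (F' (Complex t s))) = op_scaleC \<i> (F (Complex N s) - F (Complex (- N) s))"
    proof -
      have "((\<lambda>t. F' (Complex t s)) has_integral (F (Complex N s) - F (Complex (- N) s))) {- N..N}"
        using N s dt by (intro fundamental_theorem_of_calculus) (auto intro: has_vector_derivative_at_within)
      from has_integral_linear[OF this osc.bounded_linear_right[of \<i>]] show ?thesis
        by (simp add: o_def integral_unique)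
    qed
    finally show ?thesis .
  qed
  have "norm (?I b - ?I a) \<le> 2 * E * norm (b - a)"
  proof (rule differentiable_bound[of "{a..b}" ?I "\<lambda>s h. h *\<^sub>R op_scaleC \<i> (F (Complex N s) - F (Complex (- N) s))"])
    fix s assume s: "s \<in> {a..b}"
    show "(?I has_derivative (\<lambda>h. h *\<^sub>R op_scaleC \<i> (F (Complex N s) - F (Complex (- N) s)))) (at s within {a..b})"
      using der[OF s] by (simp add: has_vector_derivative_def)
    have "norm (op_scaleC \<i> (F (Complex N s) - F (Complex (- N) s))) \<le> norm (F (Complex N s) - F (Complex (- N) s))"
      using norm_op_scaleC[of \<i>] by simp
    also have "\<dots> \<le> 2 * E" using E[of s] s norm_triangle_ineq4[of "F (Complex N s)" "F (Complex (- N) s)"] by auto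
    finally have *: "norm (op_scaleC \<i> (F (Complex N s) - F (Complex (- N) s))) \<le> 2 * E" .
    have "norm (F (Complex N s)) \<le> E" using E[of s] s by auto
    then have "2 * E \<ge> 0" using norm_ge_zero[of "F (Complex N s)"] by linarith
    then show "onorm (\<lambda>h. h *\<^sub>R op_scaleC \<i> (F (Complex N s) - F (Complex (- N) s))) \<le> 2 * E"
      using * by (intro onorm_bound) (simp_all add: mult.commute[of "2 * E"] mult_left_mono)
  qed (use ab in auto)
  then show ?thesis using ab by (simp add: cbox_interval)
qed

section \<open>Resolvents of sectorial operators\<close>

lemma is_resolvent_unique: "is_resolvent A z T \<Longrightarrow> is_resolvent A z S \<Longrightarrow> T = S"
  unfolding is_resolvent_def by (intro blinfun_eqI) metis

lemma is_resolvent_clin: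
  assumes A: "complex_linear_operator A" and T: "is_resolvent A z T" shows "clin T"
  unfolding clin_def
proof (intro allI)
  fix c x
  have "(T x, z *\<^sub>C T x - x) \<in> A" using T unfolding is_resolvent_def by blast
  then have "(c *\<^sub>C T x, c *\<^sub>C (z *\<^sub>C T x - x)) \<in> A" using A unfolding complex_linear_operator_def by blast
  also have "c *\<^sub>C (z *\<^sub>C T x - x) = z *\<^sub>C (c *\<^sub>C T x) - c *\<^sub>C x"
    using linear_diff[OF bounded_linear.linear[OF bounded_linear_scaleC[of c]], of "z *\<^sub>C T x" x] by (simp add: scaleC_scaleC mult.commute)
  finally show "T (c *\<^sub>C x) = c *\<^sub>C T x" using T unfolding is_resolvent_def by metis
qed

lemma resolvent_identity:
  assumes A: "complex_linear_operator A" and T: "is_resolvent A z T" and S: "is_resolvent A w S"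
  shows "T - S = op_scaleC (w - z) (T o\<^sub>L S)"
proof (rule blinfun_eqI)
  fix x
  have "(S x, w *\<^sub>C S x - x) \<in> A" using S unfolding is_resolvent_def by blast
  also have "w *\<^sub>C S x - x = z *\<^sub>C S x - (x - (w - z) *\<^sub>C S x)"
    using scaleC_add_left[of "w - z" z "S x"] by simp
  finally have "S x = T (x - (w - z) *\<^sub>C S x)" using T unfolding is_resolvent_def by metis
  moreover define Q where "Q = (w - z) *\<^sub>C T (S x)"
  ultimately have "S x = T x - Q"
    using is_resolvent_clin[OF A T] by (simp add: blinfun.diff_right clin_def)
  then have "T x - S x = Q" by simp
  then show "(T - S) x = op_scaleC (w - z) (T o\<^sub>L S) x"
    by (simp add: blinfun.diff_left op_scaleC_apply Q_def)
qed

text \<open>The part of the fundamental strip of \<open>exp\<close> that is mapped into the resolvent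
  set of a 0-sectorial operator.\<close>

definition offaxis :: "complex set" where "offaxis = {w. 0 < \<bar>Im w\<bar> \<and> \<bar>Im w\<bar> < pi}"

text \<open>Outside the negative half line the argument is continuous, so the condition \<open>\<theta>
  < \<bar>Im w\<bar>\<close> describes an open set that misses the sector.\<close>

lemma exp_notin_closure_sector:
  assumes "0 < \<theta>" "\<theta> < \<bar>Im w\<bar>" "\<bar>Im w\<bar> < pi" shows "exp w \<notin> closure (sector \<theta>)"
proof -
  have L: "Ln (exp w) = w" using assms by (intro Ln_exp) (auto simp: abs_less_iff)
  let ?U = "{z \<in> - \<real>\<^sub>\<le>\<^sub>0. \<theta> < \<bar>Im (Ln z)\<bar>}"
  have "open ?U"
  proof -
    have "continuous_on (- \<real>\<^sub>\<le>\<^sub>0) (\<lambda>z. \<bar>Im (Ln z)\<bar>)" by (auto intro!: continuous_intros)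
    then have "open ((- \<real>\<^sub>\<le>\<^sub>0) \<inter> (\<lambda>z. \<bar>Im (Ln z)\<bar>) -` {\<theta><..})"
      by (intro continuous_open_preimage) auto
    moreover have "(- \<real>\<^sub>\<le>\<^sub>0) \<inter> (\<lambda>z. \<bar>Im (Ln z)\<bar>) -` {\<theta><..} = ?U" by auto
    ultimately show ?thesis by simp
  qed
  moreover have "exp w \<in> ?U"
  proof -
    have "exp w \<notin> \<real>\<^sub>\<le>\<^sub>0"
    proof
      assume "exp w \<in> \<real>\<^sub>\<le>\<^sub>0"
      then have "Im (exp w) = 0" by (auto elim: nonpos_Reals_cases)
      then have "sin (Im w) = 0" by (simp add: Im_exp)
      moreover have "sin \<bar>Im w\<bar> > 0" using assms by (intro sin_gt_zero) auto
      ultimately show False by (auto simp: abs_if split: if_splits)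
    qed
    then show ?thesis using L assms by simp
  qed
  moreover have "?U \<inter> sector \<theta> = {}"
  proof -
    have "\<bar>Im (Ln z)\<bar> < \<theta>" if "z \<in> sector \<theta>" for z
      using that by (simp add: sector_def Arg_def split: if_splits)
    then show ?thesis by force
  qed
  ultimately show ?thesis using open_Int_closure_eq_empty[of ?U "sector \<theta>"] by blast
qed

locale zero_sectorial_calculus =
  fixes A :: "('a::complex_banach \<times> 'a) set"
  assumes Z: "zero_sectorial A"
begin

lemma lin: "complex_linear_operator A"
  using Z[unfolded zero_sectorial_def, THEN spec[of _ 1]] by (simp add: sectorial_def)

text \<open>The resolvent in the logarithmic variable.\<close>

definition rs :: "complex \<Rightarrow> ('a \<Rightarrow>\<^sub>L 'a)" where "rs w = resolvent A (exp w)"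

lemma rs_resolvent: assumes "w \<in> offaxis" shows "is_resolvent A (exp w) (rs w)"
proof -
  define \<theta> where "\<theta> = \<bar>Im w\<bar> / 2"
  have t: "0 < \<theta>" "\<theta> < \<bar>Im w\<bar>" "\<bar>Im w\<bar> < pi" using assms by (auto simp: \<theta>_def offaxis_def)
  have "sectorial \<theta> A" using Z t unfolding zero_sectorial_def by blast
  then have "exp w \<notin> spectrum A" using exp_notin_closure_sector[OF t] unfolding sectorial_def by blast
  then obtain T where T: "is_resolvent A (exp w) T" unfolding spectrum_def by blast
  then have "resolvent A (exp w) = T" unfolding resolvent_def
    by (intro the_equality) (auto intro: is_resolvent_unique)
  then show ?thesis using T by (simp add: rs_def)
qed

lemma rs_clin: "w \<in> offaxis \<Longrightarrow> clin (rs w)"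
  using is_resolvent_clin[OF lin rs_resolvent] .

lemma rs_identity: "w \<in> offaxis \<Longrightarrow> v \<in> offaxis \<Longrightarrow> rs w - rs v = op_scaleC (exp v - exp w) (rs w o\<^sub>L rs v)"
  using resolvent_identity[OF lin rs_resolvent rs_resolvent] .

lemma rs_bound:
  assumes "0 < \<theta>"
  obtains C where "C \<ge> 0" "\<And>w. \<theta> < \<bar>Im w\<bar> \<Longrightarrow> \<bar>Im w\<bar> < pi \<Longrightarrow> norm (rs w) \<le> C / exp (Re w)"
proof -
  have "sectorial (\<theta> / 2) A" using Z assms unfolding zero_sectorial_def by simp
  then have "\<forall>t>\<theta>/2. \<exists>C. \<forall>z\<in>- closure (sector t). norm (op_scaleC z (resolvent A z)) \<le> C"
    unfolding sectorial_def by blast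
  then obtain C where C: "\<And>z. z \<notin> closure (sector \<theta>) \<Longrightarrow> norm (op_scaleC z (resolvent A z)) \<le> C"
    using assms by force
  have "norm (rs w) \<le> \<bar>C\<bar> / exp (Re w)" if "\<theta> < \<bar>Im w\<bar>" "\<bar>Im w\<bar> < pi" for w
  proof -
    have "rs w = op_scaleC (inverse (exp w)) (op_scaleC (exp w) (resolvent A (exp w)))"
      by (simp add: op_scaleC_assoc op_scaleC_one rs_def)
    then have "norm (rs w) \<le> cmod (inverse (exp w)) * norm (op_scaleC (exp w) (resolvent A (exp w)))"
      using norm_op_scaleC by metis
    also have "\<dots> \<le> cmod (inverse (exp w)) * \<bar>C\<bar>"
      using C[OF exp_notin_closure_sector[OF assms that]] by (intro mult_left_mono) auto
    finally show ?thesis by (simp add: norm_inverse divide_inverse mult.commute)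
  qed
  then show ?thesis using that by (meson abs_ge_zero)
qed

lemma open_offaxis: "open offaxis"
proof -
  have "offaxis = {w. 0 < \<bar>Im w\<bar>} \<inter> {w. \<bar>Im w\<bar> < pi}" unfolding offaxis_def by blast
  moreover have "open ({w. 0 < \<bar>Im w\<bar>} \<inter> {w. \<bar>Im w\<bar> < pi})"
    by (intro open_Int open_Collect_less continuous_intros)
  ultimately show ?thesis by (simp only:)
qed

lemma rs_isCont: assumes w: "w \<in> offaxis" shows "isCont rs w"
proof -
  define \<theta> where "\<theta> = \<bar>Im w\<bar> / 2"
  have t: "0 < \<theta>" using w by (auto simp: \<theta>_def offaxis_def)
  obtain C where C: "C \<ge> 0" "\<And>w. \<theta> < \<bar>Im w\<bar> \<Longrightarrow> \<bar>Im w\<bar> < pi \<Longrightarrow> norm (rs w) \<le> C / exp (Re w)"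
    using rs_bound[OF t] by blast
  have ev: "\<forall>\<^sub>F v in at w. v \<in> offaxis \<and> \<theta> < \<bar>Im v\<bar>"
  proof -
    have "open (offaxis \<inter> {v. \<theta> < \<bar>Im v\<bar>})" by (intro open_Int open_offaxis open_Collect_less continuous_intros)
    moreover have "w \<in> offaxis \<inter> {v. \<theta> < \<bar>Im v\<bar>}" using w t by (auto simp: \<theta>_def)
    ultimately show ?thesis by (auto simp: eventually_at_topological)
  qed
  have "((\<lambda>v. rs v - rs w) \<longlongrightarrow> 0) (at w)"
  proof (rule Lim_null_comparison)
    show "\<forall>\<^sub>F v in at w. norm (rs v - rs w) \<le> cmod (exp w - exp v) * (C / exp (Re v) * norm (rs w))"
      using ev
    proof eventually_elim
      fix v assume v: "v \<in> offaxis \<and> \<theta> < \<bar>Im v\<bar>"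
      have "norm (rs v - rs w) \<le> cmod (exp w - exp v) * norm (rs v o\<^sub>L rs w)"
        using v w by (simp add: rs_identity norm_op_scaleC)
      also have "\<dots> \<le> cmod (exp w - exp v) * (norm (rs v) * norm (rs w))"
        by (intro mult_left_mono norm_blinfun_compose) auto
      also have "\<dots> \<le> cmod (exp w - exp v) * (C / exp (Re v) * norm (rs w))"
        using v C(2)[of v] by (intro mult_left_mono mult_right_mono) (auto simp: offaxis_def)
      finally show "norm (rs v - rs w) \<le> cmod (exp w - exp v) * (C / exp (Re v) * norm (rs w))" .
    qed
    have "((\<lambda>v. cmod (exp w - exp v) * (C / exp (Re v) * norm (rs w))) \<longlongrightarrow> cmod (exp w - exp w) * (C / exp (Re w) * norm (rs w))) (at w)"
      by (intro tendsto_intros) auto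
    then show "((\<lambda>v. cmod (exp w - exp v) * (C / exp (Re v) * norm (rs w))) \<longlongrightarrow> 0) (at w)" by simp
  qed
  then show ?thesis by (simp add: isCont_def LIM_zero_iff)
qed

definition rs' :: "complex \<Rightarrow> ('a \<Rightarrow>\<^sub>L 'a)" where "rs' w = op_scaleC (- exp w) (rs w o\<^sub>L rs w)"

lemma rs'_cont: "continuous_on offaxis rs'"
  unfolding rs'_def using rs_isCont
  by (intro osc.continuous_on continuous_intros bounded_bilinear.continuous_on[OF bounded_bilinear_blinfun_compose])
    (auto intro: continuous_at_imp_continuous_on)

lemma rs_odiff: assumes w: "w \<in> offaxis" shows "odiff rs rs' w"
  unfolding odiff_def has_vector_derivative_iff_quotient
proof
  fix d :: complex
  let ?v = "\<lambda>\<tau>::real. w + of_real \<tau> * d"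
  have v0: "(?v \<longlongrightarrow> w) (at 0)"
    by (auto intro!: tendsto_eq_intros)
  have "\<forall>\<^sub>F \<tau> in at 0. ?v \<tau> \<in> offaxis" using topological_tendstoD[OF v0 open_offaxis w] .
  then have ev: "\<forall>\<^sub>F \<tau> in at 0. op_scaleC ((1 / (\<tau> - 0)) *\<^sub>R (exp w - exp (?v \<tau>))) (rs (?v \<tau>) o\<^sub>L rs w) =
      (1 / (\<tau> - 0)) *\<^sub>R (rs (?v \<tau>) - rs (w + of_real 0 * d))"
    by eventually_elim (use w in \<open>simp add: rs_identity osc.scaleR_left\<close>)
  have "((\<lambda>\<tau>. exp (?v \<tau>)) has_vector_derivative d * exp (w + of_real 0 * d)) (at 0)"
  proof -
    have "((\<lambda>z. exp (w + z * d)) has_field_derivative d * exp (w + of_real 0 * d)) (at (of_real 0))"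
      by (auto intro!: derivative_eq_intros)
    from has_vector_derivative_real_field[OF this] show ?thesis .
  qed
  then have "((\<lambda>\<tau>. (1 / (\<tau> - 0)) *\<^sub>R (exp (?v \<tau>) - exp w)) \<longlongrightarrow> d * exp w) (at 0)"
    unfolding has_vector_derivative_iff_quotient by simp
  from tendsto_minus[OF this] have q: "((\<lambda>\<tau>. (1 / (\<tau> - 0)) *\<^sub>R (exp w - exp (?v \<tau>))) \<longlongrightarrow> - (d * exp w)) (at 0)"
    by (simp flip: scaleR_minus_right)
  have "((\<lambda>\<tau>. rs (?v \<tau>)) \<longlongrightarrow> rs w) (at 0)" by (rule isCont_tendsto_compose[OF rs_isCont[OF w] v0])
  then have "((\<lambda>\<tau>. rs (?v \<tau>) o\<^sub>L rs w) \<longlongrightarrow> rs w o\<^sub>L rs w) (at 0)"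
    by (intro bounded_bilinear.tendsto[OF bounded_bilinear_blinfun_compose] tendsto_const)
  from osc.tendsto[OF q this] have "((\<lambda>\<tau>. op_scaleC ((1 / (\<tau> - 0)) *\<^sub>R (exp w - exp (?v \<tau>))) (rs (?v \<tau>) o\<^sub>L rs w)) \<longlongrightarrow>
      op_scaleC (- (d * exp w)) (rs w o\<^sub>L rs w)) (at 0)" .
  from Lim_transform_eventually[OF this ev]
  show "((\<lambda>\<tau>. (1 / (\<tau> - 0)) *\<^sub>R (rs (?v \<tau>) - rs (w + of_real 0 * d))) \<longlongrightarrow> op_scaleC d (rs' w)) (at 0)"
    by (simp add: rs'_def op_scaleC_assoc)
qed

end

section \<open>Contour integrals in the logarithmic variable\<close>

lemma Hinf0_decay:
  assumes "f \<in> Hinf0 \<theta>" "\<theta> \<le> pi"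
  obtains C e where "C > 0" "e > 0" "\<And>w. w \<in> strip \<theta> \<Longrightarrow> cmod (f (exp w)) \<le> C * (1 + \<bar>Re w\<bar>) powr (- 1 - e)"
proof -
  obtain C e where C: "C > 0" "e > 0" "\<And>z. z \<in> sector \<theta> \<Longrightarrow> cmod (f z) \<le> C * (1 + cmod (Ln z)) powr (- 1 - e)"
    using assms(1) unfolding Hinf0_def by blast
  have "cmod (f (exp w)) \<le> C * (1 + \<bar>Re w\<bar>) powr (- 1 - e)" if w: "w \<in> strip \<theta>" for w
  proof -
    have "cmod (f (exp w)) \<le> C * (1 + cmod w) powr (- 1 - e)"
      using C(3)[OF exp_strip(1)[OF w assms(2)]] exp_strip(2)[OF w assms(2)] by simp
    also have "\<dots> \<le> C * (1 + \<bar>Re w\<bar>) powr (- 1 - e)"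
      using C(1,2) abs_Re_le_cmod[of w] by (intro mult_left_mono powr_mono2') auto
    finally show ?thesis .
  qed
  then show ?thesis using that C(1,2) by blast
qed

lemma Hinf0_holo: "f \<in> Hinf0 \<theta> \<Longrightarrow> \<theta> \<le> pi \<Longrightarrow> (\<lambda>w. f (exp w)) holomorphic_on strip \<theta>"
  by (intro Hinf_holo_strip) (auto simp: Hinf0_def Hinf_def)

lemma odiff_mult:
  assumes h: "h holomorphic_on S" "open S" "w \<in> S" and F: "odiff F F' w"
  shows "odiff (\<lambda>w. op_scaleC (h w) (F w)) (\<lambda>w. op_scaleC (deriv h w) (F w) + op_scaleC (h w) (F' w)) w"
  unfolding odiff_def
proof
  fix d
  have "(h has_field_derivative deriv h w) (at w)" using h by (rule holomorphic_derivI)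
  then have "(h has_field_derivative deriv h w) (at (w + of_real 0 * d))" by simp
  moreover have "((\<lambda>\<tau>. w + \<tau> * d) has_field_derivative d) (at (of_real 0))"
    by (auto intro!: derivative_eq_intros)
  ultimately
  have "((\<lambda>\<tau>. h (w + \<tau> * d)) has_field_derivative deriv h w * d) (at (of_real 0))"
    by (rule DERIV_chain2[where f = h and g = "\<lambda>\<tau>. w + \<tau> * d" and x = "of_real 0"])
  from has_vector_derivative_real_field[OF this]
  have 1: "((\<lambda>\<tau>. h (w + of_real \<tau> * d)) has_vector_derivative deriv h w * d) (at 0)" .
  from osc.has_vector_derivative[OF 1 F[unfolded odiff_def, THEN spec, of d]]
  show "((\<lambda>\<tau>. op_scaleC (h (w + of_real \<tau> * d)) (F (w + of_real \<tau> * d))) has_vector_derivative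
      op_scaleC d (op_scaleC (deriv h w) (F w) + op_scaleC (h w) (F' w))) (at 0)"
    by (simp add: osc.add_right op_scaleC_assoc mult.commute add.commute)
qed

lemma odiff_diff: "odiff F F' w \<Longrightarrow> odiff G G' w \<Longrightarrow> odiff (\<lambda>w. F w - G w) (\<lambda>w. F' w - G' w) w"
  unfolding odiff_def by (auto simp: osc.diff_right intro!: has_vector_derivative_diff)

lemma odiff_compose: "odiff F F' w \<Longrightarrow> odiff (\<lambda>w. F w o\<^sub>L G) (\<lambda>w. F' w o\<^sub>L G) w"
  unfolding odiff_def
proof (intro allI)
  fix d
  assume "\<forall>d. ((\<lambda>\<tau>. F (w + of_real \<tau> * d)) has_vector_derivative op_scaleC d (F' w)) (at 0)"
  then have "((\<lambda>\<tau>. F (w + of_real \<tau> * d)) has_vector_derivative op_scaleC d (F' w)) (at 0)" ..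
  from bounded_linear.has_vector_derivative[OF bounded_bilinear.bounded_linear_left[OF bounded_bilinear_blinfun_compose, of G] this]
  show "((\<lambda>\<tau>. F (w + of_real \<tau> * d) o\<^sub>L G) has_vector_derivative op_scaleC d (F' w o\<^sub>L G)) (at 0)"
    by (simp add: op_scaleC_compose)
qed

text \<open>The distance of \<open>exp z\<close> from 1 is at least \<open>\<bar>sin (Im
  z)\<bar>\<close>; both estimates follow by factoring out one of the exponentials.\<close>

lemma exp_minus_exp_bound:
  "cmod (exp u - exp v) \<ge> exp (Re u) * \<bar>sin (Im u - Im v)\<bar>"
  "cmod (exp u - exp v) \<ge> exp (Re v) * \<bar>sin (Im u - Im v)\<bar>"
proof -
  have gen: "(1 - E * c)\<^sup>2 + (E * s)\<^sup>2 = (E - c)\<^sup>2 + s\<^sup>2 + E\<^sup>2 * (s\<^sup>2 + c\<^sup>2 - 1) + (1 - s\<^sup>2 - c\<^sup>2)" for E c s :: real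
    by (simp add: power2_eq_square algebra_simps)
  have *: "\<bar>sin (Im z)\<bar> \<le> cmod (1 - exp z)" for z
  proof -
    have "(sin (Im z))\<^sup>2 \<le> (cmod (1 - exp z))\<^sup>2"
    proof -
      have "(cmod (1 - exp z))\<^sup>2 = (1 - exp (Re z) * cos (Im z))\<^sup>2 + (exp (Re z) * sin (Im z))\<^sup>2"
        by (simp add: cmod_power2 Re_exp Im_exp)
      also have "\<dots> = (exp (Re z) - cos (Im z))\<^sup>2 + (sin (Im z))\<^sup>2 + (exp (Re z))\<^sup>2 * ((sin (Im z))\<^sup>2 + (cos (Im z))\<^sup>2 - 1) + (1 - (sin (Im z))\<^sup>2 - (cos (Im z))\<^sup>2)"
        by (rule gen)
      also have "\<dots> = (exp (Re z) - cos (Im z))\<^sup>2 + (sin (Im z))\<^sup>2"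
        by (simp add: sin_squared_eq)
      finally show ?thesis by simp
    qed
    then show ?thesis using abs_le_square_iff[of "sin (Im z)" "cmod (1 - exp z)"] by simp
  qed
  have "exp u - exp v = exp u * (1 - exp (v - u))" by (simp add: right_diff_distrib exp_add[symmetric])
  then have "cmod (exp u - exp v) = exp (Re u) * cmod (1 - exp (v - u))" by (simp add: norm_mult)
  then show "cmod (exp u - exp v) \<ge> exp (Re u) * \<bar>sin (Im u - Im v)\<bar>"
    using *[of "v - u"] sin_minus[of "Im u - Im v"] by (simp add: abs_minus_commute)
  have "exp u - exp v = - exp v * (1 - exp (u - v))" by (simp add: right_diff_distrib exp_add[symmetric])
  then have "cmod (exp u - exp v) = exp (Re v) * cmod (1 - exp (u - v))" by (simp only: norm_mult norm_minus_cancel norm_exp_eq_Re)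
  then show "cmod (exp u - exp v) \<ge> exp (Re v) * \<bar>sin (Im u - Im v)\<bar>"
    using *[of "u - v"] by simp
qed

lemma poly_decay_tendsto: "e > 0 \<Longrightarrow> (\<lambda>N. K * (1 + \<bar>real N\<bar>) powr (- 1 - e)) \<longlonglongrightarrow> 0"
proof -
  assume "e > 0"
  then have "((\<lambda>x::real. (1 + x) powr (- 1 - e)) \<longlongrightarrow> 0) at_top" by real_asymp
  from filterlim_compose[OF this filterlim_real_sequentially] show ?thesis
    using tendsto_mult_left[of "\<lambda>N. (1 + real N) powr (- 1 - e)" 0 sequentially K] by simp
qed

context zero_sectorial_calculus
begin

text \<open>The integrand of the contour integral in the logarithmic variable \<open>w\<close>, where
  \<open>dz = z dw\<close> and the two boundary rays of a sector become horizontal lines.\<close>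

definition ray :: "(complex \<Rightarrow> complex) \<Rightarrow> complex \<Rightarrow> ('a \<Rightarrow>\<^sub>L 'a)" where
  "ray f w = op_scaleC (f (exp w) * exp w) (rs w)"

definition ray' :: "(complex \<Rightarrow> complex) \<Rightarrow> complex \<Rightarrow> ('a \<Rightarrow>\<^sub>L 'a)" where
  "ray' f w = op_scaleC (deriv (\<lambda>w. f (exp w) * exp w) w) (rs w) + op_scaleC (f (exp w) * exp w) (rs' w)"

definition line :: "(complex \<Rightarrow> ('a \<Rightarrow>\<^sub>L 'a)) \<Rightarrow> real \<Rightarrow> ('a \<Rightarrow>\<^sub>L 'a)" where
  "line F s = integral UNIV (\<lambda>t. F (Complex t s))"

lemma sector_boundary_integral_eq: "sector_boundary_integral \<sigma> A f = op_scaleC (1 / (2 * of_real pi * \<i>)) (line (ray f) (- \<sigma>) - line (ray f) \<sigma>)"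
  by (simp add: sector_boundary_integral_def line_def ray_integrand_def[abs_def] ray_def rs_def Let_def)

lemma ray_odiff:
  assumes "f \<in> Hinf0 \<theta>" "\<theta> \<le> pi" "w \<in> offaxis" "w \<in> strip \<theta>"
  shows "odiff (ray f) (ray' f) w"
  unfolding ray_def[abs_def] ray'_def[abs_def]
  using Hinf0_holo[OF assms(1,2)] by (intro odiff_mult[OF _ open_strip assms(4) rs_odiff[OF assms(3)]])
     (auto intro!: holomorphic_intros)

lemma rs_continuous_on: "S \<subseteq> offaxis \<Longrightarrow> continuous_on S rs"
  using rs_isCont by (auto intro!: continuous_at_imp_continuous_on)

lemma ray'_continuous:
  assumes "f \<in> Hinf0 \<theta>" "\<theta> \<le> pi"
  shows "continuous_on (offaxis \<inter> strip \<theta>) (ray' f)"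
proof -
  have h: "(\<lambda>w. f (exp w) * exp w) holomorphic_on strip \<theta>"
    using Hinf0_holo[OF assms] by (auto intro!: holomorphic_intros)
  have c1: "continuous_on (offaxis \<inter> strip \<theta>) (\<lambda>w. f (exp w) * exp w)"
    using holomorphic_on_imp_continuous_on[OF h] by (rule continuous_on_subset) auto
  have c2: "continuous_on (offaxis \<inter> strip \<theta>) (deriv (\<lambda>w. f (exp w) * exp w))"
    using holomorphic_on_imp_continuous_on[OF holomorphic_deriv[OF h open_strip]] by (rule continuous_on_subset) auto
  show ?thesis unfolding ray'_def[abs_def]
    by (intro continuous_on_add osc.continuous_on c1 c2 rs_continuous_on continuous_on_subset[OF rs'_cont]) auto
qed

lemma odiff_continuous_line:
  assumes "\<And>t. odiff F F' (Complex t s)"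
  shows "continuous_on UNIV (\<lambda>t. F (Complex t s))"
proof (intro continuous_at_imp_continuous_on ballI)
  fix t
  have e: "Complex 0 s + of_real t * 1 = Complex t s" for t by (simp add: complex_eq_iff)
  have "((\<lambda>t. F (Complex t s)) has_vector_derivative op_scaleC 1 (F' (Complex t s))) (at t)"
    using odiff_at[of F F' "Complex 0 s" t 1] assms[of t] unfolding e by simp
  then show "isCont (\<lambda>t. F (Complex t s)) t" by (rule has_vector_derivative_continuous)
qed

lemma ray_bound:
  assumes f: "f \<in> Hinf0 \<theta>" "\<theta> \<le> pi" and a: "0 < a"
  obtains K e where "K \<ge> 0" "e > 0"
    "\<And>w. a \<le> \<bar>Im w\<bar> \<Longrightarrow> \<bar>Im w\<bar> < \<theta> \<Longrightarrow> norm (ray f w) \<le> K * (1 + \<bar>Re w\<bar>) powr (- 1 - e)"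
proof -
  obtain C e where C: "C > 0" "e > 0" "\<And>w. w \<in> strip \<theta> \<Longrightarrow> cmod (f (exp w)) \<le> C * (1 + \<bar>Re w\<bar>) powr (- 1 - e)"
    using Hinf0_decay[OF f] by blast
  have "0 < a / 2" using a by simp
  then obtain R where R: "R \<ge> 0" "\<And>w. a / 2 < \<bar>Im w\<bar> \<Longrightarrow> \<bar>Im w\<bar> < pi \<Longrightarrow> norm (rs w) \<le> R / exp (Re w)"
    using rs_bound by blast
  have "norm (ray f w) \<le> (C * R) * (1 + \<bar>Re w\<bar>) powr (- 1 - e)" if "a \<le> \<bar>Im w\<bar>" "\<bar>Im w\<bar> < \<theta>" for w
  proof -
    have "norm (ray f w) \<le> cmod (f (exp w)) * exp (Re w) * norm (rs w)"
      unfolding ray_def using norm_op_scaleC[of "f (exp w) * exp w" "rs w"] by (simp add: norm_mult)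
    also have "\<dots> \<le> (C * (1 + \<bar>Re w\<bar>) powr (- 1 - e)) * exp (Re w) * (R / exp (Re w))"
      using C(1) C(3)[of w] R(2)[of w] that f(2) a by (intro mult_mono) (auto simp: strip_def)
    finally show ?thesis by (simp add: mult_ac)
  qed
  then show ?thesis using that[of "C * R" e] C(1,2) R(1) by auto
qed

lemma ray_line:
  assumes f: "f \<in> Hinf0 \<theta>" "\<theta> \<le> pi" and s: "0 < \<bar>s\<bar>" "\<bar>s\<bar> < \<theta>"
  shows "(\<lambda>t. ray f (Complex t s)) integrable_on UNIV"
    "(\<lambda>N. integral {- real N..real N} (\<lambda>t. ray f (Complex t s))) \<longlonglongrightarrow> line (ray f) s"
proof -
  obtain K e where K: "K \<ge> 0" "e > 0"
    "\<And>w. \<bar>s\<bar> \<le> \<bar>Im w\<bar> \<Longrightarrow> \<bar>Im w\<bar> < \<theta> \<Longrightarrow> norm (ray f w) \<le> K * (1 + \<bar>Re w\<bar>) powr (- 1 - e)"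
    using ray_bound[OF f s(1)] by blast
  have c: "continuous_on UNIV (\<lambda>t. ray f (Complex t s))"
    by (rule odiff_continuous_line[OF ray_odiff[OF f]]) (use s f in \<open>auto simp: offaxis_def strip_def\<close>)
  have g: "(\<lambda>t. K * (1 + \<bar>t\<bar>) powr (- 1 - e)) integrable_on UNIV"
    using integrable_on_cmult_left[OF integrable_poly_decay[OF K(2)], of K] by simp
  have le: "norm (ray f (Complex t s)) \<le> K * (1 + \<bar>t\<bar>) powr (- 1 - e)" for t
    using K(3)[of "Complex t s"] s by simp
  from integrable_dominated_UNIV[OF c g le]
  show "(\<lambda>t. ray f (Complex t s)) integrable_on UNIV"
    "(\<lambda>N. integral {- real N..real N} (\<lambda>t. ray f (Complex t s))) \<longlonglongrightarrow> line (ray f) s"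
    by (auto simp: line_def)
qed

text \<open>The logarithmic decay of \<open>f\<close> makes the vertical sides of the rectangle
  negligible.\<close>

lemma line_shift:
  assumes f: "f \<in> Hinf0 \<theta>" "\<theta> \<le> pi" and ab: "a \<le> b" "0 < a \<or> b < 0" "\<bar>a\<bar> < \<theta>" "\<bar>b\<bar> < \<theta>"
  shows "line (ray f) a = line (ray f) b"
proof -
  define m where "m = min \<bar>a\<bar> \<bar>b\<bar>"
  have m: "0 < m" using ab by (auto simp: m_def)
  have im: "m \<le> \<bar>s\<bar> \<and> \<bar>s\<bar> < \<theta>" if "a \<le> s" "s \<le> b" for s using that ab by (auto simp: m_def)
  obtain K e where K: "K \<ge> 0" "e > 0"
    "\<And>w. m \<le> \<bar>Im w\<bar> \<Longrightarrow> \<bar>Im w\<bar> < \<theta> \<Longrightarrow> norm (ray f w) \<le> K * (1 + \<bar>Re w\<bar>) powr (- 1 - e)"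
    using ray_bound[OF f m] by blast
  have dm: "w \<in> offaxis \<inter> strip \<theta>" if "a \<le> Im w" "Im w \<le> b" for w
    using im[OF that] m f(2) by (auto simp: offaxis_def strip_def)
  have le: "norm (integral {- real N..real N} (\<lambda>t. ray f (Complex t b)) - integral {- real N..real N} (\<lambda>t. ray f (Complex t a)))
      \<le> 2 * (K * (1 + \<bar>real N\<bar>) powr (- 1 - e)) * (b - a)" for N
  proof (rule line_integral_shift[OF ab(1), where F' = "ray' f"])
    show "odiff (ray f) (ray' f) w" if "a \<le> Im w" "Im w \<le> b" for w
      using dm[OF that] by (intro ray_odiff[OF f]) auto
    show "continuous_on {w. a \<le> Im w \<and> Im w \<le> b} (ray' f)"
      using ray'_continuous[OF f] by (rule continuous_on_subset) (use dm in blast)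
    show "norm (ray f (Complex (real N) s)) \<le> K * (1 + \<bar>real N\<bar>) powr (- 1 - e) \<and>
         norm (ray f (Complex (- real N) s)) \<le> K * (1 + \<bar>real N\<bar>) powr (- 1 - e)" if "a \<le> s" "s \<le> b" for s
      using K(3)[of "Complex (real N) s"] K(3)[of "Complex (- real N) s"] im[OF that] by simp
  qed simp
  have "(\<lambda>N. 2 * (K * (1 + \<bar>real N\<bar>) powr (- 1 - e)) * (b - a)) \<longlonglongrightarrow> 2 * 0 * (b - a)"
    by (intro tendsto_intros poly_decay_tendsto K(2))
  then have "(\<lambda>N. integral {- real N..real N} (\<lambda>t. ray f (Complex t b)) - integral {- real N..real N} (\<lambda>t. ray f (Complex t a))) \<longlonglongrightarrow> 0"
    by (intro Lim_null_comparison[OF always_eventually[OF allI[OF le]]]) simp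
  moreover have l2: "(\<lambda>N. integral {- real N..real N} (\<lambda>t. ray f (Complex t b)) - integral {- real N..real N} (\<lambda>t. ray f (Complex t a))) \<longlonglongrightarrow> line (ray f) b - line (ray f) a"
    using ab by (intro tendsto_diff ray_line[OF f]) auto
  ultimately have "0 = line (ray f) b - line (ray f) a" by (rule LIMSEQ_unique)
  then show ?thesis by simp
qed

lemma sector_boundary_integral_angle:
  assumes f: "f \<in> Hinf0 \<theta>" "\<theta> \<le> pi" and "0 < \<sigma>" "\<sigma> < \<theta>" "0 < \<sigma>'" "\<sigma>' < \<theta>"
  shows "sector_boundary_integral \<sigma> A f = sector_boundary_integral \<sigma>' A f"
proof -
  have *: "sector_boundary_integral a A f = sector_boundary_integral b A f" if "0 < a" "a \<le> b" "b < \<theta>" for a b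
    using line_shift[OF f, of a b] line_shift[OF f, of "- b" "- a"] that by (simp add: sector_boundary_integral_eq)
  show ?thesis
  proof (cases "\<sigma> \<le> \<sigma>'")
    case True
    show ?thesis by (rule *) (use True assms in auto)
  next
    case False
    show ?thesis by (rule *[symmetric]) (use False assms in auto)
  qed
qed

lemma hcalc_angle:
  assumes "f \<in> Hinf0 \<theta>" "0 < \<theta>'" "\<theta>' \<le> \<theta>" "\<theta> \<le> pi"
  shows "hcalc \<theta> A f = hcalc \<theta>' A f"
  unfolding hcalc_def using assms by (intro sector_boundary_integral_angle[OF assms(1,4)]) auto

lemma hcalc_lincomb:
  assumes "f \<in> Hinf0 \<theta>" "g \<in> Hinf0 \<theta>" "0 < \<theta>" "\<theta> \<le> pi"
  shows "hcalc \<theta> A (\<lambda>z. f z + of_real c * g z) = hcalc \<theta> A f + c *\<^sub>R hcalc \<theta> A g"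
proof -
  have "line (ray (\<lambda>z. f z + of_real c * g z)) s = line (ray f) s + c *\<^sub>R line (ray g) s" if "0 < \<bar>s\<bar>" "\<bar>s\<bar> < \<theta>" for s
  proof -
    have "ray (\<lambda>z. f z + of_real c * g z) w = ray f w + c *\<^sub>R ray g w" for w
      unfolding ray_def op_scaleC_of_real[symmetric] op_scaleC_assoc osc.add_left[symmetric] by (simp add: ring_distribs mult_ac)
    then show ?thesis
      unfolding line_def using ray_line(1)[OF assms(1,4) that] ray_line(1)[OF assms(2,4) that]
      by (simp add: integral_add integrable_cmul)
  qed
  then show ?thesis using assms(3,4) unfolding hcalc_def sector_boundary_integral_eq
    by (simp add: osc.add_right osc.diff_right osc.scaleR_right scaleR_diff_right)
qed

end

section \<open>The Cauchy formula on a strip\<close>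

lemma contour_integral_horizontal:
  assumes N: "0 < N" and c: "continuous_on {- N..N} (\<lambda>t. f (Complex t s))"
  shows "contour_integral (linepath (Complex (- N) s) (Complex N s)) f = integral {- N..N} (\<lambda>t. f (Complex t s))"
proof -
  have "((\<lambda>t. f (Complex t s)) has_integral integral {- N..N} (\<lambda>t. f (Complex t s))) (cbox (- N) N)"
    using integrable_integral[OF integrable_continuous_interval[OF c]] by (simp add: cbox_interval)
  from has_integral_affinity'[OF this, of "2 * N" "- N"] N
  have "((\<lambda>x. f (Complex (2 * N * x - N) s)) has_integral integral {- N..N} (\<lambda>t. f (Complex t s)) /\<^sub>R (2 * N)) {0..1}"
    by (simp add: cbox_interval)
  from has_integral_mult_left[OF this, of "of_real (2 * N)"]
  have "((\<lambda>x. f (Complex (2 * N * x - N) s) * of_real (2 * N)) has_integral integral {- N..N} (\<lambda>t. f (Complex t s))) {0..1}"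
  proof -
    have "X /\<^sub>R (2 * N) * of_real (2 * N) = (inverse (2 * N) * (2 * N)) *\<^sub>R X" for X :: complex
      by (simp only: scaleR_conv_of_real of_real_mult mult_ac)
    moreover have "inverse (2 * N) * (2 * N) = 1" using N by simp
    ultimately have "X /\<^sub>R (2 * N) * of_real (2 * N) = X" for X :: complex by (simp only: scaleR_one)
    then show ?thesis using \<open>((\<lambda>x. f (Complex (2 * N * x - N) s) * of_real (2 * N)) has_integral _) {0..1}\<close> by (simp only:)
  qed
  moreover have "linepath (Complex (- N) s) (Complex N s) x = Complex (2 * N * x - N) s" for x
    by (simp add: linepath_def complex_eq_iff algebra_simps)
  moreover have "Complex N s - Complex (- N) s = of_real (2 * N)" by (simp add: complex_eq_iff)
  ultimately show ?thesis by (intro contour_integral_unique) (simp add: has_contour_integral_linepath)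
qed

lemma convex_strip: "convex (strip w)"
proof -
  have "strip w = {z. Im z < w} \<inter> {z. - w < Im z}" by (auto simp: strip_def)
  then show ?thesis using convex_halfspace_Im_lt[of w] convex_halfspace_Im_gt[of "- w"] by (auto intro: convex_Int)
qed

lemma exp_inj_strip: "u \<in> strip \<theta> \<Longrightarrow> v \<in> strip \<theta> \<Longrightarrow> \<theta> \<le> pi \<Longrightarrow> exp u = exp v \<Longrightarrow> u = v"
  using exp_strip(2) by metis

text \<open>The Cauchy kernel \<open>g(z) dz / (z - \<lambda>)\<close> at \<open>z = exp u\<close>,
  \<open>\<lambda> = exp v\<close>. Its only pole in the strip is at \<open>u = v\<close>,
  with residue \<open>g (exp v)\<close>.\<close>

definition cauchy_kernel :: "(complex \<Rightarrow> complex) \<Rightarrow> complex \<Rightarrow> complex \<Rightarrow> complex" where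
  "cauchy_kernel g v u = g (exp u) * exp u / (exp u - exp v)"

lemma cauchy_kernel_regularized_holomorphic:
  assumes g: "(\<lambda>w. g (exp w)) holomorphic_on strip \<theta>" and t: "\<theta> \<le> pi" and v: "v \<in> strip \<theta>"
  shows "(\<lambda>u. if u = v then g (exp v) else cauchy_kernel g v u * (u - v)) holomorphic_on strip \<theta>"
proof (rule no_isolated_singularity'[of "{v}"])
  let ?F = "\<lambda>u. if u = v then g (exp v) else cauchy_kernel g v u * (u - v)"
  fix z assume "z \<in> {v}"
  then have z: "z = v" by simp
  have "(exp has_field_derivative exp v) (at v within strip \<theta>)" by (auto intro!: derivative_eq_intros)
  then have 1: "((\<lambda>u. (exp u - exp v) / (u - v)) \<longlongrightarrow> exp v) (at v within strip \<theta>)"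
    by (simp add: has_field_derivative_iff)
  have "continuous_on (strip \<theta>) (\<lambda>w. g (exp w))" using g by (rule holomorphic_on_imp_continuous_on)
  then have "((\<lambda>u. g (exp u)) \<longlongrightarrow> g (exp v)) (at v within strip \<theta>)" using v by (simp add: continuous_on_def)
  then have 2: "((\<lambda>u. g (exp u) * exp u) \<longlongrightarrow> g (exp v) * exp v) (at v within strip \<theta>)"
    by (auto intro!: tendsto_intros)
  have "((\<lambda>u. g (exp u) * exp u / ((exp u - exp v) / (u - v))) \<longlongrightarrow> g (exp v) * exp v / exp v) (at v within strip \<theta>)"
    by (intro tendsto_divide 1 2) simp
  then have "((\<lambda>u. g (exp u) * exp u / ((exp u - exp v) / (u - v))) \<longlongrightarrow> ?F v) (at v within strip \<theta>)" by simp
  moreover have "\<forall>\<^sub>F u in at v within strip \<theta>. g (exp u) * exp u / ((exp u - exp v) / (u - v)) = ?F u"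
    by (auto simp: eventually_at_filter cauchy_kernel_def)
  ultimately show "(?F \<longlongrightarrow> ?F z) (at z within strip \<theta>)"
    unfolding z by (rule Lim_transform_eventually)
next
  have "(\<lambda>u. cauchy_kernel g v u * (u - v)) holomorphic_on (strip \<theta> - {v})"
    unfolding cauchy_kernel_def using g exp_inj_strip[OF _ v t]
    by (intro holomorphic_intros holomorphic_on_subset[OF g]) auto
  then show "(\<lambda>u. if u = v then g (exp v) else cauchy_kernel g v u * (u - v)) holomorphic_on (strip \<theta> - {v})"
    by (rule holomorphic_transform) auto
qed (auto simp: open_strip)

lemma cauchy_kernel_continuous:
  assumes g: "(\<lambda>w. g (exp w)) holomorphic_on strip \<theta>" and t: "\<theta> \<le> pi" and v: "v \<in> strip \<theta>"
  shows "continuous_on (strip \<theta> - {v}) (cauchy_kernel g v)"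
proof -
  have "continuous_on (strip \<theta> - {v}) (\<lambda>w. g (exp w))"
    using holomorphic_on_imp_continuous_on[OF g] by (rule continuous_on_subset) auto
  then show ?thesis unfolding cauchy_kernel_def[abs_def] using exp_inj_strip[OF _ v t]
    by (intro continuous_intros) auto
qed

lemma cauchy_kernel_rectangle:
  assumes g: "(\<lambda>w. g (exp w)) holomorphic_on strip \<theta>" and t: "\<theta> \<le> pi"
    and s: "\<sigma> < \<theta>" "\<bar>Im v\<bar> < \<sigma>" and N: "\<bar>Re v\<bar> < N"
    and B: "0 \<le> B" "\<And>u. \<bar>Re u\<bar> = N \<Longrightarrow> \<bar>Im u\<bar> \<le> \<sigma> \<Longrightarrow> cmod (cauchy_kernel g v u) \<le> B"
  shows "cmod (integral {- N..N} (\<lambda>t. cauchy_kernel g v (Complex t (- \<sigma>))) - integral {- N..N} (\<lambda>t. cauchy_kernel g v (Complex t \<sigma>))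
     - 2 * pi * \<i> * g (exp v)) \<le> 4 * \<sigma> * B"
proof -
  let ?q = "cauchy_kernel g v"
  let ?F = "\<lambda>u. if u = v then g (exp v) else ?q u * (u - v)"
  define a1 a2 a3 a4 where "a1 = Complex (- N) (- \<sigma>)" and "a2 = Complex N (- \<sigma>)" and "a3 = Complex N \<sigma>" and "a4 = Complex (- N) \<sigma>"
  note ad = a1_def a2_def a3_def a4_def
  have pos: "0 < N" "0 < \<sigma>" using N s by auto
  have v: "v \<in> strip \<theta>" using s by (auto simp: strip_def)
  have r: "rectpath a1 a3 = linepath a1 a2 +++ linepath a2 a3 +++ linepath a3 a4 +++ linepath a4 a1"
    by (simp add: rectpath_def Let_def ad)
  have segs: "closed_segment a1 a2 = {z. Im z = - \<sigma> \<and> \<bar>Re z\<bar> \<le> N}" "closed_segment a2 a3 = {z. Re z = N \<and> \<bar>Im z\<bar> \<le> \<sigma>}"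
    "closed_segment a3 a4 = {z. Im z = \<sigma> \<and> \<bar>Re z\<bar> \<le> N}" "closed_segment a4 a1 = {z. Re z = - N \<and> \<bar>Im z\<bar> \<le> \<sigma>}"
    using pos by (auto simp: ad closed_segment_same_Im closed_segment_same_Re closed_segment_eq_real_ivl)
  have sub: "closed_segment a1 a2 \<subseteq> strip \<theta> - {v}" "closed_segment a2 a3 \<subseteq> strip \<theta> - {v}"
    "closed_segment a3 a4 \<subseteq> strip \<theta> - {v}" "closed_segment a4 a1 \<subseteq> strip \<theta> - {v}"
    unfolding segs using s N by (auto simp: strip_def)
  note cq = continuous_on_subset[OF cauchy_kernel_continuous[OF g t v]]
  note ci = contour_integrable_continuous_linepath[OF cq]
  have pim: "path_image (rectpath a1 a3) \<subseteq> strip \<theta> - {v}"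
    unfolding r using sub by (simp add: path_image_join)
  have "((\<lambda>w. ?F w / (w - v)) has_contour_integral (2 * pi * \<i> * winding_number (rectpath a1 a3) v * ?F v)) (rectpath a1 a3)"
    by (rule Cauchy_integral_formula_convex_simple[OF convex_strip cauchy_kernel_regularized_holomorphic[OF g t v]])
      (use v pim in \<open>auto simp: interior_open open_strip\<close>)
  moreover have "winding_number (rectpath a1 a3) v = 1"
    using N s by (intro winding_number_rectpath) (auto simp: in_box_complex_iff ad)
  ultimately have "contour_integral (rectpath a1 a3) (\<lambda>w. ?F w / (w - v)) = 2 * pi * \<i> * g (exp v)"
    by (simp add: contour_integral_unique)
  moreover have "contour_integral (rectpath a1 a3) (\<lambda>w. ?F w / (w - v)) = contour_integral (rectpath a1 a3) ?q"
    using pim by (intro contour_integral_eq) auto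
  ultimately have e: "contour_integral (linepath a1 a2) ?q + (contour_integral (linepath a2 a3) ?q +
      (contour_integral (linepath a3 a4) ?q + contour_integral (linepath a4 a1) ?q)) = 2 * pi * \<i> * g (exp v)"
    unfolding r using ci[OF sub(1)] ci[OF sub(2)] ci[OF sub(3)] ci[OF sub(4)] by (simp add: contour_integrable_joinI)
  have h1: "contour_integral (linepath a1 a2) ?q = integral {- N..N} (\<lambda>t. ?q (Complex t (- \<sigma>)))"
    unfolding ad using pos s N
    by (intro contour_integral_horizontal continuous_on_compose2[OF cauchy_kernel_continuous[OF g t v]])
      (auto simp: Complex_eq strip_def intro!: continuous_intros)
  have "contour_integral (linepath a4 a3) ?q = integral {- N..N} (\<lambda>t. ?q (Complex t \<sigma>))"
    unfolding ad using pos s N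
    by (intro contour_integral_horizontal continuous_on_compose2[OF cauchy_kernel_continuous[OF g t v]])
      (auto simp: Complex_eq strip_def intro!: continuous_intros)
  then have h2: "contour_integral (linepath a3 a4) ?q = - integral {- N..N} (\<lambda>t. ?q (Complex t \<sigma>))"
    using contour_integral_reverse_linepath[OF cq[OF sub(3)]] by simp
  have len: "cmod (a3 - a2) = 2 * \<sigma>" "cmod (a1 - a4) = 2 * \<sigma>"
  proof -
    have "a3 - a2 = of_real (2 * \<sigma>) * \<i>" "a1 - a4 = of_real (- 2 * \<sigma>) * \<i>" by (simp_all add: ad complex_eq_iff)
    then show "cmod (a3 - a2) = 2 * \<sigma>" "cmod (a1 - a4) = 2 * \<sigma>"
      using pos by (simp_all only: norm_mult norm_of_real norm_ii)
  qed
  have "cmod (contour_integral (linepath a2 a3) ?q) \<le> B * cmod (a3 - a2)"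
    using B(2) pos(1) by (intro contour_integral_bound_linepath ci sub B(1)) (auto simp: segs)
  then have v1: "cmod (contour_integral (linepath a2 a3) ?q) \<le> B * (2 * \<sigma>)"
    unfolding len(1) .
  have "cmod (contour_integral (linepath a4 a1) ?q) \<le> B * cmod (a1 - a4)"
    using B(2) pos(1) by (intro contour_integral_bound_linepath ci sub B(1)) (auto simp: segs)
  then have v2: "cmod (contour_integral (linepath a4 a1) ?q) \<le> B * (2 * \<sigma>)"
    unfolding len(2) .
  have "integral {- N..N} (\<lambda>t. ?q (Complex t (- \<sigma>))) - integral {- N..N} (\<lambda>t. ?q (Complex t \<sigma>)) - 2 * pi * \<i> * g (exp v)
     = - (contour_integral (linepath a2 a3) ?q + contour_integral (linepath a4 a1) ?q)"
    using e unfolding h1 h2 by (simp add: algebra_simps)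
  then have "cmod (integral {- N..N} (\<lambda>t. ?q (Complex t (- \<sigma>))) - integral {- N..N} (\<lambda>t. ?q (Complex t \<sigma>)) - 2 * pi * \<i> * g (exp v))
     = cmod (contour_integral (linepath a2 a3) ?q + contour_integral (linepath a4 a1) ?q)"
    by (simp only: norm_minus_cancel)
  also have "\<dots> \<le> B * (2 * \<sigma>) + B * (2 * \<sigma>)" by (rule order_trans[OF norm_triangle_ineq add_mono[OF v1 v2]])
  also have "\<dots> = 4 * \<sigma> * B" by simp
  finally show ?thesis .
qed

lemma sin_abs_le: "sin \<bar>x::real\<bar> \<le> \<bar>sin x\<bar>"
  by (cases "x \<ge> 0") auto

lemma sin_gap:
  assumes "0 < \<theta>" "\<theta> \<le> pi" "\<bar>Im u\<bar> = \<theta> / 4" "\<bar>Im v\<bar> \<le> \<theta> / 8"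
  shows "sin (\<theta> / 8) \<le> \<bar>sin (Im u - Im v)\<bar>"
proof -
  let ?d = "Im u - Im v"
  have "\<theta> / 8 \<le> \<bar>?d\<bar>" "\<bar>?d\<bar> \<le> pi / 2" using assms by linarith+
  then have "sin (\<theta> / 8) \<le> sin \<bar>?d\<bar>" using assms(1) by (intro sin_monotone_2pi_le) auto
  also have "\<dots> \<le> \<bar>sin ?d\<bar>" by (rule sin_abs_le)
  finally show ?thesis .
qed

text \<open>If \<open>u\<close> runs through the lines at height \<open>\<theta>/4\<close> and
  \<open>v\<close> stays within \<open>\<theta>/8\<close> of the axis, the denominator of
  the Cauchy kernel stays away from 0 relative to each of the two exponentials.\<close>

lemma exp_gap:
  assumes "0 < \<theta>" "\<theta> \<le> pi" "\<bar>Im u\<bar> = \<theta> / 4" "\<bar>Im v\<bar> \<le> \<theta> / 8"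
  shows "exp (Re u) * sin (\<theta> / 8) \<le> cmod (exp u - exp v)" "exp (Re v) * sin (\<theta> / 8) \<le> cmod (exp u - exp v)"
  using exp_minus_exp_bound[where u = u and v = v] mult_left_mono[OF sin_gap[OF assms], of "exp (Re u)"] mult_left_mono[OF sin_gap[OF assms], of "exp (Re v)"]
  by (meson exp_ge_zero order_trans)+

lemma sin_pos_eighth: "0 < \<theta> \<Longrightarrow> \<theta> \<le> pi \<Longrightarrow> 0 < sin (\<theta> / 8)"
  by (intro sin_gt_zero) auto

lemma cauchy_kernel_bound:
  assumes "0 < \<theta>" "\<theta> \<le> pi" "\<bar>Im u\<bar> = \<theta> / 4" "\<bar>Im v\<bar> \<le> \<theta> / 8"
  shows "cmod (cauchy_kernel g v u) \<le> cmod (g (exp u)) / sin (\<theta> / 8)"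
proof -
  have p: "0 < sin (\<theta> / 8)" by (rule sin_pos_eighth) fact+
  then have q: "0 < exp (Re u) * sin (\<theta> / 8)" by simp
  have "cmod (cauchy_kernel g v u) = cmod (g (exp u)) * exp (Re u) / cmod (exp u - exp v)"
    by (simp add: cauchy_kernel_def norm_divide norm_mult)
  also have "\<dots> \<le> cmod (g (exp u)) * exp (Re u) / (exp (Re u) * sin (\<theta> / 8))"
  proof (rule divide_left_mono)
    show "exp (Re u) * sin (\<theta> / 8) \<le> cmod (exp u - exp v)" by (rule exp_gap(1)[OF assms])
    then have "0 < cmod (exp u - exp v)" using q by linarith
    then show "0 < cmod (exp u - exp v) * (exp (Re u) * sin (\<theta> / 8))" using q by (rule mult_pos_pos)
  qed simp
  also have "\<dots> = cmod (g (exp u)) / sin (\<theta> / 8)" by simp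
  finally show ?thesis .
qed

lemma exp_ratio_ends:
  assumes "\<bar>Re v\<bar> + 1 \<le> N" "\<bar>Re u\<bar> = N"
  shows "exp (Re u) \<le> 2 * cmod (exp u - exp v)"
proof (cases "Re u \<ge> 0")
  case True
  have "2 * exp (Re v) \<le> exp 1 * exp (Re v)" using exp_ge_add_one_self[of 1] by (intro mult_right_mono) auto
  also have "\<dots> = exp (1 + Re v)" by (simp add: exp_add)
  also have "\<dots> \<le> exp (Re u)" using True assms by simp
  finally have "2 * exp (Re v) \<le> exp (Re u)" .
  then show ?thesis using norm_triangle_ineq2[of "exp u" "exp v"] by simp
next
  case False
  have "2 * exp (Re u) \<le> exp 1 * exp (Re u)" using exp_ge_add_one_self[of 1] by (intro mult_right_mono) auto
  also have "\<dots> = exp (1 + Re u)" by (simp add: exp_add)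
  also have "\<dots> \<le> exp (Re v)" using False assms by simp
  finally have "2 * exp (Re u) \<le> exp (Re v)" .
  then show ?thesis using norm_triangle_ineq3[of "exp u" "exp v"] exp_gt_zero[of "Re u"] by simp
qed

text \<open>The Cauchy formula for the strip: the vertical sides of the rectangles vanish in the limit.\<close>

lemma cauchy_kernel_line:
  assumes g: "g \<in> Hinf0 \<theta>" and t: "0 < \<theta>" "\<theta> \<le> pi" and v: "\<bar>Im v\<bar> \<le> \<theta> / 8"
  shows "\<bar>s\<bar> = \<theta> / 4 \<Longrightarrow> (\<lambda>t. cauchy_kernel g v (Complex t s)) integrable_on UNIV"
    "integral UNIV (\<lambda>t. cauchy_kernel g v (Complex t (- (\<theta> / 4)))) - integral UNIV (\<lambda>t. cauchy_kernel g v (Complex t (\<theta> / 4))) = 2 * pi * \<i> * g (exp v)"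
proof -
  obtain C e where C: "C > 0" "e > 0" "\<And>w. w \<in> strip \<theta> \<Longrightarrow> cmod (g (exp w)) \<le> C * (1 + \<bar>Re w\<bar>) powr (- 1 - e)"
    using Hinf0_decay[OF g t(2)] by blast
  note holo = Hinf0_holo[OF g t(2)]
  have vs: "v \<in> strip \<theta>" using v t by (auto simp: strip_def)
  have p: "0 < sin (\<theta> / 8)" by (rule sin_pos_eighth) fact+
  have gi: "(\<lambda>t. C / sin (\<theta> / 8) * (1 + \<bar>t\<bar>) powr (- 1 - e)) integrable_on UNIV"
    using integrable_on_cmult_left[OF integrable_poly_decay[OF C(2)], of "C / sin (\<theta> / 8)"] by simp
  have c: "continuous_on UNIV (\<lambda>t. cauchy_kernel g v (Complex t s))" if "\<bar>s\<bar> = \<theta> / 4" for s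
    using that v t by (intro continuous_on_compose2[OF cauchy_kernel_continuous[OF holo t(2) vs]])
      (auto simp: Complex_eq strip_def intro!: continuous_intros)
  have le: "norm (cauchy_kernel g v (Complex t s)) \<le> C / sin (\<theta> / 8) * (1 + \<bar>t\<bar>) powr (- 1 - e)" if "\<bar>s\<bar> = \<theta> / 4" for s t
  proof -
    have "norm (cauchy_kernel g v (Complex t s)) \<le> cmod (g (exp (Complex t s))) / sin (\<theta> / 8)"
      using that by (intro cauchy_kernel_bound t v) auto
    also have "\<dots> \<le> (C * (1 + \<bar>t\<bar>) powr (- 1 - e)) / sin (\<theta> / 8)"
      using C(3)[of "Complex t s"] that t p by (intro divide_right_mono) (auto simp: strip_def)
    finally show ?thesis by simp
  qed
  note I = integrable_dominated_UNIV[OF c gi le]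
  show "\<bar>s\<bar> = \<theta> / 4 \<Longrightarrow> (\<lambda>t. cauchy_kernel g v (Complex t s)) integrable_on UNIV" using I(1) by blast
  let ?J = "\<lambda>N. integral {- real N..real N} (\<lambda>t. cauchy_kernel g v (Complex t (- (\<theta> / 4)))) - integral {- real N..real N} (\<lambda>t. cauchy_kernel g v (Complex t (\<theta> / 4)))"
  have "?J \<longlonglongrightarrow> integral UNIV (\<lambda>t. cauchy_kernel g v (Complex t (- (\<theta> / 4)))) - integral UNIV (\<lambda>t. cauchy_kernel g v (Complex t (\<theta> / 4)))"
    using t(1) by (intro tendsto_diff I(2)) auto
  moreover have "?J \<longlonglongrightarrow> 2 * pi * \<i> * g (exp v)"
  proof -
    have "(\<lambda>N. ?J N - 2 * pi * \<i> * g (exp v)) \<longlonglongrightarrow> 0"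
    proof (rule Lim_null_comparison)
      show "\<forall>\<^sub>F N in sequentially. cmod (?J N - 2 * pi * \<i> * g (exp v)) \<le> 4 * (\<theta> / 4) * (2 * C * (1 + \<bar>real N\<bar>) powr (- 1 - e))"
      proof (rule eventually_sequentiallyI[of "nat \<lceil>\<bar>Re v\<bar> + 1\<rceil>"])
        fix N assume "nat \<lceil>\<bar>Re v\<bar> + 1\<rceil> \<le> N"
        then have N: "\<bar>Re v\<bar> + 1 \<le> real N" using real_nat_ceiling_ge[of "\<bar>Re v\<bar> + 1"] by linarith
        show "cmod (?J N - 2 * pi * \<i> * g (exp v)) \<le> 4 * (\<theta> / 4) * (2 * C * (1 + \<bar>real N\<bar>) powr (- 1 - e))"
        proof (rule cauchy_kernel_rectangle[OF holo t(2)])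
          fix u assume u: "\<bar>Re u\<bar> = real N" "\<bar>Im u\<bar> \<le> \<theta> / 4"
          have ne: "0 < cmod (exp u - exp v)" using exp_ratio_ends[OF N u(1)] exp_gt_zero[of "Re u"] by linarith
          have "cmod (cauchy_kernel g v u) = cmod (g (exp u)) * (exp (Re u) / cmod (exp u - exp v))"
            by (simp add: cauchy_kernel_def norm_divide norm_mult)
          also have "\<dots> \<le> (C * (1 + \<bar>Re u\<bar>) powr (- 1 - e)) * 2"
            using C(1) C(3)[of u] u t exp_ratio_ends[OF N u(1)] ne
            by (intro mult_mono) (auto simp: strip_def pos_divide_le_eq)
          finally show "cmod (cauchy_kernel g v u) \<le> 2 * C * (1 + \<bar>real N\<bar>) powr (- 1 - e)" using u(1) by (simp add: mult_ac)
        qed (use t v N C(1) in auto)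
      qed
      have "(\<lambda>N. 4 * (\<theta> / 4) * (2 * C * (1 + \<bar>real N\<bar>) powr (- 1 - e))) \<longlonglongrightarrow> 4 * (\<theta> / 4) * 0"
        by (intro tendsto_mult_left poly_decay_tendsto C(2))
      then show "(\<lambda>N. 4 * (\<theta> / 4) * (2 * C * (1 + \<bar>real N\<bar>) powr (- 1 - e))) \<longlonglongrightarrow> 0" by simp
    qed
    then show ?thesis by (simp only: LIM_zero_iff)
  qed
  ultimately show "integral UNIV (\<lambda>t. cauchy_kernel g v (Complex t (- (\<theta> / 4)))) - integral UNIV (\<lambda>t. cauchy_kernel g v (Complex t (\<theta> / 4))) = 2 * pi * \<i> * g (exp v)"
    by (rule LIMSEQ_unique)
qed

context zero_sectorial_calculus
begin

section \<open>Multiplicativity of the holomorphic calculus\<close>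

definition cauchy_resolvent :: "(complex \<Rightarrow> complex) \<Rightarrow> complex \<Rightarrow> complex \<Rightarrow> ('a \<Rightarrow>\<^sub>L 'a)" where
  "cauchy_resolvent g v u = op_scaleC (cauchy_kernel g v u) (rs u)"

text \<open>The operator by which \<open>R(e\<^sup>v) g(A)\<close> differs from \<open>g(e\<^sup>v)
  R(e\<^sup>v)\<close>. The integrals run over the lines at height \<open>\<theta>/4\<close>
  and involve \<open>R(e\<^sup>v)\<close> no more, so the operator makes sense for real
  \<open>v\<close>, too.\<close>

definition correction :: "real \<Rightarrow> (complex \<Rightarrow> complex) \<Rightarrow> complex \<Rightarrow> ('a \<Rightarrow>\<^sub>L 'a)" where
  "correction \<theta> g v = op_scaleC (1 / (2 * of_real pi * \<i>)) (line (cauchy_resolvent g v) (- (\<theta> / 4)) - line (cauchy_resolvent g v) (\<theta> / 4))"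

lemma cauchy_resolvent_bounds:
  assumes g: "g \<in> Hinf0 \<theta>" and t: "0 < \<theta>" "\<theta> \<le> pi"
  obtains K e where "K \<ge> 0" "e > 0"
    "\<And>u v. \<bar>Im u\<bar> = \<theta> / 4 \<Longrightarrow> \<bar>Im v\<bar> \<le> \<theta> / 8 \<Longrightarrow> norm (cauchy_resolvent g v u) \<le> K / exp (Re v) * (1 + \<bar>Re u\<bar>) powr (- 1 - e)"
    "\<And>u v v'. \<bar>Im u\<bar> = \<theta> / 4 \<Longrightarrow> \<bar>Im v\<bar> \<le> \<theta> / 8 \<Longrightarrow> \<bar>Im v'\<bar> \<le> \<theta> / 8 \<Longrightarrow>
       norm (cauchy_resolvent g v u - cauchy_resolvent g v' u) \<le> K * cmod (exp v - exp v') / (exp (Re v) * exp (Re v')) * (1 + \<bar>Re u\<bar>) powr (- 1 - e)"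
proof -
  obtain C e where C: "C > 0" "e > 0" "\<And>w. w \<in> strip \<theta> \<Longrightarrow> cmod (g (exp w)) \<le> C * (1 + \<bar>Re w\<bar>) powr (- 1 - e)"
    using Hinf0_decay[OF g t(2)] by blast
  have "0 < \<theta> / 8" using t by simp
  then obtain R where R: "R \<ge> 0" "\<And>w. \<theta> / 8 < \<bar>Im w\<bar> \<Longrightarrow> \<bar>Im w\<bar> < pi \<Longrightarrow> norm (rs w) \<le> R / exp (Re w)"
    using rs_bound by blast
  define c where "c = sin (\<theta> / 8)"
  have c: "0 < c" unfolding c_def by (rule sin_pos_eighth) fact+
  have c1: "c \<le> 1" by (simp add: c_def)
  define K where "K = C * R / (c * c)"
  have K0: "K \<ge> 0" unfolding K_def using C R c by simp
  have KK: "C * R / c \<le> K"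
  proof -
    have "1 \<le> 1 / c" using c c1 by simp
    then have "C * R / c * 1 \<le> C * R / c * (1 / c)"
      by (rule mult_left_mono) (use C(1) R(1) c in auto)
    then show ?thesis by (simp add: K_def)
  qed
  have b: "cmod (g (exp u)) * (exp (Re u) * norm (rs u)) \<le> C * (1 + \<bar>Re u\<bar>) powr (- 1 - e) * R" if u: "\<bar>Im u\<bar> = \<theta> / 4" for u
  proof (rule mult_mono)
    show "cmod (g (exp u)) \<le> C * (1 + \<bar>Re u\<bar>) powr (- 1 - e)" using C(3)[of u] u t by (simp add: strip_def)
    show "exp (Re u) * norm (rs u) \<le> R" using R(2)[of u] u t by (simp add: field_simps)
  qed (use C in auto)
  have B1: "norm (cauchy_resolvent g v u) \<le> K / exp (Re v) * (1 + \<bar>Re u\<bar>) powr (- 1 - e)"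
    if u: "\<bar>Im u\<bar> = \<theta> / 4" and v: "\<bar>Im v\<bar> \<le> \<theta> / 8" for u v
  proof -
    have "norm (cauchy_resolvent g v u) \<le> cmod (cauchy_kernel g v u) * norm (rs u)" unfolding cauchy_resolvent_def by (rule norm_op_scaleC)
    also have "\<dots> = cmod (g (exp u)) * (exp (Re u) * norm (rs u)) / cmod (exp u - exp v)"
      by (simp add: cauchy_kernel_def norm_divide norm_mult)
    also have "\<dots> \<le> (C * (1 + \<bar>Re u\<bar>) powr (- 1 - e) * R) / (exp (Re v) * c)"
      using b[OF u] exp_gap(2)[OF t u v] c C(1) R(1) by (intro frac_le) (auto simp: c_def)
    also have "\<dots> = C * R / c * ((1 + \<bar>Re u\<bar>) powr (- 1 - e) / exp (Re v))" by (simp add: mult_ac)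
    also have "\<dots> \<le> K * ((1 + \<bar>Re u\<bar>) powr (- 1 - e) / exp (Re v))" using KK by (intro mult_right_mono) auto
    finally show ?thesis by simp
  qed
  have B2: "norm (cauchy_resolvent g v u - cauchy_resolvent g v' u) \<le> K * cmod (exp v - exp v') / (exp (Re v) * exp (Re v')) * (1 + \<bar>Re u\<bar>) powr (- 1 - e)"
    if u: "\<bar>Im u\<bar> = \<theta> / 4" and v: "\<bar>Im v\<bar> \<le> \<theta> / 8" "\<bar>Im v'\<bar> \<le> \<theta> / 8" for u v v'
  proof -
    have p: "0 < exp (Re v) * c" "0 < exp (Re v') * c" using c by auto
    have g1: "exp (Re v) * c \<le> cmod (exp u - exp v)" and g2: "exp (Re v') * c \<le> cmod (exp u - exp v')"
      using exp_gap(2)[OF t u v(1)] exp_gap(2)[OF t u v(2)] by (auto simp: c_def)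
    have q: "0 < cmod (exp u - exp v)" "0 < cmod (exp u - exp v')" using p g1 g2 by linarith+
    then have nz: "exp u - exp v \<noteq> 0" "exp u - exp v' \<noteq> 0" by auto
    have "cauchy_kernel g v u - cauchy_kernel g v' u = g (exp u) * exp u * (exp v - exp v') / ((exp u - exp v) * (exp u - exp v'))"
      unfolding cauchy_kernel_def using nz by (simp add: divide_simps) (simp add: algebra_simps)
    then have "norm (cauchy_resolvent g v u - cauchy_resolvent g v' u) \<le> cmod (g (exp u) * exp u * (exp v - exp v') / ((exp u - exp v) * (exp u - exp v'))) * norm (rs u)"
      unfolding cauchy_resolvent_def osc.diff_left[symmetric] using norm_op_scaleC by metis
    also have "\<dots> = cmod (g (exp u)) * (exp (Re u) * norm (rs u)) * cmod (exp v - exp v') / (cmod (exp u - exp v) * cmod (exp u - exp v'))"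
      by (simp add: norm_mult norm_divide)
    also have "\<dots> \<le> (C * (1 + \<bar>Re u\<bar>) powr (- 1 - e) * R) * cmod (exp v - exp v') / ((exp (Re v) * c) * (exp (Re v') * c))"
    proof (rule frac_le)
      show "cmod (g (exp u)) * (exp (Re u) * norm (rs u)) * cmod (exp v - exp v') \<le> C * (1 + \<bar>Re u\<bar>) powr (- 1 - e) * R * cmod (exp v - exp v')"
        using b[OF u] by (intro mult_right_mono) auto
      show "exp (Re v) * c * (exp (Re v') * c) \<le> cmod (exp u - exp v) * cmod (exp u - exp v')"
        using g1 g2 p by (intro mult_mono) auto
      show "0 < exp (Re v) * c * (exp (Re v') * c)" using p by (rule mult_pos_pos)
      show "0 \<le> C * (1 + \<bar>Re u\<bar>) powr (- 1 - e) * R * cmod (exp v - exp v')" using C R by simp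
    qed
    finally show ?thesis by (simp add: K_def mult_ac)
  qed
  show ?thesis using that[OF K0 C(2) B1 B2] .
qed

lemma cauchy_resolvent_integrable:
  assumes g: "g \<in> Hinf0 \<theta>" and t: "0 < \<theta>" "\<theta> \<le> pi" and s: "\<bar>s\<bar> = \<theta> / 4" and v: "\<bar>Im v\<bar> \<le> \<theta> / 8"
  shows "(\<lambda>t. cauchy_resolvent g v (Complex t s)) integrable_on UNIV"
proof -
  obtain K e where K: "K \<ge> 0" "e > 0"
    "\<And>u v. \<bar>Im u\<bar> = \<theta> / 4 \<Longrightarrow> \<bar>Im v\<bar> \<le> \<theta> / 8 \<Longrightarrow> norm (cauchy_resolvent g v u) \<le> K / exp (Re v) * (1 + \<bar>Re u\<bar>) powr (- 1 - e)"
    using cauchy_resolvent_bounds[OF g t] by metis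
  have vs: "v \<in> strip \<theta>" using v t by (auto simp: strip_def)
  have c: "continuous_on UNIV (\<lambda>t. cauchy_resolvent g v (Complex t s))" unfolding cauchy_resolvent_def
  proof (rule osc.continuous_on)
    show "continuous_on UNIV (\<lambda>t. cauchy_kernel g v (Complex t s))"
      using s v t by (intro continuous_on_compose2[OF cauchy_kernel_continuous[OF Hinf0_holo[OF g t(2)] t(2) vs]])
        (auto simp: Complex_eq strip_def intro!: continuous_intros)
    show "continuous_on UNIV (\<lambda>t. rs (Complex t s))"
      using s t by (intro continuous_on_compose2[OF rs_continuous_on[OF subset_refl]])
        (auto simp: Complex_eq offaxis_def intro!: continuous_intros)
  qed
  have gi: "(\<lambda>t. K / exp (Re v) * (1 + \<bar>t\<bar>) powr (- 1 - e)) integrable_on UNIV"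
    using integrable_on_cmult_left[OF integrable_poly_decay[OF K(2)], of "K / exp (Re v)"] by simp
  have "norm (cauchy_resolvent g v (Complex t s)) \<le> K / exp (Re v) * (1 + \<bar>t\<bar>) powr (- 1 - e)" for t
    using K(3)[of "Complex t s" v] s v by simp
  from integrable_dominated_UNIV(1)[OF c gi this] show ?thesis .
qed

text \<open>The second estimate says that the correction term is continuous across the real axis. The
  denominators show how the bounds scale under dilations.\<close>

lemma correction_bounds:
  assumes g: "g \<in> Hinf0 \<theta>" and t: "0 < \<theta>" "\<theta> \<le> pi"
  obtains M where "M \<ge> 0" "\<And>v. \<bar>Im v\<bar> \<le> \<theta> / 8 \<Longrightarrow> norm (correction \<theta> g v) \<le> M / exp (Re v)"
    "\<And>v v'. \<bar>Im v\<bar> \<le> \<theta> / 8 \<Longrightarrow> \<bar>Im v'\<bar> \<le> \<theta> / 8 \<Longrightarrow>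
       norm (correction \<theta> g v - correction \<theta> g v') \<le> M * cmod (exp v - exp v') / (exp (Re v) * exp (Re v'))"
proof -
  obtain K e where K: "K \<ge> 0" "e > 0"
    "\<And>u v. \<bar>Im u\<bar> = \<theta> / 4 \<Longrightarrow> \<bar>Im v\<bar> \<le> \<theta> / 8 \<Longrightarrow> norm (cauchy_resolvent g v u) \<le> K / exp (Re v) * (1 + \<bar>Re u\<bar>) powr (- 1 - e)"
    "\<And>u v v'. \<bar>Im u\<bar> = \<theta> / 4 \<Longrightarrow> \<bar>Im v\<bar> \<le> \<theta> / 8 \<Longrightarrow> \<bar>Im v'\<bar> \<le> \<theta> / 8 \<Longrightarrow>
       norm (cauchy_resolvent g v u - cauchy_resolvent g v' u) \<le> K * cmod (exp v - exp v') / (exp (Re v) * exp (Re v')) * (1 + \<bar>Re u\<bar>) powr (- 1 - e)"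
    using cauchy_resolvent_bounds[OF g t] by metis
  define P where "P = integral UNIV (\<lambda>t::real. (1 + \<bar>t\<bar>) powr (- 1 - e))"
  note pi' = integrable_poly_decay[OF K(2)]
  have P0: "P \<ge> 0" unfolding P_def by (rule integral_nonneg[OF pi']) simp
  have gi: "(\<lambda>t. L * (1 + \<bar>t\<bar>) powr (- 1 - e)) integrable_on UNIV" for L
    using integrable_on_cmult_left[OF pi', of L] by simp
  have gI: "integral UNIV (\<lambda>t. L * (1 + \<bar>t\<bar>) powr (- 1 - e)) = L * P" for L by (simp add: P_def)
  define k where "k = cmod (1 / (2 * of_real pi * \<i>))"
  have line1: "norm (line (cauchy_resolvent g v) s) \<le> K / exp (Re v) * P" if s: "\<bar>s\<bar> = \<theta> / 4" and v: "\<bar>Im v\<bar> \<le> \<theta> / 8" for s v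
  proof -
    have le: "norm (cauchy_resolvent g v (Complex x s)) \<le> K / exp (Re v) * (1 + \<bar>x\<bar>) powr (- 1 - e)" for x
      using K(3)[of "Complex x s" v] s v by simp
    show ?thesis unfolding line_def gI[symmetric]
      by (rule integral_norm_bound_integral[OF cauchy_resolvent_integrable[OF g t s v] gi le])
  qed
  have line2: "norm (line (cauchy_resolvent g v) s - line (cauchy_resolvent g v') s) \<le> K * cmod (exp v - exp v') / (exp (Re v) * exp (Re v')) * P"
    if s: "\<bar>s\<bar> = \<theta> / 4" and v: "\<bar>Im v\<bar> \<le> \<theta> / 8" "\<bar>Im v'\<bar> \<le> \<theta> / 8" for s v v'
  proof -
    have "line (cauchy_resolvent g v) s - line (cauchy_resolvent g v') s = integral UNIV (\<lambda>t. cauchy_resolvent g v (Complex t s) - cauchy_resolvent g v' (Complex t s))"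
      unfolding line_def by (rule integral_diff[symmetric, OF cauchy_resolvent_integrable[OF g t s v(1)] cauchy_resolvent_integrable[OF g t s v(2)]])
    moreover have "norm \<dots> \<le> K * cmod (exp v - exp v') / (exp (Re v) * exp (Re v')) * P"
    proof -
      have le: "norm (cauchy_resolvent g v (Complex x s) - cauchy_resolvent g v' (Complex x s))
          \<le> K * cmod (exp v - exp v') / (exp (Re v) * exp (Re v')) * (1 + \<bar>x\<bar>) powr (- 1 - e)" for x
        using K(4)[of "Complex x s" v v'] s v by simp
      show ?thesis unfolding gI[symmetric]
        by (rule integral_norm_bound_integral[OF integrable_diff[OF cauchy_resolvent_integrable[OF g t s v(1)] cauchy_resolvent_integrable[OF g t s v(2)]] gi le])
    qed
    ultimately show ?thesis by simp
  qed
  have k0: "k \<ge> 0" by (simp add: k_def)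
  have "norm (correction \<theta> g v) \<le> k * (2 * K * P) / exp (Re v)" if v: "\<bar>Im v\<bar> \<le> \<theta> / 8" for v
  proof -
    have "norm (correction \<theta> g v) \<le> k * norm (line (cauchy_resolvent g v) (- (\<theta> / 4)) - line (cauchy_resolvent g v) (\<theta> / 4))"
      unfolding correction_def k_def by (rule norm_op_scaleC)
    also have "\<dots> \<le> k * (K / exp (Re v) * P + K / exp (Re v) * P)"
      using t v by (intro mult_left_mono k0 order_trans[OF norm_triangle_ineq4] add_mono line1) auto
    finally show ?thesis by (simp add: field_simps)
  qed
  moreover have "norm (correction \<theta> g v - correction \<theta> g v') \<le> k * (2 * K * P) * cmod (exp v - exp v') / (exp (Re v) * exp (Re v'))"
    if v: "\<bar>Im v\<bar> \<le> \<theta> / 8" "\<bar>Im v'\<bar> \<le> \<theta> / 8" for v v'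
  proof -
    let ?l = "\<lambda>v s. line (cauchy_resolvent g v) s"
    have "correction \<theta> g v - correction \<theta> g v' = op_scaleC (1 / (2 * of_real pi * \<i>)) ((?l v (- (\<theta> / 4)) - ?l v' (- (\<theta> / 4))) - (?l v (\<theta> / 4) - ?l v' (\<theta> / 4)))"
      unfolding correction_def osc.diff_right[symmetric] by (simp add: algebra_simps)
    then have "norm (correction \<theta> g v - correction \<theta> g v') \<le> k * norm ((?l v (- (\<theta> / 4)) - ?l v' (- (\<theta> / 4))) - (?l v (\<theta> / 4) - ?l v' (\<theta> / 4)))"
      unfolding k_def by (simp only: norm_op_scaleC)
    also have "\<dots> \<le> k * (K * cmod (exp v - exp v') / (exp (Re v) * exp (Re v')) * P + K * cmod (exp v - exp v') / (exp (Re v) * exp (Re v')) * P)"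
      using t v by (intro mult_left_mono k0 order_trans[OF norm_triangle_ineq4] add_mono line2) auto
    finally show ?thesis by (simp add: field_simps)
  qed
  moreover have "k * (2 * K * P) \<ge> 0" using k0 K(1) P0 by simp
  ultimately show ?thesis using that[of "k * (2 * K * P)"] by blast
qed

lemma compose_scale_right: "bounded_linear (\<lambda>T. S o\<^sub>L T)" "bounded_linear (\<lambda>T. T o\<^sub>L S)"
  by (rule bounded_bilinear.bounded_linear_right[OF bounded_bilinear_blinfun_compose]
    bounded_bilinear.bounded_linear_left[OF bounded_bilinear_blinfun_compose])+

text \<open>The resolvent identity splits \<open>R(e\<^sup>v) R(e\<^sup>u)\<close> by partial fractions.
  The integral of the first part is evaluated by the scalar Cauchy formula.\<close>

lemma resolvent_compose_integral:
  assumes g: "g \<in> Hinf0 \<theta>" and t: "0 < \<theta>" "\<theta> \<le> pi" and v: "0 < \<bar>Im v\<bar>" "\<bar>Im v\<bar> \<le> \<theta> / 8"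
  shows "rs v o\<^sub>L sector_boundary_integral (\<theta> / 4) A g = op_scaleC (g (exp v)) (rs v) - correction \<theta> g v"
proof -
  have vo: "v \<in> offaxis" using v t by (auto simp: offaxis_def)
  let ?c = "1 / (2 * of_real pi * \<i>)"
  have L: "rs v o\<^sub>L line (ray g) s = op_scaleC (integral UNIV (\<lambda>t. cauchy_kernel g v (Complex t s))) (rs v) - line (cauchy_resolvent g v) s"
    if s: "\<bar>s\<bar> = \<theta> / 4" for s
  proof -
    have ck: "(\<lambda>t. cauchy_kernel g v (Complex t s)) integrable_on UNIV"
      using cauchy_kernel_line(1)[OF g t v(2) s] .
    have "rs v o\<^sub>L line (ray g) s = integral UNIV (\<lambda>t. rs v o\<^sub>L ray g (Complex t s))"
      unfolding line_def using integral_linear[OF ray_line(1)[OF g t(2), of s] compose_scale_right(1)[of "rs v"]] s t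
      by (simp add: o_def)
    also have "\<dots> = integral UNIV (\<lambda>t. op_scaleC (cauchy_kernel g v (Complex t s)) (rs v) - cauchy_resolvent g v (Complex t s))"
    proof (rule integral_cong)
      fix x
      let ?u = "Complex x s"
      have uo: "?u \<in> offaxis" using s t by (auto simp: offaxis_def)
      have ne: "exp ?u - exp v \<noteq> 0"
        using exp_inj_strip[of ?u pi v] v s t by (auto simp: strip_def)
      have "rs v - rs ?u = op_scaleC (exp ?u - exp v) (rs v o\<^sub>L rs ?u)" by (rule rs_identity[OF vo uo])
      then have "op_scaleC (cauchy_kernel g v ?u) (rs v - rs ?u) = op_scaleC (g (exp ?u) * exp ?u) (rs v o\<^sub>L rs ?u)"
        using ne by (simp add: op_scaleC_assoc cauchy_kernel_def)
      then show "rs v o\<^sub>L ray g ?u = op_scaleC (cauchy_kernel g v ?u) (rs v) - cauchy_resolvent g v ?u"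
        unfolding ray_def cauchy_resolvent_def by (simp add: clin_compose[OF rs_clin[OF vo]] osc.diff_right)
    qed
    also have "\<dots> = integral UNIV (\<lambda>t. op_scaleC (cauchy_kernel g v (Complex t s)) (rs v)) - line (cauchy_resolvent g v) s"
      unfolding line_def using integrable_linear[OF ck osc.bounded_linear_left[of "rs v"]]
      by (intro integral_diff cauchy_resolvent_integrable[OF g t s v(2)]) (simp add: o_def)
    also have "integral UNIV (\<lambda>t. op_scaleC (cauchy_kernel g v (Complex t s)) (rs v)) = op_scaleC (integral UNIV (\<lambda>t. cauchy_kernel g v (Complex t s))) (rs v)"
      using integral_linear[OF ck osc.bounded_linear_left[of "rs v"]] by (simp add: o_def)
    finally show ?thesis .
  qed
  have "rs v o\<^sub>L sector_boundary_integral (\<theta> / 4) A g = op_scaleC ?c ((rs v o\<^sub>L line (ray g) (- (\<theta> / 4))) - (rs v o\<^sub>L line (ray g) (\<theta> / 4)))"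
    unfolding sector_boundary_integral_eq clin_compose[OF rs_clin[OF vo]] compose_diff(2) ..
  also have "\<dots> = op_scaleC ?c (op_scaleC (integral UNIV (\<lambda>t. cauchy_kernel g v (Complex t (- (\<theta> / 4)))) - integral UNIV (\<lambda>t. cauchy_kernel g v (Complex t (\<theta> / 4)))) (rs v)
      - (line (cauchy_resolvent g v) (- (\<theta> / 4)) - line (cauchy_resolvent g v) (\<theta> / 4)))"
    using t by (simp add: L osc.diff_left algebra_simps)
  also have "\<dots> = op_scaleC (?c * (2 * pi * \<i> * g (exp v))) (rs v) - correction \<theta> g v"
    unfolding cauchy_kernel_line(2)[OF g t v(2)] correction_def osc.diff_right op_scaleC_assoc ..
  finally show ?thesis by simp
qed

end

lemma Hinf0_mult:
  assumes "f \<in> Hinf0 \<theta>" "g \<in> Hinf \<theta>" shows "(\<lambda>z. f z * g z) \<in> Hinf0 \<theta>"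
proof -
  obtain B where B: "\<And>z. z \<in> sector \<theta> \<Longrightarrow> cmod (g z) \<le> B" using assms(2) by (auto simp: Hinf_def bounded_iff)
  obtain D where D: "\<And>z. z \<in> sector \<theta> \<Longrightarrow> cmod (f z) \<le> D" using assms(1) by (auto simp: Hinf0_def Hinf_def bounded_iff)
  obtain C e where C: "C > 0" "e > 0" "\<And>z. z \<in> sector \<theta> \<Longrightarrow> cmod (f z) \<le> C * (1 + cmod (Ln z)) powr (- 1 - e)"
    using assms(1) unfolding Hinf0_def by blast
  have "cmod (f z * g z) \<le> C * (\<bar>B\<bar> + 1) * (1 + cmod (Ln z)) powr (- 1 - e)" if z: "z \<in> sector \<theta>" for z
  proof -
    have "cmod (f z * g z) \<le> (C * (1 + cmod (Ln z)) powr (- 1 - e)) * (\<bar>B\<bar> + 1)"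
      unfolding norm_mult using C(1) C(3)[OF z] B[OF z] by (intro mult_mono) auto
    then show ?thesis by (simp add: mult_ac)
  qed
  moreover have "0 < C * (\<bar>B\<bar> + 1)" using C(1) by (intro mult_pos_pos) auto
  moreover have "cmod (f z * g z) \<le> \<bar>D\<bar> * \<bar>B\<bar>" if "z \<in> sector \<theta>" for z
    unfolding norm_mult using D[OF that] B[OF that] by (intro mult_mono) auto
  then have "bounded ((\<lambda>z. f z * g z) ` sector \<theta>)" unfolding bounded_iff by blast
  moreover have "(\<lambda>z. f z * g z) holomorphic_on sector \<theta>" using assms by (auto simp: Hinf0_def Hinf_def intro!: holomorphic_intros)
  ultimately show ?thesis unfolding Hinf0_def Hinf_def using C(2) by blast
qed

lemma Hinf0_Hinf: "f \<in> Hinf0 \<theta> \<Longrightarrow> f \<in> Hinf \<theta>" by (simp add: Hinf0_def)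

context zero_sectorial_calculus
begin

lemma ray_mult_correction:
  assumes f: "f \<in> Hinf0 \<theta>" and g: "g \<in> Hinf0 \<theta>" and t: "0 < \<theta>" "\<theta> \<le> pi" and v: "0 < \<bar>Im v\<bar>" "\<bar>Im v\<bar> \<le> \<theta> / 8"
  shows "ray (\<lambda>z. f z * g z) v - (ray f v o\<^sub>L sector_boundary_integral (\<theta> / 4) A g) = op_scaleC (f (exp v) * exp v) (correction \<theta> g v)"
proof -
  have "ray f v o\<^sub>L sector_boundary_integral (\<theta> / 4) A g = op_scaleC (f (exp v) * exp v) (op_scaleC (g (exp v)) (rs v) - correction \<theta> g v)"
    unfolding ray_def op_scaleC_compose resolvent_compose_integral[OF g t v] ..
  also have "\<dots> = ray (\<lambda>z. f z * g z) v - op_scaleC (f (exp v) * exp v) (correction \<theta> g v)"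
    unfolding osc.diff_right op_scaleC_assoc ray_def by (simp add: mult_ac)
  finally show ?thesis by simp
qed

text \<open>Off the axis \<open>F\<close> is a scalar function times the correction term. Both are
  continuous across the axis, so the integrals of \<open>F\<close> over the lines at height
  \<open>-s\<close> and \<open>s\<close> have the same limit as \<open>s\<close> tends to 0;
  and moving the two lines from height \<open>\<theta>/8\<close> to height \<open>s\<close>
  changes nothing in the limit, by Cauchy's theorem.\<close>

lemma correction_cancels:
  assumes f: "f \<in> Hinf0 \<theta>" and g: "g \<in> Hinf0 \<theta>" and t: "0 < \<theta>" "\<theta> \<le> pi"
  defines "F \<equiv> \<lambda>v. ray (\<lambda>z. f z * g z) v - (ray f v o\<^sub>L sector_boundary_integral (\<theta> / 4) A g)"
  shows "\<bar>s\<bar> = \<theta> / 8 \<Longrightarrow> (\<lambda>t. F (Complex t s)) integrable_on UNIV" "line F (- (\<theta> / 8)) = line F (\<theta> / 8)"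
proof -
  let ?G = "sector_boundary_integral (\<theta> / 4) A g"
  let ?h = "\<lambda>v. f (exp v) * exp v"
  have fg: "(\<lambda>z. f z * g z) \<in> Hinf0 \<theta>" using f g by (intro Hinf0_mult Hinf0_Hinf)
  obtain C e where C: "C > 0" "e > 0" "\<And>w. w \<in> strip \<theta> \<Longrightarrow> cmod (f (exp w)) \<le> C * (1 + \<bar>Re w\<bar>) powr (- 1 - e)"
    using Hinf0_decay[OF f t(2)] by blast
  obtain M where M: "M \<ge> 0" "\<And>v. \<bar>Im v\<bar> \<le> \<theta> / 8 \<Longrightarrow> norm (correction \<theta> g v) \<le> M / exp (Re v)"
    "\<And>v v'. \<bar>Im v\<bar> \<le> \<theta> / 8 \<Longrightarrow> \<bar>Im v'\<bar> \<le> \<theta> / 8 \<Longrightarrow>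
       norm (correction \<theta> g v - correction \<theta> g v') \<le> M * cmod (exp v - exp v') / (exp (Re v) * exp (Re v'))"
    using correction_bounds[OF g t] by blast
  have FK: "F v = op_scaleC (?h v) (correction \<theta> g v)" if "0 < \<bar>Im v\<bar>" "\<bar>Im v\<bar> \<le> \<theta> / 8" for v
    unfolding F_def by (rule ray_mult_correction[OF f g t that])
  define F' where "F' v = ray' (\<lambda>z. f z * g z) v - (ray' f v o\<^sub>L ?G)" for v
  have dF: "odiff F F' v" if "v \<in> offaxis" "v \<in> strip \<theta>" for v
    unfolding F_def F'_def[abs_def] by (intro odiff_diff odiff_compose ray_odiff[OF fg t(2) that] ray_odiff[OF f t(2) that])
  have cF': "continuous_on (offaxis \<inter> strip \<theta>) F'"
    unfolding F'_def[abs_def]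
    by (intro continuous_on_diff ray'_continuous[OF fg t(2)] bounded_linear.continuous_on[OF compose_scale_right(2)] ray'_continuous[OF f t(2)])
  define E where "E N = C * M * (1 + \<bar>N\<bar>) powr (- 1 - e)" for N :: real
  have nF: "norm (F v) \<le> E (Re v)" if v: "0 < \<bar>Im v\<bar>" "\<bar>Im v\<bar> \<le> \<theta> / 8" for v
  proof -
    have "norm (F v) \<le> cmod (?h v) * norm (correction \<theta> g v)" unfolding FK[OF v] by (rule norm_op_scaleC)
    also have "\<dots> \<le> ((C * (1 + \<bar>Re v\<bar>) powr (- 1 - e)) * exp (Re v)) * (M / exp (Re v))"
      using C(1) C(3)[of v] M(1) M(2)[OF v(2)] v t by (intro mult_mono) (auto simp: norm_mult strip_def)
    finally show ?thesis by (simp add: E_def mult_ac)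
  qed
  have dom: "v \<in> offaxis \<inter> strip \<theta>" if "0 < \<bar>Im v\<bar>" "\<bar>Im v\<bar> \<le> \<theta> / 8" for v
    using that t by (auto simp: offaxis_def strip_def)
  have cl: "continuous_on UNIV (\<lambda>t. F (Complex t s))" if "0 < \<bar>s\<bar>" "\<bar>s\<bar> \<le> \<theta> / 8" for s
    by (rule odiff_continuous_line[OF dF]) (use dom[of "Complex _ s"] that in auto)
  have gi: "E integrable_on UNIV"
    unfolding E_def[abs_def] using integrable_on_cmult_left[OF integrable_poly_decay[OF C(2)], of "C * M"] by simp
  have I: "(\<lambda>t. F (Complex t s)) integrable_on UNIV"
    "(\<lambda>N. integral {- real N..real N} (\<lambda>t. F (Complex t s))) \<longlonglongrightarrow> line F s" if s: "0 < \<bar>s\<bar>" "\<bar>s\<bar> \<le> \<theta> / 8" for s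
  proof -
    have le: "norm (F (Complex t s)) \<le> E t" for t using nF[of "Complex t s"] s by simp
    from integrable_dominated_UNIV[OF cl[OF s] gi le]
    show "(\<lambda>t. F (Complex t s)) integrable_on UNIV"
      "(\<lambda>N. integral {- real N..real N} (\<lambda>t. F (Complex t s))) \<longlonglongrightarrow> line F s" by (auto simp: line_def)
  qed
  show "\<bar>s\<bar> = \<theta> / 8 \<Longrightarrow> (\<lambda>t. F (Complex t s)) integrable_on UNIV" using I(1)[of s] t by simp
  \<comment> \<open>the difference of the truncated integrals over the lines at height \<open>-s\<close> and
    \<open>s\<close>\<close>
  define J where "J N s = integral {- N..N} (\<lambda>t. F (Complex t (- s))) - integral {- N..N} (\<lambda>t. F (Complex t s))" for N s
  have J_diff: "norm (J N (\<theta> / 8) - J N s) \<le> 4 * E N * (\<theta> / 8)" if s: "0 < s" "s \<le> \<theta> / 8" and N: "0 \<le> N" for N s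
  proof -
    have sh: "norm (integral {- N..N} (\<lambda>t. F (Complex t b)) - integral {- N..N} (\<lambda>t. F (Complex t a))) \<le> 2 * E N * (b - a)"
      if ab: "a \<le> b" "0 < a \<or> b < 0" "\<bar>a\<bar> \<le> \<theta> / 8" "\<bar>b\<bar> \<le> \<theta> / 8" for a b
    proof (rule line_integral_shift[OF ab(1) N, where F' = F'])
      have im: "0 < \<bar>x\<bar> \<and> \<bar>x\<bar> \<le> \<theta> / 8" if "a \<le> x" "x \<le> b" for x using that ab by auto
      show "odiff F F' w" if "a \<le> Im w" "Im w \<le> b" for w using im[OF that] dom[of w] by (intro dF) auto
      show "continuous_on {w. a \<le> Im w \<and> Im w \<le> b} F'"
        by (rule continuous_on_subset[OF cF']) (use im dom in blast)
      show "norm (F (Complex N x)) \<le> E N \<and> norm (F (Complex (- N) x)) \<le> E N" if "a \<le> x" "x \<le> b" for x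
        using nF[of "Complex N x"] nF[of "Complex (- N) x"] im[OF that] by (simp add: E_def)
    qed
    have E0: "0 \<le> E N" using C(1) M(1) by (simp add: E_def)
    let ?I = "\<lambda>s. integral {- N..N} (\<lambda>t. F (Complex t s))"
    have 1: "norm (?I (\<theta> / 8) - ?I s) \<le> 2 * E N * (\<theta> / 8 - s)" using sh[of s "\<theta> / 8"] s t by simp
    have 2: "norm (?I (- s) - ?I (- (\<theta> / 8))) \<le> 2 * E N * (- s - - (\<theta> / 8))" using s t by (intro sh) auto
    have "J N (\<theta> / 8) - J N s = - (?I (- s) - ?I (- (\<theta> / 8))) - (?I (\<theta> / 8) - ?I s)" by (simp add: J_def)
    then have "norm (J N (\<theta> / 8) - J N s) \<le> norm (?I (- s) - ?I (- (\<theta> / 8))) + norm (?I (\<theta> / 8) - ?I s)"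
      using norm_triangle_ineq4[of "- (?I (- s) - ?I (- (\<theta> / 8)))" "?I (\<theta> / 8) - ?I s"] by (simp only: norm_minus_cancel)
    also have "\<dots> \<le> 2 * E N * (- s - - (\<theta> / 8)) + 2 * E N * (\<theta> / 8 - s)" using 1 2 by linarith
    also have "\<dots> = 4 * E N * (\<theta> / 8 - s)" by (simp add: algebra_simps)
    also have "\<dots> \<le> 4 * E N * (\<theta> / 8)" using E0 s by (intro mult_left_mono) auto
    finally show ?thesis .
  qed
  \<comment> \<open>uniform continuity on a compact rectangle: near the axis the two integrals almost agree\<close>
  have J_small: "\<exists>s. 0 < s \<and> s \<le> \<theta> / 8 \<and> norm (J N s) \<le> d * (2 * N)" if N: "0 < N" and d: "0 < d" for N d
  proof -
    \<comment> \<open>an upper bound for the difference of the values of \<open>F\<close> at conjugate points;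
      it vanishes on the axis\<close>
    define \<Psi> where "\<Psi> p = (let v = Complex (fst p) (- snd p); v' = Complex (fst p) (snd p) in
       cmod (?h v - ?h v') * (M / exp (fst p)) + cmod (?h v') * (M * cmod (exp v - exp v') / (exp (fst p) * exp (fst p))))" for p
    have hh: "?h holomorphic_on strip \<theta>" using Hinf0_holo[OF f t(2)] by (auto intro!: holomorphic_intros)
    have ch: "continuous_on ({- N..N} \<times> {0..\<theta> / 8}) (\<lambda>p. ?h (Complex (fst p) (c * snd p)))" if "\<bar>c\<bar> = 1" for c
      using t that by (intro continuous_on_compose2[OF holomorphic_on_imp_continuous_on[OF hh]])
        (auto simp: Complex_eq strip_def abs_mult intro!: continuous_intros)
    have ce: "continuous_on ({- N..N} \<times> {0..\<theta> / 8}) (\<lambda>p. exp (Complex (fst p) (c * snd p)))" for c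
      by (auto simp: Complex_eq intro!: continuous_intros)
    have gen: "continuous_on S (\<lambda>p. cmod (a p - b p) * (M / exp (fst p)) + cmod (b p) * (M * cmod (x p - y p) / (exp (fst p) * exp (fst p))))"
      if "continuous_on S a" "continuous_on S b" "continuous_on S x" "continuous_on S y" for S and a b x y :: "real \<times> real \<Rightarrow> complex"
      by (intro continuous_intros that) simp_all
    have "continuous_on ({- N..N} \<times> {0..\<theta> / 8}) \<Psi>"
      using gen[OF ch[of "-1"] ch[of 1] ce[of "-1"] ce[of 1]] unfolding \<Psi>_def[abs_def] Let_def by simp
    then have "uniformly_continuous_on ({- N..N} \<times> {0..\<theta> / 8}) \<Psi>"
      by (intro compact_uniformly_continuous compact_Times) auto
    then have "\<exists>\<delta>>0. \<forall>p\<in>{- N..N} \<times> {0..\<theta> / 8}. \<forall>q\<in>{- N..N} \<times> {0..\<theta> / 8}. dist q p < \<delta> \<longrightarrow> dist (\<Psi> q) (\<Psi> p) < d"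
      unfolding uniformly_continuous_on_def by (rule allE[of _ d]) (use d in simp)
    then obtain \<delta> where \<delta>: "\<delta> > 0"
      and \<delta>2: "\<forall>p\<in>{- N..N} \<times> {0..\<theta> / 8}. \<forall>q\<in>{- N..N} \<times> {0..\<theta> / 8}. dist q p < \<delta> \<longrightarrow> dist (\<Psi> q) (\<Psi> p) < d"
      by (elim exE conjE)
    define s where "s = min (\<delta> / 2) (\<theta> / 8)"
    have s: "0 < s" "s \<le> \<theta> / 8" "s < \<delta>" using \<delta> t by (auto simp: s_def)
    have small: "norm (F (Complex t (- s)) - F (Complex t s)) \<le> d" if tN: "t \<in> {- N..N}" for t
    proof -
      let ?v = "Complex t (- s)" and ?v' = "Complex t s"
      have "F ?v - F ?v' = op_scaleC (?h ?v - ?h ?v') (correction \<theta> g ?v) + op_scaleC (?h ?v') (correction \<theta> g ?v - correction \<theta> g ?v')"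
        using s by (simp add: FK osc.diff_left osc.diff_right)
      also have "norm \<dots> \<le> cmod (?h ?v - ?h ?v') * norm (correction \<theta> g ?v) + cmod (?h ?v') * norm (correction \<theta> g ?v - correction \<theta> g ?v')"
        by (rule order_trans[OF norm_triangle_ineq add_mono[OF norm_op_scaleC norm_op_scaleC]])
      also have "\<dots> \<le> cmod (?h ?v - ?h ?v') * (M / exp t) + cmod (?h ?v') * (M * cmod (exp ?v - exp ?v') / (exp t * exp t))"
        using M(2)[of ?v] M(3)[of ?v ?v'] s by (intro add_mono mult_left_mono) auto
      also have "\<dots> = \<Psi> (t, s)" by (simp add: \<Psi>_def Let_def)
      also have "\<Psi> (t, s) \<le> d"
      proof -
        have "dist (\<Psi> (t, s)) (\<Psi> (t, 0)) < d"
          using tN s t by (intro \<delta>2[rule_format]) (auto simp: dist_Pair_Pair)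
        moreover have "\<Psi> (t, 0) = 0" by (simp add: \<Psi>_def Let_def)
        ultimately show ?thesis by (simp add: dist_real_def)
      qed
      finally show ?thesis .
    qed
    have i: "(\<lambda>t. F (Complex t (- s))) integrable_on {- N..N}" "(\<lambda>t. F (Complex t s)) integrable_on {- N..N}"
      using s cl by (auto intro!: integrable_continuous_interval continuous_on_subset[OF cl])
    have "J N s = integral {- N..N} (\<lambda>t. F (Complex t (- s)) - F (Complex t s))"
      unfolding J_def by (rule integral_diff[OF i, symmetric])
    also have "norm \<dots> \<le> integral {- N..N} (\<lambda>t. d)"
      by (rule integral_norm_bound_integral[OF integrable_diff[OF i] _ small]) auto
    also have "\<dots> = d * (2 * N)" using N by simp
    finally show ?thesis using s by blast
  qed
  have J_bound: "norm (J N (\<theta> / 8)) \<le> 4 * E N * (\<theta> / 8)" if N: "0 < N" for N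
  proof (rule field_le_epsilon)
    fix d :: real assume d: "0 < d"
    obtain s where s: "0 < s" "s \<le> \<theta> / 8" "norm (J N s) \<le> d / (2 * N) * (2 * N)"
      using J_small[OF N, of "d / (2 * N)"] d N by auto
    have "norm (J N (\<theta> / 8)) \<le> norm (J N (\<theta> / 8) - J N s) + norm (J N s)"
      using norm_triangle_ineq[of "J N (\<theta> / 8) - J N s" "J N s"] by simp
    also have "\<dots> \<le> 4 * E N * (\<theta> / 8) + d" using J_diff[OF s(1,2), of N] s(3) N by simp
    finally show "norm (J N (\<theta> / 8)) \<le> 4 * E N * (\<theta> / 8) + d" .
  qed
  have "(\<lambda>N. J (real N) (\<theta> / 8)) \<longlonglongrightarrow> 0"
  proof (rule Lim_null_comparison)
    show "\<forall>\<^sub>F N in sequentially. norm (J (real N) (\<theta> / 8)) \<le> 4 * E (real N) * (\<theta> / 8)"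
      by (rule eventually_sequentiallyI[of 1]) (intro J_bound, simp)
    have "(\<lambda>N. 4 * (C * M * (1 + \<bar>real N\<bar>) powr (- 1 - e)) * (\<theta> / 8)) \<longlonglongrightarrow> 4 * 0 * (\<theta> / 8)"
      by (intro tendsto_mult_left tendsto_mult_right poly_decay_tendsto C(2))
    then show "(\<lambda>N. 4 * E (real N) * (\<theta> / 8)) \<longlonglongrightarrow> 0" by (simp add: E_def)
  qed
  moreover have "(\<lambda>N. J (real N) (\<theta> / 8)) \<longlonglongrightarrow> line F (- (\<theta> / 8)) - line F (\<theta> / 8)"
    unfolding J_def using t by (intro tendsto_diff I(2)) auto
  ultimately have "0 = line F (- (\<theta> / 8)) - line F (\<theta> / 8)" by (rule LIMSEQ_unique)
  then show "line F (- (\<theta> / 8)) = line F (\<theta> / 8)" by simp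
qed

text \<open>Compute \<open>g(A)\<close> on the rays of angle \<open>\<theta>/4\<close> and
  \<open>f(A)\<close> on those of angle \<open>\<theta>/8\<close>. The composition is the
  integral of \<open>f g\<close> times the resolvent, up to the integrals of
  \<open>F\<close>, which cancel.\<close>

theorem hcalc_mult:
  assumes f: "f \<in> Hinf0 \<theta>" and g: "g \<in> Hinf0 \<theta>" and t: "0 < \<theta>" "\<theta> \<le> pi"
  shows "hcalc \<theta> A f o\<^sub>L hcalc \<theta> A g = hcalc \<theta> A (\<lambda>z. f z * g z)"
proof -
  let ?G = "sector_boundary_integral (\<theta> / 4) A g" and ?c = "1 / (2 * of_real pi * \<i>)"
  have fg: "(\<lambda>z. f z * g z) \<in> Hinf0 \<theta>" using f g by (intro Hinf0_mult Hinf0_Hinf)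
  have eg: "hcalc \<theta> A g = ?G" unfolding hcalc_def using t by (intro sector_boundary_integral_angle[OF g t(2)]) auto
  have ef: "hcalc \<theta> A f = sector_boundary_integral (\<theta> / 8) A f" unfolding hcalc_def using t by (intro sector_boundary_integral_angle[OF f t(2)]) auto
  have efg: "hcalc \<theta> A (\<lambda>z. f z * g z) = sector_boundary_integral (\<theta> / 8) A (\<lambda>z. f z * g z)"
    unfolding hcalc_def using t by (intro sector_boundary_integral_angle[OF fg t(2)]) auto
  define F where "F v = ray (\<lambda>z. f z * g z) v - (ray f v o\<^sub>L ?G)" for v
  note F = correction_cancels[OF f g t, folded F_def]
  have L: "line (ray f) s o\<^sub>L ?G = line (ray (\<lambda>z. f z * g z)) s - line F s" if s: "\<bar>s\<bar> = \<theta> / 8" for s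
  proof -
    have i: "(\<lambda>t. ray (\<lambda>z. f z * g z) (Complex t s)) integrable_on UNIV"
      using s t by (intro ray_line(1)[OF fg t(2)]) auto
    have i2: "(\<lambda>t. ray f (Complex t s)) integrable_on UNIV"
      using s t by (intro ray_line(1)[OF f t(2)]) auto
    have "line (ray f) s o\<^sub>L ?G = integral UNIV (\<lambda>t. ray f (Complex t s) o\<^sub>L ?G)"
      unfolding line_def using integral_linear[OF i2 compose_scale_right(2)[of ?G]] by (simp add: o_def)
    also have "\<dots> = integral UNIV (\<lambda>t. ray (\<lambda>z. f z * g z) (Complex t s) - F (Complex t s))"
      by (simp add: F_def)
    also have "\<dots> = line (ray (\<lambda>z. f z * g z)) s - line F s"
      unfolding line_def by (rule integral_diff[OF i F(1)[OF s]])
    finally show ?thesis .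
  qed
  have "hcalc \<theta> A f o\<^sub>L hcalc \<theta> A g = op_scaleC ?c ((line (ray f) (- (\<theta> / 8)) o\<^sub>L ?G) - (line (ray f) (\<theta> / 8) o\<^sub>L ?G))"
    unfolding eg ef sector_boundary_integral_eq[of "\<theta> / 8"] op_scaleC_compose compose_diff(1) ..
  also have "\<dots> = op_scaleC ?c (line (ray (\<lambda>z. f z * g z)) (- (\<theta> / 8)) - line (ray (\<lambda>z. f z * g z)) (\<theta> / 8))"
    using t L[of "- (\<theta> / 8)"] L[of "\<theta> / 8"] F(2) by simp
  finally show ?thesis unfolding efg sector_boundary_integral_eq .
qed

end

section \<open>Gaussian approximation of test functions\<close>

definition gaussian :: "nat \<Rightarrow> real \<Rightarrow> real" where
  "gaussian k x = real (Suc k) * std_normal_density (real (Suc k) * x)"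

text \<open>The convolution of \<open>U\<close> with a Gaussian of width \<open>1/(k+1)\<close>,
  extended to complex arguments.\<close>

definition gauss_ext :: "nat \<Rightarrow> (real \<Rightarrow> complex) \<Rightarrow> complex \<Rightarrow> complex" where
  "gauss_ext k U w = (LBINT y. U y * (of_real (real (Suc k) / sqrt (2 * pi)) * exp (- ((of_real (real (Suc k)) * (w - of_real y))\<^sup>2 / 2))))"

lemma gauss_ext_of_real:
  "gauss_ext k U (of_real x) = convolution U (\<lambda>y. of_real (gaussian k y)) x"
proof -
  have "convolution U (\<lambda>y. of_real (gaussian k y)) x = (LBINT y. U y * of_real (gaussian k (x - y)))"
    using lborel_integral_real_affine[of "-1" "\<lambda>y. U y * of_real (gaussian k (x - y))" x]
    by (simp add: convolution_def)
  also have "\<dots> = gauss_ext k U (of_real x)"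
    unfolding gauss_ext_def
    by (intro Bochner_Integration.integral_cong refl)
      (simp add: gaussian_def std_normal_density_def exp_of_real[symmetric])
  finally show ?thesis by simp
qed

lemma gauss_ext_holomorphic:
  assumes "test U" shows "gauss_ext k U holomorphic_on UNIV"
proof -
  obtain a where a: "\<And>t. a < \<bar>t\<bar> \<Longrightarrow> U t = 0" using assms unfolding test_def by blast
  let ?c = "complex_of_real (real (Suc k) / sqrt (2 * pi))" and ?k = "complex_of_real (real (Suc k))"
  let ?f = "\<lambda>w y. U y * (?c * exp (- ((?k * (w - of_real y))\<^sup>2 / 2)))"
  let ?f' = "\<lambda>w y. U y * (?c * (exp (- ((?k * (w - of_real y))\<^sup>2 / 2)) * (- (?k * (w - of_real y)) * ?k)))"
  have cU: "continuous_on S (\<lambda>x. U (h x))" if "continuous_on S h" for S and h :: "'b::topological_space \<Rightarrow> real"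
    using Cb_continuous_comp[OF test_Cb[OF assms] that] .
  have "gauss_ext k U = (\<lambda>w. integral (cbox (- \<bar>a\<bar>) \<bar>a\<bar>) (?f w))"
  proof
    fix w
    have c: "continuous_on {- \<bar>a\<bar>..\<bar>a\<bar>} (?f w)" by (intro continuous_intros cU) simp_all
    have "gauss_ext k U w = (LBINT y:{- \<bar>a\<bar>..\<bar>a\<bar>}. ?f w y)"
      unfolding gauss_ext_def set_lebesgue_integral_def using a
      by (intro Bochner_Integration.integral_cong refl) (auto simp: indicator_def)
    also have "\<dots> = integral {- \<bar>a\<bar>..\<bar>a\<bar>} (?f w)"
      by (intro set_borel_integral_eq_integral(2) borel_integrable_atLeastAtMost' c)
    finally show "gauss_ext k U w = integral (cbox (- \<bar>a\<bar>) \<bar>a\<bar>) (?f w)" by (simp add: cbox_interval)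
  qed
  moreover have "(\<lambda>w. integral (cbox (- \<bar>a\<bar>) \<bar>a\<bar>) (?f w)) holomorphic_on UNIV"
  proof (rule leibniz_rule_holomorphic[where fx = ?f'])
    show "((\<lambda>w. ?f w y) has_field_derivative ?f' w y) (at w within UNIV)" for w y
    proof -
      have "((\<lambda>w. - ((?k * (w - of_real y))\<^sup>2 / 2)) has_field_derivative - (?k * (w - of_real y)) * ?k) (at w)"
        by (rule derivative_eq_intros refl | simp)+
      from DERIV_cmult[OF DERIV_cmult[OF DERIV_chain2[OF DERIV_exp this], of ?c], of "U y"] show ?thesis by simp
    qed
    show "?f w integrable_on cbox (- \<bar>a\<bar>) \<bar>a\<bar>" for w
      by (intro integrable_continuous continuous_intros cU) simp_all
    show "continuous_on (UNIV \<times> cbox (- \<bar>a\<bar>) \<bar>a\<bar>) (\<lambda>(w, y). ?f' w y)"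
      unfolding case_prod_beta by (intro continuous_intros cU) simp_all
  qed auto
  ultimately show ?thesis by simp
qed

text \<open>Lets the weight \<open>1 + x\<^sup>2\<close> be transported through a convolution.\<close>

lemma weight_shift: "1 + x\<^sup>2 \<le> 2 * (1 + y\<^sup>2) * (1 + (x - y)\<^sup>2)" for x y :: real
proof -
  have "x\<^sup>2 \<le> 2 * y\<^sup>2 + 2 * (x - y)\<^sup>2"
    using zero_le_power2[of "x - 2 * y"] by (simp add: power2_eq_square algebra_simps)
  moreover have "0 \<le> y\<^sup>2 * (x - y)\<^sup>2" by simp
  moreover have e: "2 * (1 + b) * (1 + c) = 2 + 2 * b + 2 * c + 2 * (b * c)" for b c :: real by (simp add: algebra_simps)
  ultimately show ?thesis unfolding e by linarith
qed

lemma frac_cross: "0 < b \<Longrightarrow> 0 < d \<Longrightarrow> m * d \<le> k * b \<Longrightarrow> m / b \<le> k / d" for b d m k :: real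
  by (simp add: field_simps)

text \<open>Up to a constant the Gaussian is of modulus \<open>exp (- (m Re)\<^sup>2/2 + (m
  Im)\<^sup>2/2)\<close>, so on a horizontal strip it decays quadratically at the least, and
  a compactly supported \<open>U\<close> preserves this.\<close>

lemma gauss_ext_bound:
  assumes "test U"
  obtains C where "C > 0" "\<And>w. \<bar>Im w\<bar> \<le> pi \<Longrightarrow> cmod (gauss_ext k U w) \<le> C / (1 + (Re w)\<^sup>2)"
proof -
  obtain a where a: "\<And>t. a < \<bar>t\<bar> \<Longrightarrow> U t = 0" using assms unfolding test_def by blast
  define m where "m = real (Suc k)"
  have m: "m \<ge> 1" by (simp add: m_def)
  define c where "c = m / sqrt (2 * pi)"
  have c: "c > 0" using m by (simp add: c_def)
  \<comment> \<open>a bound for the Gaussian that is uniform for \<open>y\<close> in the support \<open>[-a,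
    a]\<close> of \<open>U\<close>\<close>
  define Dc where "Dc = c * (exp ((m * pi)\<^sup>2 / 2) * (4 * (1 + a\<^sup>2)))"
  have D0: "Dc > 0" unfolding Dc_def using c by (intro mult_pos_pos) (auto simp: add_pos_nonneg)
  define L where "L = (LBINT y. cmod (U y))"
  have L0: "L \<ge> 0" by (simp add: L_def)
  have iU: "integrable lborel U" by (rule test_integrable[OF assms])
  have "cmod (gauss_ext k U w) \<le> (L * Dc + 1) / (1 + (Re w)\<^sup>2)" if w: "\<bar>Im w\<bar> \<le> pi" for w
  proof -
    let ?x = "Re w"
    let ?K = "\<lambda>y. complex_of_real c * exp (- ((of_real m * (w - of_real y))\<^sup>2 / 2))"
    have p: "0 < 1 + ?x\<^sup>2" by (simp add: add_pos_nonneg)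
    have Kb: "cmod (?K y) \<le> Dc / (1 + ?x\<^sup>2)" if y: "\<bar>y\<bar> \<le> a" for y
    proof -
      have q: "0 < 1 + (?x - y)\<^sup>2" by (simp add: add_pos_nonneg)
      have "Re (- ((of_real m * (w - of_real y))\<^sup>2 / 2)) = (m * Im w)\<^sup>2 / 2 + - ((m * (?x - y))\<^sup>2 / 2)"
      proof -
        have "Re (- (z\<^sup>2 / 2)) = (Im z)\<^sup>2 / 2 + - ((Re z)\<^sup>2 / 2)" for z by (simp add: Re_power2 diff_divide_distrib)
        then show ?thesis by simp
      qed
      then have "cmod (?K y) = c * exp ((m * Im w)\<^sup>2 / 2 + - ((m * (?x - y))\<^sup>2 / 2))"
        using c by (simp only: norm_mult norm_exp_eq_Re norm_of_real abs_of_pos)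
      also have "\<dots> = c * (exp ((m * Im w)\<^sup>2 / 2) * exp (- ((m * (?x - y))\<^sup>2 / 2)))"
        by (simp only: exp_add)
      also have "\<dots> \<le> c * (exp ((m * pi)\<^sup>2 / 2) * (2 / (1 + (?x - y)\<^sup>2)))"
      proof (intro mult_left_mono mult_mono)
        have "(m * Im w)\<^sup>2 \<le> (m * pi)\<^sup>2"
          using w m abs_le_square_iff[of "Im w" pi] by (simp add: power_mult_distrib)
        then show "exp ((m * Im w)\<^sup>2 / 2) \<le> exp ((m * pi)\<^sup>2 / 2)" by simp
        have "(1 + (?x - y)\<^sup>2) / 2 \<le> 1 + (m * (?x - y))\<^sup>2 / 2"
        proof -
          have "1 * (?x - y)\<^sup>2 \<le> m\<^sup>2 * (?x - y)\<^sup>2" using m by (intro mult_right_mono) (auto simp: one_le_power)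
          then show ?thesis by (simp add: power_mult_distrib)
        qed
        also have "\<dots> \<le> exp ((m * (?x - y))\<^sup>2 / 2)" by (rule exp_ge_add_one_self)
        finally have "inverse (exp ((m * (?x - y))\<^sup>2 / 2)) \<le> inverse ((1 + (?x - y)\<^sup>2) / 2)"
          using q by (intro le_imp_inverse_le) auto
        then show "exp (- ((m * (?x - y))\<^sup>2 / 2)) \<le> 2 / (1 + (?x - y)\<^sup>2)" by (simp add: exp_minus)
      qed (use c in auto)
      also have "\<dots> \<le> c * (exp ((m * pi)\<^sup>2 / 2) * (4 * (1 + a\<^sup>2) / (1 + ?x\<^sup>2)))"
      proof (intro mult_left_mono)
        have "1 + ?x\<^sup>2 \<le> 2 * (1 + y\<^sup>2) * (1 + (?x - y)\<^sup>2)" by (rule weight_shift)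
        also have "\<dots> \<le> 2 * (1 + a\<^sup>2) * (1 + (?x - y)\<^sup>2)"
          using y q abs_le_square_iff[of y a] by (intro mult_right_mono mult_left_mono) auto
        finally have f: "1 + ?x\<^sup>2 \<le> 2 * (1 + a\<^sup>2) * (1 + (?x - y)\<^sup>2)" .
        have "2 * (1 + ?x\<^sup>2) \<le> 2 * (2 * (1 + a\<^sup>2) * (1 + (?x - y)\<^sup>2))" by (rule mult_left_mono[OF f]) simp
        also have "\<dots> = 4 * (1 + a\<^sup>2) * (1 + (?x - y)\<^sup>2)"
        proof -
          have "2 * (2 * s * Q) = 4 * s * Q" for s Q :: real by simp
          then show ?thesis .
        qed
        finally show "2 / (1 + (?x - y)\<^sup>2) \<le> 4 * (1 + a\<^sup>2) / (1 + ?x\<^sup>2)"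
          by (intro frac_cross p q)
      qed (use c in auto)
      finally show ?thesis by (simp add: Dc_def)
    qed
    have le: "cmod (U y * ?K y) \<le> cmod (U y) * (Dc / (1 + ?x\<^sup>2))" for y
    proof (cases "\<bar>y\<bar> \<le> a")
      case True
      show ?thesis unfolding norm_mult[of "U y" "?K y"] by (rule mult_left_mono[OF Kb[OF True]]) simp
    next
      case False
      then have "U y = 0" using a[of y] by linarith
      then show ?thesis by simp
    qed
    have "cmod (gauss_ext k U w) \<le> (LBINT y. cmod (U y * ?K y))"
      unfolding gauss_ext_def m_def[symmetric] c_def[symmetric] by (rule integral_norm_bound)
    also have "\<dots> \<le> (LBINT y. cmod (U y) * (Dc / (1 + ?x\<^sup>2)))"
    proof (rule integral_mono)
      show i: "integrable lborel (\<lambda>y. cmod (U y) * (Dc / (1 + ?x\<^sup>2)))" using iU by simp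
      have "continuous_on UNIV (\<lambda>y. U y * ?K y)"
        by (intro continuous_intros Cb_continuous test_Cb assms) simp_all
      then have "(\<lambda>y. U y * ?K y) \<in> borel_measurable lborel" by (simp add: borel_measurable_continuous_onI)
      then show "integrable lborel (\<lambda>y. cmod (U y * ?K y))"
      proof (intro integrable_norm, rule Bochner_Integration.integrable_bound[OF i])
        show "AE y in lborel. norm (U y * ?K y) \<le> norm (cmod (U y) * (Dc / (1 + ?x\<^sup>2)))"
          unfolding real_norm_def by (intro always_eventually allI) (rule order_trans[OF le abs_ge_self])
      qed
      show "cmod (U y * ?K y) \<le> cmod (U y) * (Dc / (1 + ?x\<^sup>2))" for y by (rule le)
    qed
    also have "\<dots> = L * Dc / (1 + ?x\<^sup>2)" by (simp add: L_def)
    also have "\<dots> \<le> (L * Dc + 1) / (1 + ?x\<^sup>2)" using p by (intro divide_right_mono) auto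
    finally show ?thesis .
  qed
  moreover have "L * Dc + 1 > 0" using L0 D0 by (simp add: add_nonneg_pos)
  ultimately show ?thesis using that by blast
qed

text \<open>An analytic approximation of \<open>u\<close>; it belongs to \<open>Hinf0\<close> at all
  angles simultaneously, which links the calculi at different angles.\<close>

definition approx :: "nat \<Rightarrow> (real \<Rightarrow> complex) \<Rightarrow> complex \<Rightarrow> complex" where
  "approx k u z = gauss_ext k (elog u) (Ln z)"

lemma sector_notin_nonpos: "\<theta> \<le> pi \<Longrightarrow> z \<in> sector \<theta> \<Longrightarrow> z \<notin> \<real>\<^sub>\<le>\<^sub>0 \<and> z \<noteq> 0 \<and> \<bar>Im (Ln z)\<bar> < \<theta>"
proof -
  assume t: "\<theta> \<le> pi" and z: "z \<in> sector \<theta>"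
  then have "z \<noteq> 0" "\<bar>Arg z\<bar> < \<theta>" by (auto simp: sector_def)
  moreover have "Arg z = Im (Ln z)" using \<open>z \<noteq> 0\<close> by (simp add: Arg_def)
  moreover have "z \<notin> \<real>\<^sub>\<le>\<^sub>0"
  proof
    assume "z \<in> \<real>\<^sub>\<le>\<^sub>0"
    then have "Re z < 0" "Im z = 0" using \<open>z \<noteq> 0\<close> by (auto simp: complex_nonpos_Reals_iff complex_eq_iff)
    then have "Arg z = pi" by (simp add: Arg_eq_pi)
    then show False using \<open>\<bar>Arg z\<bar> < \<theta>\<close> t by simp
  qed
  ultimately show ?thesis by simp
qed

lemma approx_Hinf0:
  assumes u: "test (elog u)" and t: "0 < \<theta>" "\<theta> \<le> pi"
  shows "approx k u \<in> Hinf0 \<theta>"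
proof -
  obtain C where C: "C > 0" "\<And>w. \<bar>Im w\<bar> \<le> pi \<Longrightarrow> cmod (gauss_ext k (elog u) w) \<le> C / (1 + (Re w)\<^sup>2)"
    using gauss_ext_bound[OF u] by blast
  have bd: "cmod (approx k u z) \<le> (50 * C) * (1 + cmod (Ln z)) powr (- 1 - 1)" if z: "z \<in> sector \<theta>" for z
  proof -
    define w where "w = Ln z"
    have im: "\<bar>Im w\<bar> < pi" using sector_notin_nonpos[OF t(2) z] t by (simp add: w_def)
    have p: "0 < 1 + (Re w)\<^sup>2" by (simp add: add_pos_nonneg)
    have "1 + cmod w \<le> 5 + \<bar>Re w\<bar>" using cmod_le[of w] im pi_less_4 by linarith
    then have "(1 + cmod w)\<^sup>2 \<le> (5 + \<bar>Re w\<bar>)\<^sup>2" by (intro power_mono) auto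
    also have "\<dots> \<le> 50 * (1 + (Re w)\<^sup>2)"
    proof -
      have e: "(r - 5)\<^sup>2 = r\<^sup>2 - 10 * r + 25" "(5 + r)\<^sup>2 = r\<^sup>2 + 10 * r + 25" for r :: real
        by (simp_all add: power2_eq_square algebra_simps)
      have "10 * \<bar>Re w\<bar> \<le> (Re w)\<^sup>2 + 25" using zero_le_power2[of "\<bar>Re w\<bar> - 5"] unfolding e power2_abs by simp
      then have "(5 + \<bar>Re w\<bar>)\<^sup>2 \<le> 2 * (Re w)\<^sup>2 + 50" unfolding e power2_abs by simp
      also have "\<dots> \<le> 50 * (1 + (Re w)\<^sup>2)" by simp
      finally show ?thesis .
    qed
    finally have le: "(1 + cmod w)\<^sup>2 \<le> 50 * (1 + (Re w)\<^sup>2)" .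
    have "cmod (approx k u z) \<le> C / (1 + (Re w)\<^sup>2)" using C(2)[of w] im by (simp add: approx_def w_def)
    also have "\<dots> \<le> 50 * C / (1 + cmod w)\<^sup>2"
    proof -
      have "0 < (1 + cmod w)\<^sup>2" by (intro zero_less_power add_pos_nonneg) auto
      then show ?thesis using mult_left_mono[OF le, of C] C(1) by (intro frac_cross p) (simp_all add: mult_ac)
    qed
    also have "\<dots> = (50 * C) * (1 + cmod w) powr (- 2)"
    proof -
      have "0 < 1 + cmod w" by (intro add_pos_nonneg) auto
      then have "(1 + cmod w) powr (- 2) = 1 / (1 + cmod w)\<^sup>2"
        by (simp add: powr_minus_divide powr_numeral)
      then show ?thesis by simp
    qed
    finally show ?thesis by (simp add: w_def)
  qed
  have le1: "(1 + cmod (Ln z)) powr (- 1 - 1) \<le> 1" for z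
  proof -
    have "0 < 1 + cmod (Ln z)" by (intro add_pos_nonneg) auto
    moreover have "(1 + cmod (Ln z)) powr (- 1 - 1) \<le> (1 + cmod (Ln z)) powr 0" by (rule powr_mono) auto
    ultimately show ?thesis by simp
  qed
  have "cmod (approx k u z) \<le> 50 * C" if z: "z \<in> sector \<theta>" for z
  proof -
    have "50 * C * (1 + cmod (Ln z)) powr (- 1 - 1) \<le> 50 * C * 1" using C(1) by (intro mult_left_mono le1) simp
    then show ?thesis using order_trans[OF bd[OF z]] by simp
  qed
  then have "bounded (approx k u ` sector \<theta>)" unfolding bounded_iff by blast
  moreover have "approx k u holomorphic_on sector \<theta>"
  proof -
    have "Ln holomorphic_on sector \<theta>" using sector_notin_nonpos[OF t(2)] by (intro holomorphic_on_Ln) auto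
    then have "(gauss_ext k (elog u) \<circ> Ln) holomorphic_on sector \<theta>"
      using gauss_ext_holomorphic[OF u] by (intro holomorphic_on_compose_gen[of _ _ _ UNIV]) auto
    then show ?thesis by (simp add: approx_def[abs_def] o_def)
  qed
  moreover have "\<exists>C>0. \<exists>\<epsilon>>0. \<forall>z\<in>sector \<theta>. cmod (approx k u z) \<le> C * (1 + cmod (Ln z)) powr (- 1 - \<epsilon>)"
  proof (rule exI[of _ "50 * C"], rule conjI)
    show "50 * C > 0" using C(1) by simp
    show "\<exists>\<epsilon>>0. \<forall>z\<in>sector \<theta>. cmod (approx k u z) \<le> (50 * C) * (1 + cmod (Ln z)) powr (- 1 - \<epsilon>)"
      by (rule exI[of _ 1], rule conjI[OF zero_less_one], rule ballI, rule bd)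
  qed
  ultimately show ?thesis unfolding Hinf0_def Hinf_def mem_Collect_eq by (intro conjI)
qed

lemma elog_approx: "elog (on_reals (approx k u)) = convolution (elog u) (\<lambda>y. of_real (gaussian k y))"
proof
  fix x
  have "elog (on_reals (approx k u)) x = approx k u (of_real (exp x))" by (simp only: elog_def)
  also have "\<dots> = gauss_ext k (elog u) (of_real x)" unfolding approx_def by (subst Ln_of_real) simp_all
  finally show "elog (on_reals (approx k u)) x = convolution (elog u) (\<lambda>y. of_real (gaussian k y)) x"
    unfolding gauss_ext_of_real .
qed

lemma gaussian_integrable: "integrable lborel (gaussian k)"
  unfolding gaussian_def
  using lborel_integrable_real_affine[of std_normal_density "real (Suc k)" 0] by simp

lemma gaussian_scale: "(LBINT y. f (real (Suc k) * y) * gaussian k y) = (LBINT y. f y * std_normal_density y)" for f :: "real \<Rightarrow> real"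
  using lborel_integral_real_affine[of "real (Suc k)" "\<lambda>y. f y * std_normal_density y" 0] by (simp add: gaussian_def mult_ac)

lemma gaussian_integral: "(LBINT y. gaussian k y) = 1"
  using gaussian_scale[of "\<lambda>_. 1" k] by simp

lemma gaussian_nonneg: "0 \<le> gaussian k y" by (simp add: gaussian_def)

text \<open>Concentration of the Gaussians: the weighted first moment is \<open>O(1/(k+1))\<close> by
  scaling.\<close>

lemma gaussian_moment:
  obtains m where "m \<ge> 0" "\<And>k. integrable lborel (\<lambda>y. \<bar>y\<bar> * (1 + y\<^sup>2) * gaussian k y)"
    "\<And>k. (LBINT y. \<bar>y\<bar> * (1 + y\<^sup>2) * gaussian k y) \<le> m / real (Suc k)"
proof -
  let ?w = "\<lambda>y::real. \<bar>y\<bar> * (1 + y\<^sup>2)"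
  have i0: "integrable lborel (\<lambda>y. ?w y * std_normal_density y)"
  proof -
    have "integrable lborel (\<lambda>y. std_normal_density y * \<bar>y\<bar> ^ 1 + std_normal_density y * \<bar>y\<bar> ^ 3)"
      by (intro Bochner_Integration.integrable_add integrable_std_normal_moment_abs)
    moreover have "?w y * std_normal_density y = std_normal_density y * \<bar>y\<bar> ^ 1 + std_normal_density y * \<bar>y\<bar> ^ 3" for y
      by (simp add: algebra_simps power2_eq_square power3_eq_cube flip: abs_mult)
    ultimately show ?thesis by simp
  qed
  define m where "m = (LBINT y. ?w y * std_normal_density y)"
  have ik: "integrable lborel (\<lambda>y. ?w (real (Suc k) * y) * gaussian k y)" for k
  proof -
    define q where "q = real (Suc k)"
    have "q \<noteq> 0" by (simp add: q_def)
    from lborel_integrable_real_affine[OF i0 this, of 0]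
    have "integrable lborel (\<lambda>y. q * (?w (q * y) * std_normal_density (q * y)))" by (intro integrable_mult_right) simp
    then show ?thesis unfolding gaussian_def q_def[symmetric] by (simp add: mult_ac)
  qed
  have le: "?w y * gaussian k y \<le> (1 / real (Suc k)) * (?w (real (Suc k) * y) * gaussian k y)" for k y
  proof -
    have "1 * y\<^sup>2 \<le> (real (Suc k))\<^sup>2 * y\<^sup>2" by (intro mult_right_mono) (auto simp: one_le_power)
    then have "\<bar>y\<bar> * (1 + y\<^sup>2) \<le> \<bar>y\<bar> * (1 + (real (Suc k) * y)\<^sup>2)" unfolding power_mult_distrib by (intro mult_left_mono) simp_all
    also have "\<dots> = (1 / real (Suc k)) * ?w (real (Suc k) * y)" unfolding abs_mult by (simp del: of_nat_Suc)
    finally have "?w y \<le> (1 / real (Suc k)) * ?w (real (Suc k) * y)" .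
    from mult_right_mono[OF this gaussian_nonneg[of k y]] show ?thesis unfolding mult.assoc .
  qed
  have i: "integrable lborel (\<lambda>y. ?w y * gaussian k y)" for k
  proof (rule Bochner_Integration.integrable_bound[OF integrable_mult_right[OF ik, of "1 / real (Suc k)"]])
    show "(\<lambda>y. ?w y * gaussian k y) \<in> borel_measurable lborel"
      unfolding gaussian_def std_normal_density_def by measurable
    show "AE y in lborel. norm (?w y * gaussian k y) \<le> norm (1 / real (Suc k) * (?w (real (Suc k) * y) * gaussian k y))" for k
    proof (intro always_eventually allI)
      fix y
      have "0 \<le> ?w y * gaussian k y" by (intro mult_nonneg_nonneg gaussian_nonneg) auto
      show "norm (?w y * gaussian k y) \<le> norm (1 / real (Suc k) * (?w (real (Suc k) * y) * gaussian k y))"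
        unfolding real_norm_def abs_of_nonneg[OF \<open>0 \<le> ?w y * gaussian k y\<close>] by (rule order_trans[OF le abs_ge_self])
    qed
  qed
  have "(LBINT y. ?w y * gaussian k y) \<le> (LBINT y. (1 / real (Suc k)) * (?w (real (Suc k) * y) * gaussian k y))" for k
    using i ik le by (intro integral_mono) auto
  also have "(LBINT y. (1 / real (Suc k)) * (?w (real (Suc k) * y) * gaussian k y)) = m / real (Suc k)" for k
    using gaussian_scale[of ?w k] by (simp add: m_def)
  finally have "(LBINT y. ?w y * gaussian k y) \<le> m / real (Suc k)" for k .
  moreover have "m \<ge> 0" unfolding m_def by (intro integral_nonneg_AE) auto
  ultimately show ?thesis using that i by blast
qed

lemma test_weight: assumes "test v" obtains M where "M \<ge> 0" "\<And>x. cmod (v x) \<le> M / (1 + x\<^sup>2)"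
proof -
  obtain a where a: "\<And>t. a < \<bar>t\<bar> \<Longrightarrow> v t = 0" using assms unfolding test_def by blast
  obtain B where B: "\<And>x. cmod (v x) \<le> B" using test_bounded[OF assms] by blast
  have B0: "0 \<le> B" using B norm_ge_zero order_trans by blast
  have "cmod (v x) \<le> B * (1 + a\<^sup>2) / (1 + x\<^sup>2)" for x
  proof (cases "a < \<bar>x\<bar>")
    case True then show ?thesis using a B0 by (simp add: add_nonneg_nonneg)
  next
    case False
    then have "x\<^sup>2 \<le> a\<^sup>2" using abs_le_square_iff[of x a] by simp
    have p: "0 < 1 + x\<^sup>2" by (simp add: add_pos_nonneg)
    have "cmod (v x) * (1 + x\<^sup>2) \<le> B * (1 + a\<^sup>2)" using B \<open>x\<^sup>2 \<le> a\<^sup>2\<close> B0 p by (intro mult_mono) auto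
    then show ?thesis using p by (simp add: pos_le_divide_eq)
  qed
  then show ?thesis using that[of "B * (1 + a\<^sup>2)"] B0 by (simp add: add_nonneg_nonneg)
qed

lemma test_nd: "test m \<Longrightarrow> test (nd k m)"
  by (induction k) (auto intro: test_D)

text \<open>The mean value inequality on the segment from \<open>x - y\<close> to \<open>x\<close>, with
  the weight transported to \<open>x\<close>.\<close>

lemma test_modulus:
  assumes v: "test v" and M: "M \<ge> 0" "\<And>x. cmod (D v x) \<le> M / (1 + x\<^sup>2)"
  shows "cmod (v (x - y) - v x) \<le> 2 * M / (1 + x\<^sup>2) * (\<bar>y\<bar> * (1 + y\<^sup>2))"
proof -
  have p: "0 < 1 + x\<^sup>2" for x :: real by (simp add: add_pos_nonneg)
  have "cmod (v (x - y) - v x) \<le> (2 * M * (1 + y\<^sup>2) / (1 + x\<^sup>2)) * norm ((x - y) - x)"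
  proof (rule differentiable_bound[of "closed_segment (x - y) x" v "\<lambda>\<xi> h. h *\<^sub>R D v \<xi>"])
    fix \<xi> assume xi: "\<xi> \<in> closed_segment (x - y) x"
    show "(v has_derivative (\<lambda>h. h *\<^sub>R D v \<xi>)) (at \<xi> within closed_segment (x - y) x)"
      using smooth_has_D[OF test_smooth[OF v], of \<xi>] by (simp add: has_vector_derivative_def has_derivative_at_withinI)
    have "\<bar>x - \<xi>\<bar> \<le> \<bar>y\<bar>" using xi by (auto simp: closed_segment_eq_real_ivl split: if_splits)
    then have "(x - \<xi>)\<^sup>2 \<le> y\<^sup>2" by (simp add: abs_le_square_iff)
    then have "2 * (1 + \<xi>\<^sup>2) * (1 + (x - \<xi>)\<^sup>2) \<le> 2 * (1 + \<xi>\<^sup>2) * (1 + y\<^sup>2)" using p[of \<xi>] by (intro mult_left_mono) auto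
    then have "1 + x\<^sup>2 \<le> 2 * (1 + \<xi>\<^sup>2) * (1 + y\<^sup>2)" using weight_shift[of x \<xi>] by linarith
    then have "M * (1 + x\<^sup>2) \<le> M * (2 * (1 + \<xi>\<^sup>2) * (1 + y\<^sup>2))" using M(1) by (rule mult_left_mono)
    then have "M / (1 + \<xi>\<^sup>2) \<le> 2 * M * (1 + y\<^sup>2) / (1 + x\<^sup>2)"
      by (intro frac_cross p) (simp only: mult_ac)
    then have *: "cmod (D v \<xi>) \<le> 2 * M * (1 + y\<^sup>2) / (1 + x\<^sup>2)" using M(2)[of \<xi>] by linarith
    have "0 \<le> 2 * M * (1 + y\<^sup>2) / (1 + x\<^sup>2)" using M(1) p[of x] p[of y] by simp
    then show "onorm (\<lambda>h. h *\<^sub>R D v \<xi>) \<le> 2 * M * (1 + y\<^sup>2) / (1 + x\<^sup>2)"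
      using mult_left_mono[OF *] by (intro onorm_bound) (auto simp: mult.commute)
  qed auto
  then show ?thesis by (simp add: mult_ac)
qed

text \<open>Derivatives commute with the convolution, so the error is the average of \<open>v (x - y) -
  v x\<close> for a derivative \<open>v\<close>; the modulus of continuity reduces it to the
  weighted moment of the Gaussian.\<close>

lemma approx_error:
  assumes u: "test (elog u)"
  obtains M where "M \<ge> 0" "\<And>j k x. j \<le> N \<Longrightarrow>
    cmod (nd j (\<lambda>x. elog (on_reals (approx k u)) x - elog u x) x) \<le> M / real (Suc k) / (1 + x\<^sup>2)"
proof -
  let ?U = "elog u" and ?G = "\<lambda>k y. complex_of_real (gaussian k y)"
  have iG: "integrable lborel (?G k)" for k using gaussian_integrable by (rule integrable_of_real)
  have IG: "(LBINT y. ?G k y) = 1" for k using gaussian_integral[of k] by (simp add: integral_of_real)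
  obtain m where m: "m \<ge> 0" "\<And>k. integrable lborel (\<lambda>y. \<bar>y\<bar> * (1 + y\<^sup>2) * gaussian k y)"
    "\<And>k. (LBINT y. \<bar>y\<bar> * (1 + y\<^sup>2) * gaussian k y) \<le> m / real (Suc k)" using gaussian_moment by blast
  have "\<exists>M\<ge>0. \<forall>x. cmod (D (nd j ?U) x) \<le> M / (1 + x\<^sup>2)" for j
    using test_weight[OF test_D[OF test_nd[OF u]], of j] by metis
  then obtain Mf where Mf: "\<And>j. Mf j \<ge> 0" "\<And>j x. cmod (D (nd j ?U) x) \<le> Mf j / (1 + x\<^sup>2)" by metis
  define M0 where "M0 = (\<Sum>j\<le>N. Mf j)"
  have Mle: "Mf j \<le> M0" if "j \<le> N" for j unfolding M0_def using that Mf(1) by (intro member_le_sum) auto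
  have M00: "0 \<le> M0" unfolding M0_def using Mf(1) by (intro sum_nonneg) auto
  have "cmod (nd j (\<lambda>x. elog (on_reals (approx k u)) x - ?U x) x) \<le> 2 * M0 * m / real (Suc k) / (1 + x\<^sup>2)" if j: "j \<le> N" for j k x
  proof -
    let ?v = "nd j ?U"
    have tv: "test ?v" by (rule test_nd[OF u])
    obtain B where B: "\<And>x. cmod (?v x) \<le> B" using test_bounded[OF tv] by blast
    have ci: "integrable lborel (\<lambda>y. ?v (x - y) * ?G k y)"
      by (rule conv_integrable[OF Cb_continuous[OF test_Cb[OF tv]] B iG])
    have p: "0 < 1 + x\<^sup>2" by (simp add: add_pos_nonneg)
    have "nd j (\<lambda>x. elog (on_reals (approx k u)) x - ?U x) x = convolution ?v (?G k) x - ?v x"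
      unfolding elog_approx using nd_diff[OF Cb_smooth[OF conv_Cb[OF test_Cb[OF u] iG[of k]]] test_smooth[OF u], of j]
      by (simp add: nd_conv[OF test_Cb[OF u] iG])
    also have "\<dots> = (LBINT y. (?v (x - y) - ?v x) * ?G k y)"
      unfolding convolution_def left_diff_distrib using ci iG[of k] IG[of k] by simp
    finally have eq: "nd j (\<lambda>x. elog (on_reals (approx k u)) x - ?U x) x = (LBINT y. (?v (x - y) - ?v x) * ?G k y)" .
    have "cmod (LBINT y. (?v (x - y) - ?v x) * ?G k y) \<le> (LBINT y. cmod ((?v (x - y) - ?v x) * ?G k y))" by (rule integral_norm_bound)
    also have "\<dots> \<le> (LBINT y. 2 * M0 / (1 + x\<^sup>2) * (\<bar>y\<bar> * (1 + y\<^sup>2) * gaussian k y))"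
    proof (rule integral_mono)
      show "integrable lborel (\<lambda>y. cmod ((?v (x - y) - ?v x) * ?G k y))"
        unfolding left_diff_distrib
        by (rule integrable_norm[OF Bochner_Integration.integrable_diff[OF ci integrable_mult_right[OF iG]]])
      show "integrable lborel (\<lambda>y. 2 * M0 / (1 + x\<^sup>2) * (\<bar>y\<bar> * (1 + y\<^sup>2) * gaussian k y))" by (rule integrable_mult_right[OF m(2)])
      fix y
      have "cmod (D ?v x) \<le> M0 / (1 + x\<^sup>2)" for x
        by (rule order_trans[OF Mf(2) divide_right_mono[OF Mle[OF j]]]) (simp add: add_nonneg_nonneg)
      from test_modulus[OF tv M00 this, of x y]
      have "cmod (?v (x - y) - ?v x) * gaussian k y \<le> 2 * M0 / (1 + x\<^sup>2) * (\<bar>y\<bar> * (1 + y\<^sup>2)) * gaussian k y"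
        by (rule mult_right_mono[OF _ gaussian_nonneg])
      then show "cmod ((?v (x - y) - ?v x) * ?G k y) \<le> 2 * M0 / (1 + x\<^sup>2) * (\<bar>y\<bar> * (1 + y\<^sup>2) * gaussian k y)"
        using gaussian_nonneg[of k y] by (simp only: norm_mult norm_of_real abs_of_nonneg mult.assoc)
    qed
    also have "\<dots> = 2 * M0 / (1 + x\<^sup>2) * (LBINT y. \<bar>y\<bar> * (1 + y\<^sup>2) * gaussian k y)" by simp
    also have "\<dots> \<le> 2 * M0 / (1 + x\<^sup>2) * (m / real (Suc k))" using m(3) M00 p by (intro mult_left_mono) auto
    also have "\<dots> = 2 * M0 * m / real (Suc k) / (1 + x\<^sup>2)" by (simp add: mult_ac)
    finally show ?thesis unfolding eq .
  qed
  then show ?thesis using that[of "2 * M0 * m"] M00 m(1) by auto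
qed

section \<open>The calculus of test functions\<close>

lemma Hinf0_lincomb:
  assumes "f \<in> Hinf0 \<theta>" "g \<in> Hinf0 \<theta>" shows "(\<lambda>z. f z + c * g z) \<in> Hinf0 \<theta>"
proof -
  obtain C e where C: "C > 0" "e > 0" "\<And>z. z \<in> sector \<theta> \<Longrightarrow> cmod (f z) \<le> C * (1 + cmod (Ln z)) powr (- 1 - e)"
    using assms(1) unfolding Hinf0_def by blast
  obtain C' e' where C': "C' > 0" "e' > 0" "\<And>z. z \<in> sector \<theta> \<Longrightarrow> cmod (g z) \<le> C' * (1 + cmod (Ln z)) powr (- 1 - e')"
    using assms(2) unfolding Hinf0_def by blast
  define d where "d = min e e'"
  have le: "cmod (f z + c * g z) \<le> (C + cmod c * C') * (1 + cmod (Ln z)) powr (- 1 - d)" if z: "z \<in> sector \<theta>" for z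
  proof -
    have p: "(1 + cmod (Ln z)) powr (- 1 - e) \<le> (1 + cmod (Ln z)) powr (- 1 - d)"
      "(1 + cmod (Ln z)) powr (- 1 - e') \<le> (1 + cmod (Ln z)) powr (- 1 - d)"
      by (auto intro!: powr_mono simp: d_def)
    have "cmod (f z + c * g z) \<le> cmod (f z) + cmod c * cmod (g z)" by (metis norm_triangle_ineq norm_mult)
    also have "\<dots> \<le> C * (1 + cmod (Ln z)) powr (- 1 - d) + cmod c * (C' * (1 + cmod (Ln z)) powr (- 1 - d))"
      using C C' z by (intro add_mono mult_left_mono order_trans[OF C(3)[OF z]] order_trans[OF C'(3)[OF z]] p) auto
    finally show ?thesis by (simp add: ring_distribs)
  qed
  have "bounded ((\<lambda>z. f z + c * g z) ` sector \<theta>)"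
  proof -
    have "bounded (f ` sector \<theta>)" "bounded (g ` sector \<theta>)" using assms by (auto simp: Hinf0_def Hinf_def)
    then obtain B B' where "\<And>z. z \<in> sector \<theta> \<Longrightarrow> cmod (f z) \<le> B" "\<And>z. z \<in> sector \<theta> \<Longrightarrow> cmod (g z) \<le> B'"
      by (auto simp: bounded_iff)
    then have "cmod (f z + c * g z) \<le> B + cmod c * B'" if "z \<in> sector \<theta>" for z
      using that by (intro order_trans[OF norm_triangle_ineq] add_mono) (auto simp: norm_mult intro: mult_left_mono)
    then show ?thesis unfolding bounded_iff by blast
  qed
  moreover have "(\<lambda>z. f z + c * g z) holomorphic_on sector \<theta>"
    using assms by (intro holomorphic_intros) (auto simp: Hinf0_def Hinf_def)
  moreover have "C + cmod c * C' > 0" "d > 0" using C(1,2) C'(1,2) by (auto simp: d_def add_pos_nonneg)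
  ultimately show ?thesis unfolding Hinf0_def Hinf_def using le by blast
qed

text \<open>Convergence of \<open>N\<close> derivatives in the weighted uniform norm. It is stable under
  products with functions in \<open>Cb\<close> and implies convergence in
  \<open>mihlin1\<close>.\<close>

definition weighted_conv :: "nat \<Rightarrow> (nat \<Rightarrow> real \<Rightarrow> complex) \<Rightarrow> (real \<Rightarrow> complex) \<Rightarrow> bool" where
  "weighted_conv N G U \<longleftrightarrow> (\<exists>e. e \<longlonglongrightarrow> 0 \<and> (\<forall>k j x. j \<le> N \<longrightarrow> cmod (nd j (\<lambda>x. G k x - U x) x) \<le> e k / (1 + x\<^sup>2)))"

lemma weighted_conv_approx:
  assumes u: "test (elog u)" shows "weighted_conv N (\<lambda>k. elog (on_reals (approx k u))) (elog u)"
proof (rule approx_error[OF u, of N])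
  fix M assume M: "\<And>j k x. j \<le> N \<Longrightarrow>
    cmod (nd j (\<lambda>x. elog (on_reals (approx k u)) x - elog u x) x) \<le> M / real (Suc k) / (1 + x\<^sup>2)"
  have l: "(\<lambda>k. M / real (Suc k)) \<longlonglongrightarrow> 0" by (rule lim_const_over_n[THEN LIMSEQ_Suc])
  show ?thesis unfolding weighted_conv_def
    by (rule exI[of _ "\<lambda>k. M / real (Suc k)"], rule conjI[OF l], intro allI impI, rule M)
qed

lemma weighted_conv_mult:
  assumes "weighted_conv N G U" "Cb h" "\<And>k. Cb (G k)" "Cb U"
  shows "weighted_conv N (\<lambda>k x. h x * G k x) (\<lambda>x. h x * U x)"
proof -
  obtain e where e: "e \<longlonglongrightarrow> 0" "\<And>k j x. j \<le> N \<Longrightarrow> cmod (nd j (\<lambda>x. G k x - U x) x) \<le> e k / (1 + x\<^sup>2)"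
    using assms(1) unfolding weighted_conv_def by blast
  obtain B where B: "B \<ge> 0" "\<And>j x. j \<le> N \<Longrightarrow> cmod (nd j h x) \<le> B" using Cb_bounds_upto[OF assms(2)] by blast
  have "cmod (nd j (\<lambda>x. h x * G k x - h x * U x) x) \<le> 2 ^ N * B * e k / (1 + x\<^sup>2)" if j: "j \<le> N" for j k x
  proof -
    have 0: "0 \<le> e k / (1 + x\<^sup>2)" using order_trans[OF norm_ge_zero e(2)[of 0 k x]] by simp
    have "cmod (nd j (\<lambda>x. h x * (G k x - U x)) x) \<le> 2 ^ j * (B * (e k / (1 + x\<^sup>2)))"
      using j by (intro nd_mult_bound B(2) e(2) Cb_smooth Cb_diff assms) auto
    also have "\<dots> \<le> 2 ^ N * (B * (e k / (1 + x\<^sup>2)))" using 0 B(1) j by (intro mult_right_mono power_increasing mult_nonneg_nonneg) auto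
    finally show ?thesis by (simp add: right_diff_distrib mult.assoc)
  qed
  note b = this
  have l: "(\<lambda>k. 2 ^ N * B * e k) \<longlonglongrightarrow> 0" using tendsto_mult_left[OF e(1), of "2 ^ N * B"] by simp
  show ?thesis unfolding weighted_conv_def
    by (rule exI[of _ "\<lambda>k. 2 ^ N * B * e k"], rule conjI[OF l], intro allI impI, rule b)
qed

lemma weighted_conv_lincomb:
  assumes "weighted_conv N G U" "weighted_conv N H V" "\<And>k. Cb (G k)" "Cb U" "\<And>k. Cb (H k)" "Cb V"
  shows "weighted_conv N (\<lambda>k x. G k x + c * H k x) (\<lambda>x. U x + c * V x)"
proof -
  obtain e where e: "e \<longlonglongrightarrow> 0" "\<And>k j x. j \<le> N \<Longrightarrow> cmod (nd j (\<lambda>x. G k x - U x) x) \<le> e k / (1 + x\<^sup>2)"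
    using assms(1) unfolding weighted_conv_def by blast
  obtain d where d: "d \<longlonglongrightarrow> 0" "\<And>k j x. j \<le> N \<Longrightarrow> cmod (nd j (\<lambda>x. H k x - V x) x) \<le> d k / (1 + x\<^sup>2)"
    using assms(2) unfolding weighted_conv_def by blast
  have "cmod (nd j (\<lambda>x. G k x + c * H k x - (U x + c * V x)) x) \<le> (e k + cmod c * d k) / (1 + x\<^sup>2)" if j: "j \<le> N" for j k x
  proof -
    have s: "smooth (\<lambda>x. G k x - U x)" "smooth (\<lambda>x. H k x - V x)" "smooth (\<lambda>x. c * (H k x - V x))" by (intro Cb_smooth Cb_diff Cb_cmult assms)+
    have "(\<lambda>x. G k x + c * H k x - (U x + c * V x)) = (\<lambda>x. (G k x - U x) + c * (H k x - V x))" by (simp add: algebra_simps)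
    then have eq: "nd j (\<lambda>x. G k x + c * H k x - (U x + c * V x)) x = nd j (\<lambda>x. G k x - U x) x + c * nd j (\<lambda>x. H k x - V x) x"
      using nd_add[OF s(1,3), of j] nd_cmult[OF s(2), of j c] by simp
    have "cmod (nd j (\<lambda>x. G k x + c * H k x - (U x + c * V x)) x)
        \<le> cmod (nd j (\<lambda>x. G k x - U x) x) + cmod c * cmod (nd j (\<lambda>x. H k x - V x) x)"
      unfolding eq norm_mult[symmetric] by (rule norm_triangle_ineq)
    also have "\<dots> \<le> e k / (1 + x\<^sup>2) + cmod c * (d k / (1 + x\<^sup>2))" by (intro add_mono mult_left_mono e(2) d(2) j norm_ge_zero)
    also have "\<dots> = (e k + cmod c * d k) / (1 + x\<^sup>2)" by (simp add: add_divide_distrib)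
    finally show ?thesis .
  qed
  note b = this
  have l: "(\<lambda>k. e k + cmod c * d k) \<longlonglongrightarrow> 0" using tendsto_add[OF e(1) tendsto_mult_left[OF d(1), of "cmod c"]] by simp
  show ?thesis unfolding weighted_conv_def
    by (rule exI[of _ "\<lambda>k. e k + cmod c * d k"], rule conjI[OF l], intro allI impI, rule b)
qed

context mihlin_classes
begin

text \<open>The weight is comparable to \<open>1 + n\<^sup>2\<close> on the \<open>n\<close>-th dyadic
  interval, hence summable over \<open>n\<close>.\<close>

lemma weighted_mihlin1:
  obtains K where "K \<ge> 0" "\<And>f c. Cb (elog f) \<Longrightarrow> (\<And>j x. j \<le> N \<Longrightarrow> cmod (nd j (elog f) x) \<le> c / (1 + x\<^sup>2)) \<Longrightarrow>
     f \<in> mihlin1 \<phi> \<eta> \<alpha> \<and> mihlin1_norm \<phi> \<eta> \<alpha> f \<le> K * c"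
proof -
  obtain K where K: "K \<ge> 0" "\<And>f b. Cb (elog f) \<Longrightarrow>
     (\<And>n j x. j \<le> N \<Longrightarrow> \<bar>x - real_of_int n * ln 2\<bar> \<le> ln 2 \<Longrightarrow> cmod (nd j (elog f) x) \<le> b n) \<Longrightarrow> b summable_on UNIV \<Longrightarrow>
     f \<in> mihlin1 \<phi> \<eta> \<alpha> \<and> mihlin1_norm \<phi> \<eta> \<alpha> f \<le> K * infsum b UNIV" using mihlin1_local_bounds by blast
  define q where "q n = 9 / (1 + (real_of_int n)\<^sup>2)" for n :: int
  have q0: "0 \<le> q n" for n unfolding q_def by (intro divide_nonneg_nonneg add_nonneg_nonneg) auto
  have qs: "q summable_on UNIV"
  proof -
    have "summable (\<lambda>n. 1 / (real (Suc n))\<^sup>2)"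
      using inverse_power_summable[of 2] summable_Suc_iff[of "\<lambda>n. inverse ((real n)\<^sup>2)"] by (simp add: inverse_eq_divide)
    then have "summable (\<lambda>n. 18 * (1 / (real (Suc n))\<^sup>2))" by (rule summable_mult)
    then have "(\<lambda>n. 18 * (1 / (real (Suc n))\<^sup>2)) summable_on UNIV" by (intro norm_summable_imp_summable_on) simp
    then have s: "(\<lambda>n::int. 18 * (1 / (real (Suc (nat \<bar>n\<bar>)))\<^sup>2)) summable_on UNIV" by (rule summable_on_int_abs)
    show ?thesis
    proof (rule summable_on_comparison_test[OF s])
      fix n :: int
      define a where "a = \<bar>real_of_int n\<bar>"
      have a: "0 \<le> a" "real (Suc (nat \<bar>n\<bar>)) = 1 + a" "(real_of_int n)\<^sup>2 = a\<^sup>2" by (auto simp: a_def)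
      have "(1 + a)\<^sup>2 \<le> 2 * (1 + a\<^sup>2)" using zero_le_power2[of "1 - a"] by (simp add: power2_eq_square algebra_simps)
      then have "9 / (1 + a\<^sup>2) \<le> 18 / (1 + a)\<^sup>2" using a(1) by (intro frac_cross) (auto simp: add_pos_nonneg)
      then show "q n \<le> 18 * (1 / (real (Suc (nat \<bar>n\<bar>)))\<^sup>2)" unfolding q_def a by simp
    qed (use q0 in auto)
  qed
  have "f \<in> mihlin1 \<phi> \<eta> \<alpha> \<and> mihlin1_norm \<phi> \<eta> \<alpha> f \<le> (K * infsum q UNIV) * c"
    if f: "Cb (elog f)" and b: "\<And>j x. j \<le> N \<Longrightarrow> cmod (nd j (elog f) x) \<le> c / (1 + x\<^sup>2)" for f c
  proof -
    have "0 \<le> c" using order_trans[OF norm_ge_zero b[of 0 0]] by simp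
    have "cmod (nd j (elog f) x) \<le> c * q n" if j: "j \<le> N" and x: "\<bar>x - real_of_int n * ln 2\<bar> \<le> ln 2" for j x n
    proof -
      define t where "t = \<bar>real_of_int n\<bar>"
      have t: "0 \<le> t" by (simp add: t_def)
      have "\<bar>real_of_int n * ln 2\<bar> \<le> \<bar>x\<bar> + ln 2" using x by linarith
      then have "t * ln 2 \<le> \<bar>x\<bar> + ln 2" by (simp add: abs_mult t_def)
      moreover have "t * (2/3) \<le> t * ln 2" using ln2_ge_two_thirds t by (intro mult_left_mono) auto
      moreover have "s \<le> 2 * (y + 1)" if "p \<le> y + L" "s * (2/3) \<le> p" "L \<le> 25/36" "0 \<le> y" for s p y L :: real
        using that by argo
      ultimately have "t \<le> 2 * (\<bar>x\<bar> + 1)" using ln2_le_25_over_36 abs_ge_zero[of x] by blast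
      then have "t\<^sup>2 \<le> (2 * (\<bar>x\<bar> + 1))\<^sup>2" using t by (intro power_mono) auto
      also have "\<dots> \<le> 8 * (1 + x\<^sup>2)"
        using zero_le_power2[of "1 - \<bar>x\<bar>"] by (simp add: power2_eq_square algebra_simps)
      finally have t8: "t\<^sup>2 \<le> 8 * (1 + x\<^sup>2)" .
      have l: "1 + a \<le> 9 * (1 + b)" if "a \<le> 8 * (1 + b)" "0 \<le> b" for a b :: real using that by argo
      have "1 + t\<^sup>2 \<le> 9 * (1 + x\<^sup>2)" by (rule l[OF t8 zero_le_power2])
      then have "1 + (real_of_int n)\<^sup>2 \<le> 9 * (1 + x\<^sup>2)" by (simp add: t_def)
      then have "1 / (1 + x\<^sup>2) \<le> q n" unfolding q_def by (intro frac_cross) (auto simp: add_pos_nonneg)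
      then have "c * (1 / (1 + x\<^sup>2)) \<le> c * q n" using \<open>0 \<le> c\<close> by (rule mult_left_mono)
      then show ?thesis using b[OF j, of x] by simp
    qed
    note * = K(2)[OF f this summable_on_cmult_right[OF qs]]
    have eq: "infsum (\<lambda>n. c * q n) UNIV = c * infsum q UNIV" by (rule infsum_cmult_right[OF qs])
    show ?thesis using *[unfolded eq] by (simp add: mult_ac)
  qed
  note main = this
  show ?thesis
  proof (rule that[of "K * infsum q UNIV"])
    show "0 \<le> K * infsum q UNIV" using K(1) q0 by (intro mult_nonneg_nonneg infsum_nonneg) auto
  qed (fact main)
qed

lemma mihlin1_diff:
  assumes "Cb (elog f)" "Cb (elog g)" "f \<in> mihlin1 \<phi> \<eta> \<alpha>" "g \<in> mihlin1 \<phi> \<eta> \<alpha>"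
  shows "(\<lambda>t. f t - g t) \<in> mihlin1 \<phi> \<eta> \<alpha>"
    "mihlin1_norm \<phi> \<eta> \<alpha> (\<lambda>t. f t - g t) \<le> mihlin1_norm \<phi> \<eta> \<alpha> f + mihlin1_norm \<phi> \<eta> \<alpha> g"
  using mihlin1_lincomb[OF assms, of "-1"] by simp_all

lemma weighted_conv_mihlin1:
  assumes "weighted_conv N (\<lambda>k. elog (g k)) (elog u)" "\<And>k. Cb (elog (g k))" "Cb (elog u)"
  shows "(\<lambda>t. u t - g k t) \<in> mihlin1 \<phi> \<eta> \<alpha>" "(\<lambda>t. g k t - u t) \<in> mihlin1 \<phi> \<eta> \<alpha>"
    "(\<lambda>k. mihlin1_norm \<phi> \<eta> \<alpha> (\<lambda>t. u t - g k t)) \<longlonglongrightarrow> 0"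
    "(\<lambda>k. mihlin1_norm \<phi> \<eta> \<alpha> (\<lambda>t. g k t - u t)) \<longlonglongrightarrow> 0"
proof -
  obtain K where K: "K \<ge> 0" "\<And>f c. Cb (elog f) \<Longrightarrow> (\<And>j x. j \<le> N \<Longrightarrow> cmod (nd j (elog f) x) \<le> c / (1 + x\<^sup>2)) \<Longrightarrow>
     f \<in> mihlin1 \<phi> \<eta> \<alpha> \<and> mihlin1_norm \<phi> \<eta> \<alpha> f \<le> K * c" using weighted_mihlin1 by blast
  obtain e where e: "e \<longlonglongrightarrow> 0" "\<And>k j x. j \<le> N \<Longrightarrow> cmod (nd j (\<lambda>x. elog (g k) x - elog u x) x) \<le> e k / (1 + x\<^sup>2)"
    using assms(1) unfolding weighted_conv_def by blast
  have C: "Cb (elog (\<lambda>t. g k t - u t))" "Cb (elog (\<lambda>t. u t - g k t))" for k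
    unfolding elog_diff by (intro Cb_diff assms)+
  have "cmod (nd j (\<lambda>x. elog u x - elog (g k) x) x) = cmod (nd j (\<lambda>x. elog (g k) x - elog u x) x)" for j k x
    using nd_diff[OF Cb_smooth Cb_smooth, OF assms(3) assms(2)[of k], of j] nd_diff[OF Cb_smooth Cb_smooth, OF assms(2)[of k] assms(3), of j]
    by (simp add: norm_minus_commute)
  then have e': "j \<le> N \<Longrightarrow> cmod (nd j (\<lambda>x. elog u x - elog (g k) x) x) \<le> e k / (1 + x\<^sup>2)" for j k x using e(2) by simp
  have 1: "(\<lambda>t. g k t - u t) \<in> mihlin1 \<phi> \<eta> \<alpha> \<and> mihlin1_norm \<phi> \<eta> \<alpha> (\<lambda>t. g k t - u t) \<le> K * e k" for k
    by (rule K(2)[OF C(1)], unfold elog_diff, rule e(2))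
  have 2: "(\<lambda>t. u t - g k t) \<in> mihlin1 \<phi> \<eta> \<alpha> \<and> mihlin1_norm \<phi> \<eta> \<alpha> (\<lambda>t. u t - g k t) \<le> K * e k" for k
    by (rule K(2)[OF C(2)], unfold elog_diff, rule e')
  show "(\<lambda>t. u t - g k t) \<in> mihlin1 \<phi> \<eta> \<alpha>" "(\<lambda>t. g k t - u t) \<in> mihlin1 \<phi> \<eta> \<alpha>" using 1 2 by blast+
  have Ke: "(\<lambda>k. K * e k) \<longlonglongrightarrow> 0" using tendsto_mult_left[OF e(1), of K] by simp
  show "(\<lambda>k. mihlin1_norm \<phi> \<eta> \<alpha> (\<lambda>t. u t - g k t)) \<longlonglongrightarrow> 0"
    by (rule tendsto_sandwich[OF _ _ tendsto_const Ke]) (use 2 mihlin1_norm_nonneg[OF C(2)] in auto)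
  show "(\<lambda>k. mihlin1_norm \<phi> \<eta> \<alpha> (\<lambda>t. g k t - u t)) \<longlonglongrightarrow> 0"
    by (rule tendsto_sandwich[OF _ _ tendsto_const Ke]) (use 1 mihlin1_norm_nonneg[OF C(1)] in auto)
qed

lemma test_mihlin1: assumes u: "test (elog u)" shows "u \<in> mihlin1 \<phi> \<eta> \<alpha>"
proof -
  have C: "Cb (elog (on_reals (approx k u)))" for k
    using Hinf_Cb[OF Hinf0_Hinf[OF approx_Hinf0[OF u, of 1 k]]] pi_gt3 by simp
  have m: "on_reals (approx 0 u) \<in> mihlin1 \<phi> \<eta> \<alpha>"
    using approx_Hinf0[OF u, of 1 0] pi_gt3 by (intro Hinf0_mihlin1(2)[of _ 1]) auto
  have d: "(\<lambda>t. u t - on_reals (approx 0 u) t) \<in> mihlin1 \<phi> \<eta> \<alpha>"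
    by (rule weighted_conv_mihlin1(1)[OF weighted_conv_approx[OF u] C test_Cb[OF u]])
  have "Cb (elog (\<lambda>t. u t - on_reals (approx 0 u) t))" unfolding elog_diff by (intro Cb_diff C test_Cb u)
  from mihlin1_lincomb(1)[OF this C d m, of 1] show ?thesis by simp
qed

end

locale mihlin1_calculus = mihlin_classes \<phi> \<eta> \<alpha> N + zero_sectorial_calculus A
  for \<phi> \<eta> \<alpha> N and A :: "('a::complex_banach \<times> 'a) set" +
  assumes calculus: "has_mihlin1_calculus \<phi> \<eta> \<alpha> A"
begin

definition calc :: "(real \<Rightarrow> complex) \<Rightarrow> ('a \<Rightarrow>\<^sub>L 'a)" where
  "calc = mihlin1_calc \<phi> \<eta> \<alpha> A"

abbreviation mn :: "(real \<Rightarrow> complex) \<Rightarrow> real" where "mn \<equiv> mihlin1_norm \<phi> \<eta> \<alpha>"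

lemma estimate_const:
  assumes "mihlin1_estimate \<phi> \<eta> \<alpha> A \<omega>" "0 < \<omega>" "\<omega> < pi"
  obtains C where "C \<ge> 0" "\<And>f. f \<in> Hinf0 \<omega> \<Longrightarrow> norm (hcalc \<omega> A f) \<le> C * mn (on_reals f)"
    "\<And>f g. f \<in> Hinf0 \<omega> \<Longrightarrow> g \<in> Hinf0 \<omega> \<Longrightarrow> norm (hcalc \<omega> A f - hcalc \<omega> A g) \<le> C * mn (\<lambda>t. on_reals f t - on_reals g t)"
proof -
  obtain C where C: "\<And>f. f \<in> Hinf0 \<omega> \<Longrightarrow> norm (hcalc \<omega> A f) \<le> C * mn (on_reals f)"
    using assms(1) unfolding mihlin1_estimate_def by blast
  have 1: "norm (hcalc \<omega> A f) \<le> \<bar>C\<bar> * mn (on_reals f)" if f: "f \<in> Hinf0 \<omega>" for f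
  proof -
    have "0 \<le> mn (on_reals f)" by (rule mihlin1_norm_nonneg[OF Hinf0_mihlin1(1)[OF f assms(2,3)]])
    then have "C * mn (on_reals f) \<le> \<bar>C\<bar> * mn (on_reals f)" by (intro mult_right_mono) auto
    then show ?thesis using C[OF f] by (rule order_trans[rotated])
  qed
  have 2: "norm (hcalc \<omega> A f - hcalc \<omega> A g) \<le> \<bar>C\<bar> * mn (\<lambda>t. on_reals f t - on_reals g t)" if f: "f \<in> Hinf0 \<omega>" and g: "g \<in> Hinf0 \<omega>" for f g
    using 1[OF Hinf0_lincomb[OF f g, of "of_real (-1)"]] hcalc_lincomb[OF f g assms(2), of "-1"] assms(3) by simp
  show ?thesis by (rule that[of "\<bar>C\<bar>"]) (use 1 2 in auto)
qed

lemma Cb_approx: assumes u: "test (elog u)" shows "Cb (elog (on_reals (approx k u)))"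
  using Hinf_Cb[OF Hinf0_Hinf[OF approx_Hinf0[OF u, of 1 k]]] pi_gt3 by simp

text \<open>Two approximating sequences in the \<open>mihlin1\<close> norm are close to each other, and
  the estimate of the calculus turns this into operator norm convergence.\<close>

lemma limit_unique:
  assumes \<omega>: "mihlin1_estimate \<phi> \<eta> \<alpha> A \<omega>" "0 < \<omega>" "\<omega> < pi" and u: "Cb (elog u)" "u \<in> mihlin1 \<phi> \<eta> \<alpha>"
    and g: "\<And>k. g k \<in> Hinf0 \<omega>" "(\<lambda>k. mn (\<lambda>t. u t - on_reals (g k) t)) \<longlonglongrightarrow> 0"
    and h: "\<And>k. h k \<in> Hinf0 \<omega>" "(\<lambda>k. mn (\<lambda>t. u t - on_reals (h k) t)) \<longlonglongrightarrow> 0"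
  shows "(\<lambda>k. hcalc \<omega> A (g k) - hcalc \<omega> A (h k)) \<longlonglongrightarrow> 0"
proof -
  obtain C where C: "C \<ge> 0" "\<And>f. f \<in> Hinf0 \<omega> \<Longrightarrow> norm (hcalc \<omega> A f) \<le> C * mn (on_reals f)"
    "\<And>f g. f \<in> Hinf0 \<omega> \<Longrightarrow> g \<in> Hinf0 \<omega> \<Longrightarrow> norm (hcalc \<omega> A f - hcalc \<omega> A g) \<le> C * mn (\<lambda>t. on_reals f t - on_reals g t)"
    using estimate_const[OF \<omega>] by blast
  have d: "Cb (elog (\<lambda>t. u t - on_reals f t)) \<and> (\<lambda>t. u t - on_reals f t) \<in> mihlin1 \<phi> \<eta> \<alpha>" if f: "f \<in> Hinf0 \<omega>" for f
    using mihlin1_diff(1)[OF u(1) Hinf0_mihlin1(1)[OF f \<omega>(2,3)] u(2) Hinf0_mihlin1(2)[OF f \<omega>(2,3)]]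
      Cb_diff[OF u(1) Hinf0_mihlin1(1)[OF f \<omega>(2,3)]] by (simp add: elog_diff)
  have le: "norm (hcalc \<omega> A (g k) - hcalc \<omega> A (h k)) \<le> C * (mn (\<lambda>t. u t - on_reals (h k) t) + mn (\<lambda>t. u t - on_reals (g k) t))" for k
  proof -
    have "mn (\<lambda>t. (u t - on_reals (h k) t) - (u t - on_reals (g k) t)) \<le> mn (\<lambda>t. u t - on_reals (h k) t) + mn (\<lambda>t. u t - on_reals (g k) t)"
      using d[OF g(1)[of k]] d[OF h(1)[of k]] by (intro mihlin1_diff(2)) auto
    then have "mn (\<lambda>t. on_reals (g k) t - on_reals (h k) t) \<le> mn (\<lambda>t. u t - on_reals (h k) t) + mn (\<lambda>t. u t - on_reals (g k) t)"
      by simp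
    from order_trans[OF C(3)[OF g(1) h(1)] mult_left_mono[OF this C(1)]] show ?thesis .
  qed
  have "(\<lambda>k. C * (mn (\<lambda>t. u t - on_reals (h k) t) + mn (\<lambda>t. u t - on_reals (g k) t))) \<longlonglongrightarrow> 0"
    using tendsto_mult_left[OF tendsto_add[OF h(2) g(2)], of C] by simp
  from tendsto_sandwich[OF _ _ tendsto_const this, of "\<lambda>k. norm (hcalc \<omega> A (g k) - hcalc \<omega> A (h k))"]
  have "(\<lambda>k. norm (hcalc \<omega> A (g k) - hcalc \<omega> A (h k))) \<longlonglongrightarrow> 0" using le by simp
  then show ?thesis by (rule tendsto_norm_zero_cancel)
qed

lemma approx_norm_limit: "test (elog u) \<Longrightarrow> (\<lambda>k. mn (\<lambda>t. u t - on_reals (approx k u) t)) \<longlonglongrightarrow> 0"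
  by (rule weighted_conv_mihlin1(3)[OF weighted_conv_approx Cb_approx test_Cb])

lemma approx_convergent:
  assumes \<omega>: "mihlin1_estimate \<phi> \<eta> \<alpha> A \<omega>" "0 < \<omega>" "\<omega> < pi" and u: "test (elog u)"
  shows "convergent (\<lambda>k. hcalc \<omega> A (approx k u))"
proof -
  obtain C where C: "C \<ge> 0" "\<And>f. f \<in> Hinf0 \<omega> \<Longrightarrow> norm (hcalc \<omega> A f) \<le> C * mn (on_reals f)"
    "\<And>f g. f \<in> Hinf0 \<omega> \<Longrightarrow> g \<in> Hinf0 \<omega> \<Longrightarrow> norm (hcalc \<omega> A f - hcalc \<omega> A g) \<le> C * mn (\<lambda>t. on_reals f t - on_reals g t)"
    using estimate_const[OF \<omega>] by blast
  have a: "approx k u \<in> Hinf0 \<omega>" for k using approx_Hinf0[OF u] \<omega> by simp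
  let ?d = "\<lambda>k t. u t - on_reals (approx k u) t"
  have d: "Cb (elog (?d k))" "?d k \<in> mihlin1 \<phi> \<eta> \<alpha>" for k
    using weighted_conv_mihlin1(1)[OF weighted_conv_approx[OF u] Cb_approx[OF u] test_Cb[OF u], of k] Cb_diff[OF test_Cb[OF u] Cb_approx[OF u, of k]]
    by (simp_all add: elog_diff)
  have le: "norm (hcalc \<omega> A (approx k u) - hcalc \<omega> A (approx l u)) \<le> C * (mn (?d l) + mn (?d k))" for k l
  proof -
    have "mn (\<lambda>t. ?d l t - ?d k t) \<le> mn (?d l) + mn (?d k)" by (intro mihlin1_diff(2) d)
    then have "mn (\<lambda>t. on_reals (approx k u) t - on_reals (approx l u) t) \<le> mn (?d l) + mn (?d k)" by simp
    from order_trans[OF C(3)[OF a a] mult_left_mono[OF this C(1)]] show ?thesis .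
  qed
  have "Cauchy (\<lambda>k. hcalc \<omega> A (approx k u))"
  proof (rule CauchyI)
    fix e :: real assume e: "0 < e"
    have "(\<lambda>k. C * mn (?d k)) \<longlonglongrightarrow> 0" using tendsto_mult_left[OF approx_norm_limit[OF u], of C] by simp
    then have "\<forall>\<^sub>F k in sequentially. C * mn (?d k) < e / 2" using e by (intro order_tendstoD(2)) auto
    then obtain M where M: "\<And>k. k \<ge> M \<Longrightarrow> C * mn (?d k) < e / 2" by (auto simp: eventually_sequentially)
    have "norm (hcalc \<omega> A (approx m u) - hcalc \<omega> A (approx n u)) < e" if "m \<ge> M" "n \<ge> M" for m n
      using le[of m n] M[OF that(1)] M[OF that(2)] by (simp add: distrib_left)
    then show "\<exists>M. \<forall>m\<ge>M. \<forall>n\<ge>M. norm (hcalc \<omega> A (approx m u) - hcalc \<omega> A (approx n u)) < e" by blast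
  qed
  then show ?thesis by (simp add: Cauchy_convergent_iff)
qed

text \<open>The definition of \<open>mihlin1_calc\<close> allows any angle and any approximating
  sequence. Each such sequence is compared with the Gaussian approximations at its own
  angle, and for these all angles give the same operators.\<close>

lemma calc_limit_approx:
  assumes u: "test (elog u)" and t: "0 < \<theta>" "\<theta> < pi"
  shows "(\<lambda>k. hcalc \<theta> A (approx k u)) \<longlonglongrightarrow> calc u"
proof -
  obtain w where w: "mihlin1_estimate \<phi> \<eta> \<alpha> A w" "0 < w" "w < pi" using calculus unfolding has_mihlin1_calculus_def by blast
  \<comment> \<open>the approximations belong to \<open>Hinf0 \<pi>\<close>, so the contour may have any angle\<close>
  have eq: "hcalc a A (approx k u) = hcalc b A (approx k u)" if "0 < a" "a < pi" "0 < b" "b < pi" for a b k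
  proof -
    have "hcalc pi A (approx k u) = hcalc c A (approx k u)" if "0 < c" "c < pi" for c
      using that approx_Hinf0[OF u, of pi] by (intro hcalc_angle) auto
    then show ?thesis using that by metis
  qed
  obtain T where T: "(\<lambda>k. hcalc w A (approx k u)) \<longlonglongrightarrow> T" using approx_convergent[OF w u] unfolding convergent_def by blast
  have "calc u = T" unfolding calc_def mihlin1_calc_def
  proof (rule the_equality)
    show "\<exists>\<omega> g. 0 < \<omega> \<and> \<omega> < pi \<and> mihlin1_estimate \<phi> \<eta> \<alpha> A \<omega> \<and> (\<forall>k::nat. g k \<in> Hinf0 \<omega>) \<and>
       (\<lambda>k. mn (\<lambda>t. u t - on_reals (g k) t)) \<longlonglongrightarrow> 0 \<and> (\<lambda>k. hcalc \<omega> A (g k)) \<longlonglongrightarrow> T"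
      by (rule exI[of _ w], rule exI[of _ "\<lambda>k. approx k u"])
        (use w T approx_norm_limit[OF u] approx_Hinf0[OF u] in simp)
  next
    fix S assume "\<exists>\<omega> g. 0 < \<omega> \<and> \<omega> < pi \<and> mihlin1_estimate \<phi> \<eta> \<alpha> A \<omega> \<and> (\<forall>k::nat. g k \<in> Hinf0 \<omega>) \<and>
       (\<lambda>k. mn (\<lambda>t. u t - on_reals (g k) t)) \<longlonglongrightarrow> 0 \<and> (\<lambda>k. hcalc \<omega> A (g k)) \<longlonglongrightarrow> S"
    then obtain v g where v: "0 < v" "v < pi" "mihlin1_estimate \<phi> \<eta> \<alpha> A v" "\<And>k::nat. g k \<in> Hinf0 v"
       "(\<lambda>k. mn (\<lambda>t. u t - on_reals (g k) t)) \<longlonglongrightarrow> 0" "(\<lambda>k. hcalc v A (g k)) \<longlonglongrightarrow> S" by blast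
    have a: "approx k u \<in> Hinf0 v" for k using approx_Hinf0[OF u] v by simp
    have "(\<lambda>k. hcalc v A (g k) - hcalc v A (approx k u)) \<longlonglongrightarrow> 0"
      by (rule limit_unique[OF v(3,1,2) test_Cb[OF u] test_mihlin1[OF u] v(4,5) a approx_norm_limit[OF u]])
    from tendsto_diff[OF v(6) this] have "(\<lambda>k. hcalc v A (approx k u)) \<longlonglongrightarrow> S" by simp
    then have "(\<lambda>k. hcalc w A (approx k u)) \<longlonglongrightarrow> S" by (subst eq[of w v]) (use w v in auto)
    then show "S = T" using T by (rule LIMSEQ_unique)
  qed
  then show ?thesis using T by (subst eq[of \<theta> w]) (use w t in auto)
qed

text \<open>The angle \<open>w\<close> is one at which the calculus is estimated; there every sequence
  that converges in the weighted sense can be used.\<close>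

lemma calc_limit:
  obtains w where "0 < w" "w < pi"
    "\<And>u g. test (elog u) \<Longrightarrow> (\<And>k. g k \<in> Hinf0 w) \<Longrightarrow> weighted_conv N (\<lambda>k. elog (on_reals (g k))) (elog u) \<Longrightarrow>
       (\<lambda>k. hcalc w A (g k)) \<longlonglongrightarrow> calc u"
proof -
  obtain w where w: "mihlin1_estimate \<phi> \<eta> \<alpha> A w" "0 < w" "w < pi" using calculus unfolding has_mihlin1_calculus_def by blast
  have "(\<lambda>k. hcalc w A (g k)) \<longlonglongrightarrow> calc u"
    if u: "test (elog u)" and g: "\<And>k. g k \<in> Hinf0 w" and c: "weighted_conv N (\<lambda>k. elog (on_reals (g k))) (elog u)" for u g
  proof -
    have a: "approx k u \<in> Hinf0 w" for k using approx_Hinf0[OF u] w by simp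
    have "(\<lambda>k. hcalc w A (g k) - hcalc w A (approx k u)) \<longlonglongrightarrow> 0"
      by (rule limit_unique[OF w test_Cb[OF u] test_mihlin1[OF u] g _ a approx_norm_limit[OF u]])
        (rule weighted_conv_mihlin1(3)[OF c Hinf0_mihlin1(1)[OF g w(2,3)] test_Cb[OF u]])
    from tendsto_add[OF this calc_limit_approx[OF u w(2,3)]] show ?thesis by simp
  qed
  note main = this
  show ?thesis by (rule that[OF w(2,3) main])
qed

lemma calc_lincomb:
  assumes u: "test (elog u)" and v: "test (elog v)"
  shows "calc (\<lambda>t. u t + of_real c * v t) = calc u + c *\<^sub>R calc v"
proof -
  obtain w where w: "0 < w" "w < pi"
    "\<And>u g. test (elog u) \<Longrightarrow> (\<And>k. g k \<in> Hinf0 w) \<Longrightarrow> weighted_conv N (\<lambda>k. elog (on_reals (g k))) (elog u) \<Longrightarrow>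
       (\<lambda>k. hcalc w A (g k)) \<longlonglongrightarrow> calc u" using calc_limit by blast
  have a: "approx k u \<in> Hinf0 w" "approx k v \<in> Hinf0 w" for k using approx_Hinf0 u v w by simp_all
  have tc: "test (elog (\<lambda>t. of_real c * v t))" unfolding elog_cmult by (rule test_mult'[OF v Cb_smooth[OF Cb_const]])
  have "(\<lambda>k. hcalc w A (\<lambda>z. approx k u z + of_real c * approx k v z)) \<longlonglongrightarrow> calc (\<lambda>t. u t + of_real c * v t)"
  proof (rule w(3))
    show "test (elog (\<lambda>t. u t + of_real c * v t))" unfolding elog_add by (intro test_add u tc)
    show "(\<lambda>z. approx k u z + of_real c * approx k v z) \<in> Hinf0 w" for k by (intro Hinf0_lincomb a)
    have "weighted_conv N (\<lambda>k x. elog (on_reals (approx k u)) x + of_real c * elog (on_reals (approx k v)) x) (\<lambda>x. elog u x + of_real c * elog v x)"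
      by (intro weighted_conv_lincomb weighted_conv_approx Cb_approx test_Cb u v)
    then show "weighted_conv N (\<lambda>k. elog (on_reals (\<lambda>z. approx k u z + of_real c * approx k v z))) (elog (\<lambda>t. u t + of_real c * v t))"
      unfolding elog_def .
  qed
  moreover have "(\<lambda>k. hcalc w A (\<lambda>z. approx k u z + of_real c * approx k v z)) \<longlonglongrightarrow> calc u + c *\<^sub>R calc v"
    using w tendsto_add[OF calc_limit_approx[OF u w(1,2)] tendsto_scaleR[OF tendsto_const calc_limit_approx[OF v w(1,2)], of c]]
    by (simp add: hcalc_lincomb[OF a])
  ultimately show ?thesis by (rule LIMSEQ_unique)
qed

lemma calc_bound:
  obtains C where "C \<ge> 0" "\<And>u. test (elog u) \<Longrightarrow> norm (calc u) \<le> C * mn u"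
proof -
  obtain w where w: "mihlin1_estimate \<phi> \<eta> \<alpha> A w" "0 < w" "w < pi" using calculus unfolding has_mihlin1_calculus_def by blast
  obtain C where C: "C \<ge> 0" "\<And>f. f \<in> Hinf0 w \<Longrightarrow> norm (hcalc w A f) \<le> C * mn (on_reals f)"
    "\<And>f g. f \<in> Hinf0 w \<Longrightarrow> g \<in> Hinf0 w \<Longrightarrow> norm (hcalc w A f - hcalc w A g) \<le> C * mn (\<lambda>t. on_reals f t - on_reals g t)"
    using estimate_const[OF w] by blast
  have "norm (calc u) \<le> C * mn u" if u: "test (elog u)" for u
  proof -
    let ?d = "\<lambda>k t. on_reals (approx k u) t - u t"
    note W = weighted_conv_mihlin1(2,4)[OF weighted_conv_approx[OF u] Cb_approx[OF u] test_Cb[OF u]]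
    have d: "Cb (elog (?d k))" for k unfolding elog_diff by (intro Cb_diff Cb_approx test_Cb u)
    have a: "approx k u \<in> Hinf0 w" for k using approx_Hinf0[OF u] w by simp
    have "norm (hcalc w A (approx k u)) \<le> C * (mn u + mn (?d k))" for k
    proof -
      have "mn (\<lambda>t. u t + 1 * ?d k t) \<le> mn u + cmod 1 * mn (?d k)"
        by (rule mihlin1_lincomb(2)[OF test_Cb[OF u] d test_mihlin1[OF u] W(1)])
      then have "mn (on_reals (approx k u)) \<le> mn u + mn (?d k)" by simp
      from order_trans[OF C(2)[OF a] mult_left_mono[OF this C(1)]] show ?thesis .
    qed
    moreover have "(\<lambda>k. C * (mn u + mn (?d k))) \<longlonglongrightarrow> C * (mn u + 0)"
      by (intro tendsto_intros W(2))
    moreover have "(\<lambda>k. norm (hcalc w A (approx k u))) \<longlonglongrightarrow> norm (calc u)"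
      by (intro tendsto_norm calc_limit_approx u w)
    ultimately have "norm (calc u) \<le> C * (mn u + 0)" by (intro LIMSEQ_le) auto
    then show ?thesis by simp
  qed
  then show ?thesis using that C(1) by blast
qed

lemma calc_diff: "test (elog u) \<Longrightarrow> test (elog v) \<Longrightarrow> calc (\<lambda>t. u t - v t) = calc u - calc v"
  using calc_lincomb[of u v "-1"] by simp

lemma test_diff: "test u \<Longrightarrow> test v \<Longrightarrow> test (\<lambda>x. u x - v x)"
  using test_add[OF _ test_mult'[OF _ Cb_smooth[OF Cb_const], of v "-1"], of u] by simp

lemma calc_zero: assumes "\<And>x. elog u x = 0" shows "calc u = 0"
proof -
  obtain C where C: "C \<ge> 0" "\<And>u. test (elog u) \<Longrightarrow> norm (calc u) \<le> C * mn u" using calc_bound by blast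
  obtain K where K: "K \<ge> 0" "\<And>f c. Cb (elog f) \<Longrightarrow> (\<And>j x. j \<le> N \<Longrightarrow> cmod (nd j (elog f) x) \<le> c / (1 + x\<^sup>2)) \<Longrightarrow>
     f \<in> mihlin1 \<phi> \<eta> \<alpha> \<and> mihlin1_norm \<phi> \<eta> \<alpha> f \<le> K * c" using weighted_mihlin1 by blast
  have e: "elog u = (\<lambda>_. 0)" using assms by auto
  have t: "test (elog u)" unfolding e test_def using Cb_smooth[OF Cb_const] by auto
  have "mn u \<le> K * 0" using K(2)[OF test_Cb[OF t], of 0] by (simp add: e nd_zero)
  then have "C * mn u \<le> C * 0" using C(1) by (intro mult_left_mono) auto
  from order_trans[OF C(2)[OF t] this] have "norm (calc u) \<le> 0" by simp
  then show ?thesis by simp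
qed

lemma calc_cong: assumes "test (elog u)" "test (elog v)" "\<And>x. elog u x = elog v x" shows "calc u = calc v"
  using calc_diff[OF assms(1,2)] calc_zero[of "\<lambda>t. u t - v t"] assms(3) by (simp add: elog_diff)

text \<open>Multiplicativity on \<open>Hinf0\<close> holds for \<open>F\<close> and the Gaussian
  approximations of \<open>u\<close>, and passes to the limit because \<open>F\<close> is in
  \<open>Cb\<close> in the logarithmic variable.\<close>

lemma hcalc_calc:
  assumes F: "F \<in> Hinf0 \<theta>" "0 < \<theta>" "\<theta> < pi" "\<And>\<omega>. 0 < \<omega> \<Longrightarrow> \<omega> < pi \<Longrightarrow> F \<in> Hinf \<omega>" and u: "test (elog u)"
  shows "test (elog (\<lambda>t. on_reals F t * u t))"
    "hcalc \<theta> A F o\<^sub>L calc u = calc (\<lambda>t. on_reals F t * u t)"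
    "calc u o\<^sub>L hcalc \<theta> A F = calc (\<lambda>t. on_reals F t * u t)"
proof -
  have C: "Cb (elog (on_reals F))" by (rule Hinf_Cb[OF F(4)[OF F(2,3)] F(2)]) (use F in simp)
  show t: "test (elog (\<lambda>t. on_reals F t * u t))" unfolding elog_mult by (rule test_mult'[OF u Cb_smooth[OF C]])
  obtain w where w: "0 < w" "w < pi"
    "\<And>u g. test (elog u) \<Longrightarrow> (\<And>k. g k \<in> Hinf0 w) \<Longrightarrow> weighted_conv N (\<lambda>k. elog (on_reals (g k))) (elog u) \<Longrightarrow>
       (\<lambda>k. hcalc w A (g k)) \<longlonglongrightarrow> calc u" using calc_limit by blast
  \<comment> \<open>an angle at which both factors are defined\<close>
  define \<tau> where "\<tau> = min \<theta> w"
  have tau: "0 < \<tau>" "\<tau> \<le> \<theta>" "\<tau> \<le> w" "\<tau> < pi" using F w by (auto simp: \<tau>_def)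
  have a: "approx k u \<in> Hinf0 \<tau>" "approx k u \<in> Hinf0 w" for k using approx_Hinf0[OF u] w tau by simp_all
  have p: "(\<lambda>z. approx k u z * F z) \<in> Hinf0 w" for k by (rule Hinf0_mult[OF a(2) F(4)[OF w(1,2)]])
  have sub: "G \<in> Hinf0 \<tau>" if "G \<in> Hinf0 c" "\<tau> \<le> c" for G c
  proof -
    have s: "sector \<tau> \<subseteq> sector c" using that(2) by (auto simp: sector_def)
    have "bounded (G ` sector \<tau>)" using that(1) bounded_subset[OF _ image_mono[OF s]] by (auto simp: Hinf0_def Hinf_def)
    moreover have "G holomorphic_on sector \<tau>" using that(1) holomorphic_on_subset[OF _ s] by (auto simp: Hinf0_def Hinf_def)
    ultimately show ?thesis using that(1) s unfolding Hinf0_def Hinf_def by blast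
  qed
  have lim: "(\<lambda>k. hcalc w A (\<lambda>z. approx k u z * F z)) \<longlonglongrightarrow> calc (\<lambda>t. on_reals F t * u t)"
  proof (rule w(3)[OF t p])
    have "weighted_conv N (\<lambda>k x. elog (on_reals F) x * elog (on_reals (approx k u)) x) (\<lambda>x. elog (on_reals F) x * elog u x)"
      by (intro weighted_conv_mult weighted_conv_approx Cb_approx test_Cb u C)
    then show "weighted_conv N (\<lambda>k. elog (on_reals (\<lambda>z. approx k u z * F z))) (elog (\<lambda>t. on_reals F t * u t))"
      unfolding elog_def by (simp only: mult.commute)
  qed
  have eqw: "hcalc w A G = hcalc \<tau> A G" if "G \<in> Hinf0 w" for G by (rule hcalc_angle[OF that tau(1,3)]) (use w in simp)
  have eqF: "hcalc \<theta> A F = hcalc \<tau> A F" by (rule hcalc_angle[OF F(1) tau(1,2)]) (use F in simp)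
  have m: "hcalc w A (\<lambda>z. approx k u z * F z) = hcalc w A (approx k u) o\<^sub>L hcalc \<theta> A F"
      "hcalc w A (\<lambda>z. approx k u z * F z) = hcalc \<theta> A F o\<^sub>L hcalc w A (approx k u)" for k
  proof -
    have "hcalc \<tau> A (approx k u) o\<^sub>L hcalc \<tau> A F = hcalc \<tau> A (\<lambda>z. approx k u z * F z)"
      by (rule hcalc_mult[OF a(1) sub[OF F(1) tau(2)] tau(1)]) (use tau in simp)
    then show "hcalc w A (\<lambda>z. approx k u z * F z) = hcalc w A (approx k u) o\<^sub>L hcalc \<theta> A F" by (simp add: eqw[OF p] eqw[OF a(2)] eqF)
    have "hcalc \<tau> A F o\<^sub>L hcalc \<tau> A (approx k u) = hcalc \<tau> A (\<lambda>z. F z * approx k u z)"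
      by (rule hcalc_mult[OF sub[OF F(1) tau(2)] a(1) tau(1)]) (use tau in simp)
    moreover have "(\<lambda>z. F z * approx k u z) = (\<lambda>z. approx k u z * F z)" by (simp add: mult.commute)
    ultimately show "hcalc w A (\<lambda>z. approx k u z * F z) = hcalc \<theta> A F o\<^sub>L hcalc w A (approx k u)"
      by (simp add: eqw[OF p] eqw[OF a(2)] eqF)
  qed
  note l = calc_limit_approx[OF u w(1,2)]
  have "(\<lambda>k. hcalc w A (approx k u) o\<^sub>L hcalc \<theta> A F) \<longlonglongrightarrow> (calc u o\<^sub>L hcalc \<theta> A F)"
    by (rule bounded_bilinear.tendsto[OF bounded_bilinear_blinfun_compose l tendsto_const])
  from LIMSEQ_unique[OF this lim[unfolded m(1)]] show "calc u o\<^sub>L hcalc \<theta> A F = calc (\<lambda>t. on_reals F t * u t)" .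
  have "(\<lambda>k. hcalc \<theta> A F o\<^sub>L hcalc w A (approx k u)) \<longlonglongrightarrow> (hcalc \<theta> A F o\<^sub>L calc u)"
    by (rule bounded_bilinear.tendsto[OF bounded_bilinear_blinfun_compose tendsto_const l])
  from LIMSEQ_unique[OF this lim[unfolded m(2)]] show "hcalc \<theta> A F o\<^sub>L calc u = calc (\<lambda>t. on_reals F t * u t)" .
qed

text \<open>Apply the preceding lemma to the Gaussian approximations of \<open>u\<close>.\<close>

lemma calc_mult:
  assumes u: "test (elog u)" and v: "test (elog v)"
  shows "calc u o\<^sub>L calc v = calc (\<lambda>t. u t * v t)"
proof -
  obtain C where C: "C \<ge> 0" "\<And>u. test (elog u) \<Longrightarrow> norm (calc u) \<le> C * mn u" using calc_bound by blast
  have p: "0 < pi / 2" "pi / 2 < pi" using pi_gt_zero by auto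
  let ?g = "\<lambda>k t. on_reals (approx k u) t * v t" and ?h = "\<lambda>t. u t * v t"
  have Hi: "approx k u \<in> Hinf \<omega>" if "0 < \<omega>" "\<omega> < pi" for \<omega> k using Hinf0_Hinf[OF approx_Hinf0[OF u]] that by simp
  have a: "approx k u \<in> Hinf0 (pi / 2)" for k using approx_Hinf0[OF u] by simp
  have tg: "test (elog (?g k))" and eq: "hcalc (pi / 2) A (approx k u) o\<^sub>L calc v = calc (?g k)" for k
    using hcalc_calc(1,2)[OF a p Hi v] by simp_all
  have th: "test (elog ?h)" unfolding elog_mult by (rule test_mult'[OF v test_smooth[OF u]])
  have wc: "weighted_conv N (\<lambda>k. elog (?g k)) (elog ?h)"
  proof -
    have "weighted_conv N (\<lambda>k x. elog v x * elog (on_reals (approx k u)) x) (\<lambda>x. elog v x * elog u x)"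
      by (intro weighted_conv_mult weighted_conv_approx Cb_approx test_Cb u v)
    then show ?thesis unfolding elog_def by (simp only: mult.commute)
  qed
  have l0: "(\<lambda>k. mn (\<lambda>t. ?g k t - ?h t)) \<longlonglongrightarrow> 0" by (rule weighted_conv_mihlin1(4)[OF wc test_Cb[OF tg] test_Cb[OF th]])
  have le: "norm (calc (?g k) - calc ?h) \<le> C * mn (\<lambda>t. ?g k t - ?h t)" for k
  proof -
    have "test (elog (\<lambda>t. ?g k t - ?h t))" unfolding elog_diff by (rule test_diff[OF tg th])
    from C(2)[OF this] show ?thesis unfolding calc_diff[OF tg th] .
  qed
  have "(\<lambda>k. C * mn (\<lambda>t. ?g k t - ?h t)) \<longlonglongrightarrow> 0" using tendsto_mult_left[OF l0, of C] by simp
  from tendsto_sandwich[OF _ _ tendsto_const this, of "\<lambda>k. norm (calc (?g k) - calc ?h)"]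
  have "(\<lambda>k. norm (calc (?g k) - calc ?h)) \<longlonglongrightarrow> 0" using le by simp
  then have 1: "(\<lambda>k. calc (?g k)) \<longlonglongrightarrow> calc ?h" by (rule LIM_zero_cancel[OF tendsto_norm_zero_cancel])
  have "(\<lambda>k. hcalc (pi / 2) A (approx k u) o\<^sub>L calc v) \<longlonglongrightarrow> (calc u o\<^sub>L calc v)"
    by (rule bounded_bilinear.tendsto[OF bounded_bilinear_blinfun_compose calc_limit_approx[OF u p] tendsto_const])
  from LIMSEQ_unique[OF this[unfolded eq] 1] show ?thesis .
qed

end

section \<open>Rademacher averages\<close>

lemma prob_space_rademacher: "prob_space (rademacher :: ('i \<Rightarrow> real) measure)"
  unfolding rademacher_def by (intro prob_space_PiM measure_pmf.prob_space_axioms)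

lemma AE_rademacher_signs: "AE \<epsilon> in (rademacher :: ('i::countable \<Rightarrow> real) measure). \<forall>i. \<epsilon> i = 1 \<or> \<epsilon> i = -1"
proof (subst AE_all_countable, rule allI)
  fix i :: 'i
  have "AE x in measure_pmf (pmf_of_set {-1, 1 :: real}). x = 1 \<or> x = -1"
    by (subst AE_measure_pmf_iff) (auto simp: set_pmf_of_set)
  then show "AE \<epsilon> in rademacher. \<epsilon> i = 1 \<or> \<epsilon> i = - 1"
    unfolding rademacher_def by (intro AE_PiM_component[where P = "\<lambda>x. x = 1 \<or> x = -1"] measure_pmf.prob_space_axioms) auto
qed

text \<open>The norm of a finite random sum depends continuously on the coefficients, and for countably
  many coefficients the Borel sets of the product topology form the product
  \<open>\<sigma>\<close>-algebra.\<close>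

lemma rademacher_sum_measurable:
  fixes v :: "'i::countable \<Rightarrow> 'a::real_normed_vector"
  shows "(\<lambda>\<epsilon>. norm (\<Sum>i\<in>F. \<epsilon> i *\<^sub>R v i)) \<in> borel_measurable rademacher"
proof -
  have "(\<lambda>\<epsilon>. \<epsilon>) \<in> measurable rademacher (\<Pi>\<^sub>M i\<in>(UNIV :: 'i set). (borel :: real measure))"
  proof (rule measurable_PiM_single')
    fix i :: 'i
    have "(\<lambda>\<epsilon>. \<epsilon> i) \<in> measurable rademacher (measure_pmf (pmf_of_set {-1, 1 :: real}))"
      unfolding rademacher_def by (intro measurable_component_singleton) auto
    moreover have "(\<lambda>x. x) \<in> measurable (measure_pmf (pmf_of_set {-1, 1 :: real})) borel" by simp
    ultimately show "(\<lambda>\<epsilon>. \<epsilon> i) \<in> measurable rademacher (borel :: real measure)" by (rule measurable_compose)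
  qed auto
  then have id: "(\<lambda>\<epsilon>. \<epsilon>) \<in> measurable rademacher (borel :: ('i \<Rightarrow> real) measure)"
    using measurable_cong_sets[OF refl sets_PiM_equal_borel] by blast
  have "continuous_on UNIV (\<lambda>\<epsilon>::'i \<Rightarrow> real. norm (\<Sum>i\<in>F. \<epsilon> i *\<^sub>R v i))"
    by (intro continuous_intros continuous_on_product_coordinates)
  from measurable_compose[OF id borel_measurable_continuous_onI[OF this]] show ?thesis .
qed

lemma norm_sum_sign_le: "\<forall>i. s i = 1 \<or> s i = (-1::real) \<Longrightarrow> norm (\<Sum>i\<in>F. s i *\<^sub>R v i) \<le> (\<Sum>i\<in>F. norm (v i))"
  by (rule order_trans[OF norm_sum], rule sum_mono) (metis abs_minus abs_one mult_1 norm_scaleR order_refl)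

lemma rademacher_sum_integrable:
  fixes v :: "'i::countable \<Rightarrow> 'a::real_normed_vector"
  shows "integrable rademacher (\<lambda>\<epsilon>. norm (\<Sum>i\<in>F. \<epsilon> i *\<^sub>R v i))"
proof -
  interpret prob_space "rademacher :: ('i \<Rightarrow> real) measure" by (rule prob_space_rademacher)
  show ?thesis
  proof (rule integrable_const_bound[of _ "\<Sum>i\<in>F. norm (v i)"])
    show "AE \<epsilon> in rademacher. norm (norm (\<Sum>i\<in>F. \<epsilon> i *\<^sub>R v i)) \<le> (\<Sum>i\<in>F. norm (v i))"
      using AE_rademacher_signs unfolding real_norm_def abs_norm_cancel by eventually_elim (rule norm_sum_sign_le)
  qed (rule rademacher_sum_measurable)
qed

definition rad_avg :: "'i::countable set \<Rightarrow> ('i \<Rightarrow> 'a::real_normed_vector) \<Rightarrow> real" where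
  "rad_avg F v = (\<integral>\<epsilon>. norm (\<Sum>i\<in>F. \<epsilon> i *\<^sub>R v i) \<partial>rademacher)"

lemma rad_avg_nonneg: "0 \<le> rad_avg F v" unfolding rad_avg_def by simp

lemma rad_avg_le:
  assumes "\<And>s. \<forall>i. s i = 1 \<or> s i = -1 \<Longrightarrow> norm (\<Sum>i\<in>F. s i *\<^sub>R v i) \<le> c"
  shows "rad_avg F v \<le> c"
proof -
  interpret prob_space "rademacher :: ('a \<Rightarrow> real) measure" by (rule prob_space_rademacher)
  have "rad_avg F v \<le> (\<integral>\<epsilon>. c \<partial>(rademacher :: ('a \<Rightarrow> real) measure))"
    unfolding rad_avg_def
  proof (rule integral_mono_AE[OF rademacher_sum_integrable])
    show "AE \<epsilon> in rademacher. norm (\<Sum>i\<in>F. \<epsilon> i *\<^sub>R v i) \<le> c"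
      using AE_rademacher_signs by eventually_elim (rule assms)
  qed simp
  then show ?thesis by (simp add: prob_space)
qed

text \<open>A subfamily of independent Rademacher variables is again one.\<close>

lemma rad_avg_reindex:
  fixes h :: "'i::countable \<Rightarrow> 'j::countable"
  assumes "inj h"
  shows "rad_avg F v = (\<integral>\<epsilon>. norm (\<Sum>i\<in>F. \<epsilon> (h i) *\<^sub>R v i) \<partial>rademacher)"
proof -
  have d: "distr rademacher rademacher (\<lambda>\<omega> i. \<omega> (h i)) = (rademacher :: ('i \<Rightarrow> real) measure)"
    using distr_PiM_reindex[of UNIV "\<lambda>_. measure_pmf (pmf_of_set {-1, 1 :: real})" h UNIV] assms
    unfolding rademacher_def restrict_UNIV by (auto simp: measure_pmf.prob_space_axioms)
  have m: "(\<lambda>\<omega> i. \<omega> (h i)) \<in> measurable (rademacher :: ('j \<Rightarrow> real) measure) (rademacher :: ('i \<Rightarrow> real) measure)"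
    unfolding rademacher_def by (rule measurable_PiM_single') auto
  have "rad_avg F v = (\<integral>\<epsilon>. norm (\<Sum>i\<in>F. \<epsilon> i *\<^sub>R v i) \<partial>distr rademacher rademacher (\<lambda>\<omega> i. \<omega> (h i)))"
    unfolding d rad_avg_def ..
  also have "\<dots> = (\<integral>\<epsilon>. norm (\<Sum>i\<in>F. \<epsilon> (h i) *\<^sub>R v i) \<partial>rademacher)"
    by (rule integral_distr[OF m rademacher_sum_measurable])
  finally show ?thesis .
qed

lemma rad_avg_image:
  assumes "inj h" shows "rad_avg (h ` F) w = rad_avg F (\<lambda>i. w (h i))"
proof -
  have "inj_on h F" using assms by (rule inj_on_subset) simp
  then show ?thesis unfolding rad_avg_reindex[OF assms, of F] unfolding rad_avg_def by (simp add: sum.reindex o_def)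
qed

lemma rad_avg_sum_le:
  assumes "finite J" shows "rad_avg F (\<lambda>i. \<Sum>d\<in>J. v d i) \<le> (\<Sum>d\<in>J. rad_avg F (v d))"
proof -
  have "rad_avg F (\<lambda>i. \<Sum>d\<in>J. v d i) \<le> (\<integral>\<epsilon>. (\<Sum>d\<in>J. norm (\<Sum>i\<in>F. \<epsilon> i *\<^sub>R v d i)) \<partial>rademacher)"
    unfolding rad_avg_def
  proof (rule integral_mono)
    show "integrable rademacher (\<lambda>\<epsilon>. \<Sum>d\<in>J. norm (\<Sum>i\<in>F. \<epsilon> i *\<^sub>R v d i))"
      by (intro Bochner_Integration.integrable_sum rademacher_sum_integrable)
    fix \<epsilon> :: "'b \<Rightarrow> real"
    have "(\<Sum>i\<in>F. \<epsilon> i *\<^sub>R (\<Sum>d\<in>J. v d i)) = (\<Sum>d\<in>J. \<Sum>i\<in>F. \<epsilon> i *\<^sub>R v d i)"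
      unfolding scaleR_right.sum by (rule sum.swap)
    then show "norm (\<Sum>i\<in>F. \<epsilon> i *\<^sub>R (\<Sum>d\<in>J. v d i)) \<le> (\<Sum>d\<in>J. norm (\<Sum>i\<in>F. \<epsilon> i *\<^sub>R v d i))"
      by (simp add: norm_sum)
  qed (rule rademacher_sum_integrable)
  also have "\<dots> = (\<Sum>d\<in>J. rad_avg F (v d))"
    unfolding rad_avg_def by (intro Bochner_Integration.integral_sum rademacher_sum_integrable)
  finally show ?thesis .
qed

lemma rad_avg_scaleR: "rad_avg F (\<lambda>i. c *\<^sub>R v i) = \<bar>c\<bar> * rad_avg F v"
proof -
  have "(\<Sum>i\<in>F. \<epsilon> i *\<^sub>R c *\<^sub>R v i) = c *\<^sub>R (\<Sum>i\<in>F. \<epsilon> i *\<^sub>R v i)" for \<epsilon>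
    by (simp add: scaleR_right.sum mult.commute)
  then show ?thesis unfolding rad_avg_def by simp
qed

text \<open>R-boundedness speaks of the indices \<open>1..n\<close>. The integers are embedded into the
  positive natural numbers, and the missing indices are filled with zero vectors.\<close>

lemma R_bounded_finite_family:
  fixes \<tau> :: "('a::complex_banach \<Rightarrow>\<^sub>L 'a) set"
  assumes "R_bounded \<tau>"
  obtains R where "R \<ge> 0" "\<And>F (T :: int \<Rightarrow> ('a \<Rightarrow>\<^sub>L 'a)) x. finite F \<Longrightarrow> (\<And>m. T m \<in> \<tau>) \<Longrightarrow>
     rad_avg F (\<lambda>m. T m (x m)) \<le> R * rad_avg F x"
proof -
  from assms obtain C where "\<forall>(n::nat) T x. (\<forall>k\<in>{1..n}. T k \<in> \<tau>) \<longrightarrow>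
     rad_avg {1..n} (\<lambda>k. blinfun_apply (T k) (x k)) \<le> C * rad_avg {1..n} x"
    unfolding R_bounded_def rad_avg_def by (elim exE)
  then have C: "rad_avg {1..n} (\<lambda>k. blinfun_apply (T k) (x k)) \<le> C * rad_avg {1..n} x"
    if "\<And>k. T k \<in> \<tau>" for n :: nat and T x using that by simp
  have "rad_avg F (\<lambda>m. T m (x m)) \<le> \<bar>C\<bar> * rad_avg F x" if F: "finite F" and T: "\<And>m. T m \<in> \<tau>"
    for F and T :: "int \<Rightarrow> ('a \<Rightarrow>\<^sub>L 'a)" and x
  proof -
    \<comment> \<open>injective, and 0 is not a value because the sums start at index 1\<close>
    define h where "h m = Suc (int_encode m)" for m
    define g where "g k = int_decode (k - 1)" for k
    have gh: "g (h m) = m" for m by (simp add: g_def h_def)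
    have h: "inj h" by (metis gh injI)
    obtain n where n: "h ` F \<subseteq> {..n}" using F finite_nat_iff_bounded_le[of "h ` F"] by auto
    then have sub: "h ` F \<subseteq> {1..n}" by (auto simp: h_def)
    let ?x = "\<lambda>k. if k \<in> h ` F then x (g k) else 0"
    have ext: "rad_avg {1..n} y = rad_avg (h ` F) y" if "\<And>k. k \<notin> h ` F \<Longrightarrow> y k = 0" for y :: "nat \<Rightarrow> 'a"
      unfolding rad_avg_def using sub that by (intro Bochner_Integration.integral_cong refl arg_cong[where f = norm] sum.mono_neutral_right) auto
    have "rad_avg F (\<lambda>m. T m (x m)) = rad_avg (h ` F) (\<lambda>k. T (g k) (?x k))"
      unfolding rad_avg_image[OF h] by (simp add: rad_avg_def gh)
    also have "\<dots> = rad_avg {1..n} (\<lambda>k. T (g k) (?x k))" by (rule ext[symmetric]) simp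
    also have "\<dots> \<le> C * rad_avg {1..n} ?x" by (rule C) (rule T)
    also have "\<dots> \<le> \<bar>C\<bar> * rad_avg {1..n} ?x" by (intro mult_right_mono rad_avg_nonneg) simp
    also have "rad_avg {1..n} ?x = rad_avg (h ` F) ?x" by (rule ext) simp
    also have "\<dots> = rad_avg F x" unfolding rad_avg_image[OF h] by (simp add: rad_avg_def gh)
    finally show ?thesis .
  qed
  note main = this
  show ?thesis by (rule that[of "\<bar>C\<bar>"]) (use main in auto)
qed

section \<open>Unconditional sums\<close>

text \<open>The norm is convex in each coefficient, so its maximum over the cube is attained at a
  vertex, that is, at a subset sum. The offset \<open>w\<close> is there for the induction.\<close>

lemma convex_coefficient_bound:
  assumes "finite F" "\<And>H. H \<subseteq> F \<Longrightarrow> norm (w + (\<Sum>i\<in>H. v i)) \<le> B" "\<And>i. i \<in> F \<Longrightarrow> 0 \<le> a i \<and> a i \<le> (1::real)"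
  shows "norm (w + (\<Sum>i\<in>F. a i *\<^sub>R v i)) \<le> B"
  using assms
proof (induction F arbitrary: w rule: finite_induct)
  case empty
  then show ?case by auto
next
  case (insert k F)
  let ?S = "\<Sum>i\<in>F. a i *\<^sub>R v i"
  have 1: "norm (w + ?S) \<le> B" by (rule insert.IH) (use insert.prems in auto)
  have 2: "norm ((w + v k) + ?S) \<le> B"
  proof (rule insert.IH)
    fix H assume "H \<subseteq> F"
    then have "finite H" "k \<notin> H" using insert.hyps finite_subset by auto
    then show "norm ((w + v k) + (\<Sum>i\<in>H. v i)) \<le> B"
      using insert.prems(1)[of "insert k H"] \<open>H \<subseteq> F\<close> by (simp add: add.assoc subset_insertI2)
  qed (use insert.prems in auto)
  have a: "0 \<le> a k" "a k \<le> 1" using insert.prems(2)[of k] by auto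
  have "w + (\<Sum>i\<in>insert k F. a i *\<^sub>R v i) = (1 - a k) *\<^sub>R (w + ?S) + a k *\<^sub>R ((w + v k) + ?S)"
    using insert.hyps by (simp add: algebra_simps)
  also have "norm \<dots> \<le> (1 - a k) * norm (w + ?S) + a k * norm ((w + v k) + ?S)"
    by (rule order_trans[OF norm_triangle_ineq]) (use a in simp)
  also have "\<dots> \<le> (1 - a k) * B + a k * B" using 1 2 a by (intro add_mono mult_left_mono) auto
  finally show ?case by (simp add: algebra_simps)
qed

lemma real_coefficient_bound:
  assumes F: "finite F" and B: "\<And>H. H \<subseteq> F \<Longrightarrow> norm (\<Sum>i\<in>H. v i) \<le> B" and a: "\<And>i. \<bar>a i\<bar> \<le> (1::real)"
  shows "norm (\<Sum>i\<in>F. a i *\<^sub>R v i) \<le> 2 * B"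
proof -
  have 1: "norm (\<Sum>i\<in>F. max 0 (a i) *\<^sub>R v i) \<le> B" and 2: "norm (\<Sum>i\<in>F. max 0 (- a i) *\<^sub>R v i) \<le> B"
    using convex_coefficient_bound[OF F, of 0 v B "\<lambda>i. max 0 (a i)"] convex_coefficient_bound[OF F, of 0 v B "\<lambda>i. max 0 (- a i)"] B a
    by (auto simp: abs_le_iff)
  have "max 0 (a i) - max 0 (- a i) = a i" for i by auto
  then have "(\<Sum>i\<in>F. a i *\<^sub>R v i) = (\<Sum>i\<in>F. max 0 (a i) *\<^sub>R v i) - (\<Sum>i\<in>F. max 0 (- a i) *\<^sub>R v i)"
    unfolding sum_subtractf[symmetric] scaleR_diff_left[symmetric] by simp
  then show ?thesis using norm_triangle_ineq4[of "\<Sum>i\<in>F. max 0 (a i) *\<^sub>R v i" "\<Sum>i\<in>F. max 0 (- a i) *\<^sub>R v i"] 1 2 by simp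
qed

lemma complex_coefficient_bound:
  fixes v :: "'i \<Rightarrow> 'a::complex_banach"
  assumes F: "finite F" and B: "\<And>H. H \<subseteq> F \<Longrightarrow> norm (\<Sum>i\<in>H. v i) \<le> B" and a: "\<And>i. cmod (a i) \<le> 1"
  shows "norm (\<Sum>i\<in>F. a i *\<^sub>C v i) \<le> 4 * B"
proof -
  have re: "\<bar>Re (a i)\<bar> \<le> 1" and im: "\<bar>Im (a i)\<bar> \<le> 1" for i
    using abs_Re_le_cmod[of "a i"] abs_Im_le_cmod[of "a i"] a[of i] by auto
  have e: "a i *\<^sub>C v i = Re (a i) *\<^sub>R v i + \<i> *\<^sub>C (Im (a i) *\<^sub>R v i)" for i
    unfolding scaleC_of_real[symmetric] scaleC_scaleC scaleC_add_left[symmetric] by (simp add: complex_eq[symmetric])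
  interpret bounded_linear "\<lambda>x::'a. \<i> *\<^sub>C x" by (rule bounded_linear_scaleC)
  have "(\<Sum>i\<in>F. a i *\<^sub>C v i) = (\<Sum>i\<in>F. Re (a i) *\<^sub>R v i) + \<i> *\<^sub>C (\<Sum>i\<in>F. Im (a i) *\<^sub>R v i)"
    unfolding e sum sum.distrib ..
  then show ?thesis
    using norm_triangle_ineq[of "\<Sum>i\<in>F. Re (a i) *\<^sub>R v i" "\<i> *\<^sub>C (\<Sum>i\<in>F. Im (a i) *\<^sub>R v i)"]
      real_coefficient_bound[OF F B, of "\<lambda>i. Re (a i)"] real_coefficient_bound[OF F B, of "\<lambda>i. Im (a i)"] re im by (simp add: norm_scaleC)
qed

text \<open>Unconditional convergence as a Cauchy condition on finite sets.\<close>

lemma summable_tail: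
  fixes v :: "'i \<Rightarrow> 'a::real_normed_vector"
  assumes "v summable_on UNIV" "0 < e"
  obtains F where "finite F" "\<And>H. finite H \<Longrightarrow> H \<inter> F = {} \<Longrightarrow> norm (\<Sum>i\<in>H. v i) \<le> e"
proof -
  obtain s where "(v has_sum s) UNIV" using assms(1) unfolding summable_on_def by blast
  then have "\<forall>\<^sub>F G in finite_subsets_at_top UNIV. dist (\<Sum>i\<in>G. v i) s < e / 2"
    unfolding has_sum_def using assms(2) by (intro tendstoD) auto
  then obtain F where F: "finite F" "\<And>G. finite G \<Longrightarrow> F \<subseteq> G \<Longrightarrow> dist (\<Sum>i\<in>G. v i) s < e / 2"
    unfolding eventually_finite_subsets_at_top by auto
  have "norm (\<Sum>i\<in>H. v i) \<le> e" if H: "finite H" "H \<inter> F = {}" for H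
  proof -
    have "(\<Sum>i\<in>H. v i) = (\<Sum>i\<in>F \<union> H. v i) - (\<Sum>i\<in>F. v i)" using F(1) H by (subst sum.union_disjoint) auto
    moreover have "dist (\<Sum>i\<in>F \<union> H. v i) (\<Sum>i\<in>F. v i) \<le> e"
      using F(2)[of "F \<union> H"] F(2)[of F] F(1) H(1) dist_triangle_half_l[of _ s e] by (force simp: dist_commute intro: less_imp_le)
    ultimately show ?thesis by (simp add: dist_norm)
  qed
  then show ?thesis using that F(1) by blast
qed

lemma summable_finite_sums_bounded:
  fixes v :: "'i \<Rightarrow> 'a::real_normed_vector"
  assumes "v summable_on UNIV"
  obtains B where "\<And>H. finite H \<Longrightarrow> norm (\<Sum>i\<in>H. v i) \<le> B"
proof -
  obtain F where F: "finite F" "\<And>H. finite H \<Longrightarrow> H \<inter> F = {} \<Longrightarrow> norm (\<Sum>i\<in>H. v i) \<le> 1"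
    using summable_tail[OF assms zero_less_one] by blast
  have "norm (\<Sum>i\<in>H. v i) \<le> (\<Sum>i\<in>F. norm (v i)) + 1" if H: "finite H" for H
  proof -
    have "(\<Sum>i\<in>H. v i) = (\<Sum>i\<in>H \<inter> F. v i) + (\<Sum>i\<in>H - F. v i)"
      using H by (metis sum.Int_Diff)
    moreover have "norm (\<Sum>i\<in>H \<inter> F. v i) \<le> (\<Sum>i\<in>F. norm (v i))"
      using F(1) by (intro order_trans[OF norm_sum] sum_mono2) auto
    moreover have "norm (\<Sum>i\<in>H - F. v i) \<le> 1" using H by (intro F(2)) auto
    ultimately show ?thesis using norm_triangle_ineq[of "\<Sum>i\<in>H \<inter> F. v i" "\<Sum>i\<in>H - F. v i"] by simp
  qed
  then show ?thesis using that by blast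
qed

lemma summable_of_tails:
  fixes v :: "'i \<Rightarrow> 'a::banach"
  assumes "\<And>e. 0 < e \<Longrightarrow> \<exists>F. finite F \<and> (\<forall>H. finite H \<longrightarrow> H \<inter> F = {} \<longrightarrow> norm (\<Sum>i\<in>H. v i) \<le> e)"
  shows "v summable_on UNIV"
proof -
  have "\<exists>P. eventually P (finite_subsets_at_top UNIV) \<and> (\<forall>x y. P x \<and> P y \<longrightarrow> dist (sum v x) (sum v y) < e)" if e: "0 < e" for e
  proof -
    obtain F where F: "finite F" "\<And>H. finite H \<Longrightarrow> H \<inter> F = {} \<Longrightarrow> norm (\<Sum>i\<in>H. v i) \<le> e / 3"
      using assms[of "e / 3"] e by auto
    have *: "dist (sum v G) (sum v F) \<le> e / 3" if G: "finite G" "F \<subseteq> G" for G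
      using F(2)[of "G - F"] G by (simp add: dist_norm sum_diff Int_commute)
    have "dist (sum v x) (sum v y) < e" if "finite x \<and> F \<subseteq> x" "finite y \<and> F \<subseteq> y" for x y
      using *[of x] *[of y] that dist_triangle2[of "sum v x" "sum v y" "sum v F"] e by auto
    moreover have "eventually (\<lambda>G. finite G \<and> F \<subseteq> G) (finite_subsets_at_top UNIV)"
      unfolding eventually_finite_subsets_at_top using F(1) by auto
    ultimately show ?thesis by blast
  qed
  then have \<open>cauchy_filter (filtermap (sum v) (finite_subsets_at_top UNIV))\<close>
    by (simp add: cauchy_filter_metric_filtermap)
  moreover have "uniform_space_class.complete (UNIV::'a set)"
    by (rule complete_UNIV)
  ultimately obtain L' where \<open>(sum v \<longlongrightarrow> L') (finite_subsets_at_top UNIV)\<close>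
    using complete_uniform[where S=UNIV] by (force simp add: filterlim_def)
  then show ?thesis
    using summable_on_def has_sum_def by blast
qed

lemma rad_avg_superset:
  fixes v :: "'i::countable \<Rightarrow> 'a::real_normed_vector"
  assumes "finite G" "F \<subseteq> G" "\<And>i. i \<notin> F \<Longrightarrow> v i = 0" shows "rad_avg G v = rad_avg F v"
  unfolding rad_avg_def using assms
  by (intro Bochner_Integration.integral_cong refl arg_cong[where f = norm] sum.mono_neutral_right) auto

section \<open>The Paley-Littlewood pieces of an operator\<close>

lemma norm_has_sum_le:
  assumes "(f has_sum s) UNIV" "\<And>F. finite F \<Longrightarrow> norm (\<Sum>i\<in>F. f i) \<le> B" shows "norm s \<le> B"
proof (rule tendsto_upperbound)
  show "((\<lambda>F. norm (\<Sum>i\<in>F. f i)) \<longlongrightarrow> norm s) (finite_subsets_at_top UNIV)"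
    using assms(1) unfolding has_sum_def by (rule tendsto_norm)
  show "\<forall>\<^sub>F F in finite_subsets_at_top UNIV. norm (\<Sum>i\<in>F. f i) \<le> B"
    using eventually_finite_subsets_at_top_weakI[of UNIV "\<lambda>F. norm (\<Sum>i\<in>F. f i) \<le> B"] assms(2) by blast
qed simp

text \<open>On a sector of angle below \<open>\<pi>\<close> the modulus of \<open>1 + z\<close> is
  comparable to \<open>1 + \<bar>z\<bar>\<close>, and \<open>r / (1 + r)\<^sup>2 \<le> exp
  (- \<bar>ln r\<bar>)\<close> decays faster than any power of \<open>1 + \<bar>ln
  r\<bar>\<close>.\<close>

lemma rho_Hinf0:
  assumes t: "0 < \<theta>" "\<theta> < pi" shows "rho \<in> Hinf0 \<theta>"
proof -
  \<comment> \<open>the constant in \<open>(1 + r)\<^sup>2 \<le> k \<bar>1 + z\<bar>\<^sup>2\<close>\<close>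
  define k where "k = 2 / (1 + cos \<theta>)"
  have ct: "- 1 < cos \<theta>" using t cos_monotone_0_pi[of \<theta> pi] by simp
  have k: "k > 0" using ct by (simp add: k_def)
  have bd: "cmod (rho z) \<le> (100 * k) * (1 + cmod (Ln z)) powr (- 1 - 1)" if z: "z \<in> sector \<theta>" for z
  proof -
    define r where "r = cmod z"
    define a where "a = \<bar>ln r\<bar>"
    have z0: "z \<noteq> 0" "\<bar>Arg z\<bar> < \<theta>" using z by (auto simp: sector_def)
    have r: "r > 0" using z0 by (simp add: r_def)
    have "cos \<theta> \<le> cos \<bar>Arg z\<bar>" using z0 t by (intro cos_monotone_0_pi_le) auto
    then have c: "cos \<theta> \<le> cos (Arg z)" by simp
    have "Re z = r * cos (Arg z)" using arg_cong[OF rcis_cmod_Arg[of z], of Re] by (simp add: r_def)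
    then have Re: "r * cos \<theta> \<le> Re z" using mult_left_mono[OF c, of r] r by simp
    have n2: "(cmod (1 + z))\<^sup>2 = 1 + 2 * Re z + r\<^sup>2"
      unfolding r_def cmod_power2 by (simp add: power2_eq_square algebra_simps)
    have e: "1 + 2 * (r * q) + r\<^sup>2 = (1 + r)\<^sup>2 * (1 + q) / 2 + (1 - q) / 2 * (1 - r)\<^sup>2" for q :: real
      by (simp add: power2_eq_square field_simps)
    have "(1 + r)\<^sup>2 / k = (1 + r)\<^sup>2 * (1 + cos \<theta>) / 2" by (simp add: k_def)
    also have "\<dots> \<le> 1 + 2 * (r * cos \<theta>) + r\<^sup>2" unfolding e[of "cos \<theta>"] by simp
    also have "\<dots> \<le> (cmod (1 + z))\<^sup>2" using Re n2 by simp
    finally have d: "(1 + r)\<^sup>2 / k \<le> (cmod (1 + z))\<^sup>2" .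
    have p: "0 < (1 + r)\<^sup>2" using r by (intro zero_less_power) simp
    then have pk: "0 < (1 + r)\<^sup>2 / k" using k by simp
    have "cmod (rho z) = r / (cmod (1 + z))\<^sup>2" by (simp add: rho_def norm_divide norm_power r_def)
    also have "\<dots> \<le> r / ((1 + r)\<^sup>2 / k)" using d pk r by (intro divide_left_mono mult_pos_pos) auto
    also have "\<dots> = k * (r / (1 + r)\<^sup>2)" by simp
    also have "\<dots> \<le> k * exp (- a)"
    proof (rule mult_left_mono)
      show "r / (1 + r)\<^sup>2 \<le> exp (- a)"
      proof (cases "r \<ge> 1")
        case True
        then have "exp (- a) = 1 / r" by (simp add: a_def exp_minus inverse_eq_divide)
        moreover have "r / (1 + r)\<^sup>2 \<le> 1 / r" using r p by (intro frac_cross) (auto simp: power2_eq_square algebra_simps)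
        ultimately show ?thesis by simp
      next
        case False
        then have "exp (- a) = r" using r by (simp add: a_def)
        moreover have "r / (1 + r)\<^sup>2 \<le> r / 1" using r p by (intro divide_left_mono) (auto simp: power2_eq_square algebra_simps)
        ultimately show ?thesis by simp
      qed
    qed (use k in simp)
    also have "\<dots> \<le> k * (100 / (1 + cmod (Ln z))\<^sup>2)"
    proof (rule mult_left_mono)
      have a0: "0 \<le> a" by (simp add: a_def)
      have "cmod (Ln z) \<le> \<bar>Re (Ln z)\<bar> + \<bar>Im (Ln z)\<bar>" by (rule cmod_le)
      moreover have "\<bar>Re (Ln z)\<bar> = a" using z0 by (simp add: a_def r_def)
      moreover have "\<bar>Im (Ln z)\<bar> \<le> 4" using z0 t pi_less_4 by (simp add: Arg_def)
      ultimately have "1 + cmod (Ln z) \<le> 10 * (1 + a / 2)" using a0 by argo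
      also have "\<dots> \<le> 10 * exp (a / 2)" by (intro mult_left_mono exp_ge_add_one_self) simp
      finally have "(1 + cmod (Ln z))\<^sup>2 \<le> (10 * exp (a / 2))\<^sup>2" by (intro power_mono) auto
      also have "\<dots> = 100 * exp a" by (simp add: power_mult_distrib exp_double[symmetric])
      finally have "(1 + cmod (Ln z))\<^sup>2 \<le> 100 * exp a" .
      moreover have "0 < (1 + cmod (Ln z))\<^sup>2" by (intro zero_less_power add_pos_nonneg) auto
      ultimately have "1 / exp a \<le> 100 / (1 + cmod (Ln z))\<^sup>2" by (intro frac_cross) auto
      then show "exp (- a) \<le> 100 / (1 + cmod (Ln z))\<^sup>2" by (simp add: exp_minus inverse_eq_divide)
    qed (use k in simp)
    also have "\<dots> = (100 * k) * (1 + cmod (Ln z)) powr (- 1 - 1)"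
    proof -
      have "0 < 1 + cmod (Ln z)" by (intro add_pos_nonneg) auto
      then have "(1 + cmod (Ln z)) powr (- 2) = 1 / (1 + cmod (Ln z))\<^sup>2" by (simp add: powr_minus_divide powr_numeral)
      then show ?thesis by simp
    qed
    finally show ?thesis .
  qed
  have "cmod (rho z) \<le> 100 * k" if z: "z \<in> sector \<theta>" for z
  proof -
    have "0 < 1 + cmod (Ln z)" by (intro add_pos_nonneg) auto
    moreover have "(1 + cmod (Ln z)) powr (- 1 - 1) \<le> (1 + cmod (Ln z)) powr 0" by (rule powr_mono) auto
    ultimately have "100 * k * (1 + cmod (Ln z)) powr (- 1 - 1) \<le> 100 * k * 1" using k by (intro mult_left_mono) auto
    then show ?thesis using order_trans[OF bd[OF z]] by simp
  qed
  then have "bounded (rho ` sector \<theta>)" unfolding bounded_iff by blast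
  moreover have "rho holomorphic_on sector \<theta>"
  proof -
    have "1 + z \<noteq> 0" if "z \<in> sector \<theta>" for z
    proof
      assume "1 + z = 0"
      then have "z = - 1" by (simp add: add_eq_0_iff)
      then show False using that t sector_notin_nonpos[of \<theta> z] by (simp add: complex_nonpos_Reals_iff)
    qed
    then show ?thesis unfolding rho_def[abs_def] by (intro holomorphic_intros) auto
  qed
  moreover have "\<exists>C>0. \<exists>\<epsilon>>0. \<forall>z\<in>sector \<theta>. cmod (rho z) \<le> C * (1 + cmod (Ln z)) powr (- 1 - \<epsilon>)"
  proof (rule exI[of _ "100 * k"], rule conjI)
    show "100 * k > 0" using k by simp
    show "\<exists>\<epsilon>>0. \<forall>z\<in>sector \<theta>. cmod (rho z) \<le> (100 * k) * (1 + cmod (Ln z)) powr (- 1 - \<epsilon>)"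
      by (rule exI[of _ 1], rule conjI[OF zero_less_one], rule ballI, rule bd)
  qed
  ultimately show ?thesis unfolding Hinf0_def Hinf_def mem_Collect_eq by (intro conjI)
qed

context mihlin1_calculus
begin

lemma test_zero: "test (elog (\<lambda>_. 0))"
  unfolding elog_def test_def using Cb_smooth[OF Cb_const] by auto

lemma calc_scale: "test (elog v) \<Longrightarrow> calc (\<lambda>t. of_real c * v t) = c *\<^sub>R calc v"
  using calc_lincomb[OF test_zero, of v c] calc_zero[of "\<lambda>_. 0"] by (simp add: elog_def)

lemma calc_sum:
  assumes "finite F" "\<And>i. i \<in> F \<Longrightarrow> test (elog (u i))"
  shows "test (elog (\<lambda>t. \<Sum>i\<in>F. u i t)) \<and> calc (\<lambda>t. \<Sum>i\<in>F. u i t) = (\<Sum>i\<in>F. calc (u i))"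
  using assms
proof (induction F rule: finite_induct)
  case empty
  have "calc (\<lambda>_. 0) = 0" by (rule calc_zero) (simp add: elog_def)
  then show ?case using test_zero by simp
next
  case (insert k F)
  have k: "test (elog (u k))" and IH: "test (elog (\<lambda>t. \<Sum>i\<in>F. u i t))" "calc (\<lambda>t. \<Sum>i\<in>F. u i t) = (\<Sum>i\<in>F. calc (u i))"
    using insert by auto
  have "test (elog (\<lambda>t. u k t + (\<Sum>i\<in>F. u i t)))" unfolding elog_add by (rule test_add[OF k IH(1)])
  then show ?case using insert.hyps calc_lincomb[OF k IH(1), of 1] IH(2) by simp
qed

end

locale paley_littlewood_calculus = mihlin1_calculus +
  fixes \<psi> :: "real \<Rightarrow> complex"
  assumes Rb: "R_bounded {mihlin1_calc \<phi> \<eta> \<alpha> A f | f. f \<in> mihlin1 \<phi> \<eta> \<alpha> \<and> mihlin1_norm \<phi> \<eta> \<alpha> f \<le> 1}"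
    and part: "homogeneous_partition \<psi>"
    and PL: "paley_littlewood \<phi> \<eta> \<alpha> A \<psi>"
begin

abbreviation p :: "int \<Rightarrow> real \<Rightarrow> complex" where "p \<equiv> dyadic_piece \<psi>"

definition P :: "int \<Rightarrow> ('a \<Rightarrow>\<^sub>L 'a)" where "P n = calc (p n)"

definition E :: "'a \<Rightarrow> real" where
  "E x = (\<integral>\<epsilon>. norm (\<Sum>\<^sub>\<infinity>n. \<epsilon> n *\<^sub>R P n x) \<partial>rademacher)"

definition S :: "'a \<Rightarrow> real" where
  "S x = (SUP a\<in>{a::int \<Rightarrow> complex. \<forall>n. cmod (a n) \<le> 1}. norm (\<Sum>\<^sub>\<infinity>n. a n *\<^sub>C P n x))"

lemma P_summable: "(\<lambda>n. P n x) summable_on UNIV" and norm_E_equivalent: "equivalent norm E" and E_S_equivalent: "equivalent E S"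
  using PL unfolding paley_littlewood_def Let_def E_def[abs_def] S_def[abs_def] P_def calc_def by auto

lemma test_p: "test (elog (p n))" by (rule elog_piece_test[OF part])

text \<open>The intervals of two pieces can meet in a common end point when the indices differ by 2.
  Admitting these pairs as neighbours is harmless.\<close>

lemma distant_pieces: assumes "2 < \<bar>m - n\<bar>" shows "elog (p m) x * elog (p n) x = 0"
proof (rule ccontr)
  assume "elog (p m) x * elog (p n) x \<noteq> 0"
  then have "\<bar>x - real_of_int m * ln 2\<bar> \<le> ln 2" "\<bar>x - real_of_int n * ln 2\<bar> \<le> ln 2"
    using elog_piece_zero[OF part, of x m] elog_piece_zero[OF part, of x n] by force+
  then have "\<bar>real_of_int m * ln 2 - real_of_int n * ln 2\<bar> \<le> 2 * ln 2" by linarith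
  then have "\<bar>real_of_int m - real_of_int n\<bar> * ln 2 \<le> 2 * ln 2" by (simp add: abs_mult left_diff_distrib[symmetric])
  then have "\<bar>real_of_int m - real_of_int n\<bar> \<le> 2" by simp
  then show False using assms by linarith
qed

lemma test_fp: "Cb (elog f) \<Longrightarrow> test (elog (\<lambda>t. f t * p n t))"
  unfolding elog_mult by (rule test_mult'[OF test_p Cb_smooth])

text \<open>The last statement makes the family almost diagonal with respect to the decomposition.\<close>

lemma calc_P:
  assumes "Cb (elog f)"
  shows "calc (\<lambda>t. f t * p m t) o\<^sub>L P n = calc (\<lambda>t. f t * p m t * p n t)"
    "P n o\<^sub>L calc (\<lambda>t. f t * p m t) = calc (\<lambda>t. f t * p m t * p n t)"
    "2 < \<bar>m - n\<bar> \<Longrightarrow> calc (\<lambda>t. f t * p m t) o\<^sub>L P n = 0"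
proof -
  show 1: "calc (\<lambda>t. f t * p m t) o\<^sub>L P n = calc (\<lambda>t. f t * p m t * p n t)"
    unfolding P_def by (rule calc_mult[OF test_fp[OF assms] test_p])
  have "P n o\<^sub>L calc (\<lambda>t. f t * p m t) = calc (\<lambda>t. p n t * (f t * p m t))"
    unfolding P_def by (rule calc_mult[OF test_p test_fp[OF assms]])
  also have "(\<lambda>t. p n t * (f t * p m t)) = (\<lambda>t. f t * p m t * p n t)" by (simp only: mult.commute)
  finally show "P n o\<^sub>L calc (\<lambda>t. f t * p m t) = calc (\<lambda>t. f t * p m t * p n t)" .
  assume "2 < \<bar>m - n\<bar>"
  from distant_pieces[OF this] have "elog (\<lambda>t. f t * p m t * p n t) x = 0" for x by (simp add: elog_def)
  then show "calc (\<lambda>t. f t * p m t) o\<^sub>L P n = 0" unfolding 1 by (rule calc_zero)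
qed

text \<open>The partition of unity, multiplied by \<open>\<psi>\<^sub>m\<close>, is a finite sum.\<close>

lemma P_P_sum: "(\<Sum>n\<in>{m-2..m+2}. P m (P n x)) = P m x"
  and P_P_far: "2 < \<bar>m - n\<bar> \<Longrightarrow> P m (P n x) = 0"
proof -
  have PP: "P m o\<^sub>L P n = calc (\<lambda>t. p m t * p n t)" for n unfolding P_def by (rule calc_mult[OF test_p test_p])
  show "P m (P n x) = 0" if "2 < \<bar>m - n\<bar>" for n
  proof -
    have "elog (\<lambda>t. p m t * p n t) x = 0" for x using distant_pieces[OF that, of x] by (simp add: elog_def)
    then have "P m o\<^sub>L P n = 0" unfolding PP by (rule calc_zero)
    then show ?thesis by (metis blinfun_apply_blinfun_compose blinfun.zero_left)
  qed
  have tt: "test (elog (\<lambda>t. p m t * p n t))" for n unfolding elog_mult by (rule test_mult[OF test_p test_smooth[OF test_p]])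
  have cs: "test (elog (\<lambda>t. \<Sum>n\<in>{m-2..m+2}. p m t * p n t)) \<and>
      calc (\<lambda>t. \<Sum>n\<in>{m-2..m+2}. p m t * p n t) = (\<Sum>n\<in>{m-2..m+2}. calc (\<lambda>t. p m t * p n t))"
    by (rule calc_sum) (use tt in auto)
  have "elog (\<lambda>t. \<Sum>n\<in>{m-2..m+2}. p m t * p n t) x = elog (p m) x" for x
  proof -
    have "((\<lambda>n. p n (exp x)) has_sum 1) UNIV" using part unfolding homogeneous_partition_def by simp
    from has_sum_cmult_right[OF this, of "p m (exp x)"]
    have 1: "((\<lambda>n. p m (exp x) * p n (exp x)) has_sum p m (exp x)) UNIV" by simp
    have "((\<lambda>n. p m (exp x) * p n (exp x)) has_sum (\<Sum>n\<in>{m-2..m+2}. p m (exp x) * p n (exp x))) UNIV"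
    proof (rule has_sum_finite_neutralI)
      fix n assume "n \<in> UNIV - {m-2..m+2}"
      then have "2 < \<bar>m - n\<bar>" by auto
      from distant_pieces[OF this, of x] show "p m (exp x) * p n (exp x) = 0" by (simp only: elog_def)
    qed auto
    from has_sum_unique[OF this 1] show ?thesis by (simp only: elog_def)
  qed
  then have "calc (\<lambda>t. \<Sum>n\<in>{m-2..m+2}. p m t * p n t) = P m"
    unfolding P_def using cs test_p by (intro calc_cong) auto
  then have "(\<Sum>n\<in>{m-2..m+2}. P m o\<^sub>L P n) = P m" using cs PP by simp
  then have "(\<Sum>n\<in>{m-2..m+2}. P m o\<^sub>L P n) x = P m x" by simp
  then show "(\<Sum>n\<in>{m-2..m+2}. P m (P n x)) = P m x" unfolding blinfun.sum_left by simp
qed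

lemma E_finite:
  assumes "finite G" "\<And>m. m \<notin> G \<Longrightarrow> P m y = 0" shows "E y = rad_avg G (\<lambda>m. P m y)"
proof -
  have "(\<Sum>\<^sub>\<infinity>n. \<epsilon> n *\<^sub>R P n y) = (\<Sum>n\<in>G. \<epsilon> n *\<^sub>R P n y)" for \<epsilon>
    using assms by (intro infsumI has_sum_finite_neutralI) auto
  then show ?thesis unfolding E_def rad_avg_def by simp
qed

text \<open>The difference of \<open>x\<close> and the sum is annihilated by every \<open>P m\<close>,
  so its random sum vanishes, and with it its norm.\<close>

lemma P_has_sum: "((\<lambda>n. P n x) has_sum x) UNIV"
proof -
  define s where "s = (\<Sum>\<^sub>\<infinity>n. P n x)"
  have s: "((\<lambda>n. P n x) has_sum s) UNIV" unfolding s_def using P_summable by (rule has_sum_infsum)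
  have "P m (x - s) = 0" for m
  proof -
    have 1: "((\<lambda>n. P m (P n x)) has_sum P m s) UNIV" by (rule has_sum_bounded_linear[OF blinfun.bounded_linear_right s])
    have "((\<lambda>n. P m (P n x)) has_sum P m x) UNIV"
    proof (rule has_sum_finite_neutralI)
      show "P m (P n x) = 0" if "n \<in> UNIV - {m-2..m+2}" for n using that by (intro P_P_far) auto
    qed (auto simp: P_P_sum)
    from has_sum_unique[OF this 1] show ?thesis by (simp add: blinfun.diff_right)
  qed
  then have "E (x - s) = 0" using E_finite[of "{}" "x - s"] by (simp add: rad_avg_def)
  moreover obtain c where "c > 0" "\<And>x. c * norm x \<le> E x" using norm_E_equivalent unfolding equivalent_def by blast
  ultimately have "c > 0" "c * norm (x - s) \<le> 0" by metis+
  then have "x = s" by (simp add: mult_le_0_iff)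
  then show ?thesis using s by simp
qed

text \<open>A finite choice of signs is one of the multipliers in the supremum \<open>S x\<close>. That
  the supremum is taken over a bounded set follows from the boundedness of the finite subset
  sums.\<close>

lemma rad_avg_P_bound:
  obtains C where "C > 0" "\<And>F x. finite F \<Longrightarrow> rad_avg F (\<lambda>n. P n x) \<le> C * norm x"
proof -
  obtain C1 where C1: "C1 > 0" "\<And>x. E x \<le> C1 * norm x" using norm_E_equivalent unfolding equivalent_def by blast
  obtain C2 where C2: "C2 > 0" "\<And>x. S x \<le> C2 * E x" using E_S_equivalent unfolding equivalent_def by blast
  have "rad_avg F (\<lambda>n. P n x) \<le> (C2 * C1) * norm x" if F: "finite F" for F x
  proof -
    obtain B where B: "\<And>H. finite H \<Longrightarrow> norm (\<Sum>i\<in>H. P i x) \<le> B"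
      using summable_finite_sums_bounded[OF P_summable[of x]] by blast
    have B0: "0 \<le> B" using B[of "{}"] by simp
    let ?A = "{a::int \<Rightarrow> complex. \<forall>n. cmod (a n) \<le> 1}"
    have bdd: "bdd_above ((\<lambda>a. norm (\<Sum>\<^sub>\<infinity>n. a n *\<^sub>C P n x)) ` ?A)"
    proof (rule bdd_aboveI2)
      fix a :: "int \<Rightarrow> complex" assume a: "a \<in> ?A"
      show "norm (\<Sum>\<^sub>\<infinity>n. a n *\<^sub>C P n x) \<le> 4 * B"
      proof (cases "(\<lambda>n. a n *\<^sub>C P n x) summable_on UNIV")
        case True
        show ?thesis
        proof (rule norm_has_sum_le[OF has_sum_infsum[OF True]])
          fix H :: "int set" assume H: "finite H"
          show "norm (\<Sum>i\<in>H. a i *\<^sub>C P i x) \<le> 4 * B"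
            using a by (intro complex_coefficient_bound H B) (auto intro: finite_subset[OF _ H])
        qed
      qed (use B0 in \<open>simp add: infsum_not_exists\<close>)
    qed
    have "rad_avg F (\<lambda>n. P n x) \<le> S x"
    proof (rule rad_avg_le)
      fix s :: "int \<Rightarrow> real" assume s: "\<forall>i. s i = 1 \<or> s i = - 1"
      define a where "a n = (if n \<in> F then complex_of_real (s n) else 0)" for n
      have "cmod (a n) \<le> 1" for n using s[rule_format, of n] by (auto simp: a_def)
      then have a: "a \<in> ?A" by simp
      have "((\<lambda>n. a n *\<^sub>C P n x) has_sum (\<Sum>n\<in>F. s n *\<^sub>R P n x)) UNIV"
        using F scaleC_of_real[of 0] by (intro has_sum_finite_neutralI) (auto simp: a_def scaleC_of_real)
      then have "(\<Sum>n\<in>F. s n *\<^sub>R P n x) = (\<Sum>\<^sub>\<infinity>n. a n *\<^sub>C P n x)" by (rule infsumI[symmetric])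
      then show "norm (\<Sum>n\<in>F. s n *\<^sub>R P n x) \<le> S x" unfolding S_def using cSUP_upper[OF a bdd] by simp
    qed
    also have "\<dots> \<le> C2 * (C1 * norm x)" using order_trans[OF C2(2) mult_left_mono[OF C1(2)]] C2(1) by simp
    finally show ?thesis by simp
  qed
  then show ?thesis using that[of "C2 * C1"] C1(1) C2(1) by simp
qed

text \<open>Divide \<open>f \<psi>\<^sub>m\<close> by a multiple of \<open>K\<close> to get into the
  unit ball of \<open>mihlin1\<close>; \<open>mihlin1_multiplier\<close> provides a multiple
  that serves all \<open>m\<close>. The parameter \<open>K\<close> instead of the Mihlin
  norm itself keeps the divisor positive.\<close>

lemma piece_operators_R_bounded:
  obtains R where "R > 0" "\<And>f K F x. Cb (elog f) \<Longrightarrow> 0 < K \<Longrightarrow> mihlin_norm \<phi> \<alpha> f \<le> K \<Longrightarrow> finite F \<Longrightarrow>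
    rad_avg F (\<lambda>m. calc (\<lambda>t. f t * p m t) (x m)) \<le> R * K * rad_avg F x"
proof -
  obtain R where R: "R \<ge> 0" "\<And>F (T :: int \<Rightarrow> ('a \<Rightarrow>\<^sub>L 'a)) x. finite F \<Longrightarrow>
     (\<And>m. T m \<in> {mihlin1_calc \<phi> \<eta> \<alpha> A f | f. f \<in> mihlin1 \<phi> \<eta> \<alpha> \<and> mihlin1_norm \<phi> \<eta> \<alpha> f \<le> 1}) \<Longrightarrow>
     rad_avg F (\<lambda>m. T m (x m)) \<le> R * rad_avg F x" using R_bounded_finite_family[OF Rb] by blast
  obtain L where L: "L \<ge> 0" "\<And>f u m M. Cb (elog f) \<Longrightarrow> Cb (elog u) \<Longrightarrow>
     (\<And>j x. j \<le> N \<Longrightarrow> cmod (nd j (elog u) x) \<le> M) \<Longrightarrow> (\<And>x. ln 2 < \<bar>x - real_of_int m * ln 2\<bar> \<Longrightarrow> elog u x = 0) \<Longrightarrow>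
     (\<lambda>t. f t * u t) \<in> mihlin1 \<phi> \<eta> \<alpha> \<and> mihlin1_norm \<phi> \<eta> \<alpha> (\<lambda>t. f t * u t) \<le> L * M * mihlin_norm \<phi> \<alpha> f"
    using mihlin1_multiplier by blast
  obtain M where M: "M \<ge> 0" "\<And>j n x. j \<le> N \<Longrightarrow> cmod (nd j (elog (p n)) x) \<le> M" using elog_piece_bounds[OF part] by blast
  define W where "W = L * M + 1"
  have W: "W > 0" using L(1) M(1) by (simp add: W_def add_nonneg_pos)
  have "rad_avg F (\<lambda>m. calc (\<lambda>t. f t * p m t) (x m)) \<le> ((R + 1) * W) * K * rad_avg F x"
    if f: "Cb (elog f)" and K: "0 < K" "mihlin_norm \<phi> \<alpha> f \<le> K" and F: "finite F" for f K F x
  proof -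
    \<comment> \<open>scales \<open>f \<psi>\<^sub>m\<close> into the unit ball\<close>
    define q where "q = 1 / (W * K)"
    have q: "q > 0" using W K by (simp add: q_def)
    have n0: "0 \<le> mihlin_norm \<phi> \<alpha> f" unfolding mihlin_norm_elog by (rule besov_norm_nonneg[OF f])
    define T where "T m = calc (\<lambda>t. f t * (of_real q * p m t))" for m
    have Teq: "T m = q *\<^sub>R calc (\<lambda>t. f t * p m t)" for m
      using calc_scale[OF test_fp[OF f], of q m] unfolding T_def by (simp only: mult.left_commute)
    have in_tau: "T m \<in> {mihlin1_calc \<phi> \<eta> \<alpha> A f | f. f \<in> mihlin1 \<phi> \<eta> \<alpha> \<and> mihlin1_norm \<phi> \<eta> \<alpha> f \<le> 1}" for m
    proof -
      have "(\<lambda>t. f t * (of_real q * p m t)) \<in> mihlin1 \<phi> \<eta> \<alpha> \<and>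
        mihlin1_norm \<phi> \<eta> \<alpha> (\<lambda>t. f t * (of_real q * p m t)) \<le> L * (q * M) * mihlin_norm \<phi> \<alpha> f"
      proof (rule L(2)[OF f])
        show "Cb (elog (\<lambda>t. of_real q * p m t))" unfolding elog_cmult by (intro Cb_cmult test_Cb test_p)
        show "cmod (nd j (elog (\<lambda>t. of_real q * p m t)) x) \<le> q * M" if "j \<le> N" for j x
          unfolding elog_cmult nd_cmult[OF test_smooth[OF test_p]] using M(2)[OF that, of m x] q by (simp add: norm_mult)
        show "elog (\<lambda>t. of_real q * p m t) x = 0" if "ln 2 < \<bar>x - real_of_int m * ln 2\<bar>" for x
          unfolding elog_cmult using elog_piece_zero[OF part that] by simp
      qed
      moreover have "L * (q * M) * mihlin_norm \<phi> \<alpha> f \<le> 1"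
      proof -
        have "L * (q * M) * mihlin_norm \<phi> \<alpha> f \<le> q * (W * K)"
          using mult_mono[of "L * M" W "mihlin_norm \<phi> \<alpha> f" K] K n0 W q by (simp add: W_def mult_ac)
        also have "\<dots> = 1" using W K by (simp add: q_def)
        finally show ?thesis .
      qed
      ultimately show ?thesis unfolding T_def calc_def by (intro CollectI exI conjI refl) auto
    qed
    have "q * rad_avg F (\<lambda>m. calc (\<lambda>t. f t * p m t) (x m)) = rad_avg F (\<lambda>m. T m (x m))"
      unfolding Teq using q by (simp add: blinfun.scaleR_left rad_avg_scaleR)
    also have "\<dots> \<le> R * rad_avg F x" by (rule R(2)[OF F in_tau])
    also have "\<dots> \<le> (R + 1) * rad_avg F x" by (intro mult_right_mono rad_avg_nonneg) simp
    finally have "rad_avg F (\<lambda>m. calc (\<lambda>t. f t * p m t) (x m)) \<le> ((R + 1) * rad_avg F x) / q"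
      using q by (simp add: pos_le_divide_eq mult.commute)
    then show ?thesis using W K by (simp add: q_def mult_ac)
  qed
  note main = this
  show ?thesis
  proof (rule that[of "(R + 1) * W"])
    show "0 < (R + 1) * W" using R(1) W by (intro mult_pos_pos) auto
  qed (fact main)
qed

end

context paley_littlewood_calculus
begin

section \<open>The bounded Mihlin calculus\<close>

text \<open>Apply the norm equivalence to the partial sum \<open>y\<close>. The piece \<open>P m
  y\<close> is a sum of five terms, in each of which the operator depends on
  \<open>m\<close> and the vector is a shifted piece of \<open>x\<close>, so that
  R-boundedness applies term by term.\<close>

lemma sum_of_pieces_bound:
  obtains Q where "Q > 0" "\<And>f K F x. Cb (elog f) \<Longrightarrow> 0 < K \<Longrightarrow> mihlin_norm \<phi> \<alpha> f \<le> K \<Longrightarrow> finite F \<Longrightarrow>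
    norm (\<Sum>n\<in>F. calc (\<lambda>t. f t * p n t) x) \<le> Q * K * rad_avg F (\<lambda>n. P n x)"
proof -
  obtain R where R: "R > 0" "\<And>f K F x. Cb (elog f) \<Longrightarrow> 0 < K \<Longrightarrow> mihlin_norm \<phi> \<alpha> f \<le> K \<Longrightarrow> finite F \<Longrightarrow>
    rad_avg F (\<lambda>m. calc (\<lambda>t. f t * p m t) (x m)) \<le> R * K * rad_avg F x" using piece_operators_R_bounded by blast
  obtain c where c: "c > 0" "\<And>x. c * norm x \<le> E x" using norm_E_equivalent unfolding equivalent_def by blast
  have "norm (\<Sum>n\<in>F. calc (\<lambda>t. f t * p n t) x) \<le> (5 * R / c) * K * rad_avg F (\<lambda>n. P n x)"
    if f: "Cb (elog f)" and K: "0 < K" "mihlin_norm \<phi> \<alpha> f \<le> K" and F: "finite F" for f K F x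
  proof -
    define T where "T m = calc (\<lambda>t. f t * p m t)" for m
    define y where "y = (\<Sum>n\<in>F. T n x)"
    \<comment> \<open>the pieces of \<open>x\<close> that occur in the partial sum, shifted by
      \<open>d\<close>\<close>
    define w where "w d m = (if m + d \<in> F then P (m + d) x else 0)" for d m
    let ?J = "{-2..2::int}"
    \<comment> \<open>a finite set of indices outside of which \<open>P m y\<close> vanishes\<close>
    define G where "G = (\<Union>d\<in>?J. (\<lambda>n. n - d) ` F)"
    have G: "finite G" using F by (auto simp: G_def)
    have PT: "P m (T n x) = T m (P n x)" for m n
    proof -
      have "P m o\<^sub>L T n = calc (\<lambda>t. f t * p n t * p m t)" unfolding T_def by (rule calc_P(2)[OF f])
      also have "(\<lambda>t. f t * p n t * p m t) = (\<lambda>t. f t * p m t * p n t)" by (simp add: mult_ac)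
      also have "calc (\<lambda>t. f t * p m t * p n t) = T m o\<^sub>L P n" unfolding T_def by (rule calc_P(1)[OF f, symmetric])
      finally show ?thesis by (metis blinfun_apply_blinfun_compose)
    qed
    have far: "T m (P n x) = 0" if "2 < \<bar>m - n\<bar>" for m n
      using calc_P(3)[OF f that] unfolding T_def by (metis blinfun_apply_blinfun_compose blinfun.zero_left)
    have Py: "P m y = (\<Sum>d\<in>?J. T m (w d m))" for m
    proof -
      have "P m y = (\<Sum>n\<in>F. T m (P n x))" unfolding y_def by (simp add: blinfun.sum_right PT)
      also have "\<dots> = (\<Sum>n\<in>F. if n \<in> {m-2..m+2} then T m (P n x) else 0)"
        using far by (intro sum.cong refl) auto
      also have "\<dots> = (\<Sum>n\<in>F \<inter> {m-2..m+2}. T m (P n x))" by (rule sum.inter_restrict[OF F, symmetric])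
      also have "\<dots> = (\<Sum>n\<in>{m-2..m+2} \<inter> F. T m (P n x))" by (simp only: Int_commute)
      also have "\<dots> = (\<Sum>n\<in>{m-2..m+2}. if n \<in> F then T m (P n x) else 0)" by (rule sum.inter_restrict) simp
      also have "\<dots> = (\<Sum>d\<in>?J. if m + d \<in> F then T m (P (m + d) x) else 0)"
        by (rule sum.reindex_bij_witness[of _ "\<lambda>d. m + d" "\<lambda>n. n - m"]) auto
      also have "\<dots> = (\<Sum>d\<in>?J. T m (w d m))" by (intro sum.cong refl) (simp add: w_def)
      finally show ?thesis .
    qed
    have out: "P m y = 0" if m: "m \<notin> G" for m
    proof -
      have "w d m = 0" if "d \<in> ?J" for d
      proof -
        have "m + d \<notin> F"
        proof
          assume "m + d \<in> F"
          then have "m + d - d \<in> (\<lambda>n. n - d) ` F" by (rule imageI)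
          then have "m \<in> G" using that unfolding G_def by auto
          then show False using m by simp
        qed
        then show ?thesis by (simp add: w_def)
      qed
      then show ?thesis unfolding Py by simp
    qed
    have shift: "rad_avg G (w d) = rad_avg F (\<lambda>n. P n x)" if d: "d \<in> ?J" for d
    proof -
      have inj: "inj (\<lambda>n. n - d)" by (simp add: inj_on_def)
      have "rad_avg G (w d) = rad_avg ((\<lambda>n. n - d) ` F) (w d)"
      proof (rule rad_avg_superset[OF G])
        show "(\<lambda>n. n - d) ` F \<subseteq> G" using d unfolding G_def by blast
        show "w d i = 0" if "i \<notin> (\<lambda>n. n - d) ` F" for i
        proof -
          have "i + d \<notin> F" using that image_eqI[of i "\<lambda>n. n - d" "i + d" F] by auto
          then show ?thesis by (simp add: w_def)
        qed
      qed
      also have "\<dots> = rad_avg F (\<lambda>n. w d (n - d))" by (rule rad_avg_image[OF inj])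
      also have "\<dots> = rad_avg F (\<lambda>n. P n x)"
        unfolding rad_avg_def by (intro Bochner_Integration.integral_cong refl arg_cong[where f = norm] sum.cong) (simp add: w_def)
      finally show ?thesis .
    qed
    have "c * norm y \<le> E y" by (rule c(2))
    also have "\<dots> = rad_avg G (\<lambda>m. P m y)" using G out by (rule E_finite)
    also have "\<dots> = rad_avg G (\<lambda>m. \<Sum>d\<in>?J. T m (w d m))" by (simp only: Py)
    also have "\<dots> \<le> (\<Sum>d\<in>?J. rad_avg G (\<lambda>m. T m (w d m)))" by (rule rad_avg_sum_le) simp
    also have "\<dots> \<le> (\<Sum>d\<in>?J. R * K * rad_avg F (\<lambda>n. P n x))"
    proof (rule sum_mono)
      fix d assume d: "d \<in> ?J"
      have "rad_avg G (\<lambda>m. T m (w d m)) \<le> R * K * rad_avg G (w d)" unfolding T_def by (rule R(2)[OF f K G])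
      then show "rad_avg G (\<lambda>m. T m (w d m)) \<le> R * K * rad_avg F (\<lambda>n. P n x)" unfolding shift[OF d] .
    qed
    also have "\<dots> = 5 * (R * K * rad_avg F (\<lambda>n. P n x))" by simp
    finally have "norm y \<le> 5 * (R * K * rad_avg F (\<lambda>n. P n x)) / c" using c(1) by (simp add: pos_le_divide_eq mult.commute)
    then show ?thesis by (simp add: y_def T_def mult_ac)
  qed
  note main = this
  show ?thesis
  proof (rule that[of "5 * R / c"])
    show "0 < 5 * R / c" using R(1) c(1) by simp
  qed (fact main)
qed

text \<open>Partial sums over sets far out are small because the random averages of \<open>P\<^sub>n
  x\<close> over such sets are.\<close>

lemma multiplier_operator:
  obtains C where "\<And>f. Cb (elog f) \<Longrightarrow>
    \<exists>T. (\<forall>x. ((\<lambda>n. calc (\<lambda>t. f t * p n t) x) has_sum blinfun_apply T x) UNIV) \<and> norm T \<le> C * mihlin_norm \<phi> \<alpha> f"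
proof -
  obtain Q where Q: "Q > 0" "\<And>f K F x. Cb (elog f) \<Longrightarrow> 0 < K \<Longrightarrow> mihlin_norm \<phi> \<alpha> f \<le> K \<Longrightarrow> finite F \<Longrightarrow>
    norm (\<Sum>n\<in>F. calc (\<lambda>t. f t * p n t) x) \<le> Q * K * rad_avg F (\<lambda>n. P n x)" using sum_of_pieces_bound by blast
  obtain C where C: "C > 0" "\<And>F x. finite F \<Longrightarrow> rad_avg F (\<lambda>n. P n x) \<le> C * norm x" using rad_avg_P_bound by blast
  have "\<exists>T. (\<forall>x. ((\<lambda>n. calc (\<lambda>t. f t * p n t) x) has_sum blinfun_apply T x) UNIV) \<and> norm T \<le> Q * C * mihlin_norm \<phi> \<alpha> f"
    if f: "Cb (elog f)" for f
  proof -
    let ?t = "\<lambda>n x. calc (\<lambda>t. f t * p n t) x"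
    have n0: "0 \<le> mihlin_norm \<phi> \<alpha> f" unfolding mihlin_norm_elog by (rule besov_norm_nonneg[OF f])
    have summ: "(\<lambda>n. ?t n x) summable_on UNIV" for x
    proof (rule summable_of_tails)
      fix e :: real assume e: "0 < e"
      define K where "K = mihlin_norm \<phi> \<alpha> f + 1"
      have K: "0 < K" "mihlin_norm \<phi> \<alpha> f \<le> K" using n0 by (auto simp: K_def)
      \<comment> \<open>the factor 2 comes from splitting a sign pattern into its positive and negative parts\<close>
      define d where "d = e / (Q * K * 2)"
      have d: "0 < d" using e Q(1) K by (simp add: d_def)
      obtain F where F: "finite F" "\<And>H. finite H \<Longrightarrow> H \<inter> F = {} \<Longrightarrow> norm (\<Sum>i\<in>H. P i x) \<le> d"
        using summable_tail[OF P_summable[of x] d] by blast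
      have "norm (\<Sum>n\<in>H. ?t n x) \<le> e" if H: "finite H" "H \<inter> F = {}" for H
      proof -
        have "rad_avg H (\<lambda>n. P n x) \<le> 2 * d"
        proof (rule rad_avg_le)
          fix s :: "int \<Rightarrow> real" assume s: "\<forall>i. s i = 1 \<or> s i = - 1"
          have "\<bar>s i\<bar> \<le> 1" for i using s[rule_format, of i] by auto
          moreover have "norm (\<Sum>i\<in>H'. P i x) \<le> d" if "H' \<subseteq> H" for H'
            using that H by (intro F(2) finite_subset[OF that]) auto
          ultimately show "norm (\<Sum>i\<in>H. s i *\<^sub>R P i x) \<le> 2 * d" by (intro real_coefficient_bound H(1))
        qed
        then have "Q * K * rad_avg H (\<lambda>n. P n x) \<le> Q * K * (2 * d)" using Q(1) K(1) by (intro mult_left_mono) auto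
        also have "\<dots> = e" using Q(1) K(1) by (simp add: d_def)
        finally show ?thesis using Q(2)[OF f K H(1), of x] by simp
      qed
      then show "\<exists>F. finite F \<and> (\<forall>H. finite H \<longrightarrow> H \<inter> F = {} \<longrightarrow> norm (\<Sum>n\<in>H. ?t n x) \<le> e)" using F(1) by blast
    qed
    define h where "h x = (\<Sum>\<^sub>\<infinity>n. ?t n x)" for x
    have h: "((\<lambda>n. ?t n x) has_sum h x) UNIV" for x unfolding h_def by (rule has_sum_infsum[OF summ])
    have bound: "norm (h x) \<le> (Q * C * K) * norm x" if K: "0 < K" "mihlin_norm \<phi> \<alpha> f \<le> K" for K x
    proof (rule norm_has_sum_le[OF h])
      fix F :: "int set" assume F: "finite F"
      have "Q * K * rad_avg F (\<lambda>n. P n x) \<le> Q * K * (C * norm x)" using Q(1) K(1) C(2)[OF F] by (intro mult_left_mono) auto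
      also have "\<dots> = (Q * C * K) * norm x" by simp
      finally show "norm (\<Sum>n\<in>F. ?t n x) \<le> (Q * C * K) * norm x" using Q(2)[OF f K F, of x] by linarith
    qed
    have "bounded_linear h"
    proof (rule bounded_linear_intro)
      show "h (x + y) = h x + h y" for x y
        using has_sum_unique[OF h[of "x + y"]] has_sum_add[OF h[of x] h[of y]] by (simp add: blinfun.add_right)
      show "h (r *\<^sub>R x) = r *\<^sub>R h x" for r x
        using has_sum_unique[OF h[of "r *\<^sub>R x"]] has_sum_bounded_linear[OF bounded_linear_scaleR_right h[of x], of r] by (simp add: blinfun.scaleR_right)
      show "norm (h x) \<le> norm x * (Q * C * (mihlin_norm \<phi> \<alpha> f + 1))" for x
        using bound[of "mihlin_norm \<phi> \<alpha> f + 1" x] n0 by (simp add: mult.commute)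
    qed
    then have T: "blinfun_apply (Blinfun h) = h" by (rule bounded_linear_Blinfun_apply)
    have "norm (Blinfun h) \<le> Q * C * mihlin_norm \<phi> \<alpha> f"
    proof -
      have QC: "0 < Q * C" using Q(1) C(1) by simp
      have "norm (Blinfun h) / (Q * C) \<le> K" if K: "mihlin_norm \<phi> \<alpha> f < K" for K
      proof -
        have "0 < K" "mihlin_norm \<phi> \<alpha> f \<le> K" using K n0 by auto
        from bound[OF this] have "norm (Blinfun h) \<le> Q * C * K"
          using \<open>0 < K\<close> QC by (intro norm_blinfun_bound) (auto simp: T)
        then show ?thesis using QC by (simp add: pos_divide_le_eq mult.commute)
      qed
      then have "norm (Blinfun h) / (Q * C) \<le> mihlin_norm \<phi> \<alpha> f" by (rule dense_ge)
      then show ?thesis using QC by (simp add: pos_divide_le_eq mult.commute)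
    qed
    then show ?thesis using h T by (intro exI[of _ "Blinfun h"]) simp
  qed
  then show ?thesis by (rule that)
qed

text \<open>Multiply the decomposition of \<open>x\<close> by \<open>F(A)\<close>.\<close>

lemma hcalc_P:
  assumes F: "F \<in> Hinf0 \<theta>" "0 < \<theta>" "\<theta> < pi" "\<And>\<omega>. 0 < \<omega> \<Longrightarrow> \<omega> < pi \<Longrightarrow> F \<in> Hinf \<omega>"
  shows "((\<lambda>n. calc (\<lambda>t. on_reals F t * p n t) x) has_sum hcalc \<theta> A F x) UNIV"
proof -
  have "hcalc \<theta> A F (P n x) = calc (\<lambda>t. on_reals F t * p n t) x" for n
    using hcalc_calc(2)[OF F test_p, of n] unfolding P_def by (metis blinfun_apply_blinfun_compose)
  then show ?thesis using has_sum_bounded_linear[OF blinfun.bounded_linear_right P_has_sum, of "hcalc \<theta> A F" x] by simp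
qed

lemma rho_Hinf: "0 < \<omega> \<Longrightarrow> \<omega> < pi \<Longrightarrow> rho \<in> Hinf \<omega>" by (rule Hinf0_Hinf[OF rho_Hinf0])

text \<open>\<open>\<psi>\<^sub>n / \<rho>\<close> is still a test function in the logarithmic variable,
  so \<open>P\<^sub>n\<close> factors through \<open>\<rho>(A)\<close>.\<close>

lemma hcalc_rho_inj:
  assumes t: "0 < \<theta>" "\<theta> < pi" and x: "hcalc \<theta> A rho x = 0" shows "x = 0"
proof -
  have "P n x = 0" for n
  proof -
    \<comment> \<open>\<open>1 / \<rho>\<close> in the logarithmic variable\<close>
    let ?s = "\<lambda>w. (1 + exp w)\<^sup>2 * exp (- w)"
    let ?u = "\<lambda>t. p n t * ((1 + complex_of_real t)\<^sup>2 / complex_of_real t)"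
    have "?s holomorphic_on strip 1" by (intro holomorphic_intros)
    then have s: "smooth (\<lambda>y. ?s (complex_of_real y))" by (rule strip_smooth) simp
    have eu: "elog ?u = (\<lambda>y. elog (p n) y * ?s (complex_of_real y))"
      by (rule ext) (simp add: elog_def exp_of_real[symmetric] exp_minus field_simps)
    have tu: "test (elog ?u)" unfolding eu by (rule test_mult[OF test_p s])
    note H = hcalc_calc[OF rho_Hinf0[OF t] t rho_Hinf tu]
    have "calc (\<lambda>t. on_reals rho t * ?u t) = P n" unfolding P_def
    proof (rule calc_cong[OF H(1) test_p])
      fix y :: real
      have n: "1 + complex_of_real (exp y) \<noteq> 0"
        by (metis add_pos_pos exp_gt_zero less_irrefl of_real_1 of_real_add of_real_eq_0_iff zero_less_one)
      have "complex_of_real (exp y) \<noteq> 0" by simp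
      then show "elog (\<lambda>t. on_reals rho t * ?u t) y = elog (p n) y"
        using n unfolding elog_def rho_def by (simp add: field_simps del: of_real_exp)
    qed
    then have "P n = calc ?u o\<^sub>L hcalc \<theta> A rho" using H(3) by simp
    then show "P n x = 0" using x by (simp add: blinfun.zero_right)
  qed
  then have "((\<lambda>n. P n x) has_sum 0) UNIV" by simp
  from has_sum_unique[OF P_has_sum this] show ?thesis .
qed

text \<open>If \<open>f\<close> lies in \<open>Hinf0\<close> the extended calculus needs no
  regularisation, otherwise one factor \<open>\<rho>\<close> suffices, because
  \<open>f\<close> is bounded. In both cases the operator \<open>T\<close> is identified by
  comparing the two expansions into pieces.\<close>

theorem bounded_mihlin_calculus: "has_bounded_mihlin_calculus \<phi> \<alpha> A"
proof -
  obtain C where C: "\<And>f. Cb (elog f) \<Longrightarrow>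
    \<exists>T. (\<forall>x. ((\<lambda>n. calc (\<lambda>t. f t * p n t) x) has_sum blinfun_apply T x) UNIV) \<and> norm T \<le> C * mihlin_norm \<phi> \<alpha> f"
    using multiplier_operator by blast
  have "\<exists>T. ext_hcalc \<theta> A f = graph_of T \<and> norm T \<le> C * mihlin_norm \<phi> \<alpha> (on_reals f)"
    if f: "\<And>\<omega>. 0 < \<omega> \<Longrightarrow> \<omega> < pi \<Longrightarrow> f \<in> Hinf \<omega>" and t: "0 < \<theta>" "\<theta> < pi" for f \<theta>
  proof -
    have cf: "Cb (elog (on_reals f))" by (rule Hinf_Cb[OF f[OF t] t(1)]) (use t in simp)
    obtain T where T: "\<And>x. ((\<lambda>n. calc (\<lambda>t. on_reals f t * p n t) x) has_sum blinfun_apply T x) UNIV"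
      "norm T \<le> C * mihlin_norm \<phi> \<alpha> (on_reals f)" using C[OF cf] by blast
    have "ext_hcalc \<theta> A f = graph_of T"
    proof (cases "f \<in> Hinf0 \<theta>")
      case True
      have "(LEAST n. (\<lambda>z. rho z ^ n * f z) \<in> Hinf0 \<theta>) = 0" by (rule Least_eq_0) (simp add: True)
      then have "ext_hcalc \<theta> A f = {(x, y). y = hcalc \<theta> A f x}" unfolding ext_hcalc_def by (simp add: Let_def)
      moreover have "hcalc \<theta> A f x = T x" for x
        by (rule has_sum_unique[OF hcalc_P[OF True t f] T(1)])
      ultimately show ?thesis unfolding graph_of_def by simp
    next
      case False
      let ?rf = "\<lambda>z. rho z * f z"
      have rf: "?rf \<in> Hinf0 \<theta>" by (rule Hinf0_mult[OF rho_Hinf0[OF t] f[OF t]])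
      have rfH: "?rf \<in> Hinf \<omega>" if "0 < \<omega>" "\<omega> < pi" for \<omega>
        by (rule Hinf0_Hinf[OF Hinf0_mult[OF rho_Hinf0[OF that] f[OF that]]])
      have "(LEAST n. (\<lambda>z. rho z ^ n * f z) \<in> Hinf0 \<theta>) = 1"
      proof (rule Least_equality)
        show "(\<lambda>z. rho z ^ 1 * f z) \<in> Hinf0 \<theta>" using rf by simp
        show "1 \<le> n" if "(\<lambda>z. rho z ^ n * f z) \<in> Hinf0 \<theta>" for n
          using that False by (cases n) auto
      qed
      then have e: "ext_hcalc \<theta> A f = {(x, y). hcalc \<theta> A rho y = hcalc \<theta> A ?rf x}" unfolding ext_hcalc_def by (simp add: Let_def)
      have "hcalc \<theta> A rho (T x) = hcalc \<theta> A ?rf x" for x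
      proof -
        have "hcalc \<theta> A rho (calc (\<lambda>t. on_reals f t * p n t) x) = calc (\<lambda>t. on_reals ?rf t * p n t) x" for n
        proof -
          have "hcalc \<theta> A rho o\<^sub>L calc (\<lambda>t. on_reals f t * p n t) = calc (\<lambda>t. on_reals rho t * (on_reals f t * p n t))"
            by (rule hcalc_calc(2)[OF rho_Hinf0[OF t] t rho_Hinf test_fp[OF cf]])
          also have "(\<lambda>t. on_reals rho t * (on_reals f t * p n t)) = (\<lambda>t. on_reals ?rf t * p n t)" by (simp add: mult.assoc)
          finally show ?thesis by (metis blinfun_apply_blinfun_compose)
        qed
        then have "((\<lambda>n. calc (\<lambda>t. on_reals ?rf t * p n t) x) has_sum hcalc \<theta> A rho (T x)) UNIV"
          using has_sum_bounded_linear[OF blinfun.bounded_linear_right T(1), of "hcalc \<theta> A rho" x] by simp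
        from has_sum_unique[OF this hcalc_P[OF rf t rfH]] show ?thesis .
      qed
      then have "hcalc \<theta> A rho y = hcalc \<theta> A ?rf x \<longleftrightarrow> y = T x" for x y
        using hcalc_rho_inj[OF t, of "y - T x"] by (auto simp: blinfun.diff_right)
      then show ?thesis unfolding e graph_of_def by simp
    qed
    then show ?thesis using T(2) by blast
  qed
  then show ?thesis unfolding has_bounded_mihlin_calculus_def by blast
qed

end

theorem proposition4p11:
  fixes \<alpha> :: real
    and A :: "('a::complex_banach \<times> 'a) set"
    and \<phi> :: "int \<Rightarrow> real \<Rightarrow> complex"
    and \<eta> \<psi> :: "real \<Rightarrow> complex"
  assumes "\<alpha> > 0"
    and "inhomogeneous_partition \<phi>"
    and "homogeneous_partition \<eta>"
    and "zero_sectorial A"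
    and "has_mihlin1_calculus \<phi> \<eta> \<alpha> A"
    and "R_bounded {mihlin1_calc \<phi> \<eta> \<alpha> A f | f. f \<in> mihlin1 \<phi> \<eta> \<alpha> \<and> mihlin1_norm \<phi> \<eta> \<alpha> f \<le> 1}"
    and "homogeneous_partition \<psi>"
    and "paley_littlewood \<phi> \<eta> \<alpha> A \<psi>"
  shows "has_bounded_mihlin_calculus \<phi> \<alpha> A"
proof -
  obtain N :: nat where N: "\<alpha> < real N" using reals_Archimedean2 by blast
  interpret paley_littlewood_calculus \<phi> \<eta> \<alpha> N A \<psi>
    by unfold_locales (use assms N in auto)
  show ?thesis by (rule bounded_mihlin_calculus)
qed

end
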